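(* Let $R$ be a polynomial ring over a commutative ring $S$ and $B$ be a finitely generated monomial $R$-ideal. Then, for every $\ell\ge 0$, the Čech cohomology functor $H^\ell_{B}$ is the $\ell$-th right derived functor of $H^0_{B}$.
   Context: For a finitely generated ideal $B$ of a commutative ring $R$ and an $R$-module $M$, $H^\ell_B(M)$ denotes the $\ell$-th cohomology of the Čech complex of $M$ on a finite set of generators of $B$ (independent of the choice of generators, up to natural isomorphism). $H^0_B$ is the left exact functor sending $M$ to its submodule of elements annihilated by some power of $B$; derived functors are taken on the category of $R$-modules. A monomial ideal is an ideal generated by monomials in the variables. *)

theory Defs
  imports "HOL-Algebra.Algebra"
begin

section \<open>Polynomial rings and monomial ideals\<close>

text \<open>Monomials are multisets of variables and polynomials are functions from monomials to
  coefficients, as in \<^theory>\<open>HOL-Algebra.Indexed_Polynomials\<close>, which provides the carrier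
  (polynomials in the possibly infinitely many variables \<open>V\<close>) and the addition but no
  multiplication of two polynomials.\<close>

definition mpoly_ring :: "('s, 'c) ring_scheme \<Rightarrow> 'v set \<Rightarrow> ('v multiset \<Rightarrow> 's) ring" where
  "mpoly_ring S V = \<lparr>
     carrier = ring.indexed_pset S V (carrier S),
     monoid.mult = (\<lambda>p q m. finsum S (\<lambda>a. p a \<otimes>\<^bsub>S\<^esub> q (m - a)) {a. a \<subseteq># m}),
     monoid.one = ring.indexed_const S \<one>\<^bsub>S\<^esub>,
     ring.zero = ring.indexed_const S \<zero>\<^bsub>S\<^esub>,
     ring.add = ring.indexed_padd S\<rparr>"

definition mpoly_monom :: "('s, 'c) ring_scheme \<Rightarrow> 'v multiset \<Rightarrow> ('v multiset \<Rightarrow> 's)" where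
  "mpoly_monom S a = (\<lambda>m. if m = a then \<one>\<^bsub>S\<^esub> else \<zero>\<^bsub>S\<^esub>)"

definition monomial_ideal ::
  "('s, 'c) ring_scheme \<Rightarrow> 'v set \<Rightarrow> ('v multiset \<Rightarrow> 's) set \<Rightarrow> bool" where
  "monomial_ideal S V B \<longleftrightarrow>
     (\<exists>A \<subseteq> {a. set_mset a \<subseteq> V}. B = genideal (mpoly_ring S V) (mpoly_monom S ` A))"


section \<open>Homomorphisms of modules and functors\<close>

definition mod_hom ::
  "('a, 'r) ring_scheme \<Rightarrow> ('a, 'm) module \<Rightarrow> ('a, 'n) module \<Rightarrow> ('m \<Rightarrow> 'n) set" where
  "mod_hom R M N = {f \<in> carrier M \<rightarrow> carrier N.
     (\<forall>x\<in>carrier M. \<forall>y\<in>carrier M. f (x \<oplus>\<^bsub>M\<^esub> y) = f x \<oplus>\<^bsub>N\<^esub> f y) \<and>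
     (\<forall>a\<in>carrier R. \<forall>x\<in>carrier M. f (a \<odot>\<^bsub>M\<^esub> x) = a \<odot>\<^bsub>N\<^esub> f x)}"

definition mod_iso ::
  "('a, 'r) ring_scheme \<Rightarrow> ('a, 'm) module \<Rightarrow> ('a, 'n) module \<Rightarrow> ('m \<Rightarrow> 'n) set" where
  "mod_iso R M N = {f \<in> mod_hom R M N. bij_betw f (carrier M) (carrier N)}"

text \<open>\<open>on_hom F M N f\<close> is the map \<open>F f : F M \<rightarrow> F N\<close> induced by \<open>f : M \<rightarrow> N\<close>.\<close>

record ('a, 'm, 'n) mod_functor =
  on_obj :: "('a, 'm) module \<Rightarrow> ('a, 'n) module"
  on_hom :: "('a, 'm) module \<Rightarrow> ('a, 'm) module \<Rightarrow> ('m \<Rightarrow> 'm) \<Rightarrow> 'n \<Rightarrow> 'n"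

definition naturally_isomorphic ::
  "('a, 'r) ring_scheme \<Rightarrow> ('a, 'm, 'n) mod_functor \<Rightarrow> ('a, 'm, 'k) mod_functor \<Rightarrow> bool" where
  "naturally_isomorphic R F G \<longleftrightarrow>
     (\<exists>\<theta> :: ('a, 'm) module \<Rightarrow> 'n \<Rightarrow> 'k.
        (\<forall>M. module R M \<longrightarrow> \<theta> M \<in> mod_iso R (on_obj F M) (on_obj G M)) \<and>
        (\<forall>M N f. module R M \<and> module R N \<and> f \<in> mod_hom R M N \<longrightarrow>
           (\<forall>x\<in>carrier (on_obj F M). \<theta> N (on_hom F M N f x) = on_hom G M N f (\<theta> M x))))"


section \<open>Cohomology of cochain complexes\<close>

definition cocycles ::
  "(nat \<Rightarrow> ('a, 'n) module) \<Rightarrow> (nat \<Rightarrow> 'n \<Rightarrow> 'n) \<Rightarrow> nat \<Rightarrow> 'n set" where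
  "cocycles C d l = {z \<in> carrier (C l). d l z = \<zero>\<^bsub>C (Suc l)\<^esub>}"

definition coboundaries ::
  "(nat \<Rightarrow> ('a, 'n) module) \<Rightarrow> (nat \<Rightarrow> 'n \<Rightarrow> 'n) \<Rightarrow> nat \<Rightarrow> 'n set" where
  "coboundaries C d l = (case l of 0 \<Rightarrow> {\<zero>\<^bsub>C 0\<^esub>} | Suc k \<Rightarrow> d k ` carrier (C k))"

text \<open>The fields \<open>mult\<close> and \<open>one\<close> that the record type \<open>module\<close> inherits from \<open>ring\<close> play no role
  for modules.\<close>

definition cohomology ::
  "(nat \<Rightarrow> ('a, 'n) module) \<Rightarrow> (nat \<Rightarrow> 'n \<Rightarrow> 'n) \<Rightarrow> nat \<Rightarrow> ('a, 'n set) module" where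
  "cohomology C d l = \<lparr>
     carrier = (\<lambda>z. coboundaries C d l +>\<^bsub>C l\<^esub> z) ` cocycles C d l,
     monoid.mult = undefined,
     monoid.one = undefined,
     ring.zero = coboundaries C d l,
     ring.add = (\<lambda>Y Z. Y <+>\<^bsub>C l\<^esub> Z),
     smult = (\<lambda>a Z. \<Union>z\<in>Z. coboundaries C d l +>\<^bsub>C l\<^esub> (a \<odot>\<^bsub>C l\<^esub> z))\<rparr>"

text \<open>The map induced by a cochain map \<open>\<phi>\<close> into the complex \<open>(D, \<delta>)\<close>.  On a class \<open>Z\<close> the sets in the
  union all coincide.\<close>

definition cohomology_map ::
  "(nat \<Rightarrow> ('a, 'k) module) \<Rightarrow> (nat \<Rightarrow> 'k \<Rightarrow> 'k) \<Rightarrow> (nat \<Rightarrow> 'n \<Rightarrow> 'k) \<Rightarrow> nat \<Rightarrow> 'n set \<Rightarrow> 'k set" where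
  "cohomology_map D \<delta> \<phi> l Z = (\<Union>z\<in>Z. coboundaries D \<delta> l +>\<^bsub>D l\<^esub> \<phi> l z)"


section \<open>Injective resolutions and right derived functors\<close>

text \<open>All modules in a HOL statement have their carriers in fixed types.  Below, \<open>'i\<close> is the type of
  the terms of injective resolutions, and injectivity is tested against the modules with carrier
  in \<open>'i\<close>.\<close>

definition injective_module :: "('a, 'r) ring_scheme \<Rightarrow> ('a, 'i) module \<Rightarrow> bool" where
  "injective_module R I \<longleftrightarrow> module R I \<and>
     (\<forall>(M :: ('a, 'i) module) (N :: ('a, 'i) module) f g.
        module R M \<and> module R N \<and> f \<in> mod_hom R M N \<and> inj_on f (carrier M) \<and> g \<in> mod_hom R M I \<longrightarrow>
        (\<exists>h \<in> mod_hom R N I. \<forall>x\<in>carrier M. h (f x) = g x))"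

record ('a, 'm, 'i) resolution =
  terms :: "nat \<Rightarrow> ('a, 'i) module"
  diff :: "nat \<Rightarrow> 'i \<Rightarrow> 'i"
  aug :: "'m \<Rightarrow> 'i"

text \<open>Exactness of \<open>0 \<rightarrow> M \<rightarrow> I\<^sup>0 \<rightarrow> I\<^sup>1 \<rightarrow> \<dots>\<close> with all \<open>I\<^sup>n\<close> injective.\<close>

definition injective_resolution ::
  "('a, 'r) ring_scheme \<Rightarrow> ('a, 'm) module \<Rightarrow> ('a, 'm, 'i) resolution \<Rightarrow> bool" where
  "injective_resolution R M P \<longleftrightarrow>
     (\<forall>n. injective_module R (terms P n)) \<and>
     (\<forall>n. diff P n \<in> mod_hom R (terms P n) (terms P (Suc n))) \<and>
     aug P \<in> mod_hom R M (terms P 0) \<and>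
     inj_on (aug P) (carrier M) \<and>
     aug P ` carrier M = cocycles (terms P) (diff P) 0 \<and>
     (\<forall>n. diff P n ` carrier (terms P n) = cocycles (terms P) (diff P) (Suc n))"

definition lifts_to_resolutions ::
  "('a, 'r) ring_scheme \<Rightarrow> ('a, 'm) module \<Rightarrow> ('m \<Rightarrow> 'm) \<Rightarrow>
     ('a, 'm, 'i) resolution \<Rightarrow> ('a, 'm, 'i) resolution \<Rightarrow> (nat \<Rightarrow> 'i \<Rightarrow> 'i) \<Rightarrow> bool" where
  "lifts_to_resolutions R M f P Q \<phi> \<longleftrightarrow>
     (\<forall>n. \<phi> n \<in> mod_hom R (terms P n) (terms Q n)) \<and>
     (\<forall>n. \<forall>x\<in>carrier (terms P n). \<phi> (Suc n) (diff P n x) = diff Q n (\<phi> n x)) \<and>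
     (\<forall>x\<in>carrier M. \<phi> 0 (aug P x) = aug Q (f x))"

text \<open>The functor computed from a choice \<open>\<rho>\<close> of an injective resolution of every module:
  \<open>M\<close> goes to the cohomology of \<open>F (\<rho> M)\<close>, and \<open>f : M \<rightarrow> N\<close> to the map induced by
  any lift of \<open>f\<close> to the chosen resolutions (unique up to homotopy).\<close>

definition right_derived ::
  "('a, 'r) ring_scheme \<Rightarrow> (('a, 'm) module \<Rightarrow> ('a, 'm, 'i) resolution) \<Rightarrow> nat \<Rightarrow>
     ('a, 'i, 'j) mod_functor \<Rightarrow> ('a, 'm, 'j set) mod_functor" where
  "right_derived R \<rho> l F =
    (let C = (\<lambda>M n. on_obj F (terms (\<rho> M) n));
         d = (\<lambda>M n. on_hom F (terms (\<rho> M) n) (terms (\<rho> M) (Suc n)) (diff (\<rho> M) n))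
     in \<lparr> on_obj = (\<lambda>M. cohomology (C M) (d M) l),
          on_hom = (\<lambda>M N f.
            let \<phi> = (SOME \<phi>. lifts_to_resolutions R M f (\<rho> M) (\<rho> N) \<phi>)
            in cohomology_map (C N) (d N)
                 (\<lambda>n. on_hom F (terms (\<rho> M) n) (terms (\<rho> N) n) (\<phi> n)) l) \<rparr>)"

text \<open>\<open>G\<close> is the \<open>l\<close>-th right derived functor of \<open>F\<close>: injective resolutions exist, and whichever are
  chosen, \<open>G\<close> is naturally isomorphic to the functor they compute.\<close>

definition is_right_derived_functor ::
  "('a, 'r) ring_scheme \<Rightarrow> nat \<Rightarrow> ('a, 'i, 'j) mod_functor \<Rightarrow> ('a, 'm, 'n) mod_functor \<Rightarrow> bool" where
  "is_right_derived_functor R l F G \<longleftrightarrow>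
     (\<exists>\<rho> :: ('a, 'm) module \<Rightarrow> ('a, 'm, 'i) resolution.
        \<forall>M. module R M \<longrightarrow> injective_resolution R M (\<rho> M)) \<and>
     (\<forall>\<rho> :: ('a, 'm) module \<Rightarrow> ('a, 'm, 'i) resolution.
        (\<forall>M. module R M \<longrightarrow> injective_resolution R M (\<rho> M)) \<longrightarrow>
        naturally_isomorphic R G (right_derived R \<rho> l F))"

text \<open>A type for the terms of injective resolutions of modules with carrier in \<open>'m\<close> over rings with
  carrier in \<open>'a\<close>.  It is infinite, contains copies of \<open>'a\<close> and \<open>'m\<close>, and is equipotent to the type of
  functions from \<open>'a\<close> to it.  So each module with carrier in \<open>'m\<close> or in this type embeds into an
  injective one with carrier in this type (namely \<open>Hom\<^sub>\<int>(R, D)\<close> for a divisible group \<open>D\<close>), and by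
  Baer's criterion injectivity tested against modules with carrier in this type is injectivity in the
  category of all modules.\<close>

type_synonym ('a, 'm) inj_univ = "nat \<times> 'a \<Rightarrow> nat + 'm"


section \<open>The functor of torsion elements\<close>

definition torsion ::
  "('a, 'r) ring_scheme \<Rightarrow> 'a set \<Rightarrow> ('a, 'm) module \<Rightarrow> 'm set" where
  "torsion R B M =
     {x \<in> carrier M. \<exists>n::nat. \<forall>b \<in> B [^]\<^bsub>ideals_set R\<^esub> n. b \<odot>\<^bsub>M\<^esub> x = \<zero>\<^bsub>M\<^esub>}"

definition torsion_functor :: "('a, 'r) ring_scheme \<Rightarrow> 'a set \<Rightarrow> ('a, 'm, 'm) mod_functor" where
  "torsion_functor R B = \<lparr>
     on_obj = (\<lambda>M. M\<lparr>carrier := torsion R B M\<rparr>),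
     on_hom = (\<lambda>M N f. restrict f (torsion R B M))\<rparr>"


section \<open>Localisation of modules\<close>

text \<open>The module \<open>M\<^sub>x\<close> of fractions \<open>m / x\<^sup>k\<close>, as equivalence classes of pairs \<open>(m, k)\<close>.\<close>

definition loc_rel ::
  "('a, 'r) ring_scheme \<Rightarrow> ('a, 'm) module \<Rightarrow> 'a \<Rightarrow> (('m \<times> nat) \<times> ('m \<times> nat)) set" where
  "loc_rel R M x = {((m, k), (n, l)). m \<in> carrier M \<and> n \<in> carrier M \<and>
     (\<exists>t::nat. (x [^]\<^bsub>R\<^esub> (t + l)) \<odot>\<^bsub>M\<^esub> m = (x [^]\<^bsub>R\<^esub> (t + k)) \<odot>\<^bsub>M\<^esub> n)}"

definition loc_frac ::
  "('a, 'r) ring_scheme \<Rightarrow> ('a, 'm) module \<Rightarrow> 'a \<Rightarrow> 'm \<Rightarrow> nat \<Rightarrow> ('m \<times> nat) set" where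
  "loc_frac R M x m k = loc_rel R M x `` {(m, k)}"

definition loc_module ::
  "('a, 'r) ring_scheme \<Rightarrow> ('a, 'm) module \<Rightarrow> 'a \<Rightarrow> ('a, ('m \<times> nat) set) module" where
  "loc_module R M x = \<lparr>
     carrier = (carrier M \<times> UNIV) // loc_rel R M x,
     monoid.mult = undefined,
     monoid.one = undefined,
     ring.zero = loc_frac R M x \<zero>\<^bsub>M\<^esub> 0,
     ring.add = (\<lambda>Y Z. \<Union>(m, k)\<in>Y. \<Union>(n, l)\<in>Z.
       loc_frac R M x ((x [^]\<^bsub>R\<^esub> l) \<odot>\<^bsub>M\<^esub> m \<oplus>\<^bsub>M\<^esub> (x [^]\<^bsub>R\<^esub> k) \<odot>\<^bsub>M\<^esub> n) (k + l)),
     smult = (\<lambda>a Z. \<Union>(m, k)\<in>Z. loc_frac R M x (a \<odot>\<^bsub>M\<^esub> m) k)\<rparr>"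


section \<open>The Cech complex\<close>

text \<open>For \<open>x\<^sub>0, \<dots>, x\<^sub>n\<^sub>-\<^sub>1\<close> given by the list \<open>xs\<close>, the term of degree \<open>p\<close> is the direct sum of
  the modules \<open>M\<^sub>x\<^sub>(\<^sub>\<sigma>\<^sub>)\<close> over the subsets \<open>\<sigma>\<close> of \<open>{..<n}\<close> with \<open>p\<close> elements, where \<open>x(\<sigma>)\<close> is the product
  of the \<open>x\<^sub>i\<close> with \<open>i \<in> \<sigma>\<close>.  The term of degree \<open>0\<close> is \<open>M\<close>, in the shape of its localisation at \<open>1\<close>.\<close>

definition cech_index :: "'a list \<Rightarrow> nat \<Rightarrow> nat set set" where
  "cech_index xs p = {\<sigma>. \<sigma> \<subseteq> {..<length xs} \<and> card \<sigma> = p}"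

definition cech_prod :: "('a, 'r) ring_scheme \<Rightarrow> 'a list \<Rightarrow> nat set \<Rightarrow> 'a" where
  "cech_prod R xs \<sigma> = finprod R (\<lambda>i. xs ! i) \<sigma>"

definition cech_term ::
  "('a, 'r) ring_scheme \<Rightarrow> 'a list \<Rightarrow> ('a, 'm) module \<Rightarrow> nat \<Rightarrow>
     ('a, nat set \<Rightarrow> ('m \<times> nat) set) module" where
  "cech_term R xs M p =
    (let L = (\<lambda>\<sigma>. loc_module R M (cech_prod R xs \<sigma>)); T = cech_index xs p
     in \<lparr> carrier = (\<Pi>\<^sub>E \<sigma>\<in>T. carrier (L \<sigma>)),
          monoid.mult = undefined,
          monoid.one = undefined,
          ring.zero = (\<lambda>\<sigma>\<in>T. \<zero>\<^bsub>L \<sigma>\<^esub>),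
          ring.add = (\<lambda>b c. \<lambda>\<sigma>\<in>T. b \<sigma> \<oplus>\<^bsub>L \<sigma>\<^esub> c \<sigma>),
          smult = (\<lambda>a c. \<lambda>\<sigma>\<in>T. a \<odot>\<^bsub>L \<sigma>\<^esub> c \<sigma>) \<rparr>)"

text \<open>The localisation map from \<open>M\<^sub>x\<^sub>(\<^sub>\<sigma>\<^sub>-\<^sub>{\<^sub>j\<^sub>}\<^sub>)\<close> to \<open>M\<^sub>x\<^sub>(\<^sub>\<sigma>\<^sub>)\<close> for \<open>j \<in> \<sigma>\<close>; it rewrites \<open>m / x(\<sigma> - {j})\<^sup>k\<close>
  as \<open>x\<^sub>j\<^sup>k m / x(\<sigma>)\<^sup>k\<close>.\<close>

definition cech_res ::
  "('a, 'r) ring_scheme \<Rightarrow> 'a list \<Rightarrow> ('a, 'm) module \<Rightarrow> nat set \<Rightarrow> nat \<Rightarrow>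
     ('m \<times> nat) set \<Rightarrow> ('m \<times> nat) set" where
  "cech_res R xs M \<sigma> j Z =
     (\<Union>(m, k)\<in>Z. loc_frac R M (cech_prod R xs \<sigma>) (((xs ! j) [^]\<^bsub>R\<^esub> k) \<odot>\<^bsub>M\<^esub> m) k)"

text \<open>The summand for \<open>j\<close> has the sign \<open>(-1)\<^sup>q\<close> if \<open>q\<close> elements of \<open>\<sigma>\<close> are smaller than \<open>j\<close>.\<close>

definition cech_diff ::
  "('a, 'r) ring_scheme \<Rightarrow> 'a list \<Rightarrow> ('a, 'm) module \<Rightarrow> nat \<Rightarrow>
     (nat set \<Rightarrow> ('m \<times> nat) set) \<Rightarrow> nat set \<Rightarrow> ('m \<times> nat) set" where
  "cech_diff R xs M p c = (\<lambda>\<sigma>\<in>cech_index xs (Suc p).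
     let L = loc_module R M (cech_prod R xs \<sigma>)
     in finsum L (\<lambda>j. let y = cech_res R xs M \<sigma> j (c (\<sigma> - {j}))
                      in if even (card {i\<in>\<sigma>. i < j}) then y else \<ominus>\<^bsub>L\<^esub> y) \<sigma>)"

definition cech_map ::
  "('a, 'r) ring_scheme \<Rightarrow> 'a list \<Rightarrow> ('a, 'n) module \<Rightarrow> ('m \<Rightarrow> 'n) \<Rightarrow> nat \<Rightarrow>
     (nat set \<Rightarrow> ('m \<times> nat) set) \<Rightarrow> nat set \<Rightarrow> ('n \<times> nat) set" where
  "cech_map R xs N f p c = (\<lambda>\<sigma>\<in>cech_index xs p.
     \<Union>(m, k)\<in>c \<sigma>. loc_frac R N (cech_prod R xs \<sigma>) (f m) k)"

definition cech_cohomology ::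
  "('a, 'r) ring_scheme \<Rightarrow> 'a list \<Rightarrow> nat \<Rightarrow>
     ('a, 'm, (nat set \<Rightarrow> ('m \<times> nat) set) set) mod_functor" where
  "cech_cohomology R xs l = \<lparr>
     on_obj = (\<lambda>M. cohomology (cech_term R xs M) (cech_diff R xs M) l),
     on_hom = (\<lambda>M N f. cohomology_map (cech_term R xs N) (cech_diff R xs N) (cech_map R xs N f) l)\<rparr>"

end

theory Submission
  imports Defs "HOL-Library.Nat_Bijection"
begin

text \<open>Let \<open>M \<rightarrow> I\<^sup>0 \<rightarrow> I\<^sup>1 \<rightarrow> \<dots>\<close> be an injective resolution, and let \<open>C(N)\<close> denote the Cech complex of a
  module \<open>N\<close> on generators \<open>x\<^sub>i\<close> of \<open>B\<close>.  The two functors are compared through the double complex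
  \<open>C\<^sup>p(I\<^sup>q)\<close>.  For fixed \<open>p\<close> it is a resolution of \<open>C\<^sup>p(M)\<close>, because localisation is exact
  (\<open>cech_map_exact\<close>).  For fixed \<open>q\<close> its cohomology in degree \<open>0\<close> is the submodule of \<open>B\<close>-torsion
  elements of \<open>I\<^sup>q\<close> (\<open>coaug_cocycle_iff\<close>), and if the Cech complex of an injective module has no
  cohomology in positive degrees, it is a resolution of that submodule.  A double complex that is
  resolved in both directions identifies the cohomologies of the two complexes it resolves
  (\<open>linked_cohomology_relation\<close>), here the Cech complex of \<open>M\<close> and the complex of torsion submodules
  of the \<open>I\<^sup>q\<close>, and a map of double complexes respects the identification (\<open>linked_map\<close>).

  It remains to show that the Cech complex of an injective module \<open>I\<close> is acyclic in positive
  degrees.  The Cech complex is the direct limit over \<open>s\<close> of the Koszul complexes of the powers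
  \<open>x\<^sub>i\<^sup>s\<close> with values in \<open>I\<close>, so the claim is that each cocycle of positive degree becomes a coboundary
  when \<open>s\<close> is increased (\<open>koszul_acyclic\<close>).  As \<open>Hom(-, I)\<close> is exact, this follows if the transition
  maps between the Koszul complexes of \<open>R\<close> itself eventually vanish on homology in positive degrees
  (\<open>injective_koszul_acyclic\<close>), that is, if the \<open>x\<^sub>i\<close> form a weakly proregular sequence.  Monomials do,
  over every coefficient ring (\<open>weakly_proregular\<close>): in each multidegree the Koszul complex is the
  chain complex of a simplicial complex with coefficients in \<open>S\<close>, and the transition map factors
  through the chain complex of a full simplex, which is acyclic.

  The given generators are arbitrary.  But the vanishing only depends on the radical of the ideal
  they generate: if a power of \<open>x\<^sub>j\<close> is a combination of the other \<open>x\<^sub>i\<^sup>s\<close>, contraction with its coefficients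
  is a homotopy that allows to add or to drop \<open>x\<^sub>j\<close> (\<open>koszul_acyclic_change_generators\<close>).

  Finally, injective resolutions exist in the prescribed type, since every quotient of a module
  embeds into \<open>Hom\<^sub>\<int>(R, D)\<close> for a divisible group \<open>D\<close> (\<open>enough_injectives\<close>).\<close>


section \<open>Homomorphisms of modules\<close>

lemma mod_homI:
  assumes "\<And>x. x \<in> carrier M \<Longrightarrow> f x \<in> carrier N"
    and "\<And>x y. x \<in> carrier M \<Longrightarrow> y \<in> carrier M \<Longrightarrow> f (x \<oplus>\<^bsub>M\<^esub> y) = f x \<oplus>\<^bsub>N\<^esub> f y"
    and "\<And>a x. a \<in> carrier R \<Longrightarrow> x \<in> carrier M \<Longrightarrow> f (a \<odot>\<^bsub>M\<^esub> x) = a \<odot>\<^bsub>N\<^esub> f x"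
  shows "f \<in> mod_hom R M N"
  using assms unfolding mod_hom_def by auto

lemma mod_hom_closed: "f \<in> mod_hom R M N \<Longrightarrow> x \<in> carrier M \<Longrightarrow> f x \<in> carrier N"
  and mod_hom_add: "f \<in> mod_hom R M N \<Longrightarrow> x \<in> carrier M \<Longrightarrow> y \<in> carrier M \<Longrightarrow>
    f (x \<oplus>\<^bsub>M\<^esub> y) = f x \<oplus>\<^bsub>N\<^esub> f y"
  and mod_hom_smult: "f \<in> mod_hom R M N \<Longrightarrow> a \<in> carrier R \<Longrightarrow> x \<in> carrier M \<Longrightarrow>
    f (a \<odot>\<^bsub>M\<^esub> x) = a \<odot>\<^bsub>N\<^esub> f x"
  unfolding mod_hom_def by auto

lemma mod_hom_zero:
  assumes "module R M" "module R N" "f \<in> mod_hom R M N"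
  shows "f \<zero>\<^bsub>M\<^esub> = \<zero>\<^bsub>N\<^esub>"
proof -
  interpret M: module R M by fact
  interpret N: module R N by fact
  have "f (\<zero>\<^bsub>R\<^esub> \<odot>\<^bsub>M\<^esub> \<zero>\<^bsub>M\<^esub>) = \<zero>\<^bsub>R\<^esub> \<odot>\<^bsub>N\<^esub> f \<zero>\<^bsub>M\<^esub>"
    by (rule mod_hom_smult[OF assms(3)]) auto
  then show ?thesis
    using mod_hom_closed[OF assms(3) M.M.zero_closed] by simp
qed

lemma mod_hom_neg:
  assumes "module R M" "module R N" "f \<in> mod_hom R M N" "x \<in> carrier M"
  shows "f (\<ominus>\<^bsub>M\<^esub> x) = \<ominus>\<^bsub>N\<^esub> f x"
proof -
  interpret M: module R M by fact
  interpret N: module R N by fact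
  have "f x \<oplus>\<^bsub>N\<^esub> f (\<ominus>\<^bsub>M\<^esub> x) = \<zero>\<^bsub>N\<^esub>"
    using mod_hom_add[OF assms(3,4), of "\<ominus>\<^bsub>M\<^esub> x"] assms mod_hom_zero[OF assms(1-3)]
    by (simp add: M.r_neg)
  moreover have "f x \<in> carrier N" "f (\<ominus>\<^bsub>M\<^esub> x) \<in> carrier N"
    using assms by (auto intro: mod_hom_closed)
  ultimately show ?thesis
    using N.M.minus_equality N.M.a_comm by metis
qed

lemma mod_hom_finsum:
  assumes "module R M" "module R N" "f \<in> mod_hom R M N" "finite A" "g \<in> A \<rightarrow> carrier M"
  shows "f (finsum M g A) = finsum N (\<lambda>i. f (g i)) A"
proof -
  interpret M: module R M by fact
  interpret N: module R N by fact
  show ?thesis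
    using assms(4,5)
  proof (induction A)
    case empty
    then show ?case using mod_hom_zero[OF assms(1-3)] by simp
  next
    case (insert a A)
    then have *: "g a \<in> carrier M" "g \<in> A \<rightarrow> carrier M" by auto
    have **: "(\<lambda>i. f (g i)) \<in> A \<rightarrow> carrier N" "f (g a) \<in> carrier N"
      using * assms(3) by (auto intro: mod_hom_closed)
    show ?case
      using insert * ** by (simp add: mod_hom_add[OF assms(3)] M.M.finsum_closed)
  qed
qed

lemma mod_hom_compose:
  assumes "f \<in> mod_hom R M N" "g \<in> mod_hom R N P"
  shows "(\<lambda>x. g (f x)) \<in> mod_hom R M P"
  using assms by (intro mod_homI) (auto simp: mod_hom_closed mod_hom_add mod_hom_smult)

lemma module_restrict_carrier:
  assumes "module R M" "L \<subseteq> carrier M" "\<zero>\<^bsub>M\<^esub> \<in> L"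
    and "\<And>x y. x \<in> L \<Longrightarrow> y \<in> L \<Longrightarrow> x \<oplus>\<^bsub>M\<^esub> y \<in> L"
    and "\<And>a x. a \<in> carrier R \<Longrightarrow> x \<in> L \<Longrightarrow> a \<odot>\<^bsub>M\<^esub> x \<in> L"
  shows "module R (M\<lparr>carrier := L\<rparr>)"
proof -
  interpret M: module R M by fact
  have neg: "\<ominus>\<^bsub>M\<^esub> x \<in> L" if "x \<in> L" for x
    using assms(5)[of "\<ominus>\<^bsub>R\<^esub> \<one>\<^bsub>R\<^esub>" x] that assms(2) M.smult_l_minus[of "\<one>\<^bsub>R\<^esub>" x] by auto
  show ?thesis
  proof (rule moduleI)
    show "abelian_group (M\<lparr>carrier := L\<rparr>)"
    proof (rule abelian_groupI)
      fix x assume "x \<in> carrier (M\<lparr>carrier := L\<rparr>)"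
      then show "\<exists>y\<in>carrier (M\<lparr>carrier := L\<rparr>). y \<oplus>\<^bsub>M\<lparr>carrier := L\<rparr>\<^esub> x = \<zero>\<^bsub>M\<lparr>carrier := L\<rparr>\<^esub>"
        using assms(2) by (intro bexI[of _ "\<ominus>\<^bsub>M\<^esub> x"]) (auto simp: neg M.l_neg)
    qed (use assms in \<open>auto simp: subset_iff M.M.a_assoc intro!: M.M.a_comm\<close>)
  qed (use assms in \<open>auto simp: subset_iff M.smult_l_distr M.smult_r_distr M.smult_assoc1 intro: M.is_cring\<close>)
qed


section \<open>Double complexes\<close>

text \<open>With anticommuting differentials the total differential needs no signs, and exchanging the two
  indices yields a double complex again.\<close>

locale double_complex =
  fixes R :: "('a, 'r) ring_scheme"
    and K :: "nat \<Rightarrow> nat \<Rightarrow> ('a, 'e) module"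
    and h v :: "nat \<Rightarrow> nat \<Rightarrow> 'e \<Rightarrow> 'e"
  assumes K: "\<And>p q. module R (K p q)"
    and h: "\<And>p q. h p q \<in> mod_hom R (K p q) (K (Suc p) q)"
    and v: "\<And>p q. v p q \<in> mod_hom R (K p q) (K p (Suc q))"
    and hh: "\<And>p q x. x \<in> carrier (K p q) \<Longrightarrow> h (Suc p) q (h p q x) = \<zero>\<^bsub>K (Suc (Suc p)) q\<^esub>"
    and vv: "\<And>p q x. x \<in> carrier (K p q) \<Longrightarrow> v p (Suc q) (v p q x) = \<zero>\<^bsub>K p (Suc (Suc q))\<^esub>"
    and hv: "\<And>p q x. x \<in> carrier (K p q) \<Longrightarrow>
      h p (Suc q) (v p q x) \<oplus>\<^bsub>K (Suc p) (Suc q)\<^esub> v (Suc p) q (h p q x) = \<zero>\<^bsub>K (Suc p) (Suc q)\<^esub>"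
begin

text \<open>Elements of the total complex of all degrees at once: the part in degree \<open>l\<close> consists of the
  components with \<open>p + q = l\<close>, and statements about degree \<open>l\<close> are restricted to these.\<close>

definition fam :: "(nat \<Rightarrow> nat \<Rightarrow> 'e) \<Rightarrow> bool" where
  "fam c \<longleftrightarrow> (\<forall>p q. c p q \<in> carrier (K p q))"

definition hpart :: "(nat \<Rightarrow> nat \<Rightarrow> 'e) \<Rightarrow> nat \<Rightarrow> nat \<Rightarrow> 'e" where
  "hpart c p q = (case p of 0 \<Rightarrow> \<zero>\<^bsub>K p q\<^esub> | Suc p' \<Rightarrow> h p' q (c p' q))"

definition vpart :: "(nat \<Rightarrow> nat \<Rightarrow> 'e) \<Rightarrow> nat \<Rightarrow> nat \<Rightarrow> 'e" where
  "vpart c p q = (case q of 0 \<Rightarrow> \<zero>\<^bsub>K p q\<^esub> | Suc q' \<Rightarrow> v p q' (c p q'))"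

definition tdiff :: "(nat \<Rightarrow> nat \<Rightarrow> 'e) \<Rightarrow> nat \<Rightarrow> nat \<Rightarrow> 'e" where
  "tdiff c p q = hpart c p q \<oplus>\<^bsub>K p q\<^esub> vpart c p q"

definition fadd :: "(nat \<Rightarrow> nat \<Rightarrow> 'e) \<Rightarrow> (nat \<Rightarrow> nat \<Rightarrow> 'e) \<Rightarrow> nat \<Rightarrow> nat \<Rightarrow> 'e" where
  "fadd c d p q = c p q \<oplus>\<^bsub>K p q\<^esub> d p q"

definition fsmult :: "'a \<Rightarrow> (nat \<Rightarrow> nat \<Rightarrow> 'e) \<Rightarrow> nat \<Rightarrow> nat \<Rightarrow> 'e" where
  "fsmult r c p q = r \<odot>\<^bsub>K p q\<^esub> c p q"

definition fneg :: "(nat \<Rightarrow> nat \<Rightarrow> 'e) \<Rightarrow> nat \<Rightarrow> nat \<Rightarrow> 'e" where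
  "fneg c p q = \<ominus>\<^bsub>K p q\<^esub> c p q"

lemma famD: "fam c \<Longrightarrow> c p q \<in> carrier (K p q)"
  by (simp add: fam_def)

lemma K_group: "abelian_group (K p q)"
  using K[of p q] by (simp add: module_def)

lemma K_add: "x \<in> carrier (K p q) \<Longrightarrow> y \<in> carrier (K p q) \<Longrightarrow> x \<oplus>\<^bsub>K p q\<^esub> y \<in> carrier (K p q)"
  using abelian_group.axioms(1)[OF K_group[of p q]] by (simp add: abelian_monoid.a_closed)

lemma h_closed: "x \<in> carrier (K p q) \<Longrightarrow> h p q x \<in> carrier (K (Suc p) q)"
  and v_closed: "x \<in> carrier (K p q) \<Longrightarrow> v p q x \<in> carrier (K p (Suc q))"
  by (rule mod_hom_closed[OF h], assumption) (rule mod_hom_closed[OF v])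

lemma K_simps [simp]:
  "\<zero>\<^bsub>K p q\<^esub> \<in> carrier (K p q)"
  "x \<in> carrier (K p q) \<Longrightarrow> \<zero>\<^bsub>K p q\<^esub> \<oplus>\<^bsub>K p q\<^esub> x = x"
  "x \<in> carrier (K p q) \<Longrightarrow> x \<oplus>\<^bsub>K p q\<^esub> \<zero>\<^bsub>K p q\<^esub> = x"
  "\<ominus>\<^bsub>K p q\<^esub> \<zero>\<^bsub>K p q\<^esub> = \<zero>\<^bsub>K p q\<^esub>"
  "r \<in> carrier R \<Longrightarrow> r \<odot>\<^bsub>K p q\<^esub> \<zero>\<^bsub>K p q\<^esub> = \<zero>\<^bsub>K p q\<^esub>"
proof -
  interpret N: module R "K p q" by (rule K)
  show "\<zero>\<^bsub>K p q\<^esub> \<in> carrier (K p q)"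
    "x \<in> carrier (K p q) \<Longrightarrow> \<zero>\<^bsub>K p q\<^esub> \<oplus>\<^bsub>K p q\<^esub> x = x"
    "x \<in> carrier (K p q) \<Longrightarrow> x \<oplus>\<^bsub>K p q\<^esub> \<zero>\<^bsub>K p q\<^esub> = x"
    "\<ominus>\<^bsub>K p q\<^esub> \<zero>\<^bsub>K p q\<^esub> = \<zero>\<^bsub>K p q\<^esub>"
    "r \<in> carrier R \<Longrightarrow> r \<odot>\<^bsub>K p q\<^esub> \<zero>\<^bsub>K p q\<^esub> = \<zero>\<^bsub>K p q\<^esub>"
    by auto
qed

lemma h_zero: "h p q \<zero>\<^bsub>K p q\<^esub> = \<zero>\<^bsub>K (Suc p) q\<^esub>"
  and v_zero: "v p q \<zero>\<^bsub>K p q\<^esub> = \<zero>\<^bsub>K p (Suc q)\<^esub>"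
  using mod_hom_zero[OF K K h] mod_hom_zero[OF K K v] by auto

lemma hpart_closed: "fam c \<Longrightarrow> hpart c p q \<in> carrier (K p q)"
  and vpart_closed: "fam c \<Longrightarrow> vpart c p q \<in> carrier (K p q)"
  by (auto simp: hpart_def vpart_def famD h_closed v_closed split: nat.split)

lemma fam_tdiff: "fam c \<Longrightarrow> fam (tdiff c)"
  by (simp add: fam_def[of "tdiff c"] tdiff_def hpart_closed vpart_closed K_add)

lemma fam_fadd: "fam c \<Longrightarrow> fam d \<Longrightarrow> fam (fadd c d)"
  by (simp add: fam_def fadd_def K_add)

lemma fam_fneg: "fam c \<Longrightarrow> fam (fneg c)"
  by (simp add: fam_def fneg_def abelian_group.a_inv_closed[OF K_group])

lemma fam_fsmult: "fam c \<Longrightarrow> r \<in> carrier R \<Longrightarrow> fam (fsmult r c)"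
  by (simp add: fam_def fsmult_def module.smult_closed[OF K])

lemma tdiff_fadd:
  assumes "fam c" "fam d"
  shows "tdiff (fadd c d) p q = tdiff c p q \<oplus>\<^bsub>K p q\<^esub> tdiff d p q"
proof -
  interpret N: module R "K p q" by (rule K)
  have "hpart (fadd c d) p q = hpart c p q \<oplus>\<^bsub>K p q\<^esub> hpart d p q"
    unfolding hpart_def fadd_def
    by (cases p) (auto simp: mod_hom_add[OF h] famD assms)
  moreover have "vpart (fadd c d) p q = vpart c p q \<oplus>\<^bsub>K p q\<^esub> vpart d p q"
    unfolding vpart_def fadd_def
    by (cases q) (auto simp: mod_hom_add[OF v] famD assms)
  ultimately show ?thesis
    unfolding tdiff_def
    using hpart_closed[OF assms(1)] hpart_closed[OF assms(2)]
      vpart_closed[OF assms(1)] vpart_closed[OF assms(2)]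
    by (simp add: N.M.a_ac)
qed

lemma tdiff_fneg:
  assumes "fam c"
  shows "tdiff (fneg c) p q = \<ominus>\<^bsub>K p q\<^esub> tdiff c p q"
proof -
  interpret N: module R "K p q" by (rule K)
  have "hpart (fneg c) p q = \<ominus>\<^bsub>K p q\<^esub> hpart c p q"
    unfolding hpart_def fneg_def
    by (cases p) (auto simp: mod_hom_neg[OF K K h] famD assms)
  moreover have "vpart (fneg c) p q = \<ominus>\<^bsub>K p q\<^esub> vpart c p q"
    unfolding vpart_def fneg_def
    by (cases q) (auto simp: mod_hom_neg[OF K K v] famD assms)
  ultimately show ?thesis
    unfolding tdiff_def
    using hpart_closed[OF assms(1)] vpart_closed[OF assms(1)]
    by (simp add: N.M.minus_add)
qed

lemma tdiff_fsmult:
  assumes "fam c" "r \<in> carrier R"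
  shows "tdiff (fsmult r c) p q = r \<odot>\<^bsub>K p q\<^esub> tdiff c p q"
proof -
  interpret N: module R "K p q" by (rule K)
  have "hpart (fsmult r c) p q = r \<odot>\<^bsub>K p q\<^esub> hpart c p q"
    unfolding hpart_def fsmult_def
    by (cases p) (auto simp: mod_hom_smult[OF h] famD assms)
  moreover have "vpart (fsmult r c) p q = r \<odot>\<^bsub>K p q\<^esub> vpart c p q"
    unfolding vpart_def fsmult_def
    by (cases q) (auto simp: mod_hom_smult[OF v] famD assms)
  ultimately show ?thesis
    unfolding tdiff_def
    using hpart_closed[OF assms(1)] vpart_closed[OF assms(1)]
    by (simp add: N.smult_r_distr assms)
qed

lemma tdiff_tdiff:
  assumes "fam c"
  shows "tdiff (tdiff c) p q = \<zero>\<^bsub>K p q\<^esub>"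
proof -
  interpret N: module R "K p q" by (rule K)
  have hp: "hpart (tdiff c) p q = (case p of 0 \<Rightarrow> \<zero>\<^bsub>K p q\<^esub> | Suc p' \<Rightarrow> h p' q (vpart c p' q))"
  proof (cases p)
    case (Suc p')
    interpret N': module R "K (Suc p') q" by (rule K)
    have "h p' q (hpart c p' q) = \<zero>\<^bsub>K (Suc p') q\<^esub>"
      by (cases p') (auto simp: hpart_def h_zero hh famD assms)
    then show ?thesis
      using Suc mod_hom_add[OF h hpart_closed[OF assms] vpart_closed[OF assms], of p' q]
        h_closed[OF vpart_closed[OF assms]]
      by (simp add: hpart_def[of "tdiff c"] tdiff_def)
  qed (simp add: hpart_def)
  have vp: "vpart (tdiff c) p q = (case q of 0 \<Rightarrow> \<zero>\<^bsub>K p q\<^esub> | Suc q' \<Rightarrow> v p q' (hpart c p q'))"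
  proof (cases q)
    case (Suc q')
    interpret N': module R "K p (Suc q')" by (rule K)
    have "v p q' (vpart c p q') = \<zero>\<^bsub>K p (Suc q')\<^esub>"
      by (cases q') (auto simp: vpart_def v_zero vv famD assms)
    then show ?thesis
      using Suc mod_hom_add[OF v hpart_closed[OF assms] vpart_closed[OF assms], of p q']
        v_closed[OF hpart_closed[OF assms]]
      by (simp add: vpart_def[of "tdiff c"] tdiff_def)
  qed (simp add: vpart_def)
  show ?thesis
    unfolding tdiff_def[of "tdiff c"] hp vp
    by (cases p; cases q) (auto simp: hpart_def vpart_def h_zero v_zero hv famD assms)
qed

lemma tdiff_cong:
  assumes "\<And>p q. p + q = l \<Longrightarrow> t p q = t' p q" "p + q = Suc l"
  shows "tdiff t p q = tdiff t' p q"
  using assms(2) by (cases p; cases q) (auto simp: tdiff_def hpart_def vpart_def assms(1))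

lemma double_complex_transpose:
  "double_complex R (\<lambda>p q. K q p) (\<lambda>p q. v q p) (\<lambda>p q. h q p)"
proof (rule double_complex.intro, goal_cases)
  case (6 p q x)
  interpret N: module R "K (Suc q) (Suc p)" by (rule K)
  show ?case
    using hv[OF 6] N.M.a_comm[OF h_closed[OF v_closed[OF 6]] v_closed[OF h_closed[OF 6]]] by simp
qed (use K h v hh vv in auto)

lemma tdiff_transpose:
  assumes "fam c"
  shows "double_complex.tdiff (\<lambda>p q. K q p) (\<lambda>p q. v q p) (\<lambda>p q. h q p) (\<lambda>p q. c q p) p q = tdiff c q p"
proof -
  interpret T: double_complex R "\<lambda>p q. K q p" "\<lambda>p q. v q p" "\<lambda>p q. h q p"
    by (rule double_complex_transpose)
  interpret N: module R "K q p" by (rule K)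
  have "T.hpart (\<lambda>p q. c q p) p q = vpart c q p" "T.vpart (\<lambda>p q. c q p) p q = hpart c q p"
    unfolding T.hpart_def T.vpart_def hpart_def vpart_def by (auto split: nat.split)
  then show ?thesis
    unfolding T.tdiff_def tdiff_def
    by (simp add: N.M.a_comm hpart_closed[OF assms] vpart_closed[OF assms])
qed

end

text \<open>A double complex whose columns \<open>K p 0 \<rightarrow> K p 1 \<rightarrow> \<dots>\<close> resolve the terms \<open>A p\<close> of a complex.\<close>

locale resolved_complex = double_complex R K h v
  for R :: "('a, 'r) ring_scheme" and K :: "nat \<Rightarrow> nat \<Rightarrow> ('a, 'e) module"
    and h v :: "nat \<Rightarrow> nat \<Rightarrow> 'e \<Rightarrow> 'e" +
  fixes A :: "nat \<Rightarrow> ('a, 'k) module"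
    and dA :: "nat \<Rightarrow> 'k \<Rightarrow> 'k"
    and a :: "nat \<Rightarrow> 'k \<Rightarrow> 'e"
  assumes A: "\<And>p. module R (A p)"
    and dA: "\<And>p. dA p \<in> mod_hom R (A p) (A (Suc p))"
    and a: "\<And>p. a p \<in> mod_hom R (A p) (K p 0)"
    and a_chain: "\<And>p x. x \<in> carrier (A p) \<Longrightarrow> h p 0 (a p x) = a (Suc p) (dA p x)"
    and a_inj: "\<And>p x. x \<in> carrier (A p) \<Longrightarrow> a p x = \<zero>\<^bsub>K p 0\<^esub> \<Longrightarrow> x = \<zero>\<^bsub>A p\<^esub>"
    and va: "\<And>p x. x \<in> carrier (A p) \<Longrightarrow> v p 0 (a p x) = \<zero>\<^bsub>K p (Suc 0)\<^esub>"
    and exact_0: "\<And>p y. y \<in> carrier (K p 0) \<Longrightarrow> v p 0 y = \<zero>\<^bsub>K p (Suc 0)\<^esub> \<Longrightarrow>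
      \<exists>x\<in>carrier (A p). y = a p x"
    and exact_Suc: "\<And>p q y. y \<in> carrier (K p (Suc q)) \<Longrightarrow> v p (Suc q) y = \<zero>\<^bsub>K p (Suc (Suc q))\<^esub> \<Longrightarrow>
      \<exists>x\<in>carrier (K p q). y = v p q x"
begin

definition aug :: "nat \<Rightarrow> 'k \<Rightarrow> nat \<Rightarrow> nat \<Rightarrow> 'e" where
  "aug l z p q = (if p = l \<and> q = 0 then a l z else \<zero>\<^bsub>K p q\<^esub>)"

lemma a_closed: "z \<in> carrier (A l) \<Longrightarrow> a l z \<in> carrier (K l 0)"
  using a by (rule mod_hom_closed)

lemma fam_aug: "z \<in> carrier (A l) \<Longrightarrow> fam (aug l z)"
  by (auto simp: fam_def aug_def a_closed)

lemma a_zero: "a l \<zero>\<^bsub>A l\<^esub> = \<zero>\<^bsub>K l 0\<^esub>"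
  by (rule mod_hom_zero[OF A K a])

lemma tdiff_aug:
  assumes "z \<in> carrier (A l)"
  shows "tdiff (aug l z) p q = aug (Suc l) (dA l z) p q"
proof -
  interpret N: module R "K p q" by (rule K)
  have "hpart (aug l z) p q = aug (Suc l) (dA l z) p q"
    by (cases p) (auto simp: hpart_def aug_def h_zero a_chain[OF assms])
  moreover have "vpart (aug l z) p q = \<zero>\<^bsub>K p q\<^esub>"
    by (cases q) (auto simp: vpart_def aug_def v_zero va[OF assms])
  moreover have "aug (Suc l) (dA l z) p q \<in> carrier (K p q)"
    using fam_aug[OF mod_hom_closed[OF dA assms]] by (rule famD)
  ultimately show ?thesis
    by (simp add: tdiff_def)
qed

text \<open>The components of \<open>t\<close> are removed one after the other, those with the largest \<open>q\<close> first:
  such a component is a cocycle of its column, so it is hit by an element of \<open>K p (q - 1)\<close>, and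
  subtracting the total differential of that element only affects components with smaller \<open>q\<close>.\<close>

lemma reduce_to_augmentation_aux:
  assumes "fam t"
    and "\<And>p q. p + q = Suc l \<Longrightarrow> q > 0 \<Longrightarrow> tdiff t p q = \<zero>\<^bsub>K p q\<^esub>"
    and "\<And>p q. p + q = l \<Longrightarrow> q > n \<Longrightarrow> t p q = \<zero>\<^bsub>K p q\<^esub>"
  shows "\<exists>y\<in>carrier (A l). \<exists>c. fam c \<and>
    (\<forall>p q. p + q = l \<longrightarrow> t p q = aug l y p q \<oplus>\<^bsub>K p q\<^esub> tdiff c p q)"
  using assms
proof (induction n arbitrary: t)
  case 0
  have hp: "hpart t l (Suc 0) = \<zero>\<^bsub>K l (Suc 0)\<^esub>"
    using 0(3)[of "l - 1" "Suc 0"] by (cases l) (auto simp: hpart_def h_zero)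
  have "tdiff t l (Suc 0) = v l 0 (t l 0)"
    using v_closed[OF famD[OF 0(1)]] by (simp add: tdiff_def hp vpart_def)
  then have "v l 0 (t l 0) = \<zero>\<^bsub>K l (Suc 0)\<^esub>"
    using 0(2)[of l "Suc 0"] by simp
  then obtain y where y: "y \<in> carrier (A l)" "t l 0 = a l y"
    using exact_0 famD[OF 0(1)] by blast
  let ?c = "\<lambda>p q. \<zero>\<^bsub>K p q\<^esub>"
  have fc: "fam ?c" by (simp add: fam_def)
  have "t p q = aug l y p q \<oplus>\<^bsub>K p q\<^esub> tdiff ?c p q" if "p + q = l" for p q
  proof -
    interpret N: module R "K p q" by (rule K)
    have "tdiff ?c p q = \<zero>\<^bsub>K p q\<^esub>"
      by (cases p; cases q) (auto simp: tdiff_def hpart_def vpart_def h_zero v_zero)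
    moreover have "t p q = aug l y p q"
      using 0(3)[OF that] that y(2) by (cases "q = 0") (auto simp: aug_def)
    ultimately show ?thesis
      using famD[OF fam_aug[OF y(1)]] by simp
  qed
  with y(1) fc show ?case by blast
next
  case (Suc n)
  show ?case
  proof (cases "Suc n \<le> l")
    case False
    show ?thesis
      by (rule Suc.IH) (use Suc.prems False in auto)
  next
    case True
    define p0 where "p0 = l - Suc n"
    have p0: "p0 + Suc n = l" using True by (simp add: p0_def)
    have hp: "hpart t p0 (Suc (Suc n)) = \<zero>\<^bsub>K p0 (Suc (Suc n))\<^esub>"
      using Suc.prems(3)[of "p0 - 1" "Suc (Suc n)"] p0 by (cases p0) (auto simp: hpart_def h_zero)
    have "tdiff t p0 (Suc (Suc n)) = v p0 (Suc n) (t p0 (Suc n))"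
      using v_closed[OF famD[OF Suc.prems(1)]] by (simp add: tdiff_def hp vpart_def)
    then have "v p0 (Suc n) (t p0 (Suc n)) = \<zero>\<^bsub>K p0 (Suc (Suc n))\<^esub>"
      using Suc.prems(2)[of p0 "Suc (Suc n)"] p0 by simp
    then obtain e where e: "e \<in> carrier (K p0 n)" "t p0 (Suc n) = v p0 n e"
      using exact_Suc famD[OF Suc.prems(1)] by blast
    define c where "c = (\<lambda>p q. if p = p0 \<and> q = n then e else \<zero>\<^bsub>K p q\<^esub>)"
    have fc: "fam c" by (auto simp: fam_def c_def e)
    define t' where "t' = fadd t (fneg (tdiff c))"
    have ft': "fam t'"
      unfolding t'_def by (intro fam_fadd fam_fneg fam_tdiff fc Suc.prems)
    have t': "t p q = t' p q \<oplus>\<^bsub>K p q\<^esub> tdiff c p q" for p q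
    proof -
      interpret N: module R "K p q" by (rule K)
      show ?thesis
        using famD[OF Suc.prems(1)] famD[OF fam_tdiff[OF fc]]
        by (simp add: t'_def fadd_def fneg_def N.M.a_assoc N.M.l_neg)
    qed
    have "\<exists>y\<in>carrier (A l). \<exists>c. fam c \<and>
      (\<forall>p q. p + q = l \<longrightarrow> t' p q = aug l y p q \<oplus>\<^bsub>K p q\<^esub> tdiff c p q)"
    proof (rule Suc.IH[OF ft'])
      fix p q assume pq: "p + q = Suc l" "q > 0"
      interpret N: module R "K p q" by (rule K)
      show "tdiff t' p q = \<zero>\<^bsub>K p q\<^esub>"
        unfolding t'_def
        using Suc.prems(2)[OF pq] fc Suc.prems(1)
        by (simp add: tdiff_fadd fam_fneg fam_tdiff tdiff_fneg tdiff_tdiff)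
    next
      fix p q assume pq: "p + q = l" "q > n"
      interpret N: module R "K p q" by (rule K)
      have hc: "hpart c p q = \<zero>\<^bsub>K p q\<^esub>"
        using pq by (cases p) (auto simp: hpart_def c_def h_zero)
      show "t' p q = \<zero>\<^bsub>K p q\<^esub>"
      proof (cases "q = Suc n")
        case True
        then have "p = p0" using pq p0 by simp
        then have "tdiff c p q = t p q"
          using hc True e v_closed[OF e(1)] by (simp add: tdiff_def vpart_def c_def)
        then show ?thesis
          using famD[OF Suc.prems(1)] by (simp add: t'_def fadd_def fneg_def N.M.r_neg)
      next
        case False
        then have "vpart c p q = \<zero>\<^bsub>K p q\<^esub>"
          using pq by (cases q) (auto simp: vpart_def c_def v_zero)
        moreover have "t p q = \<zero>\<^bsub>K p q\<^esub>"
          using Suc.prems(3)[OF pq(1)] False pq by auto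
        ultimately show ?thesis
          by (simp add: t'_def fadd_def fneg_def tdiff_def hc)
      qed
    qed
    then obtain y c' where y: "y \<in> carrier (A l)" "fam c'"
      "\<And>p q. p + q = l \<Longrightarrow> t' p q = aug l y p q \<oplus>\<^bsub>K p q\<^esub> tdiff c' p q"
      by blast
    have "t p q = aug l y p q \<oplus>\<^bsub>K p q\<^esub> tdiff (fadd c' c) p q" if "p + q = l" for p q
    proof -
      interpret N: module R "K p q" by (rule K)
      show ?thesis
        unfolding t'[of p q] y(3)[OF that] tdiff_fadd[OF y(2) fc]
        using famD[OF fam_aug[OF y(1)]] famD[OF fam_tdiff[OF fc]] famD[OF fam_tdiff[OF y(2)]]
        by (simp add: N.M.a_assoc)
    qed
    then show ?thesis
      using y(1) fam_fadd[OF y(2) fc] by blast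
  qed
qed

lemma reduce_to_augmentation:
  assumes "fam t"
    and "\<And>p q. p + q = Suc l \<Longrightarrow> q > 0 \<Longrightarrow> tdiff t p q = \<zero>\<^bsub>K p q\<^esub>"
  obtains y c where "y \<in> carrier (A l)" "fam c"
    "\<And>p q. p + q = l \<Longrightarrow> t p q = aug l y p q \<oplus>\<^bsub>K p q\<^esub> tdiff c p q"
proof -
  have "\<exists>y\<in>carrier (A l). \<exists>c. fam c \<and>
    (\<forall>p q. p + q = l \<longrightarrow> t p q = aug l y p q \<oplus>\<^bsub>K p q\<^esub> tdiff c p q)"
    by (rule reduce_to_augmentation_aux[where n = l]) (use assms in auto)
  then show ?thesis using that by blast
qed

text \<open>The map from the cohomology of \<open>A\<close> to that of the total complex is injective: all components of the
  bounding cochain \<open>c\<close> can be removed except one that comes from \<open>A\<close>, and \<open>a\<close> is injective.\<close>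

lemma aug_bounding_imp_coboundary:
  assumes "z \<in> carrier (A l)" "fam c"
    and "\<And>p q. p + q = l \<Longrightarrow> aug l z p q = tdiff c p q"
  shows "z \<in> coboundaries A dA l"
proof (cases l)
  case 0
  interpret N: module R "K 0 0" by (rule K)
  have "tdiff c 0 0 = \<zero>\<^bsub>K 0 0\<^esub>"
    by (simp add: tdiff_def hpart_def vpart_def)
  then have "a 0 z = \<zero>\<^bsub>K 0 0\<^esub>"
    using assms(3)[of 0 0] 0 by (simp add: aug_def)
  then show ?thesis
    using a_inj assms(1) 0 by (simp add: coboundaries_def)
next
  case (Suc l')
  obtain y e where y: "y \<in> carrier (A l')" "fam e"
    "\<And>p q. p + q = l' \<Longrightarrow> c p q = aug l' y p q \<oplus>\<^bsub>K p q\<^esub> tdiff e p q"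
  proof (rule reduce_to_augmentation[OF assms(2), of l'])
    fix p q assume "p + q = Suc l'" "q > 0"
    then show "tdiff c p q = \<zero>\<^bsub>K p q\<^esub>"
      using assms(3)[of p q] Suc by (simp add: aug_def)
  qed blast
  interpret N: module R "K l 0" by (rule K)
  have dy: "dA l' y \<in> carrier (A l)"
    using mod_hom_closed[OF dA y(1)] Suc by simp
  have "a l z = tdiff c l 0"
    using assms(3)[of l 0] by (simp add: aug_def)
  also have "\<dots> = tdiff (fadd (aug l' y) (tdiff e)) l 0"
    using y(3)[of l' 0] Suc by (simp add: tdiff_def hpart_def vpart_def fadd_def)
  also have "\<dots> = a l (dA l' y)"
    using y(1,2) a_closed[OF dy] Suc
    by (simp add: tdiff_fadd fam_aug fam_tdiff tdiff_tdiff tdiff_aug) (simp add: aug_def)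
  finally have eq: "a l z = a l (dA l' y)" .
  interpret A': module R "A l" by (rule A)
  have "a l (z \<ominus>\<^bsub>A l\<^esub> dA l' y) = \<zero>\<^bsub>K l 0\<^esub>"
    using eq assms(1) dy a_closed[OF dy]
    by (simp add: a_minus_def mod_hom_add[OF a] mod_hom_neg[OF A K a] N.M.r_neg)
  then have "z \<ominus>\<^bsub>A l\<^esub> dA l' y = \<zero>\<^bsub>A l\<^esub>"
    using a_inj assms(1) dy by simp
  then have "z = dA l' y"
    using assms(1) dy A'.M.minus_equality[of z "\<ominus>\<^bsub>A l\<^esub> dA l' y"] by (simp add: a_minus_def)
  then show ?thesis
    using y(1) Suc by (auto simp: coboundaries_def)
qed

end


section \<open>Cohomology of cochain complexes\<close>

locale cochain_complex =
  fixes R :: "('a, 'r) ring_scheme" and C :: "nat \<Rightarrow> ('a, 'n) module" and d :: "nat \<Rightarrow> 'n \<Rightarrow> 'n"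
  assumes C: "\<And>p. module R (C p)"
    and d: "\<And>p. d p \<in> mod_hom R (C p) (C (Suc p))"
    and dd: "\<And>p x. x \<in> carrier (C p) \<Longrightarrow> d (Suc p) (d p x) = \<zero>\<^bsub>C (Suc (Suc p))\<^esub>"
begin

lemma d_zero: "d p \<zero>\<^bsub>C p\<^esub> = \<zero>\<^bsub>C (Suc p)\<^esub>"
  by (rule mod_hom_zero[OF C C d])

lemma d_closed: "x \<in> carrier (C p) \<Longrightarrow> d p x \<in> carrier (C (Suc p))"
  using d by (rule mod_hom_closed)

lemma C_zero: "\<zero>\<^bsub>C p\<^esub> \<in> carrier (C p)"
proof -
  interpret N: module R "C p" by (rule C)
  show ?thesis by simp
qed

lemma cocycles_subset: "z \<in> cocycles C d l \<Longrightarrow> z \<in> carrier (C l)"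
  by (simp add: cocycles_def)

lemma cocycles_add:
  assumes "z \<in> cocycles C d l" "w \<in> cocycles C d l"
  shows "z \<oplus>\<^bsub>C l\<^esub> w \<in> cocycles C d l"
proof -
  interpret N: module R "C l" by (rule C)
  interpret N': module R "C (Suc l)" by (rule C)
  show ?thesis using assms by (simp add: cocycles_def mod_hom_add[OF d])
qed

lemma cocycles_smult:
  assumes "z \<in> cocycles C d l" "r \<in> carrier R"
  shows "r \<odot>\<^bsub>C l\<^esub> z \<in> cocycles C d l"
proof -
  interpret N: module R "C l" by (rule C)
  interpret N': module R "C (Suc l)" by (rule C)
  show ?thesis using assms by (simp add: cocycles_def mod_hom_smult[OF d])
qed

lemma coboundaries_subset: "coboundaries C d l \<subseteq> cocycles C d l"
  by (cases l) (auto simp: coboundaries_def cocycles_def d_zero C_zero d_closed dd)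

lemma coboundaries_add:
  assumes "z \<in> coboundaries C d l" "w \<in> coboundaries C d l"
  shows "z \<oplus>\<^bsub>C l\<^esub> w \<in> coboundaries C d l"
proof (cases l)
  case 0
  interpret N: module R "C 0" by (rule C)
  show ?thesis using assms 0 by (simp add: coboundaries_def)
next
  case (Suc k)
  interpret N: module R "C k" by (rule C)
  obtain x y where "x \<in> carrier (C k)" "y \<in> carrier (C k)" "z = d k x" "w = d k y"
    using assms Suc by (auto simp: coboundaries_def)
  then show ?thesis
    using Suc by (auto simp: coboundaries_def mod_hom_add[OF d, symmetric])
qed

lemma coboundaries_smult:
  assumes "z \<in> coboundaries C d l" "r \<in> carrier R"
  shows "r \<odot>\<^bsub>C l\<^esub> z \<in> coboundaries C d l"
proof (cases l)
  case 0
  interpret N: module R "C 0" by (rule C)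
  show ?thesis using assms 0 by (simp add: coboundaries_def)
next
  case (Suc k)
  interpret N: module R "C k" by (rule C)
  obtain x where "x \<in> carrier (C k)" "z = d k x"
    using assms Suc by (auto simp: coboundaries_def)
  then show ?thesis
    using Suc assms(2) by (auto simp: coboundaries_def mod_hom_smult[OF d, symmetric])
qed

lemma coboundaries_zero: "\<zero>\<^bsub>C l\<^esub> \<in> coboundaries C d l"
  by (cases l) (auto simp: coboundaries_def d_zero[symmetric] C_zero)

lemma coboundaries_abelian_subgroup: "abelian_subgroup (coboundaries C d l) (C l)"
proof -
  interpret N: module R "C l" by (rule C)
  have neg: "\<ominus>\<^bsub>C l\<^esub> z \<in> coboundaries C d l" if "z \<in> coboundaries C d l" for z
    using coboundaries_smult[OF that, of "\<ominus>\<^bsub>R\<^esub> \<one>\<^bsub>R\<^esub>"] that coboundaries_subset[of l] cocycles_subset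
    by (auto simp: N.smult_l_minus)
  have "subgroup (coboundaries C d l) (add_monoid (C l))"
    using coboundaries_subset[of l] cocycles_subset coboundaries_add coboundaries_zero neg
    by (intro subgroup.intro) (auto simp: a_inv_def[symmetric])
  then show ?thesis
    by (intro abelian_subgroupI3 additive_subgroupI N.M.abelian_group_axioms)
qed

abbreviation cls where "cls l z \<equiv> coboundaries C d l +>\<^bsub>C l\<^esub> z"

lemma coset_eq_iff:
  assumes "z \<in> carrier (C l)" "w \<in> carrier (C l)"
  shows "cls l z = cls l w \<longleftrightarrow> z \<ominus>\<^bsub>C l\<^esub> w \<in> coboundaries C d l"
proof -
  interpret H: abelian_subgroup "coboundaries C d l" "C l"
    by (rule coboundaries_abelian_subgroup)
  have "z \<in> cls l w \<longleftrightarrow> z \<ominus>\<^bsub>C l\<^esub> w \<in> coboundaries C d l"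
    using H.a_rcos_module_minus[OF _ assms(2,1)] coboundaries_abelian_subgroup
      H.a_rcos_module[OF assms(2,1)] by (simp add: a_minus_def)
  then show ?thesis
    using H.a_repr_independence[of z _ w, OF _ assms(2) H.a_subgroup] H.a_rcos_self[OF assms(1)] assms by metis
qed

lemma coset_eqI_coboundary:
  assumes "z \<in> carrier (C l)" "b \<in> coboundaries C d l"
  shows "cls l (b \<oplus>\<^bsub>C l\<^esub> z) = cls l z"
proof -
  interpret N: module R "C l" by (rule C)
  have "b \<in> carrier (C l)"
    using assms coboundaries_subset cocycles_subset by blast
  then show ?thesis
    using assms by (subst coset_eq_iff) (auto simp: a_minus_def N.M.a_assoc N.M.r_neg)
qed

lemma mem_coset_iff: "y \<in> cls l z \<longleftrightarrow> (\<exists>b\<in>coboundaries C d l. y = b \<oplus>\<^bsub>C l\<^esub> z)"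
  using a_r_coset_def'[of "C l"] by auto

lemma coset_self:
  assumes "z \<in> carrier (C l)"
  shows "z \<in> cls l z"
proof -
  interpret N: module R "C l" by (rule C)
  show ?thesis
    using assms coboundaries_zero by (force simp: mem_coset_iff)
qed

lemma cohomology_cases:
  assumes "Y \<in> carrier (cohomology C d l)"
  obtains z where "z \<in> cocycles C d l" "Y = cls l z"
  using assms by (auto simp: cohomology_def)

lemma coset_in_cohomology: "z \<in> cocycles C d l \<Longrightarrow> cls l z \<in> carrier (cohomology C d l)"
  by (simp add: cohomology_def)

lemma cohomology_add:
  assumes "z \<in> carrier (C l)" "w \<in> carrier (C l)"
  shows "cls l z \<oplus>\<^bsub>cohomology C d l\<^esub> cls l w = cls l (z \<oplus>\<^bsub>C l\<^esub> w)"
proof -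
  interpret H: abelian_subgroup "coboundaries C d l" "C l"
    by (rule coboundaries_abelian_subgroup)
  show ?thesis
    using H.a_rcos_sum[OF assms] by (simp add: cohomology_def)
qed

lemma cohomology_smult:
  assumes "z \<in> carrier (C l)" "r \<in> carrier R"
  shows "r \<odot>\<^bsub>cohomology C d l\<^esub> cls l z = cls l (r \<odot>\<^bsub>C l\<^esub> z)"
proof -
  interpret N: module R "C l" by (rule C)
  have eq: "cls l (r \<odot>\<^bsub>C l\<^esub> y) = cls l (r \<odot>\<^bsub>C l\<^esub> z)" if "y \<in> cls l z" for y
  proof -
    obtain b where b: "b \<in> coboundaries C d l" "y = b \<oplus>\<^bsub>C l\<^esub> z"
      using \<open>y \<in> cls l z\<close> by (auto simp: mem_coset_iff)
    moreover have "b \<in> carrier (C l)"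
      using b coboundaries_subset cocycles_subset by blast
    ultimately show ?thesis
      using assms by (simp add: N.smult_r_distr coset_eqI_coboundary coboundaries_smult)
  qed
  have "(\<Union>y\<in>cls l z. cls l (r \<odot>\<^bsub>C l\<^esub> y)) = cls l (r \<odot>\<^bsub>C l\<^esub> z)"
    by (intro UN_constant_eq[OF coset_self[OF assms(1)]] ballI eq)
  then show ?thesis
    by (simp add: cohomology_def)
qed

lemma cohomology_map_coset:
  assumes "z \<in> carrier (C l)" "cochain_complex R D \<delta>"
    and f: "\<And>p. f p \<in> mod_hom R (C p) (D p)"
    and chain: "\<And>p x. x \<in> carrier (C p) \<Longrightarrow> f (Suc p) (d p x) = \<delta> p (f p x)"
  shows "cohomology_map D \<delta> f l (cls l z) = coboundaries D \<delta> l +>\<^bsub>D l\<^esub> f l z"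
proof -
  interpret D: cochain_complex R D \<delta> by fact
  have fb: "f l b \<in> coboundaries D \<delta> l" if "b \<in> coboundaries C d l" for b
    using that mod_hom_zero[OF C D.C f]
    by (cases l) (auto simp: coboundaries_def chain mod_hom_closed[OF f])
  have eq: "D.cls l (f l y) = D.cls l (f l z)" if "y \<in> cls l z" for y
  proof -
    obtain b where b: "b \<in> coboundaries C d l" "y = b \<oplus>\<^bsub>C l\<^esub> z"
      using \<open>y \<in> cls l z\<close> by (auto simp: mem_coset_iff)
    moreover have "b \<in> carrier (C l)"
      using b coboundaries_subset cocycles_subset by blast
    ultimately show ?thesis
      using assms(1) fb by (simp add: mod_hom_add[OF f] D.coset_eqI_coboundary mod_hom_closed[OF f])
  qed
  show ?thesis
    unfolding cohomology_map_def by (intro UN_constant_eq[OF coset_self[OF assms(1)]] ballI eq)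
qed

end

text \<open>Two resolutions of a double complex give an isomorphism of cohomology modules that is not induced
  by a map between the two complexes; what they give directly is a linear relation between the
  cocycles.\<close>

locale cohomology_relation =
  C: cochain_complex R C d + D: cochain_complex R D \<delta>
  for R :: "('a, 'r) ring_scheme" and C :: "nat \<Rightarrow> ('a, 'n) module" and d
    and D :: "nat \<Rightarrow> ('a, 'k) module" and \<delta> +
  fixes l :: nat and rel :: "'n \<Rightarrow> 'k \<Rightarrow> bool"
  assumes rel_cocycles: "\<And>z w. rel z w \<Longrightarrow> z \<in> cocycles C d l \<and> w \<in> cocycles D \<delta> l"
    and rel_left: "\<And>z. z \<in> cocycles C d l \<Longrightarrow> \<exists>w. rel z w"
    and rel_right: "\<And>w. w \<in> cocycles D \<delta> l \<Longrightarrow> \<exists>z. rel z w"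
    and rel_add: "\<And>z w z' w'. rel z w \<Longrightarrow> rel z' w' \<Longrightarrow> rel (z \<oplus>\<^bsub>C l\<^esub> z') (w \<oplus>\<^bsub>D l\<^esub> w')"
    and rel_smult: "\<And>z w r. rel z w \<Longrightarrow> r \<in> carrier R \<Longrightarrow> rel (r \<odot>\<^bsub>C l\<^esub> z) (r \<odot>\<^bsub>D l\<^esub> w)"
    and rel_coboundary: "\<And>z w. rel z w \<Longrightarrow> z \<in> coboundaries C d l \<longleftrightarrow> w \<in> coboundaries D \<delta> l"
begin

definition rel_map :: "'n set \<Rightarrow> 'k set" where
  "rel_map Y = {w. \<exists>z\<in>Y. rel z w}"

lemma rel_carrier: "rel z w \<Longrightarrow> z \<in> carrier (C l)" "rel z w \<Longrightarrow> w \<in> carrier (D l)"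
  using rel_cocycles by (auto simp: cocycles_def)

lemma rel_diff:
  assumes "rel z w" "rel z' w'"
  shows "rel (z \<ominus>\<^bsub>C l\<^esub> z') (w \<ominus>\<^bsub>D l\<^esub> w')"
proof -
  interpret N: module R "C l" by (rule C.C)
  interpret N': module R "D l" by (rule D.C)
  have "rel (\<ominus>\<^bsub>C l\<^esub> z') (\<ominus>\<^bsub>D l\<^esub> w')"
    using rel_smult[OF assms(2), of "\<ominus>\<^bsub>R\<^esub> \<one>\<^bsub>R\<^esub>"] rel_carrier[OF assms(2)]
    by (simp add: N.smult_l_minus N'.smult_l_minus)
  then show ?thesis
    unfolding a_minus_def using assms(1) by (rule rel_add[rotated])
qed

text \<open>An element related to some member of the coset of \<open>z\<close> differs from \<open>w\<close> by an element related to a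
  coboundary, hence by a coboundary.  Conversely, each coboundary is related to some coboundary.\<close>

lemma rel_map_coset:
  assumes "rel z w"
  shows "rel_map (C.cls l z) = D.cls l w"
proof (rule equalityI; rule subsetI)
  interpret N': module R "D l" by (rule D.C)
  fix w' assume "w' \<in> rel_map (C.cls l z)"
  then obtain z' where z': "z' \<in> C.cls l z" "rel z' w'"
    by (auto simp: rel_map_def)
  have "C.cls l z' = C.cls l z"
    using z'(1) rel_carrier[OF assms] by (auto simp: C.mem_coset_iff C.coset_eqI_coboundary)
  then have "z' \<ominus>\<^bsub>C l\<^esub> z \<in> coboundaries C d l"
    using C.coset_eq_iff rel_carrier assms z'(2) by blast
  then have "w' \<ominus>\<^bsub>D l\<^esub> w \<in> coboundaries D \<delta> l"
    using rel_coboundary[OF rel_diff[OF z'(2) assms]] by simp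
  then show "w' \<in> D.cls l w"
    using D.coset_eq_iff[of w' l w] D.coset_self[of w' l] rel_carrier(2)[OF z'(2)] rel_carrier(2)[OF assms]
    by simp
next
  fix w' assume "w' \<in> D.cls l w"
  then obtain b where b: "b \<in> coboundaries D \<delta> l" "w' = b \<oplus>\<^bsub>D l\<^esub> w"
    by (auto simp: D.mem_coset_iff)
  then obtain y where y: "rel y b"
    using rel_right D.coboundaries_subset by blast
  then have "y \<in> coboundaries C d l"
    using rel_coboundary b(1) by blast
  then have "y \<oplus>\<^bsub>C l\<^esub> z \<in> C.cls l z"
    using C.mem_coset_iff by blast
  moreover have "rel (y \<oplus>\<^bsub>C l\<^esub> z) w'"
    using rel_add[OF y assms] b(2) by simp
  ultimately show "w' \<in> rel_map (C.cls l z)"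
    unfolding rel_map_def by blast
qed

lemma rel_map_iso: "rel_map \<in> mod_iso R (cohomology C d l) (cohomology D \<delta> l)"
proof -
  have hom: "rel_map \<in> mod_hom R (cohomology C d l) (cohomology D \<delta> l)"
  proof (rule mod_homI)
    fix Y assume "Y \<in> carrier (cohomology C d l)"
    then obtain z w where z: "Y = C.cls l z" "rel z w"
      using rel_left by (metis C.cohomology_cases)
    then show "rel_map Y \<in> carrier (cohomology D \<delta> l)"
      using rel_cocycles D.coset_in_cohomology by (simp add: rel_map_coset)
    fix r assume r: "r \<in> carrier R"
    show "rel_map (r \<odot>\<^bsub>cohomology C d l\<^esub> Y) = r \<odot>\<^bsub>cohomology D \<delta> l\<^esub> rel_map Y"
      using z r rel_map_coset[OF rel_smult[OF z(2) r]] rel_carrier[OF z(2)]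
      by (simp add: C.cohomology_smult D.cohomology_smult rel_map_coset)
  next
    fix Y Y' assume "Y \<in> carrier (cohomology C d l)" "Y' \<in> carrier (cohomology C d l)"
    then obtain z w z' w' where z: "Y = C.cls l z" "rel z w" "Y' = C.cls l z'" "rel z' w'"
      using rel_left by (metis C.cohomology_cases)
    show "rel_map (Y \<oplus>\<^bsub>cohomology C d l\<^esub> Y') = rel_map Y \<oplus>\<^bsub>cohomology D \<delta> l\<^esub> rel_map Y'"
      using z rel_map_coset[OF rel_add[OF z(2,4)]] rel_carrier[OF z(2)] rel_carrier[OF z(4)]
      by (simp add: C.cohomology_add D.cohomology_add rel_map_coset)
  qed
  have "inj_on rel_map (carrier (cohomology C d l))"
  proof (rule inj_onI)
    fix Y Y' assume "Y \<in> carrier (cohomology C d l)" "Y' \<in> carrier (cohomology C d l)"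
      and eq: "rel_map Y = rel_map Y'"
    then obtain z w z' w' where z: "Y = C.cls l z" "rel z w" "Y' = C.cls l z'" "rel z' w'"
      using rel_left by (metis C.cohomology_cases)
    have "w \<ominus>\<^bsub>D l\<^esub> w' \<in> coboundaries D \<delta> l"
      using eq z D.coset_eq_iff rel_carrier rel_map_coset by metis
    then have "z \<ominus>\<^bsub>C l\<^esub> z' \<in> coboundaries C d l"
      using rel_coboundary[OF rel_diff[OF z(2,4)]] by simp
    then show "Y = Y'"
      using z C.coset_eq_iff rel_carrier by metis
  qed
  moreover have "rel_map ` carrier (cohomology C d l) = carrier (cohomology D \<delta> l)"
  proof
    show "rel_map ` carrier (cohomology C d l) \<subseteq> carrier (cohomology D \<delta> l)"
      using hom by (auto intro: mod_hom_closed)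
    show "carrier (cohomology D \<delta> l) \<subseteq> rel_map ` carrier (cohomology C d l)"
    proof
      fix Y assume "Y \<in> carrier (cohomology D \<delta> l)"
      then obtain z w where z: "Y = D.cls l w" "rel z w"
        using rel_right by (metis D.cohomology_cases)
      then show "Y \<in> rel_map ` carrier (cohomology C d l)"
        using rel_cocycles C.coset_in_cohomology rel_map_coset by (metis imageI)
    qed
  qed
  ultimately show ?thesis
    using hom by (simp add: mod_iso_def bij_betw_def)
qed

end


section \<open>Comparison of two resolutions of the same double complex\<close>

locale biresolved_complex =
  A: resolved_complex R K h v A dA a +
  B: resolved_complex R "\<lambda>p q. K q p" "\<lambda>p q. v q p" "\<lambda>p q. h q p" B dB b
  for R :: "('a, 'r) ring_scheme" and K :: "nat \<Rightarrow> nat \<Rightarrow> ('a, 'e) module" and h v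
    and A :: "nat \<Rightarrow> ('a, 'k) module" and dA a
    and B :: "nat \<Rightarrow> ('a, 'n) module" and dB b +
  assumes A_complex: "cochain_complex R A dA"
    and B_complex: "cochain_complex R B dB"
begin

text \<open>The cocycles \<open>z\<close> and \<open>w\<close> become cohomologous in the total complex.\<close>

definition linked :: "nat \<Rightarrow> 'k \<Rightarrow> 'n \<Rightarrow> bool" where
  "linked l z w \<longleftrightarrow> z \<in> cocycles A dA l \<and> w \<in> cocycles B dB l \<and>
     (\<exists>c. A.fam c \<and> (\<forall>p q. p + q = l \<longrightarrow>
        A.aug l z p q = B.aug l w q p \<oplus>\<^bsub>K p q\<^esub> A.tdiff c p q))"

lemma fam_transpose: "B.fam (\<lambda>q p. c p q) \<longleftrightarrow> A.fam c"
  by (auto simp: A.fam_def B.fam_def)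

lemma fam_baug:
  assumes "w \<in> carrier (B l)"
  shows "A.fam (\<lambda>p q. B.aug l w q p)"
  using B.fam_aug[OF assms] by (simp add: A.fam_def B.fam_def)

lemma tdiff_baug:
  assumes "w \<in> carrier (B l)"
  shows "A.tdiff (\<lambda>p q. B.aug l w q p) p q = B.aug (Suc l) (dB l w) q p"
  using A.tdiff_transpose[OF fam_baug[OF assms], of q p] B.tdiff_aug[OF assms] by simp

text \<open>The cocycle of the total complex that comes from \<open>z\<close> is reduced along the other direction.\<close>

lemma linked_left:
  assumes "z \<in> cocycles A dA l"
  shows "\<exists>w. linked l z w"
proof -
  have z: "z \<in> carrier (A l)" "dA l z = \<zero>\<^bsub>A (Suc l)\<^esub>"
    using assms by (auto simp: cocycles_def)
  have D0: "A.tdiff (A.aug l z) p q = \<zero>\<^bsub>K p q\<^esub>" for p q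
    using z by (simp add: A.tdiff_aug) (simp add: A.aug_def A.a_zero)
  have f: "B.fam (\<lambda>q p. A.aug l z p q)"
    using A.fam_aug[OF z(1)] by (simp add: fam_transpose)
  have "B.tdiff (\<lambda>q p. A.aug l z p q) q p = \<zero>\<^bsub>K p q\<^esub>" for p q
    using A.tdiff_transpose[OF A.fam_aug[OF z(1)]] D0 by simp
  then obtain w c where w: "w \<in> carrier (B l)" "B.fam c"
    "\<And>q p. q + p = l \<Longrightarrow> A.aug l z p q = B.aug l w q p \<oplus>\<^bsub>K p q\<^esub> B.tdiff c q p"
    using B.reduce_to_augmentation[OF f, of l] by blast
  define c' where "c' = (\<lambda>p q. c q p)"
  have c': "A.fam c'" "B.tdiff c q p = A.tdiff c' p q" for p q
  proof -
    show *: "A.fam c'"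
      using w(2) by (simp add: c'_def A.fam_def B.fam_def)
    show "B.tdiff c q p = A.tdiff c' p q"
      using A.tdiff_transpose[OF *, of q p] by (simp add: c'_def)
  qed
  have eq: "A.aug l z p q = B.aug l w q p \<oplus>\<^bsub>K p q\<^esub> A.tdiff c' p q" if "p + q = l" for p q
    using w(3)[of q p] that c'(2) by (simp add: add.commute)
  have "A.tdiff (A.aug l z) 0 (Suc l) =
      A.tdiff (A.fadd (\<lambda>p q. B.aug l w q p) (A.tdiff c')) 0 (Suc l)"
    by (rule A.tdiff_cong) (auto simp: eq A.fadd_def)
  also have "\<dots> = B.aug (Suc l) (dB l w) (Suc l) 0"
    using B.famD[OF B.fam_aug[OF mod_hom_closed[OF B.dA w(1)]], of "Suc l" 0]
    by (simp add: A.tdiff_fadd fam_baug w(1) A.fam_tdiff c' A.tdiff_tdiff tdiff_baug)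
  finally have "b (Suc l) (dB l w) = \<zero>\<^bsub>K 0 (Suc l)\<^esub>"
    by (simp add: B.aug_def D0)
  then have "dB l w = \<zero>\<^bsub>B (Suc l)\<^esub>"
    using B.a_inj mod_hom_closed[OF B.dA w(1)] by blast
  then show ?thesis
    using assms w(1) c' eq unfolding linked_def by (auto simp: cocycles_def)
qed

lemma linked_add:
  assumes "linked l z w" "linked l z' w'"
  shows "linked l (z \<oplus>\<^bsub>A l\<^esub> z') (w \<oplus>\<^bsub>B l\<^esub> w')"
proof -
  obtain c c' where c: "A.fam c" "\<And>p q. p + q = l \<Longrightarrow> A.aug l z p q = B.aug l w q p \<oplus>\<^bsub>K p q\<^esub> A.tdiff c p q"
    and c': "A.fam c'" "\<And>p q. p + q = l \<Longrightarrow> A.aug l z' p q = B.aug l w' q p \<oplus>\<^bsub>K p q\<^esub> A.tdiff c' p q"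
    using assms unfolding linked_def by blast
  have zw: "z \<in> carrier (A l)" "z' \<in> carrier (A l)" "w \<in> carrier (B l)" "w' \<in> carrier (B l)"
    using assms by (auto simp: linked_def cocycles_def)
  have "A.aug l (z \<oplus>\<^bsub>A l\<^esub> z') p q = B.aug l (w \<oplus>\<^bsub>B l\<^esub> w') q p \<oplus>\<^bsub>K p q\<^esub> A.tdiff (A.fadd c c') p q"
    if pq: "p + q = l" for p q
  proof -
    interpret N: module R "K p q" by (rule A.K)
    have "A.aug l (z \<oplus>\<^bsub>A l\<^esub> z') p q = A.aug l z p q \<oplus>\<^bsub>K p q\<^esub> A.aug l z' p q"
      using zw by (simp add: A.aug_def mod_hom_add[OF A.a])
    moreover have "B.aug l (w \<oplus>\<^bsub>B l\<^esub> w') q p = B.aug l w q p \<oplus>\<^bsub>K p q\<^esub> B.aug l w' q p"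
      using zw by (simp add: B.aug_def mod_hom_add[OF B.a])
    ultimately show ?thesis
      using A.famD[OF A.fam_tdiff[OF c(1)], of p q] A.famD[OF A.fam_tdiff[OF c'(1)], of p q]
        B.famD[OF B.fam_aug[OF zw(3)], of q p] B.famD[OF B.fam_aug[OF zw(4)], of q p]
      by (simp add: c(2)[OF pq] c'(2)[OF pq] A.tdiff_fadd c(1) c'(1) N.M.a_ac)
  qed
  then show ?thesis
    using assms A.fam_fadd[OF c(1) c'(1)] cochain_complex.cocycles_add[OF A_complex]
      cochain_complex.cocycles_add[OF B_complex]
    unfolding linked_def by blast
qed

lemma linked_smult:
  assumes "linked l z w" "r \<in> carrier R"
  shows "linked l (r \<odot>\<^bsub>A l\<^esub> z) (r \<odot>\<^bsub>B l\<^esub> w)"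
proof -
  obtain c where c: "A.fam c" "\<And>p q. p + q = l \<Longrightarrow> A.aug l z p q = B.aug l w q p \<oplus>\<^bsub>K p q\<^esub> A.tdiff c p q"
    using assms unfolding linked_def by blast
  have zw: "z \<in> carrier (A l)" "w \<in> carrier (B l)"
    using assms by (auto simp: linked_def cocycles_def)
  have "A.aug l (r \<odot>\<^bsub>A l\<^esub> z) p q = B.aug l (r \<odot>\<^bsub>B l\<^esub> w) q p \<oplus>\<^bsub>K p q\<^esub> A.tdiff (A.fsmult r c) p q"
    if pq: "p + q = l" for p q
  proof -
    interpret N: module R "K p q" by (rule A.K)
    have "A.aug l (r \<odot>\<^bsub>A l\<^esub> z) p q = r \<odot>\<^bsub>K p q\<^esub> A.aug l z p q"
      using zw assms(2) by (simp add: A.aug_def mod_hom_smult[OF A.a])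
    moreover have "B.aug l (r \<odot>\<^bsub>B l\<^esub> w) q p = r \<odot>\<^bsub>K p q\<^esub> B.aug l w q p"
      using zw assms(2) by (simp add: B.aug_def mod_hom_smult[OF B.a])
    ultimately show ?thesis
      using A.famD[OF A.fam_tdiff[OF c(1)], of p q] B.famD[OF B.fam_aug[OF zw(2)], of q p] assms(2)
      by (simp add: c(2)[OF pq] A.tdiff_fsmult c(1) N.smult_r_distr)
  qed
  then show ?thesis
    using assms A.fam_fsmult[OF c(1) assms(2)] cochain_complex.cocycles_smult[OF A_complex]
      cochain_complex.cocycles_smult[OF B_complex]
    unfolding linked_def by blast
qed

text \<open>If \<open>w\<close> bounds in \<open>B\<close>, then \<open>z\<close> bounds in the total complex, hence in \<open>A\<close>.\<close>

lemma linked_coboundary: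
  assumes "linked l z w" "w \<in> coboundaries B dB l"
  shows "z \<in> coboundaries A dA l"
proof -
  obtain c where c: "A.fam c" "\<And>p q. p + q = l \<Longrightarrow> A.aug l z p q = B.aug l w q p \<oplus>\<^bsub>K p q\<^esub> A.tdiff c p q"
    using assms unfolding linked_def by blast
  have "\<exists>e. A.fam e \<and> (\<forall>p q. p + q = l \<longrightarrow> B.aug l w q p = A.tdiff e p q)"
  proof (cases l)
    case 0
    then have "w = \<zero>\<^bsub>B 0\<^esub>" using assms(2) by (simp add: coboundaries_def)
    then have "B.aug l w 0 0 = A.tdiff (\<lambda>p q. \<zero>\<^bsub>K p q\<^esub>) 0 0"
      using 0 by (simp add: B.aug_def A.tdiff_def A.hpart_def A.vpart_def B.a_zero)
    moreover have "A.fam (\<lambda>p q. \<zero>\<^bsub>K p q\<^esub>)" by (simp add: A.fam_def)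
    ultimately show ?thesis using 0 by auto
  next
    case (Suc l')
    then obtain y where y: "y \<in> carrier (B l')" "w = dB l' y"
      using assms(2) by (auto simp: coboundaries_def)
    then show ?thesis
      using fam_baug[OF y(1)] tdiff_baug[OF y(1)] Suc by (intro exI[of _ "\<lambda>p q. B.aug l' y q p"]) simp
  qed
  then obtain e where e: "A.fam e" "\<And>p q. p + q = l \<Longrightarrow> B.aug l w q p = A.tdiff e p q"
    by blast
  show ?thesis
  proof (rule A.aug_bounding_imp_coboundary)
    show "z \<in> carrier (A l)" using assms by (auto simp: linked_def cocycles_def)
    show "A.fam (A.fadd e c)" using c e by (simp add: A.fam_fadd)
    show "A.aug l z p q = A.tdiff (A.fadd e c) p q" if "p + q = l" for p q
      using c e that by (simp add: A.tdiff_fadd)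
  qed
qed

lemma biresolved_complex_transpose:
  "biresolved_complex R (\<lambda>p q. K q p) (\<lambda>p q. v q p) (\<lambda>p q. h q p) B dB b A dA a"
  using A_complex B_complex A.resolved_complex_axioms B.resolved_complex_axioms
  by (simp add: biresolved_complex_def biresolved_complex_axioms_def)

text \<open>Replacing the cochain \<open>c\<close> by \<open>- c\<close> exchanges the roles of \<open>A\<close> and \<open>B\<close>.\<close>

lemma linked_transpose:
  assumes "biresolved_complex.linked (\<lambda>p q. K q p) (\<lambda>p q. v q p) (\<lambda>p q. h q p) B dB b A dA a l w z"
  shows "linked l z w"
proof -
  interpret T: biresolved_complex R "\<lambda>p q. K q p" "\<lambda>p q. v q p" "\<lambda>p q. h q p" B dB b A dA a
    by (rule biresolved_complex_transpose)
  obtain c where c: "B.fam c" "\<And>p q. p + q = l \<Longrightarrow> B.aug l w p q = A.aug l z q p \<oplus>\<^bsub>K q p\<^esub> B.tdiff c p q"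
    using assms unfolding T.linked_def by blast
  define c' where "c' = (\<lambda>p q. c q p)"
  have c': "A.fam c'" using c(1) by (simp add: c'_def A.fam_def B.fam_def)
  have zw: "z \<in> carrier (A l)" "w \<in> carrier (B l)"
    using assms by (auto simp: T.linked_def cocycles_def)
  have "A.aug l z p q = B.aug l w q p \<oplus>\<^bsub>K p q\<^esub> A.tdiff (A.fneg c') p q" if pq: "p + q = l" for p q
  proof -
    interpret N: module R "K p q" by (rule A.K)
    have "B.tdiff c q p = A.tdiff c' p q"
      using A.tdiff_transpose[OF c', of q p] by (simp add: c'_def)
    then have "B.aug l w q p = A.aug l z p q \<oplus>\<^bsub>K p q\<^esub> A.tdiff c' p q"
      using c(2)[of q p] pq by (simp add: add.commute)
    then show ?thesis
      using A.famD[OF A.fam_tdiff[OF c'], of p q] A.famD[OF A.fam_aug[OF zw(1)], of p q]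
      by (simp add: A.tdiff_fneg c' N.M.a_assoc N.M.r_neg)
  qed
  then show ?thesis
    using assms A.fam_fneg[OF c'] unfolding linked_def T.linked_def by blast
qed

lemma linked_transpose_iff:
  "biresolved_complex.linked (\<lambda>p q. K q p) (\<lambda>p q. v q p) (\<lambda>p q. h q p) B dB b A dA a l w z \<longleftrightarrow> linked l z w"
  using linked_transpose biresolved_complex.linked_transpose[OF biresolved_complex_transpose] by blast

lemma linked_cohomology_relation: "cohomology_relation R A dA B dB l (linked l)"
proof -
  interpret T: biresolved_complex R "\<lambda>p q. K q p" "\<lambda>p q. v q p" "\<lambda>p q. h q p" B dB b A dA a
    by (rule biresolved_complex_transpose)
  show ?thesis
  proof (intro cohomology_relation.intro cohomology_relation_axioms.intro A_complex B_complex)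
    fix z w assume zw: "linked l z w"
    show "z \<in> cocycles A dA l \<and> w \<in> cocycles B dB l"
      using zw by (simp add: linked_def)
    show "z \<in> coboundaries A dA l \<longleftrightarrow> w \<in> coboundaries B dB l"
      using linked_coboundary[OF zw] T.linked_coboundary[of l w z] zw linked_transpose_iff by blast
  next
    fix w assume "w \<in> cocycles B dB l"
    then show "\<exists>z. linked l z w"
      using T.linked_left linked_transpose_iff by blast
  qed (use linked_left linked_add linked_smult in auto)
qed

end


section \<open>Finite sums in modules\<close>

lemma (in abelian_monoid) finsum_swap:
  assumes "finite A" "finite B" "\<And>i j. i \<in> A \<Longrightarrow> j \<in> B \<Longrightarrow> f i j \<in> carrier G"
  shows "(\<Oplus>i\<in>A. \<Oplus>j\<in>B. f i j) = (\<Oplus>j\<in>B. \<Oplus>i\<in>A. f i j)"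
  using assms(1,3)
proof (induction A)
  case empty
  then show ?case by simp
next
  case (insert a A)
  have c: "\<And>i j. i \<in> A \<Longrightarrow> j \<in> B \<Longrightarrow> f i j \<in> carrier G" "\<And>j. j \<in> B \<Longrightarrow> f a j \<in> carrier G"
    using insert.prems by auto
  have "(\<Oplus>i\<in>insert a A. \<Oplus>j\<in>B. f i j) = (\<Oplus>j\<in>B. f a j) \<oplus> (\<Oplus>j\<in>B. \<Oplus>i\<in>A. f i j)"
    using insert.hyps c by (subst finsum_insert) (auto intro!: finsum_closed simp: insert.IH)
  also have "\<dots> = (\<Oplus>j\<in>B. f a j \<oplus> (\<Oplus>i\<in>A. f i j))"
    using c by (intro finsum_addf[symmetric]) (auto intro!: finsum_closed)
  also have "\<dots> = (\<Oplus>j\<in>B. \<Oplus>i\<in>insert a A. f i j)"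
    using insert.hyps c by (intro finsum_cong') (auto intro!: finsum_closed)
  finally show ?case .
qed

text \<open>This is the cancellation behind \<open>d\<^sup>2 = 0\<close> for alternating sums.\<close>

lemma (in abelian_group) finsum_antisymmetric:
  assumes "finite A"
    and "\<And>i j. i \<in> A \<Longrightarrow> j \<in> A \<Longrightarrow> i \<noteq> j \<Longrightarrow> f i j \<in> carrier G"
    and "\<And>i j. i \<in> A \<Longrightarrow> j \<in> A \<Longrightarrow> i \<noteq> j \<Longrightarrow> f i j \<oplus> f j i = \<zero>"
  shows "(\<Oplus>i\<in>A. \<Oplus>j\<in>A - {i}. f i j) = \<zero>"
  using assms
proof (induction A)
  case empty
  then show ?case by simp
next
  case (insert a A)
  have c: "f i j \<in> carrier G" if "i \<in> insert a A" "j \<in> insert a A" "i \<noteq> j" for i j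
    using insert.prems(1) that by blast
  have c': "f a i \<in> carrier G" "f i a \<in> carrier G" "(\<Oplus>j\<in>A - {i}. f i j) \<in> carrier G" if "i \<in> A" for i
    using that insert.hyps by (auto intro!: c finsum_closed)
  have "(\<Oplus>i\<in>insert a A. \<Oplus>j\<in>insert a A - {i}. f i j) =
      (\<Oplus>j\<in>insert a A - {a}. f a j) \<oplus> (\<Oplus>i\<in>A. \<Oplus>j\<in>insert a A - {i}. f i j)"
    using insert.hyps by (intro finsum_insert) (auto intro!: finsum_closed c)
  also have "(\<Oplus>j\<in>insert a A - {a}. f a j) = (\<Oplus>j\<in>A. f a j)"
    using insert.hyps c' by (intro finsum_cong') auto
  also have "(\<Oplus>i\<in>A. \<Oplus>j\<in>insert a A - {i}. f i j) = (\<Oplus>i\<in>A. f i a \<oplus> (\<Oplus>j\<in>A - {i}. f i j))"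
  proof (intro finsum_cong' refl)
    fix i assume i: "i \<in> A"
    then have "insert a A - {i} = insert a (A - {i})" using insert.hyps by auto
    then show "(\<Oplus>j\<in>insert a A - {i}. f i j) = f i a \<oplus> (\<Oplus>j\<in>A - {i}. f i j)"
      using i insert.hyps by (simp, intro finsum_insert) (auto intro!: c)
  qed (use c' in auto)
  also have "\<dots> = (\<Oplus>i\<in>A. f i a) \<oplus> (\<Oplus>i\<in>A. \<Oplus>j\<in>A - {i}. f i j)"
    using c' by (intro finsum_addf) auto
  also have "(\<Oplus>i\<in>A. \<Oplus>j\<in>A - {i}. f i j) = \<zero>"
    using insert.prems by (intro insert.IH) auto
  also have "(\<Oplus>j\<in>A. f a j) \<oplus> ((\<Oplus>i\<in>A. f i a) \<oplus> \<zero>) = (\<Oplus>i\<in>A. f a i \<oplus> f i a)"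
    using c' by (subst finsum_addf) (auto intro!: finsum_closed)
  also have "\<dots> = \<zero>"
    using insert.prems(2) insert.hyps by (intro add.finprod_one_eqI) auto
  finally show ?case .
qed

lemma (in module) finsum_smult_rdistr:
  assumes "finite A" "f \<in> A \<rightarrow> carrier R" "x \<in> carrier M"
  shows "finsum R f A \<odot>\<^bsub>M\<^esub> x = (\<Oplus>\<^bsub>M\<^esub>i\<in>A. f i \<odot>\<^bsub>M\<^esub> x)"
  using assms(1,2)
proof (induction A)
  case (insert a A)
  then have c: "f a \<in> carrier R" "f \<in> A \<rightarrow> carrier R" by auto
  then have "(\<lambda>i. f i \<odot>\<^bsub>M\<^esub> x) \<in> A \<rightarrow> carrier M" using assms(3) by auto
  then show ?case
    using insert c assms(3) by (simp add: smult_l_distr R.finsum_closed)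
qed (use assms(3) in simp)


section \<open>Cochains with values in a module\<close>

text \<open>The sign with which \<open>j\<close> is added to or removed from \<open>\<mu>\<close>; it is the same for \<open>\<mu>\<close> and \<open>insert j \<mu>\<close>, so
  that it serves for boundaries as well as for coboundaries.\<close>

definition ksign :: "('a, 'r) ring_scheme \<Rightarrow> nat \<Rightarrow> nat set \<Rightarrow> 'a" where
  "ksign R j \<mu> = (if even (card {i\<in>\<mu>. i < j}) then \<one>\<^bsub>R\<^esub> else \<ominus>\<^bsub>R\<^esub> \<one>\<^bsub>R\<^esub>)"

lemma (in ring) ksign_closed [simp, intro]: "ksign R j \<mu> \<in> carrier R"
  by (simp add: ksign_def)

lemma (in ring) ksign_square [simp]: "ksign R j \<mu> \<otimes> ksign R j \<mu> = \<one>"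
  by (simp add: ksign_def l_minus r_minus)

lemma ksign_insert_self [simp]: "ksign R j (insert j \<mu>) = ksign R j \<mu>"
proof -
  have "{i\<in>insert j \<mu>. i < j} = {i\<in>\<mu>. i < j}" by auto
  then show ?thesis unfolding ksign_def by (simp only:)
qed

lemma ksign_remove_self [simp]: "ksign R j (\<mu> - {j}) = ksign R j \<mu>"
proof -
  have "{i\<in>\<mu> - {j}. i < j} = {i\<in>\<mu>. i < j}" by auto
  then show ?thesis unfolding ksign_def by (simp only:)
qed

lemma (in ring) ksign_insert:
  assumes "finite \<mu>" "k \<notin> \<mu>"
  shows "ksign R i (insert k \<mu>) = (if k < i then \<ominus> ksign R i \<mu> else ksign R i \<mu>)"
proof -
  have "{j\<in>insert k \<mu>. j < i} = (if k < i then insert k {j\<in>\<mu>. j < i} else {j\<in>\<mu>. j < i})"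
    by auto
  then show ?thesis
    using assms by (simp add: ksign_def)
qed

lemma (in ring) ksign_remove:
  assumes "finite \<mu>" "k \<in> \<mu>"
  shows "ksign R i (\<mu> - {k}) = (if k < i then \<ominus> ksign R i \<mu> else ksign R i \<mu>)"
  using ksign_insert[of "\<mu> - {k}" k i] assms by (simp add: insert_absorb)

lemma (in ring) ksign_swap:
  assumes "finite \<mu>" "i \<in> \<mu>" "k \<notin> \<mu>"
  shows "ksign R i \<mu> \<otimes> ksign R k (\<mu> - {i}) = \<ominus> (ksign R k \<mu> \<otimes> ksign R i (insert k \<mu>))"
proof -
  have "ksign R i \<mu> \<otimes> ksign R k \<mu> = ksign R k \<mu> \<otimes> ksign R i \<mu>"
    by (simp add: ksign_def l_minus r_minus)
  moreover have "i < k \<longleftrightarrow> \<not> k < i" using assms by (metis linorder_neqE_nat order_less_asym)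
  ultimately show ?thesis
    using assms by (simp add: ksign_insert ksign_remove l_minus r_minus)
qed

text \<open>The differential of the Koszul cochain complex of the \<open>x\<^sub>j\<^sup>s\<close> with values in \<open>M\<close>.  A cochain assigns
  elements of \<open>M\<close> to the sets of indices of all sizes at once; the component at \<open>\<mu>\<close> has degree \<open>card \<mu>\<close>.\<close>

definition cobd :: "('a, 'r) ring_scheme \<Rightarrow> ('a, 'm, 'z) module_scheme \<Rightarrow> (nat \<Rightarrow> 'a) \<Rightarrow> nat \<Rightarrow>
    (nat set \<Rightarrow> 'm) \<Rightarrow> nat set \<Rightarrow> 'm" where
  "cobd R M x s u \<tau> =
     finsum M (\<lambda>j. (ksign R j \<tau> \<otimes>\<^bsub>R\<^esub> x j [^]\<^bsub>R\<^esub> s) \<odot>\<^bsub>M\<^esub> u (\<tau> - {j})) \<tau>"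

text \<open>The transition map from the complex of the \<open>x\<^sub>i\<^sup>s\<close> to that of the \<open>x\<^sub>i\<^sup>s\<^sup>+\<^sup>t\<close>: expanding the fraction
  \<open>u(\<mu>) / x(\<mu>)\<^sup>s\<close> by \<open>x(\<mu>)\<^sup>t\<close>.\<close>

definition level_up :: "('a, 'r) ring_scheme \<Rightarrow> ('a, 'm, 'z) module_scheme \<Rightarrow> (nat \<Rightarrow> 'a) \<Rightarrow> nat \<Rightarrow>
    (nat set \<Rightarrow> 'm) \<Rightarrow> nat set \<Rightarrow> 'm" where
  "level_up R M x t u \<mu> = (finprod R x \<mu> [^]\<^bsub>R\<^esub> t) \<odot>\<^bsub>M\<^esub> u \<mu>"

text \<open>The direct limit over \<open>s\<close> of the Koszul complexes, which is the Cech complex, is acyclic in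
  positive degrees.\<close>

definition koszul_acyclic :: "('a, 'r) ring_scheme \<Rightarrow> ('a, 'm, 'z) module_scheme \<Rightarrow> (nat \<Rightarrow> 'a) \<Rightarrow> nat set \<Rightarrow> bool" where
  "koszul_acyclic R M x T \<longleftrightarrow> (\<forall>s. \<forall>u \<in> Pow T \<rightarrow> carrier M.
     u {} = \<zero>\<^bsub>M\<^esub> \<and> (\<forall>\<tau>\<subseteq>T. cobd R M x s u \<tau> = \<zero>\<^bsub>M\<^esub>) \<longrightarrow>
     (\<exists>t. \<exists>v \<in> Pow T \<rightarrow> carrier M. \<forall>\<mu>\<subseteq>T. level_up R M x t u \<mu> = cobd R M x (s + t) v \<mu>))"

lemma koszul_acyclicD:
  assumes "koszul_acyclic R M x T" "u \<in> Pow T \<rightarrow> carrier M" "u {} = \<zero>\<^bsub>M\<^esub>"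
    and "\<And>\<tau>. \<tau> \<subseteq> T \<Longrightarrow> cobd R M x s u \<tau> = \<zero>\<^bsub>M\<^esub>"
  shows "\<exists>t. \<exists>v \<in> Pow T \<rightarrow> carrier M. \<forall>\<mu>\<subseteq>T. level_up R M x t u \<mu> = cobd R M x (s + t) v \<mu>"
  using assms(1)[unfolded koszul_acyclic_def, rule_format, OF assms(2)] assms(3,4) by blast

locale cochains = module +
  fixes x :: "nat \<Rightarrow> 'a" and T :: "nat set"
  assumes T: "finite T" and x: "x \<in> T \<rightarrow> carrier R"
begin

lemma x_closed: "j \<in> T \<Longrightarrow> x j \<in> carrier R"
  using x by auto

lemma finite_subset_T: "\<tau> \<subseteq> T \<Longrightarrow> finite \<tau>"
  using T by (rule finite_subset[rotated])

lemma coeff_closed: "j \<in> T \<Longrightarrow> ksign R j \<tau> \<otimes> x j [^] (s::nat) \<in> carrier R"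
  by (auto simp: x_closed)

lemma xprod_closed: "\<mu> \<subseteq> T \<Longrightarrow> finprod R x \<mu> \<in> carrier R"
  using x by (intro R.finprod_closed) auto

lemma cobd_term_closed:
  assumes "u \<in> Pow T \<rightarrow> carrier M" "\<tau> \<subseteq> T" "j \<in> T"
  shows "(ksign R j \<tau> \<otimes> x j [^] (s::nat)) \<odot>\<^bsub>M\<^esub> u (\<tau> - {j}) \<in> carrier M"
proof -
  have "u (\<tau> - {j}) \<in> carrier M" using assms(1,2) by auto
  then show ?thesis using coeff_closed[OF assms(3)] by simp
qed

lemma cobd_closed:
  assumes "u \<in> Pow T \<rightarrow> carrier M" "\<tau> \<subseteq> T"
  shows "cobd R M x s u \<tau> \<in> carrier M"
  unfolding cobd_def using assms by (intro M.finsum_closed) (auto intro!: cobd_term_closed)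

lemma cobd_cong:
  assumes "\<And>\<mu>. \<mu> \<subseteq> T \<Longrightarrow> u \<mu> = u' \<mu>" "u' \<in> Pow T \<rightarrow> carrier M" "\<tau> \<subseteq> T"
  shows "cobd R M x s u \<tau> = cobd R M x s u' \<tau>"
  unfolding cobd_def
proof (intro M.finsum_cong' refl)
  fix j assume "j \<in> \<tau>"
  show "(ksign R j \<tau> \<otimes> x j [^] s) \<odot>\<^bsub>M\<^esub> u (\<tau> - {j}) = (ksign R j \<tau> \<otimes> x j [^] s) \<odot>\<^bsub>M\<^esub> u' (\<tau> - {j})"
    using assms(1)[OF subset_trans[OF Diff_subset assms(3)]] by simp
qed (use assms in \<open>auto intro!: cobd_term_closed\<close>)

lemma cobd_add:
  assumes "u \<in> Pow T \<rightarrow> carrier M" "v \<in> Pow T \<rightarrow> carrier M" "\<tau> \<subseteq> T"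
  shows "cobd R M x s (\<lambda>\<mu>. u \<mu> \<oplus>\<^bsub>M\<^esub> v \<mu>) \<tau> = cobd R M x s u \<tau> \<oplus>\<^bsub>M\<^esub> cobd R M x s v \<tau>"
proof -
  have "cobd R M x s (\<lambda>\<mu>. u \<mu> \<oplus>\<^bsub>M\<^esub> v \<mu>) \<tau> =
    (\<Oplus>\<^bsub>M\<^esub>j\<in>\<tau>. (ksign R j \<tau> \<otimes> x j [^] s) \<odot>\<^bsub>M\<^esub> u (\<tau> - {j}) \<oplus>\<^bsub>M\<^esub>
            (ksign R j \<tau> \<otimes> x j [^] s) \<odot>\<^bsub>M\<^esub> v (\<tau> - {j}))"
    unfolding cobd_def
  proof (intro M.finsum_cong' refl)
    fix j assume "j \<in> \<tau>"
    then have "j \<in> T" "u (\<tau> - {j}) \<in> carrier M" "v (\<tau> - {j}) \<in> carrier M"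
      using assms by auto
    then show "(ksign R j \<tau> \<otimes> x j [^] s) \<odot>\<^bsub>M\<^esub> (u (\<tau> - {j}) \<oplus>\<^bsub>M\<^esub> v (\<tau> - {j})) =
        (ksign R j \<tau> \<otimes> x j [^] s) \<odot>\<^bsub>M\<^esub> u (\<tau> - {j}) \<oplus>\<^bsub>M\<^esub>
        (ksign R j \<tau> \<otimes> x j [^] s) \<odot>\<^bsub>M\<^esub> v (\<tau> - {j})"
      by (intro smult_r_distr coeff_closed)
  qed (use assms in \<open>auto intro!: cobd_term_closed\<close>)
  also have "\<dots> = cobd R M x s u \<tau> \<oplus>\<^bsub>M\<^esub> cobd R M x s v \<tau>"
    unfolding cobd_def using assms by (intro M.finsum_addf) (auto intro!: cobd_term_closed)
  finally show ?thesis .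
qed

lemma cobd_smult:
  assumes "u \<in> Pow T \<rightarrow> carrier M" "r \<in> carrier R" "\<tau> \<subseteq> T"
  shows "cobd R M x s (\<lambda>\<mu>. r \<odot>\<^bsub>M\<^esub> u \<mu>) \<tau> = r \<odot>\<^bsub>M\<^esub> cobd R M x s u \<tau>"
proof -
  have "r \<odot>\<^bsub>M\<^esub> cobd R M x s u \<tau> =
    (\<Oplus>\<^bsub>M\<^esub>j\<in>\<tau>. r \<odot>\<^bsub>M\<^esub> ((ksign R j \<tau> \<otimes> x j [^] s) \<odot>\<^bsub>M\<^esub> u (\<tau> - {j})))"
    unfolding cobd_def using assms finite_subset_T
    by (intro finsum_smult_ldistr) (auto intro!: cobd_term_closed)
  also have "\<dots> = cobd R M x s (\<lambda>\<mu>. r \<odot>\<^bsub>M\<^esub> u \<mu>) \<tau>"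
    unfolding cobd_def
  proof (intro M.finsum_cong' refl)
    fix j assume "j \<in> \<tau>"
    then have "j \<in> T" "u (\<tau> - {j}) \<in> carrier M"
      using assms by auto
    then show "r \<odot>\<^bsub>M\<^esub> ((ksign R j \<tau> \<otimes> x j [^] s) \<odot>\<^bsub>M\<^esub> u (\<tau> - {j})) =
        (ksign R j \<tau> \<otimes> x j [^] s) \<odot>\<^bsub>M\<^esub> (r \<odot>\<^bsub>M\<^esub> u (\<tau> - {j}))"
      using coeff_closed[of j \<tau> s] assms(2) by (simp add: smult_assoc1[symmetric] R.m_comm)
  qed (use assms in \<open>auto intro!: cobd_term_closed\<close>)
  finally show ?thesis by simp
qed

lemma cobd_neg:
  assumes "u \<in> Pow T \<rightarrow> carrier M" "\<tau> \<subseteq> T"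
  shows "cobd R M x s (\<lambda>\<mu>. \<ominus>\<^bsub>M\<^esub> u \<mu>) \<tau> = \<ominus>\<^bsub>M\<^esub> cobd R M x s u \<tau>"
proof -
  have "cobd R M x s (\<lambda>\<mu>. \<ominus>\<^bsub>M\<^esub> u \<mu>) \<tau> = cobd R M x s (\<lambda>\<mu>. (\<ominus> \<one>) \<odot>\<^bsub>M\<^esub> u \<mu>) \<tau>"
    using assms by (intro cobd_cong) (auto simp: smult_l_minus Pi_iff)
  then show ?thesis
    using assms cobd_closed[OF assms] by (simp add: cobd_smult smult_l_minus)
qed

lemma cobd_zero: "\<tau> \<subseteq> T \<Longrightarrow> cobd R M x s (\<lambda>\<mu>. \<zero>\<^bsub>M\<^esub>) \<tau> = \<zero>\<^bsub>M\<^esub>"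
  using cobd_smult[of "\<lambda>\<mu>. \<zero>\<^bsub>M\<^esub>" \<zero> \<tau> s] cobd_closed[of "\<lambda>\<mu>. \<zero>\<^bsub>M\<^esub>" \<tau> s] by simp

lemma level_up_closed:
  assumes "u \<in> Pow T \<rightarrow> carrier M"
  shows "level_up R M x t u \<in> Pow T \<rightarrow> carrier M"
  using assms xprod_closed unfolding level_up_def by (auto intro!: smult_closed)

lemma level_up_add:
  assumes "u \<in> Pow T \<rightarrow> carrier M" "\<mu> \<subseteq> T"
  shows "level_up R M x (s + t) u \<mu> = level_up R M x s (level_up R M x t u) \<mu>"
  using assms xprod_closed[OF assms(2)]
  by (auto simp: level_up_def smult_assoc1[symmetric] R.nat_pow_mult Pi_iff)

lemma cobd_level_up:
  assumes "u \<in> Pow T \<rightarrow> carrier M" "\<tau> \<subseteq> T"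
  shows "cobd R M x (s + t) (level_up R M x t u) \<tau> = level_up R M x t (cobd R M x s u) \<tau>"
proof -
  have "level_up R M x t (cobd R M x s u) \<tau> =
    (\<Oplus>\<^bsub>M\<^esub>j\<in>\<tau>. finprod R x \<tau> [^] t \<odot>\<^bsub>M\<^esub> ((ksign R j \<tau> \<otimes> x j [^] s) \<odot>\<^bsub>M\<^esub> u (\<tau> - {j})))"
    unfolding cobd_def level_up_def using assms finite_subset_T xprod_closed[OF assms(2)]
    by (intro finsum_smult_ldistr) (auto intro!: cobd_term_closed)
  also have "\<dots> = cobd R M x (s + t) (level_up R M x t u) \<tau>"
    unfolding cobd_def
  proof (intro M.finsum_cong' refl)
    fix j assume j: "j \<in> \<tau>"
    then have c: "j \<in> T" "u (\<tau> - {j}) \<in> carrier M" "x j \<in> carrier R" "finprod R x (\<tau> - {j}) \<in> carrier R"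
      using assms x_closed xprod_closed[of "\<tau> - {j}"] by auto
    have "finprod R x (insert j (\<tau> - {j})) = x j \<otimes> finprod R x (\<tau> - {j})"
      using finite_subset_T[OF assms(2)] assms(2) c x_closed by (intro R.finprod_insert) auto
    then have "finprod R x \<tau> = x j \<otimes> finprod R x (\<tau> - {j})"
      using j by (simp add: insert_absorb)
    then have "finprod R x \<tau> [^] t \<otimes> (ksign R j \<tau> \<otimes> x j [^] s) =
      (ksign R j \<tau> \<otimes> x j [^] (s + t)) \<otimes> finprod R x (\<tau> - {j}) [^] t"
      using c by (simp add: R.nat_pow_distrib R.nat_pow_mult[symmetric] R.m_ac)
    then show "finprod R x \<tau> [^] t \<odot>\<^bsub>M\<^esub> ((ksign R j \<tau> \<otimes> x j [^] s) \<odot>\<^bsub>M\<^esub> u (\<tau> - {j})) =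
        (ksign R j \<tau> \<otimes> x j [^] (s + t)) \<odot>\<^bsub>M\<^esub> level_up R M x t u (\<tau> - {j})"
      using c xprod_closed[OF assms(2)] by (simp add: level_up_def smult_assoc1[symmetric])
  qed (use assms level_up_closed[OF assms(1)] in \<open>auto intro!: cobd_term_closed\<close>)
  finally show ?thesis by simp
qed

lemma cobd_cobd:
  assumes "u \<in> Pow T \<rightarrow> carrier M" "\<tau> \<subseteq> T"
  shows "cobd R M x s (cobd R M x s u) \<tau> = \<zero>\<^bsub>M\<^esub>"
proof -
  let ?f = "\<lambda>j i. (ksign R j \<tau> \<otimes> x j [^] s) \<odot>\<^bsub>M\<^esub>
    ((ksign R i (\<tau> - {j}) \<otimes> x i [^] s) \<odot>\<^bsub>M\<^esub> u (\<tau> - {j} - {i}))"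
  have f: "?f j i \<in> carrier M" if "j \<in> \<tau>" "i \<in> \<tau>" for i j
    using cobd_term_closed[OF assms(1), of "\<tau> - {j}" i s] coeff_closed[of j \<tau> s] that assms(2) by auto
  have "cobd R M x s (cobd R M x s u) \<tau> = (\<Oplus>\<^bsub>M\<^esub>j\<in>\<tau>. \<Oplus>\<^bsub>M\<^esub>i\<in>\<tau> - {j}. ?f j i)"
    unfolding cobd_def
  proof (intro M.finsum_cong' refl)
    fix j assume j: "j \<in> \<tau>"
    show "(ksign R j \<tau> \<otimes> x j [^] s) \<odot>\<^bsub>M\<^esub>
        (\<Oplus>\<^bsub>M\<^esub>i\<in>\<tau> - {j}. (ksign R i (\<tau> - {j}) \<otimes> x i [^] s) \<odot>\<^bsub>M\<^esub> u (\<tau> - {j} - {i})) =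
        (\<Oplus>\<^bsub>M\<^esub>i\<in>\<tau> - {j}. ?f j i)"
      using j assms finite_subset_T coeff_closed
      by (intro finsum_smult_ldistr) (auto intro!: cobd_term_closed)
  qed (auto intro!: M.finsum_closed f)
  also have "\<dots> = \<zero>\<^bsub>M\<^esub>"
  proof (rule M.finsum_antisymmetric)
    fix j i assume ij: "j \<in> \<tau>" "i \<in> \<tau>" "j \<noteq> i"
    have c: "x i \<in> carrier R" "x j \<in> carrier R" "u (\<tau> - {i} - {j}) \<in> carrier M"
      using ij assms x_closed by auto
    have e: "\<tau> - {j} - {i} = \<tau> - {i} - {j}" by auto
    have "ksign R i (\<tau> - {i}) \<otimes> ksign R j (\<tau> - {i} - {j}) = ksign R i \<tau> \<otimes> ksign R j (\<tau> - {i})"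
      by simp
    have k: "ksign R j \<tau> \<otimes> ksign R i (\<tau> - {j}) = \<ominus> (ksign R i \<tau> \<otimes> ksign R j (\<tau> - {i}))"
      using ksign_swap[of "\<tau> - {i}" j i] ij finite_subset_T[OF assms(2)]
      by (auto simp: e[symmetric] insert_absorb R.m_comm ksign_remove)
    have s: "(ksign R j \<tau> \<otimes> x j [^] s) \<otimes> (ksign R i (\<tau> - {j}) \<otimes> x i [^] s) =
      (ksign R j \<tau> \<otimes> ksign R i (\<tau> - {j})) \<otimes> (x i [^] s \<otimes> x j [^] s)"
      if "x i \<in> carrier R" "x j \<in> carrier R" for i j
      using that by (simp add: R.m_ac)
    have "?f j i = (\<ominus> (ksign R i \<tau> \<otimes> ksign R j (\<tau> - {i})) \<otimes> (x i [^] s \<otimes> x j [^] s)) \<odot>\<^bsub>M\<^esub> u (\<tau> - {i} - {j})"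
      using c by (simp add: smult_assoc1[symmetric] s k[symmetric] e)
    moreover have "?f i j = ((ksign R i \<tau> \<otimes> ksign R j (\<tau> - {i})) \<otimes> (x i [^] s \<otimes> x j [^] s)) \<odot>\<^bsub>M\<^esub> u (\<tau> - {i} - {j})"
      using c by (simp add: smult_assoc1[symmetric] s R.m_comm[of "x i [^] s"])
    ultimately show "?f j i \<oplus>\<^bsub>M\<^esub> ?f i j = \<zero>\<^bsub>M\<^esub>"
      using c by (simp add: smult_l_distr[symmetric] R.l_minus R.l_neg)
  qed (use finite_subset_T assms f in auto)
  finally show ?thesis .
qed


text \<open>If \<open>y = \<Sum> r\<^sub>i x\<^sub>i\<^sup>s\<close>, contracting with the coefficients \<open>r\<^sub>i\<close> is a homotopy between multiplication by
  \<open>y\<close> and \<open>0\<close>.\<close>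

definition contract :: "(nat \<Rightarrow> 'a) \<Rightarrow> (nat set \<Rightarrow> 'c) \<Rightarrow> nat set \<Rightarrow> 'c" where
  "contract r u \<mu> = (\<Oplus>\<^bsub>M\<^esub>k\<in>T - \<mu>. (ksign R k \<mu> \<otimes> r k) \<odot>\<^bsub>M\<^esub> u (insert k \<mu>))"

lemma contract_term_closed:
  assumes "u \<in> Pow T \<rightarrow> carrier M" "r \<in> T \<rightarrow> carrier R" "k \<in> T" "\<mu> \<subseteq> T"
  shows "(ksign R k \<nu> \<otimes> r k) \<odot>\<^bsub>M\<^esub> u (insert k \<mu>) \<in> carrier M"
  using assms by (intro smult_closed) auto

lemma contract_closed:
  assumes "u \<in> Pow T \<rightarrow> carrier M" "r \<in> T \<rightarrow> carrier R"
  shows "contract r u \<in> Pow T \<rightarrow> carrier M"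
  unfolding contract_def using contract_term_closed[OF assms]
  by (auto intro!: M.finsum_closed)

lemma cobd_contract:
  assumes u: "u \<in> Pow T \<rightarrow> carrier M" and r: "r \<in> T \<rightarrow> carrier R"
    and cocycle: "\<And>\<tau>. \<tau> \<subseteq> T \<Longrightarrow> cobd R M x s u \<tau> = \<zero>\<^bsub>M\<^esub>"
    and \<mu>: "\<mu> \<subseteq> T"
  shows "cobd R M x s (contract r u) \<mu> = (\<Oplus>i\<in>T. r i \<otimes> x i [^] s) \<odot>\<^bsub>M\<^esub> u \<mu>"
proof -
  have u\<mu>: "u \<mu> \<in> carrier M" using u \<mu> by auto
  have rc: "r i \<in> carrier R" if "i \<in> T" for i using r that by auto
  let ?g = "\<lambda>i. (r i \<otimes> x i [^] s) \<odot>\<^bsub>M\<^esub> u \<mu>"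
  let ?f = "\<lambda>i k. (ksign R i \<mu> \<otimes> x i [^] s) \<odot>\<^bsub>M\<^esub> ((ksign R k (\<mu> - {i}) \<otimes> r k) \<odot>\<^bsub>M\<^esub> u (insert k (\<mu> - {i})))"
  have g: "?g i \<in> carrier M" if "i \<in> T" for i
    using that u\<mu> x_closed rc by simp
  have f: "?f i k \<in> carrier M" if "i \<in> \<mu>" "k \<in> T" for i k
    using that \<mu> by (intro smult_closed contract_term_closed u r coeff_closed) auto
  have "cobd R M x s (contract r u) \<mu> = (\<Oplus>\<^bsub>M\<^esub>i\<in>\<mu>. ?g i \<oplus>\<^bsub>M\<^esub> (\<Oplus>\<^bsub>M\<^esub>k\<in>T - \<mu>. ?f i k))"
    unfolding cobd_def
  proof (intro M.finsum_cong' refl)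
    fix i assume i: "i \<in> \<mu>"
    have "(ksign R i \<mu> \<otimes> x i [^] s) \<odot>\<^bsub>M\<^esub> contract r u (\<mu> - {i}) = (\<Oplus>\<^bsub>M\<^esub>k\<in>T - (\<mu> - {i}). ?f i k)"
      unfolding contract_def using i \<mu> T u r
      by (intro finsum_smult_ldistr coeff_closed) (auto intro!: contract_term_closed)
    also have "T - (\<mu> - {i}) = insert i (T - \<mu>)" using i \<mu> by auto
    also have "(\<Oplus>\<^bsub>M\<^esub>k\<in>insert i (T - \<mu>). ?f i k) = ?f i i \<oplus>\<^bsub>M\<^esub> (\<Oplus>\<^bsub>M\<^esub>k\<in>T - \<mu>. ?f i k)"
      using T i \<mu> f[OF i, of i] by (intro M.finsum_insert) (auto intro!: f)
    also have "?f i i = ?g i"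
    proof -
      have c: "x i [^] s \<in> carrier R" "r i \<in> carrier R" using i \<mu> x_closed rc by auto
      have "(ksign R i \<mu> \<otimes> x i [^] s) \<otimes> (ksign R i \<mu> \<otimes> r i) = (ksign R i \<mu> \<otimes> ksign R i \<mu>) \<otimes> (r i \<otimes> x i [^] s)"
        using c by (simp only: R.m_ac ksign_closed R.m_closed)
      then show ?thesis
        using i c u\<mu> by (simp add: smult_assoc1[symmetric] insert_absorb)
    qed
    finally show "(ksign R i \<mu> \<otimes> x i [^] s) \<odot>\<^bsub>M\<^esub> contract r u (\<mu> - {i}) =
        ?g i \<oplus>\<^bsub>M\<^esub> (\<Oplus>\<^bsub>M\<^esub>k\<in>T - \<mu>. ?f i k)" .
  next
    show "(\<lambda>i. ?g i \<oplus>\<^bsub>M\<^esub> (\<Oplus>\<^bsub>M\<^esub>k\<in>T - \<mu>. ?f i k)) \<in> \<mu> \<rightarrow> carrier M"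
      using \<mu> by (auto intro!: M.a_closed g M.finsum_closed f)
  qed
  also have "\<dots> = (\<Oplus>\<^bsub>M\<^esub>i\<in>\<mu>. ?g i) \<oplus>\<^bsub>M\<^esub> (\<Oplus>\<^bsub>M\<^esub>i\<in>\<mu>. \<Oplus>\<^bsub>M\<^esub>k\<in>T - \<mu>. ?f i k)"
    using \<mu> by (intro M.finsum_addf) (auto intro!: g M.finsum_closed f)
  also have "(\<Oplus>\<^bsub>M\<^esub>i\<in>\<mu>. \<Oplus>\<^bsub>M\<^esub>k\<in>T - \<mu>. ?f i k) = (\<Oplus>\<^bsub>M\<^esub>k\<in>T - \<mu>. \<Oplus>\<^bsub>M\<^esub>i\<in>\<mu>. ?f i k)"
    using \<mu> T finite_subset_T by (intro M.finsum_swap f) auto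
  also have "\<dots> = (\<Oplus>\<^bsub>M\<^esub>k\<in>T - \<mu>. ?g k)"
  proof (intro M.finsum_cong' refl)
    fix k assume k: "k \<in> T - \<mu>"
    let ?\<nu> = "insert k \<mu>"
    let ?h = "\<lambda>i. (ksign R i ?\<nu> \<otimes> x i [^] s) \<odot>\<^bsub>M\<^esub> u (?\<nu> - {i})"
    have h: "?h i \<in> carrier M" if "i \<in> \<mu>" for i
      using that k \<mu> by (intro cobd_term_closed u) auto
    have kk: "?h k \<in> carrier M"
      using k \<mu> by (intro cobd_term_closed u) auto
    have "\<zero>\<^bsub>M\<^esub> = (\<Oplus>\<^bsub>M\<^esub>i\<in>?\<nu>. ?h i)"
      using cocycle[of ?\<nu>] k \<mu> by (simp add: cobd_def)
    also have "\<dots> = ?h k \<oplus>\<^bsub>M\<^esub> (\<Oplus>\<^bsub>M\<^esub>i\<in>\<mu>. ?h i)"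
      using k finite_subset_T[OF \<mu>] kk by (intro M.finsum_insert) (auto intro!: h)
    finally have hk: "(\<Oplus>\<^bsub>M\<^esub>i\<in>\<mu>. ?h i) = \<ominus>\<^bsub>M\<^esub> ?h k"
      using kk h M.minus_equality[of "\<Oplus>\<^bsub>M\<^esub>i\<in>\<mu>. ?h i" "?h k"] M.a_comm
      by (simp add: M.finsum_closed)
    have "(\<Oplus>\<^bsub>M\<^esub>i\<in>\<mu>. ?f i k) = (\<Oplus>\<^bsub>M\<^esub>i\<in>\<mu>. (\<ominus> (ksign R k \<mu> \<otimes> r k)) \<odot>\<^bsub>M\<^esub> ?h i)"
    proof (intro M.finsum_cong' refl)
      fix i assume i: "i \<in> \<mu>"
      have e: "insert k (\<mu> - {i}) = ?\<nu> - {i}" using i k by auto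
      have c: "x i [^] s \<in> carrier R" "r k \<in> carrier R" "u (?\<nu> - {i}) \<in> carrier M"
        using i k \<mu> x_closed rc u by auto
      have "(ksign R i \<mu> \<otimes> x i [^] s) \<otimes> (ksign R k (\<mu> - {i}) \<otimes> r k) =
          (ksign R i \<mu> \<otimes> ksign R k (\<mu> - {i})) \<otimes> (x i [^] s \<otimes> r k)"
        using c by (simp only: R.m_ac ksign_closed R.m_closed)
      also have "\<dots> = \<ominus> (ksign R k \<mu> \<otimes> ksign R i ?\<nu>) \<otimes> (x i [^] s \<otimes> r k)"
        using ksign_swap[OF finite_subset_T[OF \<mu>] i] k by simp
      also have "\<dots> = \<ominus> ((ksign R k \<mu> \<otimes> ksign R i ?\<nu>) \<otimes> (x i [^] s \<otimes> r k))"
        using c by (simp add: R.l_minus)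
      also have "(ksign R k \<mu> \<otimes> ksign R i ?\<nu>) \<otimes> (x i [^] s \<otimes> r k) =
          (ksign R k \<mu> \<otimes> r k) \<otimes> (ksign R i ?\<nu> \<otimes> x i [^] s)"
        using c by (simp only: R.m_ac ksign_closed R.m_closed)
      finally have "(ksign R i \<mu> \<otimes> x i [^] s) \<otimes> (ksign R k (\<mu> - {i}) \<otimes> r k) =
          (\<ominus> (ksign R k \<mu> \<otimes> r k)) \<otimes> (ksign R i ?\<nu> \<otimes> x i [^] s)"
        using c by (simp add: R.l_minus)
      then show "?f i k = (\<ominus> (ksign R k \<mu> \<otimes> r k)) \<odot>\<^bsub>M\<^esub> ?h i"
        using c unfolding e by (simp add: smult_assoc1[symmetric])
    qed (use k rc h in \<open>auto intro!: smult_closed\<close>)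
    also have "\<dots> = (\<ominus> (ksign R k \<mu> \<otimes> r k)) \<odot>\<^bsub>M\<^esub> (\<Oplus>\<^bsub>M\<^esub>i\<in>\<mu>. ?h i)"
      using k rc h finite_subset_T[OF \<mu>] by (intro finsum_smult_ldistr[symmetric]) auto
    also have "\<dots> = (ksign R k \<mu> \<otimes> r k) \<odot>\<^bsub>M\<^esub> ?h k"
      unfolding hk using k rc kk by (simp add: smult_l_minus smult_r_minus)
    also have "\<dots> = ?g k"
    proof -
      have c: "x k [^] s \<in> carrier R" "r k \<in> carrier R" using k x_closed rc by auto
      have "(ksign R k \<mu> \<otimes> r k) \<otimes> (ksign R k \<mu> \<otimes> x k [^] s) = (ksign R k \<mu> \<otimes> ksign R k \<mu>) \<otimes> (r k \<otimes> x k [^] s)"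
        using c by (simp only: R.m_ac ksign_closed R.m_closed)
      then show ?thesis
        using k c u\<mu> by (simp add: smult_assoc1[symmetric])
    qed
    finally show "(\<Oplus>\<^bsub>M\<^esub>i\<in>\<mu>. ?f i k) = ?g k" .
  qed (use g in auto)
  also have "(\<Oplus>\<^bsub>M\<^esub>i\<in>\<mu>. ?g i) \<oplus>\<^bsub>M\<^esub> (\<Oplus>\<^bsub>M\<^esub>k\<in>T - \<mu>. ?g k) = (\<Oplus>\<^bsub>M\<^esub>i\<in>\<mu> \<union> (T - \<mu>). ?g i)"
    using \<mu> T finite_subset_T[OF \<mu>] g by (intro M.finsum_Un_disjoint[symmetric]) auto
  also have "\<mu> \<union> (T - \<mu>) = T" using \<mu> by auto
  also have "(\<Oplus>\<^bsub>M\<^esub>i\<in>T. ?g i) = (\<Oplus>i\<in>T. r i \<otimes> x i [^] s) \<odot>\<^bsub>M\<^esub> u \<mu>"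
    using T u\<mu> x_closed rc by (intro finsum_smult_rdistr[symmetric]) auto
  finally show ?thesis .
qed

end


section \<open>Independence of the generators\<close>

locale cochains_insert = cochains +
  fixes j :: nat
  assumes j: "j \<notin> T" and xj: "x j \<in> carrier R"
begin

sublocale I: cochains R M x "insert j T"
  by unfold_locales (use T x xj in auto)

text \<open>A cochain over \<open>insert j T\<close> consists of one on the sets without \<open>j\<close> and one on the sets with \<open>j\<close>.
  With the sign chosen here, the coboundary is, up to sign, \<open>x\<^sub>j\<^sup>s w + d f\<close> on the sets with \<open>j\<close>.\<close>

definition join :: "(nat set \<Rightarrow> 'c) \<Rightarrow> (nat set \<Rightarrow> 'c) \<Rightarrow> nat set \<Rightarrow> 'c" where
  "join w f \<mu> = (if j \<in> \<mu> then \<ominus>\<^bsub>M\<^esub> (ksign R j \<mu> \<odot>\<^bsub>M\<^esub> f (\<mu> - {j})) else w \<mu>)"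

lemma subset_insertE:
  assumes "\<mu> \<subseteq> insert j T"
  obtains "\<mu> \<subseteq> T" "j \<notin> \<mu>" | \<nu> where "\<nu> \<subseteq> T" "\<mu> = insert j \<nu>" "j \<notin> \<nu>"
proof (cases "j \<in> \<mu>")
  case True
  have "\<mu> - {j} \<subseteq> T" "\<mu> = insert j (\<mu> - {j})" using assms True by auto
  then show ?thesis using that(2)[of "\<mu> - {j}"] by auto
next
  case False
  then show ?thesis using that(1) assms by auto
qed

lemma join_closed:
  assumes "w \<in> Pow T \<rightarrow> carrier M" "f \<in> Pow T \<rightarrow> carrier M"
  shows "join w f \<in> Pow (insert j T) \<rightarrow> carrier M"
proof
  fix \<mu> assume "\<mu> \<in> Pow (insert j T)"
  then have "\<mu> \<subseteq> insert j T" by simp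
  then show "join w f \<mu> \<in> carrier M"
    by (cases rule: subset_insertE) (use assms j in \<open>auto simp: join_def Pi_iff\<close>)
qed

lemma cobd_join_old:
  assumes "w \<in> Pow T \<rightarrow> carrier M" "\<mu> \<subseteq> T"
  shows "cobd R M x s (join w f) \<mu> = cobd R M x s w \<mu>"
  using assms j by (intro cobd_cong) (auto simp: join_def)

lemma cobd_join_new:
  assumes w: "w \<in> Pow T \<rightarrow> carrier M" and f: "f \<in> Pow T \<rightarrow> carrier M" and \<mu>: "\<mu> \<subseteq> T"
  shows "cobd R M x s (join w f) (insert j \<mu>) =
    ksign R j \<mu> \<odot>\<^bsub>M\<^esub> (x j [^] s \<odot>\<^bsub>M\<^esub> w \<mu> \<oplus>\<^bsub>M\<^esub> cobd R M x s f \<mu>)"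
proof -
  have j\<mu>: "j \<notin> \<mu>" using \<mu> j by auto
  have w\<mu>: "w \<mu> \<in> carrier M" using w \<mu> by auto
  let ?\<nu> = "insert j \<mu>"
  let ?h = "\<lambda>i. (ksign R i ?\<nu> \<otimes> x i [^] s) \<odot>\<^bsub>M\<^esub> join w f (?\<nu> - {i})"
  let ?g = "\<lambda>i. (ksign R i \<mu> \<otimes> x i [^] s) \<odot>\<^bsub>M\<^esub> f (\<mu> - {i})"
  have h: "?h i \<in> carrier M" if "i \<in> ?\<nu>" for i
    using that \<mu> by (intro I.cobd_term_closed join_closed w f) auto
  have g: "?g i \<in> carrier M" if "i \<in> \<mu>" for i
    using that \<mu> by (intro cobd_term_closed f) auto
  have "cobd R M x s (join w f) ?\<nu> = ?h j \<oplus>\<^bsub>M\<^esub> (\<Oplus>\<^bsub>M\<^esub>i\<in>\<mu>. ?h i)"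
    unfolding cobd_def using finite_subset_T[OF \<mu>] j\<mu> h h[of j] by (intro M.finsum_insert) auto
  also have "(\<Oplus>\<^bsub>M\<^esub>i\<in>\<mu>. ?h i) = (\<Oplus>\<^bsub>M\<^esub>i\<in>\<mu>. ksign R j \<mu> \<odot>\<^bsub>M\<^esub> ?g i)"
  proof (intro M.finsum_cong' refl)
    fix i assume i: "i \<in> \<mu>"
    have e: "?\<nu> - {i} = insert j (\<mu> - {i})" "insert j (\<mu> - {i}) - {j} = \<mu> - {i}" using i j\<mu> by auto
    have c: "x i [^] s \<in> carrier R" "f (\<mu> - {i}) \<in> carrier M"
      using i \<mu> x_closed f by auto
    have k1: "ksign R i \<mu> \<otimes> ksign R j (\<mu> - {i}) = \<ominus> (ksign R j \<mu> \<otimes> ksign R i ?\<nu>)"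
      by (rule ksign_swap[OF finite_subset_T[OF \<mu>] i j\<mu>])
    have "ksign R i ?\<nu> \<otimes> ksign R j (\<mu> - {i}) =
      (ksign R i ?\<nu> \<otimes> ksign R i \<mu>) \<otimes> (ksign R i \<mu> \<otimes> ksign R j (\<mu> - {i}))"
      by (simp add: R.m_assoc[symmetric]) (simp add: R.m_assoc)
    also have "\<dots> = \<ominus> (((ksign R i ?\<nu> \<otimes> ksign R i ?\<nu>) \<otimes> ksign R i \<mu>) \<otimes> ksign R j \<mu>)"
      unfolding k1 by (simp only: R.r_minus R.m_ac ksign_closed R.m_closed)
    finally have k: "ksign R i ?\<nu> \<otimes> ksign R j (\<mu> - {i}) = \<ominus> (ksign R j \<mu> \<otimes> ksign R i \<mu>)"
      by (simp add: R.m_comm)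
    have "?h i = \<ominus>\<^bsub>M\<^esub> (((ksign R i ?\<nu> \<otimes> x i [^] s) \<otimes> ksign R j (\<mu> - {i})) \<odot>\<^bsub>M\<^esub> f (\<mu> - {i}))"
      using c by (simp add: join_def e smult_r_minus smult_assoc1)
    also have "(ksign R i ?\<nu> \<otimes> x i [^] s) \<otimes> ksign R j (\<mu> - {i}) =
        (ksign R i ?\<nu> \<otimes> ksign R j (\<mu> - {i})) \<otimes> x i [^] s"
      using c by (simp add: R.m_ac)
    also have "\<ominus>\<^bsub>M\<^esub> (\<dots> \<odot>\<^bsub>M\<^esub> f (\<mu> - {i})) = ksign R j \<mu> \<odot>\<^bsub>M\<^esub> ?g i"
      unfolding k using c by (simp add: R.l_minus smult_l_minus smult_assoc1[symmetric] R.m_assoc)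
    finally show "?h i = ksign R j \<mu> \<odot>\<^bsub>M\<^esub> ?g i" .
  qed (use g in auto)
  also have "\<dots> = ksign R j \<mu> \<odot>\<^bsub>M\<^esub> cobd R M x s f \<mu>"
    unfolding cobd_def using g finite_subset_T[OF \<mu>] by (intro finsum_smult_ldistr[symmetric]) auto
  also have "?h j = ksign R j \<mu> \<odot>\<^bsub>M\<^esub> (x j [^] s \<odot>\<^bsub>M\<^esub> w \<mu>)"
    using j\<mu> w\<mu> xj by (simp add: join_def smult_assoc1)
  finally show ?thesis
    using w\<mu> xj cobd_closed[OF f \<mu>] by (simp add: smult_r_distr)
qed

lemma xprod_insert: "\<mu> \<subseteq> T \<Longrightarrow> finprod R x (insert j \<mu>) = x j \<otimes> finprod R x \<mu>"
  using finite_subset_T[of \<mu>] j x xj by (intro R.finprod_insert) auto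

text \<open>\<open>x\<^sub>j\<close> lies in the radical of the ideal generated by the other elements.\<close>

context
  assumes radical: "\<And>s::nat. \<exists>N::nat. \<exists>r \<in> T \<rightarrow> carrier R. x j [^] N = (\<Oplus>i\<in>T. r i \<otimes> x i [^] s)"
begin

text \<open>Contraction with the coefficients of \<open>x\<^sub>j\<^sup>N\<close> shows that \<open>x\<^sub>j\<^sup>N u\<close> is a coboundary.\<close>

lemma kill_cocycle:
  assumes "u \<in> Pow T \<rightarrow> carrier M" "\<And>\<tau>. \<tau> \<subseteq> T \<Longrightarrow> cobd R M x s u \<tau> = \<zero>\<^bsub>M\<^esub>"
  shows "\<exists>N::nat. \<exists>e \<in> Pow T \<rightarrow> carrier M. \<forall>\<tau>\<subseteq>T.
    cobd R M x (s + N) e \<tau> = x j [^] N \<odot>\<^bsub>M\<^esub> level_up R M x N u \<tau>"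
proof -
  obtain N r where r: "r \<in> T \<rightarrow> carrier R" "x j [^] (N::nat) = (\<Oplus>i\<in>T. r i \<otimes> x i [^] s)"
    using radical by blast
  define e where "e = level_up R M x N (contract r u)"
  have "e \<in> Pow T \<rightarrow> carrier M"
    unfolding e_def by (intro level_up_closed contract_closed assms r)
  moreover have "cobd R M x (s + N) e \<tau> = x j [^] N \<odot>\<^bsub>M\<^esub> level_up R M x N u \<tau>" if \<tau>: "\<tau> \<subseteq> T" for \<tau>
  proof -
    have "u \<tau> \<in> carrier M" using assms(1) \<tau> by auto
    then show ?thesis
      unfolding e_def using cobd_level_up[OF contract_closed[OF assms(1) r(1)] \<tau>, of s N]
        cobd_contract[OF assms(1) r(1) assms(2) \<tau>] xprod_closed[OF \<tau>] xj
      by (simp add: level_up_def r(2)[symmetric] smult_assoc1[symmetric] R.m_comm)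
  qed
  ultimately show ?thesis by blast
qed

text \<open>As \<open>x\<^sub>j\<^sup>N u\<close> is a coboundary, \<open>u\<close> extends to a cocycle over \<open>insert j T\<close>.  This is a coboundary, and
  restricting a bounding cochain to the subsets of \<open>T\<close> shows the same for \<open>u\<close>.\<close>

lemma koszul_acyclic_drop:
  assumes "koszul_acyclic R M x (insert j T)"
  shows "koszul_acyclic R M x T"
  unfolding koszul_acyclic_def
proof (intro allI ballI impI)
  fix s :: nat and u assume u: "u \<in> Pow T \<rightarrow> carrier M"
    and "u {} = \<zero>\<^bsub>M\<^esub> \<and> (\<forall>\<tau>\<subseteq>T. cobd R M x s u \<tau> = \<zero>\<^bsub>M\<^esub>)"
  then have u0: "u {} = \<zero>\<^bsub>M\<^esub>" and ucc: "\<And>\<tau>. \<tau> \<subseteq> T \<Longrightarrow> cobd R M x s u \<tau> = \<zero>\<^bsub>M\<^esub>" by auto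
  obtain N e where e: "e \<in> Pow T \<rightarrow> carrier M"
    "\<And>\<tau>. \<tau> \<subseteq> T \<Longrightarrow> cobd R M x (s + N) e \<tau> = x j [^] N \<odot>\<^bsub>M\<^esub> level_up R M x N u \<tau>"
    using kill_cocycle[OF u ucc] by blast
  define u2 where "u2 = level_up R M x N u"
  define f where "f \<mu> = \<ominus>\<^bsub>M\<^esub> (x j [^] s \<odot>\<^bsub>M\<^esub> e \<mu>)" for \<mu>
  have u2: "u2 \<in> Pow T \<rightarrow> carrier M" unfolding u2_def by (intro level_up_closed u)
  have f: "f \<in> Pow T \<rightarrow> carrier M" using e(1) xj by (auto simp: f_def Pi_iff)
  have u2cc: "cobd R M x (s + N) u2 \<tau> = \<zero>\<^bsub>M\<^esub>" if "\<tau> \<subseteq> T" for \<tau>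
    using cobd_level_up[OF u that] ucc[OF that] xprod_closed[OF that] by (simp add: u2_def level_up_def)
  have fcob: "cobd R M x (s + N) f \<tau> = \<ominus>\<^bsub>M\<^esub> (x j [^] (s + N) \<odot>\<^bsub>M\<^esub> u2 \<tau>)" if "\<tau> \<subseteq> T" for \<tau>
  proof -
    have "(\<lambda>\<mu>. x j [^] s \<odot>\<^bsub>M\<^esub> e \<mu>) \<in> Pow T \<rightarrow> carrier M" using e(1) xj by (auto simp: Pi_iff)
    moreover have "u2 \<tau> \<in> carrier M" using u2 that by auto
    ultimately show ?thesis
      unfolding f_def using e xj that
      by (simp add: cobd_neg cobd_smult u2_def[symmetric] smult_assoc1[symmetric] R.nat_pow_mult)
  qed
  let ?w = "join u2 f"
  have w: "?w \<in> Pow (insert j T) \<rightarrow> carrier M" by (intro join_closed u2 f)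
  have w0: "?w {} = \<zero>\<^bsub>M\<^esub>" using u0 by (simp add: join_def u2_def level_up_def)
  have wcc: "cobd R M x (s + N) ?w \<tau> = \<zero>\<^bsub>M\<^esub>" if "\<tau> \<subseteq> insert j T" for \<tau>
    using that
  proof (cases rule: subset_insertE)
    case 1
    then show ?thesis using u2 u2cc by (simp add: cobd_join_old)
  next
    case (2 \<nu>)
    have "u2 \<nu> \<in> carrier M" using u2 2 by auto
    then show ?thesis
      using 2 u2 f xj by (simp add: cobd_join_new fcob M.r_neg)
  qed
  from koszul_acyclicD[OF assms w w0 wcc] obtain t v where v: "v \<in> Pow (insert j T) \<rightarrow> carrier M"
    "\<And>\<mu>. \<mu> \<subseteq> insert j T \<Longrightarrow> level_up R M x t ?w \<mu> = cobd R M x (s + N + t) v \<mu>"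
    by blast
  have "level_up R M x (t + N) u \<mu> = cobd R M x (s + (t + N)) v \<mu>" if "\<mu> \<subseteq> T" for \<mu>
  proof -
    have "level_up R M x (t + N) u \<mu> = level_up R M x t ?w \<mu>"
      unfolding level_up_add[OF u that] using that j by (auto simp: level_up_def join_def u2_def)
    also have "\<dots> = cobd R M x (s + N + t) v \<mu>"
      by (rule v(2)) (use that in auto)
    also have "s + N + t = s + (t + N)" by simp
    finally show ?thesis .
  qed
  moreover have "v \<in> Pow T \<rightarrow> carrier M" using v(1) by auto
  ultimately show "\<exists>t. \<exists>v\<in>Pow T \<rightarrow> carrier M. \<forall>\<mu>\<subseteq>T. level_up R M x t u \<mu> = cobd R M x (s + t) v \<mu>"
    by blast
qed

text \<open>The restriction of \<open>u\<close> to the subsets of \<open>T\<close> is a coboundary; subtracting the coboundary from \<open>u\<close>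
  leaves a cocycle \<open>u2\<close> on the sets that contain \<open>j\<close>.  Its transition to a higher level multiplies it
  by powers of \<open>x\<^sub>j\<close>, so it becomes a coboundary.\<close>

lemma koszul_acyclic_add:
  assumes "koszul_acyclic R M x T"
  shows "koszul_acyclic R M x (insert j T)"
  unfolding koszul_acyclic_def
proof (intro allI ballI impI)
  fix s :: nat and u assume u: "u \<in> Pow (insert j T) \<rightarrow> carrier M"
    and "u {} = \<zero>\<^bsub>M\<^esub> \<and> (\<forall>\<tau>\<subseteq>insert j T. cobd R M x s u \<tau> = \<zero>\<^bsub>M\<^esub>)"
  then have u0: "u {} = \<zero>\<^bsub>M\<^esub>"
    and ucc: "\<And>\<tau>. \<tau> \<subseteq> insert j T \<Longrightarrow> cobd R M x s u \<tau> = \<zero>\<^bsub>M\<^esub>" by auto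
  have uT: "u \<in> Pow T \<rightarrow> carrier M" using u by auto
  have "cobd R M x s u \<tau> = \<zero>\<^bsub>M\<^esub>" if "\<tau> \<subseteq> T" for \<tau>
    using ucc that by auto
  from koszul_acyclicD[OF assms uT u0 this] obtain t v where v: "v \<in> Pow T \<rightarrow> carrier M"
    "\<And>\<mu>. \<mu> \<subseteq> T \<Longrightarrow> level_up R M x t u \<mu> = cobd R M x (s + t) v \<mu>"
    by blast
  let ?z = "\<lambda>\<mu>. \<zero>\<^bsub>M\<^esub>"
  have z: "?z \<in> Pow T \<rightarrow> carrier M" by simp
  define v' where "v' = join v ?z"
  define s2 where "s2 = s + t"
  have v': "v' \<in> Pow (insert j T) \<rightarrow> carrier M" unfolding v'_def by (intro join_closed v z)
  let ?d = "cobd R M x s2 v'"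
  have d: "?d \<in> Pow (insert j T) \<rightarrow> carrier M" using I.cobd_closed[OF v'] by auto
  define u1 where "u1 = level_up R M x t u"
  have u1: "u1 \<in> Pow (insert j T) \<rightarrow> carrier M" unfolding u1_def by (rule I.level_up_closed[OF u])
  define u2 where "u2 \<mu> = u1 \<mu> \<oplus>\<^bsub>M\<^esub> \<ominus>\<^bsub>M\<^esub> ?d \<mu>" for \<mu>
  have nd: "(\<lambda>\<mu>. \<ominus>\<^bsub>M\<^esub> ?d \<mu>) \<in> Pow (insert j T) \<rightarrow> carrier M" using d by (auto simp: Pi_iff)
  have u2: "u2 \<in> Pow (insert j T) \<rightarrow> carrier M" using u1 nd by (auto simp: u2_def Pi_iff)
  have u2T: "u2 \<mu> = \<zero>\<^bsub>M\<^esub>" if "\<mu> \<subseteq> T" for \<mu>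
    using v(2)[OF that] cobd_join_old[OF v(1) that] cobd_closed[OF v(1) that]
    by (simp add: u2_def u1_def v'_def s2_def M.r_neg)
  have u2cc: "cobd R M x s2 u2 \<tau> = \<zero>\<^bsub>M\<^esub>" if "\<tau> \<subseteq> insert j T" for \<tau>
  proof -
    have "cobd R M x s2 u1 \<tau> = \<zero>\<^bsub>M\<^esub>"
      using I.cobd_level_up[OF u that, of s t] ucc[OF that] I.xprod_closed[OF that]
      by (simp add: u1_def s2_def level_up_def)
    then show ?thesis
      unfolding u2_def using I.cobd_add[OF u1 nd that] I.cobd_neg[OF d that] I.cobd_cobd[OF v' that]
      by simp
  qed
  define b where "b \<mu> = \<ominus>\<^bsub>M\<^esub> (ksign R j \<mu> \<odot>\<^bsub>M\<^esub> u2 (insert j \<mu>))" for \<mu>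
  have u2c: "u2 (insert j \<mu>) \<in> carrier M" if "\<mu> \<subseteq> T" for \<mu>
    using u2 that by auto
  have b: "b \<in> Pow T \<rightarrow> carrier M" using u2c by (auto simp: b_def)
  have u2_join: "u2 \<mu> = join ?z b \<mu>" if "\<mu> \<subseteq> insert j T" for \<mu>
    using that
  proof (cases rule: subset_insertE)
    case 1
    then show ?thesis using u2T by (simp add: join_def)
  next
    case (2 \<nu>)
    have "insert j \<nu> - {j} = \<nu>" using 2 by auto
    then show ?thesis
      using 2 u2c[OF 2(1)] by (simp add: join_def b_def smult_r_minus smult_assoc1[symmetric])
  qed
  have bcc: "cobd R M x s2 b \<tau> = \<zero>\<^bsub>M\<^esub>" if "\<tau> \<subseteq> T" for \<tau>
  proof -
    have sub: "insert j \<tau> \<subseteq> insert j T" using that by auto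
    have "\<zero>\<^bsub>M\<^esub> = cobd R M x s2 (join ?z b) (insert j \<tau>)"
      using u2cc[OF sub] I.cobd_cong[OF u2_join join_closed[OF z b] sub] by simp
    also have "\<dots> = ksign R j \<tau> \<odot>\<^bsub>M\<^esub> cobd R M x s2 b \<tau>"
      using cobd_join_new[OF z b that] cobd_closed[OF b that] xj by simp
    finally have "ksign R j \<tau> \<odot>\<^bsub>M\<^esub> (ksign R j \<tau> \<odot>\<^bsub>M\<^esub> cobd R M x s2 b \<tau>) = \<zero>\<^bsub>M\<^esub>"
      by (metis ksign_closed smult_r_null)
    then show ?thesis
      using cobd_closed[OF b that] by (simp add: smult_assoc1[symmetric])
  qed
  obtain N e where e: "e \<in> Pow T \<rightarrow> carrier M"
    "\<And>\<tau>. \<tau> \<subseteq> T \<Longrightarrow> cobd R M x (s2 + N) e \<tau> = x j [^] N \<odot>\<^bsub>M\<^esub> level_up R M x N b \<tau>"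
    using kill_cocycle[OF b bcc] by blast
  define v2 where "v2 = join ?z e"
  have v2: "v2 \<in> Pow (insert j T) \<rightarrow> carrier M" unfolding v2_def by (intro join_closed e z)
  have v2cob: "cobd R M x (s2 + N) v2 \<mu> = level_up R M x N (\<lambda>\<mu>. \<ominus>\<^bsub>M\<^esub> u2 \<mu>) \<mu>" if "\<mu> \<subseteq> insert j T" for \<mu>
    using that
  proof (cases rule: subset_insertE)
    case 1
    have "\<ominus>\<^bsub>M\<^esub> u2 \<mu> = \<zero>\<^bsub>M\<^esub>"
      unfolding u2T[OF 1(1)] by (rule M.minus_equality) simp_all
    then show ?thesis
      unfolding v2_def using cobd_join_old[OF z 1(1)] xprod_closed[OF 1(1)] 1(1)
      by (simp add: cobd_zero level_up_def)
  next
    case (2 \<nu>)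
    have bc: "b \<nu> \<in> carrier M" using b 2 by auto
    have c: "finprod R x \<nu> \<in> carrier R" using 2 xprod_closed by auto
    have "cobd R M x (s2 + N) v2 \<mu> = ksign R j \<nu> \<odot>\<^bsub>M\<^esub> cobd R M x (s2 + N) e \<nu>"
      using cobd_join_new[OF z e(1) 2(1)] cobd_closed[OF e(1) 2(1)] xj 2 by (simp add: v2_def)
    also have "\<dots> = (finprod R x \<mu> [^] N) \<odot>\<^bsub>M\<^esub> (ksign R j \<nu> \<odot>\<^bsub>M\<^esub> b \<nu>)"
      using 2 bc c xj
      by (simp add: e(2) level_up_def xprod_insert R.nat_pow_distrib smult_assoc1[symmetric] R.m_ac)
    also have "ksign R j \<nu> \<odot>\<^bsub>M\<^esub> b \<nu> = \<ominus>\<^bsub>M\<^esub> u2 \<mu>"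
      using u2c[OF 2(1)] 2(2) by (simp add: b_def smult_r_minus smult_assoc1[symmetric])
    finally show ?thesis by (simp add: level_up_def)
  qed
  define vf where "vf \<mu> = level_up R M x N v' \<mu> \<oplus>\<^bsub>M\<^esub> \<ominus>\<^bsub>M\<^esub> v2 \<mu>" for \<mu>
  have lv': "level_up R M x N v' \<in> Pow (insert j T) \<rightarrow> carrier M" by (rule I.level_up_closed[OF v'])
  have nv2: "(\<lambda>\<mu>. \<ominus>\<^bsub>M\<^esub> v2 \<mu>) \<in> Pow (insert j T) \<rightarrow> carrier M" using v2 by (auto simp: Pi_iff)
  have vf: "vf \<in> Pow (insert j T) \<rightarrow> carrier M" using lv' nv2 by (auto simp: vf_def Pi_iff)
  have "level_up R M x (N + t) u \<mu> = cobd R M x (s + (N + t)) vf \<mu>" if \<mu>: "\<mu> \<subseteq> insert j T" for \<mu>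
  proof -
    have c: "finprod R x \<mu> [^] N \<in> carrier R" "u1 \<mu> \<in> carrier M" "?d \<mu> \<in> carrier M" "u2 \<mu> \<in> carrier M"
      using I.xprod_closed[OF \<mu>] u1 u2 I.cobd_closed[OF v' \<mu>] \<mu> by auto
    have "cobd R M x (s2 + N) vf \<mu> = level_up R M x N ?d \<mu> \<oplus>\<^bsub>M\<^esub> \<ominus>\<^bsub>M\<^esub> level_up R M x N (\<lambda>\<mu>. \<ominus>\<^bsub>M\<^esub> u2 \<mu>) \<mu>"
      unfolding vf_def using I.cobd_add[OF lv' nv2 \<mu>] I.cobd_neg[OF v2 \<mu>] v2cob[OF \<mu>]
        I.cobd_level_up[OF v' \<mu>] by simp
    also have "\<dots> = finprod R x \<mu> [^] N \<odot>\<^bsub>M\<^esub> (?d \<mu> \<oplus>\<^bsub>M\<^esub> u2 \<mu>)"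
      using c by (simp add: level_up_def smult_r_minus smult_r_distr)
    also have "?d \<mu> \<oplus>\<^bsub>M\<^esub> u2 \<mu> = u1 \<mu>"
      using c by (simp add: u2_def M.a_lcomm M.r_neg)
    finally show ?thesis
      unfolding I.level_up_add[OF u \<mu>] by (simp add: u1_def s2_def level_up_def add.assoc add.commute[of N])
  qed
  then show "\<exists>t. \<exists>v\<in>Pow (insert j T) \<rightarrow> carrier M. \<forall>\<mu>\<subseteq>insert j T.
      level_up R M x t u \<mu> = cobd R M x (s + t) v \<mu>"
    using vf by blast
qed

end

end


section \<open>The polynomial ring\<close>

lemma finite_submultisets: "finite {a. a \<subseteq># (m :: 'v multiset)}"
proof (induction m)
  case (add x m)
  have "{a. a \<subseteq># add_mset x m} \<subseteq> {a. a \<subseteq># m} \<union> add_mset x ` {a. a \<subseteq># m}"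
  proof
    fix a assume "a \<in> {a. a \<subseteq># add_mset x m}"
    then have a: "a \<subseteq># add_mset x m" by simp
    show "a \<in> {a. a \<subseteq># m} \<union> add_mset x ` {a. a \<subseteq># m}"
    proof (cases "x \<in># a")
      case True
      then obtain b where "a = add_mset x b" by (metis insert_DiffM)
      then show ?thesis using a by auto
    next
      case False
      then have "a \<subseteq># m" using a by (simp add: inter_add_left1 subset_mset.inf.absorb_iff2)
      then show ?thesis by simp
    qed
  qed
  then show ?case
    using add by (meson finite_UnI finite_imageI finite_subset)
qed simp

lemma set_repeat_mset_subset: "set_mset (repeat_mset n m) \<subseteq> set_mset m"
  by (induction n) auto

text \<open>For double sums in which the range of the inner index depends on the outer one, as in a product of
  three polynomials or in the pairing of chains and cochains.\<close>

lemma (in abelian_monoid) finsum_swap_dependent: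
  assumes "finite A" "finite B" "\<And>i j. i \<in> A \<Longrightarrow> j \<in> B \<Longrightarrow> Q i j \<Longrightarrow> f i j \<in> carrier G"
  shows "(\<Oplus>i\<in>A. \<Oplus>j\<in>{j \<in> B. Q i j}. f i j) = (\<Oplus>j\<in>B. \<Oplus>i\<in>{i \<in> A. Q i j}. f i j)"
proof -
  let ?g = "\<lambda>i j. if Q i j then f i j else \<zero>"
  have g: "?g i j \<in> carrier G" if "i \<in> A" "j \<in> B" for i j
    using assms(3) that by auto
  have "(\<Oplus>i\<in>A. \<Oplus>j\<in>{j \<in> B. Q i j}. f i j) = (\<Oplus>i\<in>A. \<Oplus>j\<in>B. ?g i j)"
    using assms g
    by (intro finsum_cong' add.finprod_mono_neutral_cong_left refl) (auto intro!: finsum_closed)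
  also have "\<dots> = (\<Oplus>j\<in>B. \<Oplus>i\<in>A. ?g i j)"
    using assms g by (intro finsum_swap) auto
  also have "\<dots> = (\<Oplus>j\<in>B. \<Oplus>i\<in>{i \<in> A. Q i j}. f i j)"
    using assms g
    by (intro finsum_cong' add.finprod_mono_neutral_cong_right refl) (auto intro!: finsum_closed)
  finally show ?thesis .
qed

locale mpoly = cring S for S :: "('s, 'c) ring_scheme" (structure) +
  fixes V :: "'v set"
begin

abbreviation P where "P \<equiv> mpoly_ring S V"

lemma P_simps:
  "p \<oplus>\<^bsub>P\<^esub> q = (\<lambda>m. p m \<oplus> q m)"
  "p \<otimes>\<^bsub>P\<^esub> q = (\<lambda>m. \<Oplus>a\<in>{a. a \<subseteq># m}. p a \<otimes> q (m - a))"
  "\<zero>\<^bsub>P\<^esub> = (\<lambda>m. \<zero>)"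
  "\<one>\<^bsub>P\<^esub> = (\<lambda>m. if m = {#} then \<one> else \<zero>)"
  by (auto simp: mpoly_ring_def indexed_padd_def indexed_const_def)

lemma P_carrierI:
  assumes "\<And>m. p m \<in> carrier S" "finite {m. p m \<noteq> \<zero>}" "\<And>m. p m \<noteq> \<zero> \<Longrightarrow> set_mset m \<subseteq> V"
  shows "p \<in> carrier P"
proof -
  have monomial: "(\<lambda>m. if m = a then k else \<zero>) \<in> indexed_pset V (carrier S)"
    if "k \<in> carrier S" "set_mset a \<subseteq> V" for k a
    using that(2)
  proof (induction a)
    case empty
    then show ?case
      using indexed_pset.indexed_const[OF that(1), of V] by (simp add: indexed_const_def)
  next
    case (add x a)
    have "(\<lambda>m. if m = add_mset x a then k else \<zero>) = indexed_pmult (\<lambda>m. if m = a then k else \<zero>) x"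
      by (rule ext) (auto simp: indexed_pmult_def)
    moreover have "indexed_pmult (\<lambda>m. if m = a then k else \<zero>) x \<in> indexed_pset V (carrier S)"
      using add by (intro indexed_pset.indexed_pmult) auto
    ultimately show ?case by simp
  qed
  have "finite F \<Longrightarrow> {m. p m \<noteq> \<zero>} \<subseteq> F \<Longrightarrow> (\<forall>m. p m \<in> carrier S \<and> (p m \<noteq> \<zero> \<longrightarrow> set_mset m \<subseteq> V)) \<Longrightarrow>
      p \<in> indexed_pset V (carrier S)" for F
  proof (induction F arbitrary: p rule: finite_induct)
    case empty
    then have "p = indexed_const \<zero>" by (auto simp: indexed_const_def)
    then show ?case by (auto intro: indexed_pset.indexed_const)
  next
    case (insert a F)
    have "p(a := \<zero>) \<in> indexed_pset V (carrier S)"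
      by (rule insert.IH) (use insert.prems in auto)
    moreover have "(\<lambda>m. if m = a then p a else \<zero>) \<in> indexed_pset V (carrier S)"
    proof (cases "p a = \<zero>")
      case True
      then have "(\<lambda>m. if m = a then p a else \<zero>) = indexed_const \<zero>" by (auto simp: indexed_const_def)
      then show ?thesis by (auto intro: indexed_pset.indexed_const)
    next
      case False
      then show ?thesis using insert.prems by (intro monomial) auto
    qed
    moreover have "p = indexed_padd (p(a := \<zero>)) (\<lambda>m. if m = a then p a else \<zero>)"
      using insert.prems by (auto simp: indexed_padd_def)
    ultimately show ?case
      by (metis indexed_pset.indexed_padd)
  qed
  then show ?thesis
    using assms by (auto simp: mpoly_ring_def)
qed

lemma P_carrierD:
  assumes "p \<in> carrier P"
  shows "p m \<in> carrier S" "finite {m. p m \<noteq> \<zero>}" "p m \<noteq> \<zero> \<Longrightarrow> set_mset m \<subseteq> V"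
proof -
  have "p \<in> indexed_pset V (carrier S)" using assms by (simp add: mpoly_ring_def)
  then have "(\<forall>m. p m \<in> carrier S) \<and> finite {m. p m \<noteq> \<zero>} \<and> (\<forall>m. p m \<noteq> \<zero> \<longrightarrow> set_mset m \<subseteq> V)"
  proof (induction rule: indexed_pset.induct)
    case (indexed_const k)
    have "{m. indexed_const k m \<noteq> \<zero>} \<subseteq> {{#}}" by (auto simp: indexed_const_def)
    then have "finite {m. indexed_const k m \<noteq> \<zero>}" by (rule finite_subset) simp
    then show ?case using indexed_const by (auto simp: indexed_const_def)
  next
    case (indexed_padd p q)
    have "{m. indexed_padd p q m \<noteq> \<zero>} \<subseteq> {m. p m \<noteq> \<zero>} \<union> {m. q m \<noteq> \<zero>}"
      by (auto simp: indexed_padd_def)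
    moreover have "indexed_padd p q m \<noteq> \<zero> \<Longrightarrow> p m \<noteq> \<zero> \<or> q m \<noteq> \<zero>" for m
      by (auto simp: indexed_padd_def)
    ultimately show ?case
      using indexed_padd by (simp add: indexed_padd_def) (meson finite_UnI finite_subset)
  next
    case (indexed_pmult p i)
    have "{m. indexed_pmult p i m \<noteq> \<zero>} \<subseteq> add_mset i ` {m. p m \<noteq> \<zero>}"
    proof
      fix m assume "m \<in> {m. indexed_pmult p i m \<noteq> \<zero>}"
      then have "i \<in># m" "p (m - {#i#}) \<noteq> \<zero>" by (auto simp: indexed_pmult_def split: if_splits)
      then show "m \<in> add_mset i ` {m. p m \<noteq> \<zero>}"
        by (intro image_eqI[of _ _ "m - {#i#}"]) auto
    qed
    moreover have "set_mset m \<subseteq> V" if "indexed_pmult p i m \<noteq> \<zero>" for m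
    proof -
      from calculation that obtain m' where "m = add_mset i m'" "p m' \<noteq> \<zero>" by auto
      then show ?thesis using indexed_pmult by auto
    qed
    moreover have "finite {m. indexed_pmult p i m \<noteq> \<zero>}"
      using calculation(1) indexed_pmult by (meson finite_imageI finite_subset)
    moreover have "indexed_pmult p i m \<in> carrier S" for m
      using indexed_pmult by (simp add: indexed_pmult_def)
    ultimately show ?case by blast
  qed
  then show "p m \<in> carrier S" "finite {m. p m \<noteq> \<zero>}" "p m \<noteq> \<zero> \<Longrightarrow> set_mset m \<subseteq> V" by auto
qed

lemma P_mult_coeff_closed:
  assumes "p \<in> carrier P" "q \<in> carrier P"
  shows "(p \<otimes>\<^bsub>P\<^esub> q) m \<in> carrier S"
  using assms by (auto simp: P_simps P_carrierD intro!: finsum_closed)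

lemma P_mult_closed:
  assumes "p \<in> carrier P" "q \<in> carrier P"
  shows "p \<otimes>\<^bsub>P\<^esub> q \<in> carrier P"
proof (rule P_carrierI)
  have sub: "m \<in> (\<lambda>(a, b). a + b) ` ({m. p m \<noteq> \<zero>} \<times> {m. q m \<noteq> \<zero>})" if "(p \<otimes>\<^bsub>P\<^esub> q) m \<noteq> \<zero>" for m
  proof -
    obtain a where "a \<subseteq># m" "p a \<otimes> q (m - a) \<noteq> \<zero>"
      using \<open>(p \<otimes>\<^bsub>P\<^esub> q) m \<noteq> \<zero>\<close> by (auto simp: P_simps dest: add.finprod_one_eqI)
        (metis (mono_tags, lifting) add.finprod_one_eqI mem_Collect_eq)
    then have "p a \<noteq> \<zero>" "q (m - a) \<noteq> \<zero>"
      using P_carrierD(1)[OF assms(1)] P_carrierD(1)[OF assms(2)] by auto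
    then show ?thesis
      using \<open>a \<subseteq># m\<close> by (intro image_eqI[of _ _ "(a, m - a)"]) auto
  qed
  show "(p \<otimes>\<^bsub>P\<^esub> q) m \<in> carrier S" for m
    using assms by (rule P_mult_coeff_closed)
  have "finite ((\<lambda>(a, b). a + b) ` ({m. p m \<noteq> \<zero>} \<times> {m. q m \<noteq> \<zero>}))"
    using P_carrierD(2)[OF assms(1)] P_carrierD(2)[OF assms(2)] by simp
  then show "finite {m. (p \<otimes>\<^bsub>P\<^esub> q) m \<noteq> \<zero>}"
    by (rule rev_finite_subset) (use sub in blast)
  show "set_mset m \<subseteq> V" if "(p \<otimes>\<^bsub>P\<^esub> q) m \<noteq> \<zero>" for m
  proof -
    obtain a b where "m = a + b" "p a \<noteq> \<zero>" "q b \<noteq> \<zero>" using sub[OF \<open>(p \<otimes>\<^bsub>P\<^esub> q) m \<noteq> \<zero>\<close>] by auto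
    then show ?thesis
      using P_carrierD(3)[OF assms(1)] P_carrierD(3)[OF assms(2)] by auto
  qed
qed

lemma submultiset_double_diff: "a \<subseteq># m \<Longrightarrow> m - (m - a) = a" for a m :: "'v multiset"
  by (simp add: multiset_eq_iff subseteq_mset_def)

lemma P_mult_comm:
  assumes "p \<in> carrier P" "q \<in> carrier P"
  shows "p \<otimes>\<^bsub>P\<^esub> q = q \<otimes>\<^bsub>P\<^esub> p"
proof
  fix m :: "'v multiset"
  have inj: "inj_on (\<lambda>a. m - a) {a. a \<subseteq># m}"
    by (rule inj_on_inverseI[of _ "\<lambda>a. m - a"]) (auto simp: submultiset_double_diff)
  have im: "(\<lambda>a. m - a) ` {a. a \<subseteq># m} = {a. a \<subseteq># m}"
  proof (intro equalityI subsetI)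
    fix a assume "a \<in> {a. a \<subseteq># m}"
    then show "a \<in> (\<lambda>a. m - a) ` {a. a \<subseteq># m}"
      by (intro image_eqI[of _ _ "m - a"]) (auto simp: submultiset_double_diff)
  qed auto
  have "(q \<otimes>\<^bsub>P\<^esub> p) m = (\<Oplus>a\<in>(\<lambda>a. m - a) ` {a. a \<subseteq># m}. q a \<otimes> p (m - a))"
    by (simp add: P_simps im)
  also have "\<dots> = (\<Oplus>a\<in>{a. a \<subseteq># m}. q (m - a) \<otimes> p (m - (m - a)))"
    using assms by (intro finsum_reindex inj) (auto simp: P_carrierD)
  also have "\<dots> = (p \<otimes>\<^bsub>P\<^esub> q) m"
    unfolding P_simps
    using assms by (intro finsum_cong' refl) (auto simp: P_carrierD submultiset_double_diff m_comm)
  finally show "(p \<otimes>\<^bsub>P\<^esub> q) m = (q \<otimes>\<^bsub>P\<^esub> p) m" by simp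
qed

lemma P_mult_assoc:
  assumes "p \<in> carrier P" "q \<in> carrier P" "r \<in> carrier P"
  shows "(p \<otimes>\<^bsub>P\<^esub> q) \<otimes>\<^bsub>P\<^esub> r = p \<otimes>\<^bsub>P\<^esub> (q \<otimes>\<^bsub>P\<^esub> r)"
proof
  fix m :: "'v multiset"
  note c = P_carrierD(1)[OF assms(1)] P_carrierD(1)[OF assms(2)] P_carrierD(1)[OF assms(3)]
  let ?D = "{a. a \<subseteq># m}"
  have "((p \<otimes>\<^bsub>P\<^esub> q) \<otimes>\<^bsub>P\<^esub> r) m = (\<Oplus>a\<in>?D. \<Oplus>b\<in>{b \<in> ?D. b \<subseteq># a}. p b \<otimes> q (a - b) \<otimes> r (m - a))"
    unfolding P_simps
  proof (intro finsum_cong' refl)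
    fix a assume "a \<in> ?D"
    then have "{b \<in> ?D. b \<subseteq># a} = {b. b \<subseteq># a}" by (auto intro: subset_mset.order_trans)
    then show "(\<Oplus>b\<in>{b. b \<subseteq># a}. p b \<otimes> q (a - b)) \<otimes> r (m - a) =
        (\<Oplus>b\<in>{b \<in> ?D. b \<subseteq># a}. p b \<otimes> q (a - b) \<otimes> r (m - a))"
      using c by (simp add: finsum_ldistr finite_submultisets)
  qed (use c in \<open>auto intro!: finsum_closed\<close>)
  also have "\<dots> = (\<Oplus>b\<in>?D. \<Oplus>a\<in>{a \<in> ?D. b \<subseteq># a}. p b \<otimes> q (a - b) \<otimes> r (m - a))"
    using c by (intro finsum_swap_dependent) (auto simp: finite_submultisets)
  also have "\<dots> = (p \<otimes>\<^bsub>P\<^esub> (q \<otimes>\<^bsub>P\<^esub> r)) m"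
    unfolding P_simps
  proof (intro finsum_cong' refl)
    fix b assume b: "b \<in> ?D"
    have im: "{a \<in> ?D. b \<subseteq># a} = (\<lambda>d. b + d) ` {d. d \<subseteq># m - b}"
    proof (intro equalityI subsetI)
      fix a assume a: "a \<in> {a \<in> ?D. b \<subseteq># a}"
      then have "a = b + (a - b)" "a - b \<subseteq># m - b"
        by (auto simp: subset_eq_diff_conv subset_mset.le_diff_conv2)
      then show "a \<in> (\<lambda>d. b + d) ` {d. d \<subseteq># m - b}" by blast
    next
      fix a assume "a \<in> (\<lambda>d. b + d) ` {d. d \<subseteq># m - b}"
      then show "a \<in> {a \<in> ?D. b \<subseteq># a}"
        using b by (auto simp: subset_mset.le_diff_conv2 add.commute)
    qed
    have "(\<Oplus>a\<in>{a \<in> ?D. b \<subseteq># a}. p b \<otimes> q (a - b) \<otimes> r (m - a)) =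
        (\<Oplus>d\<in>{d. d \<subseteq># m - b}. p b \<otimes> q (b + d - b) \<otimes> r (m - (b + d)))"
      unfolding im using c by (intro finsum_reindex) auto
    also have "\<dots> = p b \<otimes> (\<Oplus>d\<in>{d. d \<subseteq># m - b}. q d \<otimes> r (m - b - d))"
      using c by (simp add: finsum_rdistr finite_submultisets m_assoc)
    finally show "(\<Oplus>a\<in>{a \<in> ?D. b \<subseteq># a}. p b \<otimes> q (a - b) \<otimes> r (m - a)) =
        p b \<otimes> (\<Oplus>d\<in>{d. d \<subseteq># m - b}. q d \<otimes> r (m - b - d))" .
  qed (use c in \<open>auto intro!: finsum_closed\<close>)
  finally show "((p \<otimes>\<^bsub>P\<^esub> q) \<otimes>\<^bsub>P\<^esub> r) m = (p \<otimes>\<^bsub>P\<^esub> (q \<otimes>\<^bsub>P\<^esub> r)) m" .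
qed

lemma monom_mult:
  assumes "p \<in> carrier P"
  shows "mpoly_monom S b \<otimes>\<^bsub>P\<^esub> p = (\<lambda>m. if b \<subseteq># m then p (m - b) else \<zero>)"
proof
  fix m
  note c = P_carrierD(1)[OF assms]
  have "(mpoly_monom S b \<otimes>\<^bsub>P\<^esub> p) m = (\<Oplus>a\<in>{a. a \<subseteq># m}. if b = a then p (m - a) else \<zero>)"
    unfolding P_simps using c by (intro finsum_cong' refl) (auto simp: mpoly_monom_def)
  also have "\<dots> = (if b \<subseteq># m then p (m - b) else \<zero>)"
  proof (cases "b \<subseteq># m")
    case True
    then show ?thesis
      using finsum_singleton[of b "{a. a \<subseteq># m}" "\<lambda>a. p (m - a)"] c by (simp add: finite_submultisets)
  next
    case False
    then have "(\<Oplus>a\<in>{a. a \<subseteq># m}. if b = a then p (m - a) else \<zero>) = \<zero>"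
      by (intro add.finprod_one_eqI) auto
    then show ?thesis using False by simp
  qed
  finally show "(mpoly_monom S b \<otimes>\<^bsub>P\<^esub> p) m = (if b \<subseteq># m then p (m - b) else \<zero>)" .
qed

lemma monom_one: "mpoly_monom S {#} = \<one>\<^bsub>P\<^esub>"
  by (auto simp: mpoly_monom_def P_simps)

lemma monom_closed:
  assumes "set_mset a \<subseteq> V"
  shows "mpoly_monom S a \<in> carrier P"
proof (rule P_carrierI)
  have "{m. mpoly_monom S a m \<noteq> \<zero>} \<subseteq> {a}" by (auto simp: mpoly_monom_def)
  then show "finite {m. mpoly_monom S a m \<noteq> \<zero>}" by (rule finite_subset) simp
qed (use assms in \<open>auto simp: mpoly_monom_def split: if_splits\<close>)

lemma P_cring: "cring P"
proof (rule cringI)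
  show "abelian_group P"
  proof (rule abelian_groupI)
    fix p q assume pq: "p \<in> carrier P" "q \<in> carrier P"
    show "p \<oplus>\<^bsub>P\<^esub> q \<in> carrier P"
    proof (rule P_carrierI)
      have "{m. (p \<oplus>\<^bsub>P\<^esub> q) m \<noteq> \<zero>} \<subseteq> {m. p m \<noteq> \<zero>} \<union> {m. q m \<noteq> \<zero>}"
        by (auto simp: P_simps)
      then show "finite {m. (p \<oplus>\<^bsub>P\<^esub> q) m \<noteq> \<zero>}"
        using P_carrierD(2)[OF pq(1)] P_carrierD(2)[OF pq(2)] by (meson finite_UnI finite_subset)
      show "set_mset m \<subseteq> V" if "(p \<oplus>\<^bsub>P\<^esub> q) m \<noteq> \<zero>" for m
      proof -
        have "p m \<noteq> \<zero> \<or> q m \<noteq> \<zero>" using that by (auto simp: P_simps)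
        then show ?thesis using P_carrierD(3)[OF pq(1)] P_carrierD(3)[OF pq(2)] by blast
      qed
    qed (use pq in \<open>auto simp: P_simps P_carrierD\<close>)
    show "p \<oplus>\<^bsub>P\<^esub> q = q \<oplus>\<^bsub>P\<^esub> p"
      using pq by (auto simp: P_simps P_carrierD a_comm)
  next
    fix p assume p: "p \<in> carrier P"
    have "(\<lambda>m. \<ominus> p m) \<in> carrier P"
    proof (rule P_carrierI)
      have "{m. \<ominus> p m \<noteq> \<zero>} \<subseteq> {m. p m \<noteq> \<zero>}" by auto
      then show "finite {m. \<ominus> p m \<noteq> \<zero>}" using P_carrierD(2)[OF p] by (rule finite_subset)
      show "set_mset m \<subseteq> V" if "\<ominus> p m \<noteq> \<zero>" for m
        using that P_carrierD(3)[OF p, of m] by (cases "p m = \<zero>") auto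
    qed (use p in \<open>auto simp: P_carrierD\<close>)
    moreover have "(\<lambda>m. \<ominus> p m) \<oplus>\<^bsub>P\<^esub> p = \<zero>\<^bsub>P\<^esub>"
      using p by (auto simp: P_simps P_carrierD l_neg)
    ultimately show "\<exists>q\<in>carrier P. q \<oplus>\<^bsub>P\<^esub> p = \<zero>\<^bsub>P\<^esub>" by blast
  next
    show "\<zero>\<^bsub>P\<^esub> \<in> carrier P" by (rule P_carrierI) (auto simp: P_simps)
  qed (auto simp: P_simps P_carrierD a_assoc)
  show "comm_monoid P"
  proof (rule comm_monoidI)
    show "\<one>\<^bsub>P\<^esub> \<in> carrier P" using monom_closed[of "{#}"] by (simp add: monom_one)
    show "\<one>\<^bsub>P\<^esub> \<otimes>\<^bsub>P\<^esub> p = p" if "p \<in> carrier P" for p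
      using monom_mult[OF that, of "{#}"] by (simp add: monom_one)
  qed (use P_mult_closed P_mult_assoc P_mult_comm in blast)+
  fix p q r assume pqr: "p \<in> carrier P" "q \<in> carrier P" "r \<in> carrier P"
  have "(\<Oplus>a\<in>{a. a \<subseteq># m}. (p a \<oplus> q a) \<otimes> r (m - a)) =
     (\<Oplus>a\<in>{a. a \<subseteq># m}. p a \<otimes> r (m - a)) \<oplus> (\<Oplus>a\<in>{a. a \<subseteq># m}. q a \<otimes> r (m - a))" for m
    using pqr by (subst finsum_addf[symmetric]) (auto simp: P_carrierD l_distr intro!: finsum_cong')
  then show "(p \<oplus>\<^bsub>P\<^esub> q) \<otimes>\<^bsub>P\<^esub> r = p \<otimes>\<^bsub>P\<^esub> r \<oplus>\<^bsub>P\<^esub> q \<otimes>\<^bsub>P\<^esub> r"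
    by (simp add: P_simps)
qed

sublocale P: cring P
  by (rule P_cring)

lemma P_neg:
  assumes "p \<in> carrier P"
  shows "\<ominus>\<^bsub>P\<^esub> p = (\<lambda>m. \<ominus> p m)"
proof
  fix m
  have "(\<ominus>\<^bsub>P\<^esub> p \<oplus>\<^bsub>P\<^esub> p) m = \<zero>"
    using assms by (simp add: P.l_neg) (simp add: P_simps)
  then show "(\<ominus>\<^bsub>P\<^esub> p) m = \<ominus> p m"
    using P_carrierD(1)[OF assms] P_carrierD(1)[OF P.a_inv_closed[OF assms]]
    by (intro minus_equality[symmetric]) (simp_all add: P_simps)
qed

lemma P_finsum:
  assumes "finite A" "f \<in> A \<rightarrow> carrier P"
  shows "finsum P f A m = finsum S (\<lambda>i. f i m) A"
  using assms
proof (induction A)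
  case (insert a A)
  then have "f a \<in> carrier P" "f \<in> A \<rightarrow> carrier P" "(\<lambda>i. f i m) \<in> A \<rightarrow> carrier S" "f a m \<in> carrier S"
    by (auto intro!: P_carrierD(1))
  then show ?case
    using insert by (simp add: P.finsum_insert finsum_insert) (simp add: P_simps)
qed (simp add: P_simps)

lemma P_ksign_mult:
  assumes "p \<in> carrier P"
  shows "(ksign P j \<nu> \<otimes>\<^bsub>P\<^esub> p) m = ksign S j \<nu> \<otimes> p m"
proof -
  have "\<ominus>\<^bsub>P\<^esub> \<one>\<^bsub>P\<^esub> \<otimes>\<^bsub>P\<^esub> p = (\<lambda>m. \<ominus> p m)"
    by (simp only: P.l_minus[OF P.one_closed assms] P.l_one[OF assms] P_neg[OF assms])
  then show ?thesis
    using assms by (simp add: ksign_def P_carrierD l_minus)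
qed

lemma monom_add:
  assumes "set_mset b \<subseteq> V"
  shows "mpoly_monom S a \<otimes>\<^bsub>P\<^esub> mpoly_monom S b = mpoly_monom S (a + b)"
  unfolding monom_mult[OF monom_closed[OF assms]]
  by (rule ext) (auto simp: mpoly_monom_def)

lemma monom_pow:
  assumes "set_mset a \<subseteq> V"
  shows "mpoly_monom S a [^]\<^bsub>P\<^esub> (n::nat) = mpoly_monom S (repeat_mset n a)"
proof (induction n)
  case (Suc n)
  then show ?case
    using monom_add[OF assms, of "repeat_mset n a"] by (simp add: add.commute)
qed (simp add: monom_one)

lemma monom_prod:
  assumes "finite A" "\<And>i. i \<in> A \<Longrightarrow> set_mset (a i) \<subseteq> V"
  shows "finprod P (\<lambda>i. mpoly_monom S (a i)) A = mpoly_monom S (\<Sum>i\<in>A. a i)"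
  using assms
proof (induction A)
  case (insert j A)
  have "set_mset (\<Sum>i\<in>A. a i) \<subseteq> V"
    using insert.hyps(1) insert.prems by (auto simp: set_mset_sum)
  then show ?case
    using insert by (simp add: monom_add monom_closed Pi_iff)
qed (simp add: monom_one)


end


section \<open>Weak proregularity of monomials\<close>

text \<open>The full simplex on \<open>D\<close> is acyclic, being a cone with apex \<open>Min D\<close>.\<close>

lemma (in cring) simplex_acyclic:
  fixes T D :: "nat set"
  assumes T: "finite T" and D: "D \<subseteq> T" and Z: "Z \<in> Pow T \<rightarrow> carrier R" and Z0: "Z {} = \<zero>"
    and supp: "\<And>\<mu>. \<mu> \<subseteq> T \<Longrightarrow> Z \<mu> \<noteq> \<zero> \<Longrightarrow> \<mu> \<subseteq> D"
    and cycle: "\<And>\<nu>. \<nu> \<subseteq> T \<Longrightarrow> (\<Oplus>j\<in>T - \<nu>. ksign R j \<nu> \<otimes> Z (insert j \<nu>)) = \<zero>"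
    and \<mu>: "\<mu> \<subseteq> T"
  shows "(\<Oplus>j\<in>T - \<mu>. ksign R j \<mu> \<otimes>
     (if D \<noteq> {} \<and> Min D \<in> insert j \<mu> then Z (insert j \<mu> - {Min D}) else \<zero>)) = Z \<mu>"
    (is "?L = _")
proof (cases "D = {}")
  case True
  then have "Z \<mu> = \<zero>" using supp[OF \<mu>] Z0 by auto
  moreover have "?L = \<zero>" using True by (intro add.finprod_one_eqI) auto
  ultimately show ?thesis by simp
next
  case False
  define d where "d = Min D"
  have fD: "finite D" using D T by (rule finite_subset)
  have dD: "d \<in> D" and dmin: "\<And>i. i \<in> D \<Longrightarrow> d \<le> i"
    using False fD by (auto simp: d_def)
  have dT: "d \<in> T" using dD D by auto
  have Zc: "Z \<nu> \<in> carrier R" if "\<nu> \<subseteq> T" for \<nu> using Z that by auto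
  have f\<mu>: "finite \<mu>" using \<mu> T by (rule finite_subset)
  have sign_d: "ksign R d \<mu> \<otimes> Z \<mu> = Z \<mu>"
  proof (cases "Z \<mu> = \<zero>")
    case False
    then have "{i \<in> \<mu>. i < d} = {}" using supp[OF \<mu>] dmin by fastforce
    then have "ksign R d \<mu> = \<one>" unfolding ksign_def by (simp only: card.empty even_zero if_True)
    then show ?thesis using Zc[OF \<mu>] by simp
  qed simp
  show ?thesis
  proof (cases "d \<in> \<mu>")
    case True
    let ?\<nu> = "\<mu> - {d}"
    let ?f = "\<lambda>j. ksign R j ?\<nu> \<otimes> Z (insert j ?\<nu>)"
    have f: "?f j \<in> carrier R" if "j \<in> T" for j
      using that \<mu> by (intro m_closed Zc) auto
    have "T - ?\<nu> = insert d (T - \<mu>)" using True dT by auto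
    then have "\<zero> = (\<Oplus>j\<in>insert d (T - \<mu>). ?f j)" using cycle[OF subset_trans[OF Diff_subset \<mu>], of "{d}"] by simp
    also have "\<dots> = ?f d \<oplus> (\<Oplus>j\<in>T - \<mu>. ?f j)"
      using T True f f[OF dT] by (intro finsum_insert) auto
    also have "?f d = Z \<mu>" using True sign_d by (simp add: insert_absorb)
    finally have s: "Z \<mu> \<oplus> (\<Oplus>j\<in>T - \<mu>. ?f j) = \<zero>" by simp
    have "?L = (\<Oplus>j\<in>T - \<mu>. \<ominus> ?f j)"
    proof (intro finsum_cong' refl)
      fix j assume j: "j \<in> T - \<mu>"
      have e: "insert j \<mu> - {d} = insert j ?\<nu>" using j True by auto
      show "ksign R j \<mu> \<otimes> (if D \<noteq> {} \<and> Min D \<in> insert j \<mu> then Z (insert j \<mu> - {Min D}) else \<zero>) = \<ominus> ?f j"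
      proof (cases "Z (insert j ?\<nu>) = \<zero>")
        case True
        then show ?thesis using \<open>d \<in> \<mu>\<close> False by (simp add: d_def[symmetric] e)
      next
        case nz: False
        have "insert j ?\<nu> \<subseteq> T" using j \<mu> by auto
        from supp[OF this nz] have "d < j" using dmin[of j] j True by (auto simp: le_less)
        then have "ksign R j ?\<nu> = \<ominus> ksign R j \<mu>" using True f\<mu> by (simp add: ksign_remove)
        then show ?thesis
          using \<open>d \<in> \<mu>\<close> \<open>D \<noteq> {}\<close> Zc[OF \<open>insert j ?\<nu> \<subseteq> T\<close>] by (simp add: d_def[symmetric] e l_minus)
      qed
    qed (use f in auto)
    also have "\<dots> = (\<Oplus>j\<in>T - \<mu>. \<ominus> \<one> \<otimes> ?f j)"
      using f by (intro finsum_cong' refl) (auto simp: l_minus)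
    also have "\<dots> = \<ominus> \<one> \<otimes> (\<Oplus>j\<in>T - \<mu>. ?f j)"
      using f T by (intro finsum_rdistr[symmetric]) auto
    also have "\<dots> = \<ominus> (\<Oplus>j\<in>T - \<mu>. ?f j)"
      using f by (simp add: l_minus finsum_closed)
    also have "\<dots> = Z \<mu>"
      using s f Zc[OF \<mu>] by (intro minus_equality) (auto intro!: finsum_closed)
    finally show ?thesis .
  next
    case d\<mu>: False
    have "?L = (\<Oplus>j\<in>T - \<mu>. if d = j then Z \<mu> else \<zero>)"
    proof (intro finsum_cong' refl)
      fix j assume "j \<in> T - \<mu>"
      have "insert d \<mu> - {d} = \<mu>" using d\<mu> by auto
      then show "ksign R j \<mu> \<otimes> (if D \<noteq> {} \<and> Min D \<in> insert j \<mu> then Z (insert j \<mu> - {Min D}) else \<zero>) =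
          (if d = j then Z \<mu> else \<zero>)"
        using d\<mu> False sign_d by (auto simp: d_def[symmetric])
    qed (use Zc[OF \<mu>] in auto)
    also have "\<dots> = Z \<mu>"
      using dT d\<mu> T Zc[OF \<mu>] by (intro finsum_singleton) auto
    finally show ?thesis .
  qed
qed

text \<open>The Koszul differential of the \<open>x\<^sub>j\<^sup>s\<close> on chains, with homological grading.\<close>

definition bd :: "('a, 'r) ring_scheme \<Rightarrow> (nat \<Rightarrow> 'a) \<Rightarrow> nat set \<Rightarrow> nat \<Rightarrow> (nat set \<Rightarrow> 'a) \<Rightarrow> nat set \<Rightarrow> 'a" where
  "bd R x T s z \<nu> = finsum R (\<lambda>j. ksign R j \<nu> \<otimes>\<^bsub>R\<^esub> (x j [^]\<^bsub>R\<^esub> s \<otimes>\<^bsub>R\<^esub> z (insert j \<nu>))) (T - \<nu>)"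

locale monomials = mpoly S V for S :: "('s, 'c) ring_scheme" (structure) and V :: "'v set" +
  fixes T :: "nat set" and a :: "nat \<Rightarrow> 'v multiset" and x :: "nat \<Rightarrow> 'v multiset \<Rightarrow> 's"
  assumes T: "finite T" and a: "\<And>i. i \<in> T \<Longrightarrow> set_mset (a i) \<subseteq> V"
    and x: "\<And>i. i \<in> T \<Longrightarrow> x i = mpoly_monom S (a i)"
begin

text \<open>The exponent of the monomial \<open>x(\<mu>)\<close>.\<close>

definition asum :: "nat set \<Rightarrow> 'v multiset" where "asum \<mu> = (\<Sum>i\<in>\<mu>. a i)"

lemma asum_insert: "finite \<mu> \<Longrightarrow> j \<notin> \<mu> \<Longrightarrow> asum (insert j \<mu>) = a j + asum \<mu>"
  by (simp add: asum_def)

lemma fin: "\<mu> \<subseteq> T \<Longrightarrow> finite \<mu>"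
  using T by (rule finite_subset[rotated])

lemma asum_V: "\<mu> \<subseteq> T \<Longrightarrow> set_mset (asum \<mu>) \<subseteq> V"
  using a fin[of \<mu>] by (auto simp: asum_def set_mset_sum)

lemma x_pow: "i \<in> T \<Longrightarrow> x i [^]\<^bsub>P\<^esub> (s::nat) = mpoly_monom S (repeat_mset s (a i))"
  by (simp add: x monom_pow a)

lemma xprod_pow: "\<mu> \<subseteq> T \<Longrightarrow> finprod P x \<mu> [^]\<^bsub>P\<^esub> (s::nat) = mpoly_monom S (repeat_mset s (asum \<mu>))"
proof -
  assume \<mu>: "\<mu> \<subseteq> T"
  have "finprod P x \<mu> = finprod P (\<lambda>i. mpoly_monom S (a i)) \<mu>"
    using \<mu> a by (intro P.finprod_cong' refl) (auto simp: x intro!: monom_closed)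
  also have "\<dots> = mpoly_monom S (asum \<mu>)"
    unfolding asum_def using fin[OF \<mu>] \<mu> a by (intro monom_prod) auto
  finally show ?thesis using \<mu> by (simp add: monom_pow asum_V)
qed

text \<open>The coefficient of \<open>z\<close> at the basis element \<open>\<mu>\<close> in multidegree \<open>m\<close>, where the basis element \<open>\<mu>\<close>
  has the multidegree of \<open>x(\<mu>)\<^sup>s\<close>.\<close>

definition mcoeff :: "nat \<Rightarrow> (nat set \<Rightarrow> 'v multiset \<Rightarrow> 's) \<Rightarrow> 'v multiset \<Rightarrow> nat set \<Rightarrow> 's" where
  "mcoeff s z m \<mu> = (if repeat_mset s (asum \<mu>) \<subseteq># m then z \<mu> (m - repeat_mset s (asum \<mu>)) else \<zero>\<^bsub>S\<^esub>)"

text \<open>The \<open>card \<mu> \<le> card T\<close> exponents can be added up because each of them leaves room for \<open>card T\<close> copies.\<close>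

lemma subset_of_scaled:
  assumes "\<mu> \<subseteq> T" "\<And>i. i \<in> \<mu> \<Longrightarrow> repeat_mset (card T * s) (a i) \<subseteq># m"
  shows "repeat_mset s (asum \<mu>) \<subseteq># m"
proof (rule mset_subset_eqI)
  fix c
  show "count (repeat_mset s (asum \<mu>)) c \<le> count m c"
  proof (cases "T = {}")
    case True
    then show ?thesis using assms by (simp add: asum_def)
  next
    case False
    have "card T * count (repeat_mset s (asum \<mu>)) c = (\<Sum>i\<in>\<mu>. card T * (s * count (a i) c))"
      by (simp add: asum_def count_sum sum_distrib_left)
    also have "\<dots> \<le> (\<Sum>i\<in>\<mu>. count m c)"
    proof (rule sum_mono)
      fix i assume "i \<in> \<mu>"
      then show "card T * (s * count (a i) c) \<le> count m c"
        using mset_subset_eq_count[OF assms(2), of i c] by (simp add: mult.assoc)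
    qed
    also have "\<dots> \<le> card T * count m c"
      using card_mono[OF T assms(1)] by simp
    finally show ?thesis
      using False T by (simp add: card_gt_0_iff)
  qed
qed

lemma element_of_scaled:
  assumes "\<mu> \<subseteq> T" "repeat_mset s (asum \<mu>) \<subseteq># m" "i \<in> \<mu>"
  shows "repeat_mset s (a i) \<subseteq># m"
proof -
  have "asum \<mu> = a i + asum (\<mu> - {i})"
    using asum_insert[of "\<mu> - {i}" i] fin[OF assms(1)] assms(3) by (simp add: insert_absorb)
  then show ?thesis
    using assms(2) by (metis mset_subset_eq_add_left repeat_mset_distrib2 subset_mset.order_trans)
qed

text \<open>The map from the Koszul complex of the \<open>x\<^sub>i\<^sup>s\<^sup>+\<^sup>t\<close> to that of the \<open>x\<^sub>i\<^sup>s\<close> kills the homology in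
  positive degrees once \<open>t \<ge> card T * s\<close>.  Look at one multidegree \<open>m\<close>: the basis elements \<open>\<mu>\<close> that
  occur in the first complex only involve indices \<open>i\<close> with \<open>card T * s * a\<^sub>i \<le> m\<close>, and all sets of
  such indices occur in the second complex, where they form an acyclic simplex.\<close>

lemma weakly_proregular:
  assumes z: "z \<in> Pow T \<rightarrow> carrier P" and z0: "z {} = \<zero>\<^bsub>P\<^esub>"
    and cycle: "\<And>\<nu>. \<nu> \<subseteq> T \<Longrightarrow> bd P x T (s + card T * s) z \<nu> = \<zero>\<^bsub>P\<^esub>"
  shows "\<exists>w \<in> Pow T \<rightarrow> carrier P. \<forall>\<mu>\<subseteq>T.
    bd P x T s w \<mu> = finprod P x \<mu> [^]\<^bsub>P\<^esub> (card T * s) \<otimes>\<^bsub>P\<^esub> z \<mu>"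
proof -
  define t where "t = card T * s"
  let ?Z = "\<lambda>m. mcoeff (s + t) z m"
  define D where "D m = {i \<in> T. repeat_mset t (a i) \<subseteq># m}" for m
  define W where "W m \<mu> = (if D m \<noteq> {} \<and> Min (D m) \<in> \<mu> then ?Z m (\<mu> - {Min (D m)}) else \<zero>\<^bsub>S\<^esub>)" for m \<mu>
  have zc: "z \<mu> \<in> carrier P" if "\<mu> \<subseteq> T" for \<mu> using z that by auto
  have fD: "finite (D m)" and DT: "D m \<subseteq> T" for m using T by (auto simp: D_def)
  have Zc: "?Z m \<mu> \<in> carrier S" if "\<mu> \<subseteq> T" for m \<mu>
    using P_carrierD(1)[OF zc[OF that]] by (simp add: mcoeff_def)
  have Z0: "?Z m {} = \<zero>\<^bsub>S\<^esub>" for m using z0 by (simp add: mcoeff_def P_simps)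
  have supp: "\<mu> \<subseteq> D m" if "\<mu> \<subseteq> T" "?Z m \<mu> \<noteq> \<zero>\<^bsub>S\<^esub>" for m \<mu>
  proof
    fix i assume i: "i \<in> \<mu>"
    have "repeat_mset (s + t) (asum \<mu>) \<subseteq># m" using that(2) by (auto simp: mcoeff_def split: if_splits)
    from element_of_scaled[OF that(1) this i] have "repeat_mset t (a i) \<subseteq># m"
      by (metis mset_subset_eq_add_right repeat_mset_distrib subset_mset.order_trans)
    then show "i \<in> D m" using i that(1) by (auto simp: D_def)
  qed
  \<comment> \<open>Both boundary operators become the simplicial one in each multidegree.\<close>
  have simplicial: "bd P x T r y \<nu> (m - repeat_mset r (asum \<nu>)) =
      (\<Oplus>\<^bsub>S\<^esub>j\<in>T - \<nu>. ksign S j \<nu> \<otimes>\<^bsub>S\<^esub> mcoeff r y m (insert j \<nu>))"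
    if y: "y \<in> Pow T \<rightarrow> carrier P" and \<nu>: "\<nu> \<subseteq> T" and m: "repeat_mset r (asum \<nu>) \<subseteq># m" for r y \<nu> m
  proof -
    let ?m = "m - repeat_mset r (asum \<nu>)"
    have yc: "y (insert j \<nu>) \<in> carrier P" if "j \<in> T" for j using y \<nu> that by auto
    have c: "x j [^]\<^bsub>P\<^esub> r \<otimes>\<^bsub>P\<^esub> y (insert j \<nu>) \<in> carrier P" if "j \<in> T" for j
      using that yc[OF that] by (simp add: x monom_closed a)
    have "bd P x T r y \<nu> ?m = (\<Oplus>\<^bsub>S\<^esub>j\<in>T - \<nu>. (ksign P j \<nu> \<otimes>\<^bsub>P\<^esub> (x j [^]\<^bsub>P\<^esub> r \<otimes>\<^bsub>P\<^esub> y (insert j \<nu>))) ?m)"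
      unfolding bd_def using T c by (intro P_finsum) auto
    also have "\<dots> = (\<Oplus>\<^bsub>S\<^esub>j\<in>T - \<nu>. ksign S j \<nu> \<otimes>\<^bsub>S\<^esub> mcoeff r y m (insert j \<nu>))"
    proof (intro finsum_cong' refl)
      fix j assume j: "j \<in> T - \<nu>"
      have e: "repeat_mset r (asum (insert j \<nu>)) = repeat_mset r (asum \<nu>) + repeat_mset r (a j)"
        using j fin[OF \<nu>] by (simp add: asum_insert add.commute)
      have "repeat_mset r (a j) \<subseteq># ?m \<longleftrightarrow> repeat_mset r (asum (insert j \<nu>)) \<subseteq># m"
        unfolding e using m by (simp add: subset_mset.le_diff_conv2 add.commute)
      moreover have "?m - repeat_mset r (a j) = m - repeat_mset r (asum (insert j \<nu>))"
        unfolding e by simp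
      ultimately show "(ksign P j \<nu> \<otimes>\<^bsub>P\<^esub> (x j [^]\<^bsub>P\<^esub> r \<otimes>\<^bsub>P\<^esub> y (insert j \<nu>))) ?m =
          ksign S j \<nu> \<otimes>\<^bsub>S\<^esub> mcoeff r y m (insert j \<nu>)"
        using j c[of j] by (simp add: P_ksign_mult x_pow monom_mult yc mcoeff_def)
    next
      show "(\<lambda>j. ksign S j \<nu> \<otimes>\<^bsub>S\<^esub> mcoeff r y m (insert j \<nu>)) \<in> T - \<nu> \<rightarrow> carrier S"
        using yc by (auto simp: mcoeff_def P_carrierD)
    qed
    finally show ?thesis .
  qed
  have Zcycle: "(\<Oplus>\<^bsub>S\<^esub>j\<in>T - \<nu>. ksign S j \<nu> \<otimes>\<^bsub>S\<^esub> ?Z m (insert j \<nu>)) = \<zero>\<^bsub>S\<^esub>" if \<nu>: "\<nu> \<subseteq> T" for m \<nu>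
  proof (cases "repeat_mset (s + t) (asum \<nu>) \<subseteq># m")
    case True
    show ?thesis
      using simplicial[OF z \<nu> True] cycle[OF \<nu>] by (simp add: t_def P_simps)
  next
    case False
    have "?Z m (insert j \<nu>) = \<zero>\<^bsub>S\<^esub>" if "j \<in> T - \<nu>" for j
    proof -
      have "repeat_mset (s + t) (asum (insert j \<nu>)) = repeat_mset (s + t) (asum \<nu>) + repeat_mset (s + t) (a j)"
        using that fin[OF \<nu>] by (simp add: asum_insert add.commute)
      then have "\<not> repeat_mset (s + t) (asum (insert j \<nu>)) \<subseteq># m"
        using False by (metis mset_subset_eq_add_left subset_mset.order_trans)
      then show ?thesis by (simp add: mcoeff_def)
    qed
    then show ?thesis by (intro add.finprod_one_eqI) simp
  qed
  have W: "(\<Oplus>\<^bsub>S\<^esub>j\<in>T - \<mu>. ksign S j \<mu> \<otimes>\<^bsub>S\<^esub> W m (insert j \<mu>)) = ?Z m \<mu>" if \<mu>: "\<mu> \<subseteq> T" for m \<mu>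
    unfolding W_def using Zc by (intro simplex_acyclic[OF T DT _ Z0 supp Zcycle \<mu>]) auto
  have Wsupp: "repeat_mset s (asum \<mu>) \<subseteq># m" if "\<mu> \<subseteq> T" "W m \<mu> \<noteq> \<zero>\<^bsub>S\<^esub>" for m \<mu>
  proof (rule subset_of_scaled[OF that(1)])
    fix i assume i: "i \<in> \<mu>"
    have "D m \<noteq> {}" and *: "?Z m (\<mu> - {Min (D m)}) \<noteq> \<zero>\<^bsub>S\<^esub>"
      using that(2) by (auto simp: W_def split: if_splits)
    have "\<mu> - {Min (D m)} \<subseteq> T" using that(1) by auto
    from supp[OF this *] have "\<mu> \<subseteq> D m"
      using Min_in[OF fD \<open>D m \<noteq> {}\<close>] by auto
    then show "repeat_mset (card T * s) (a i) \<subseteq># m" using i by (auto simp: D_def t_def)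
  qed
  define w where "w \<mu> = (\<lambda>m. W (m + repeat_mset s (asum \<mu>)) \<mu>)" for \<mu>
  have Wc: "W m \<mu> \<in> carrier S" if "\<mu> \<subseteq> T" for m \<mu>
  proof -
    have "\<mu> - {Min (D m)} \<subseteq> T" using that by auto
    then show ?thesis using Zc by (simp add: W_def)
  qed
  have w: "w \<in> Pow T \<rightarrow> carrier P"
  proof
    fix \<mu> assume "\<mu> \<in> Pow T"
    then have \<mu>: "\<mu> \<subseteq> T" by simp
    have nz: "\<exists>d\<in>\<mu>. \<exists>m'. z (\<mu> - {d}) m' \<noteq> \<zero>\<^bsub>S\<^esub> \<and>
        m + repeat_mset s (asum \<mu>) = m' + repeat_mset (s + t) (asum (\<mu> - {d}))" if "w \<mu> m \<noteq> \<zero>\<^bsub>S\<^esub>" for m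
    proof -
      let ?m = "m + repeat_mset s (asum \<mu>)"
      have "Min (D ?m) \<in> \<mu>" "?Z ?m (\<mu> - {Min (D ?m)}) \<noteq> \<zero>\<^bsub>S\<^esub>"
        using that by (auto simp: w_def W_def split: if_splits)
      then show ?thesis
        by (intro bexI[of _ "Min (D ?m)"] exI[of _ "?m - repeat_mset (s + t) (asum (\<mu> - {Min (D ?m)}))"])
          (auto simp: mcoeff_def split: if_splits)
    qed
    show "w \<mu> \<in> carrier P"
    proof (rule P_carrierI)
      show "w \<mu> m \<in> carrier S" for m using Wc[OF \<mu>] by (simp add: w_def)
      let ?F = "\<Union>d\<in>\<mu>. (\<lambda>m'. m' + repeat_mset (s + t) (asum (\<mu> - {d})) - repeat_mset s (asum \<mu>)) `
          {m'. z (\<mu> - {d}) m' \<noteq> \<zero>\<^bsub>S\<^esub>}"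
      have "m \<in> ?F" if "w \<mu> m \<noteq> \<zero>\<^bsub>S\<^esub>" for m
      proof -
        obtain d m' where d: "d \<in> \<mu>" "z (\<mu> - {d}) m' \<noteq> \<zero>\<^bsub>S\<^esub>"
          "m + repeat_mset s (asum \<mu>) = m' + repeat_mset (s + t) (asum (\<mu> - {d}))"
          using nz[OF \<open>w \<mu> m \<noteq> \<zero>\<^bsub>S\<^esub>\<close>] by blast
        have "m = m' + repeat_mset (s + t) (asum (\<mu> - {d})) - repeat_mset s (asum \<mu>)"
          by (simp only: d(3)[symmetric] add_diff_cancel_right')
        then show ?thesis using d by blast
      qed
      then have "{m. w \<mu> m \<noteq> \<zero>\<^bsub>S\<^esub>} \<subseteq> ?F" by blast
      moreover have "finite ?F"
      proof (intro finite_UN_I finite_imageI fin[OF \<mu>])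
        fix d assume "d \<in> \<mu>"
        have "\<mu> - {d} \<subseteq> T" using \<mu> by auto
        then show "finite {m'. z (\<mu> - {d}) m' \<noteq> \<zero>\<^bsub>S\<^esub>}" by (rule P_carrierD(2)[OF zc])
      qed
      ultimately show "finite {m. w \<mu> m \<noteq> \<zero>\<^bsub>S\<^esub>}" by (rule finite_subset)
      show "set_mset m \<subseteq> V" if "w \<mu> m \<noteq> \<zero>\<^bsub>S\<^esub>" for m
      proof -
        obtain d m' where d: "d \<in> \<mu>" "z (\<mu> - {d}) m' \<noteq> \<zero>\<^bsub>S\<^esub>"
          "m + repeat_mset s (asum \<mu>) = m' + repeat_mset (s + t) (asum (\<mu> - {d}))"
          using nz[OF \<open>w \<mu> m \<noteq> \<zero>\<^bsub>S\<^esub>\<close>] by blast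
        have \<mu>d: "\<mu> - {d} \<subseteq> T" using \<mu> by auto
        have "set_mset m \<subseteq> set_mset (m' + repeat_mset (s + t) (asum (\<mu> - {d})))"
          unfolding d(3)[symmetric] by simp
        also have "\<dots> \<subseteq> set_mset m' \<union> set_mset (asum (\<mu> - {d}))"
using set_repeat_mset_subset by fastforce
        also have "\<dots> \<subseteq> V"
          using P_carrierD(3)[OF zc[OF \<mu>d] d(2)] asum_V[OF \<mu>d] by simp
        finally show ?thesis .
      qed
    qed
  qed
  have "bd P x T s w \<mu> = finprod P x \<mu> [^]\<^bsub>P\<^esub> t \<otimes>\<^bsub>P\<^esub> z \<mu>" if \<mu>: "\<mu> \<subseteq> T" for \<mu>
  proof
    fix m'
    define m where "m = m' + repeat_mset s (asum \<mu>)"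
    have "bd P x T s w \<mu> m' = (\<Oplus>\<^bsub>S\<^esub>j\<in>T - \<mu>. ksign S j \<mu> \<otimes>\<^bsub>S\<^esub> mcoeff s w m (insert j \<mu>))"
      using simplicial[OF w \<mu>, of s m] by (simp add: m_def)
    also have "\<dots> = (\<Oplus>\<^bsub>S\<^esub>j\<in>T - \<mu>. ksign S j \<mu> \<otimes>\<^bsub>S\<^esub> W m (insert j \<mu>))"
    proof (intro finsum_cong' refl)
      fix j assume "j \<in> T - \<mu>"
      then have "insert j \<mu> \<subseteq> T" using \<mu> by auto
      then have "mcoeff s w m (insert j \<mu>) = W m (insert j \<mu>)"
        using Wsupp[of "insert j \<mu>" m]
        by (cases "W m (insert j \<mu>) = \<zero>\<^bsub>S\<^esub>") (auto simp: mcoeff_def w_def)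
      then show "ksign S j \<mu> \<otimes>\<^bsub>S\<^esub> mcoeff s w m (insert j \<mu>) = ksign S j \<mu> \<otimes>\<^bsub>S\<^esub> W m (insert j \<mu>)" by simp
    next
      show "(\<lambda>j. ksign S j \<mu> \<otimes>\<^bsub>S\<^esub> W m (insert j \<mu>)) \<in> T - \<mu> \<rightarrow> carrier S"
        using Wc \<mu> by auto
    qed
    also have "\<dots> = ?Z m \<mu>" by (rule W[OF \<mu>])
    also have "\<dots> = (finprod P x \<mu> [^]\<^bsub>P\<^esub> t \<otimes>\<^bsub>P\<^esub> z \<mu>) m'"
    proof -
      have "repeat_mset (s + t) (asum \<mu>) \<subseteq># m \<longleftrightarrow> repeat_mset t (asum \<mu>) \<subseteq># m'"
        unfolding m_def repeat_mset_distrib by (simp add: add.commute)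
      moreover have "m - repeat_mset (s + t) (asum \<mu>) = m' - repeat_mset t (asum \<mu>)"
        unfolding m_def repeat_mset_distrib by (simp add: add.commute)
      ultimately show ?thesis
        using \<mu> by (simp add: mcoeff_def xprod_pow monom_mult zc)
    qed
    finally show "bd P x T s w \<mu> m' = (finprod P x \<mu> [^]\<^bsub>P\<^esub> t \<otimes>\<^bsub>P\<^esub> z \<mu>) m'" .
  qed
  then show ?thesis using w unfolding t_def by blast
qed

end


section \<open>Radicals and torsion\<close>

context cring
begin

lemma finsum_in_ideal:
  assumes "ideal J R" "\<And>i. i \<in> A \<Longrightarrow> f i \<in> J" "finite A"
  shows "finsum R f A \<in> J"
proof -
  interpret J: ideal J R by fact
  show ?thesis
    using assms(3,2)
  proof (induction A)
    case (insert a A)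
    then show ?case by (subst finsum_insert) (auto intro!: J.Icarr)
  qed simp
qed

lemma genideal_finite_family:
  assumes T: "finite T" and x: "x \<in> T \<rightarrow> carrier R" and y: "y \<in> genideal R (x ` T)"
  shows "\<exists>r \<in> T \<rightarrow> carrier R. y = (\<Oplus>i\<in>T. r i \<otimes> x i)"
proof -
  let ?J = "{(\<Oplus>i\<in>T. r i \<otimes> x i) | r. r \<in> T \<rightarrow> carrier R}"
  have xc: "x i \<in> carrier R" if "i \<in> T" for i using x that by auto
  have c: "r i \<otimes> x i \<in> carrier R" if "r \<in> T \<rightarrow> carrier R" "i \<in> T" for r i
    using that xc by auto
  have smul: "s \<otimes> (\<Oplus>i\<in>T. r i \<otimes> x i) \<in> ?J" if s: "s \<in> carrier R" and r: "r \<in> T \<rightarrow> carrier R" for s r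
  proof -
    have "s \<otimes> (\<Oplus>i\<in>T. r i \<otimes> x i) = (\<Oplus>i\<in>T. (s \<otimes> r i) \<otimes> x i)"
      using s T c[OF r] r xc by (subst finsum_rdistr) (auto intro!: finsum_cong' simp: m_assoc Pi_iff)
    then show ?thesis using s r by (auto intro!: exI[of _ "\<lambda>i. s \<otimes> r i"])
  qed
  have sub: "subgroup ?J (add_monoid R)"
  proof (rule add.subgroupI)
    show "?J \<subseteq> carrier R" using c by (auto intro!: finsum_closed)
    show "?J \<noteq> {}" by (auto intro!: exI[of _ "\<lambda>i. \<zero>"])
  next
    fix y assume "y \<in> ?J"
    then obtain r where r: "r \<in> T \<rightarrow> carrier R" "y = (\<Oplus>i\<in>T. r i \<otimes> x i)" by auto
    then have "y \<in> carrier R" using c by (auto intro!: finsum_closed)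
    then have "\<ominus> y = \<ominus> \<one> \<otimes> y" by (simp add: l_minus)
    then show "\<ominus> y \<in> ?J" using smul[of "\<ominus> \<one>" r] r by simp
  next
    fix y y' assume "y \<in> ?J" "y' \<in> ?J"
    then obtain r r' where r: "r \<in> T \<rightarrow> carrier R" "y = (\<Oplus>i\<in>T. r i \<otimes> x i)"
      "r' \<in> T \<rightarrow> carrier R" "y' = (\<Oplus>i\<in>T. r' i \<otimes> x i)" by auto
    have "y \<oplus> y' = (\<Oplus>i\<in>T. r i \<otimes> x i \<oplus> r' i \<otimes> x i)"
      unfolding r(2,4) using c r by (intro finsum_addf[symmetric]) auto
    also have "\<dots> = (\<Oplus>i\<in>T. (r i \<oplus> r' i) \<otimes> x i)"
      using r xc by (intro finsum_cong') (auto simp: l_distr Pi_iff)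
    finally show "y \<oplus> y' \<in> ?J"
      using r by (auto intro!: exI[of _ "\<lambda>i. r i \<oplus> r' i"])
  qed
  have "ideal ?J R"
  proof (rule idealI[OF ring_axioms sub])
    fix y s assume "y \<in> ?J" and s: "s \<in> carrier R"
    then obtain r where r: "r \<in> T \<rightarrow> carrier R" "y = (\<Oplus>i\<in>T. r i \<otimes> x i)" by auto
    have yc: "y \<in> carrier R" using r c by (auto intro!: finsum_closed)
    show "s \<otimes> y \<in> ?J" using smul[OF s r(1)] r(2) by simp
    then show "y \<otimes> s \<in> ?J" using yc s by (simp add: m_comm)
  qed
  moreover have "x ` T \<subseteq> ?J"
  proof
    fix y assume "y \<in> x ` T"
    then obtain i where i: "i \<in> T" "y = x i" by auto
    have "(\<Oplus>k\<in>T. (if i = k then \<one> else \<zero>) \<otimes> x k) = (\<Oplus>k\<in>T. if i = k then x k else \<zero>)"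
      using xc by (intro finsum_cong') auto
    also have "\<dots> = x i" using i T x by (intro finsum_singleton) auto
    finally show "y \<in> ?J" using i by (auto intro!: exI[of _ "\<lambda>k. if i = k then \<one> else \<zero>"])
  qed
  ultimately have "genideal R (x ` T) \<subseteq> ?J" by (rule genideal_minimal)
  then show ?thesis using y by blast
qed

lemma ideals_set_simps [simp]: "\<one>\<^bsub>ideals_set R\<^esub> = carrier R"
  "B \<otimes>\<^bsub>ideals_set R\<^esub> C = ideal_prod R B C"
  by (auto simp: ideals_set_def)

lemma ideal_pow_closed: "ideal B R \<Longrightarrow> ideal (B [^]\<^bsub>ideals_set R\<^esub> (n::nat)) R"
  by (induction n) (auto simp: oneideal intro!: ideal_prod_is_ideal)

lemma pow_in_ideal_pow: "ideal B R \<Longrightarrow> b \<in> B \<Longrightarrow> b [^] (n::nat) \<in> B [^]\<^bsub>ideals_set R\<^esub> n"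
  by (induction n) (auto intro: ideal_prod.prod)

text \<open>Pigeonhole principle: in a product of \<open>card T * k + 1\<close> elements of the ideal generated by the \<open>x\<^sub>i\<close>
  some \<open>x\<^sub>i\<close> occurs at least \<open>k\<close> times in each term.  The induction replaces one factor after the
  other by a generator; \<open>e\<^sub>i\<close> counts the generators that have been split off.\<close>

lemma ideal_pow_subset_aux:
  fixes x :: "nat \<Rightarrow> 'a" and k :: nat
  assumes T: "finite T" and x: "x \<in> T \<rightarrow> carrier R" and J: "ideal J R"
    and xk: "\<And>i. i \<in> T \<Longrightarrow> x i [^] k \<in> J"
  shows "card T * k < n + sum e T \<Longrightarrow> b \<in> genideal R (x ` T) [^]\<^bsub>ideals_set R\<^esub> n \<Longrightarrow>
    finprod R (\<lambda>i. x i [^] (e i :: nat)) T \<otimes> b \<in> J"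
proof (induction n arbitrary: e b)
  interpret J: ideal J R by fact
  have xc: "x i \<in> carrier R" if "i \<in> T" for i using x that by auto
  {
    case 0
    have "\<exists>i\<in>T. k \<le> e i"
    proof (rule ccontr)
      assume "\<not> (\<exists>i\<in>T. k \<le> e i)"
      then have "sum e T \<le> card T * k" using sum_bounded_above[of T e k] by force
      then show False using 0 by simp
    qed
    then obtain i where i: "i \<in> T" "k \<le> e i" by blast
    have rest: "finprod R (\<lambda>i. x i [^] e i) (T - {i}) \<in> carrier R"
      using xc by (intro finprod_closed) auto
    have "finprod R (\<lambda>i. x i [^] e i) (insert i (T - {i})) =
        x i [^] e i \<otimes> finprod R (\<lambda>i. x i [^] e i) (T - {i})"
      using T xc i by (intro finprod_insert) auto
    then have "finprod R (\<lambda>i. x i [^] e i) T = x i [^] e i \<otimes> finprod R (\<lambda>i. x i [^] e i) (T - {i})"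
      using i by (simp add: insert_absorb)
    moreover have "x i [^] e i = x i [^] k \<otimes> x i [^] (e i - k)"
      using i xc by (simp add: nat_pow_mult)
    then have "x i [^] e i \<in> J" using xk[OF i(1)] xc[OF i(1)] J.I_r_closed by simp
    ultimately show ?case
      using 0 rest J.I_r_closed by simp
  next
    case (Suc n)
    let ?m = "\<lambda>e. finprod R (\<lambda>i. x i [^] (e i :: nat)) T"
    have mc: "?m e \<in> carrier R" for e using xc by (intro finprod_closed) auto
    have gi: "ideal (genideal R (x ` T)) R" using xc by (intro genideal_ideal) auto
    interpret B: ideal "genideal R (x ` T) [^]\<^bsub>ideals_set R\<^esub> n" R by (rule ideal_pow_closed[OF gi])
    have "b \<in> ideal_prod R (genideal R (x ` T) [^]\<^bsub>ideals_set R\<^esub> n) (genideal R (x ` T))"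
      using Suc.prems(2) by simp
    then have "?m e \<otimes> b \<in> J \<and> b \<in> carrier R"
    proof (induction b)
      case (prod c d)
      obtain r where r: "r \<in> T \<rightarrow> carrier R" "d = (\<Oplus>i\<in>T. r i \<otimes> x i)"
        using genideal_finite_family[OF T x prod(2)] by blast
      have cc: "c \<in> carrier R" using prod(1) by (rule B.Icarr)
      have rc: "r i \<in> carrier R" if "i \<in> T" for i using r that by auto
      have dc: "d \<in> carrier R" unfolding r(2) using rc xc by (intro finsum_closed) auto
      have summand: "(?m e \<otimes> c) \<otimes> (r i \<otimes> x i) \<in> J" if i: "i \<in> T" for i
      proof -
        let ?e = "e(i := Suc (e i))"
        have rest: "finprod R (\<lambda>k. x k [^] ?e k) (T - {i}) = finprod R (\<lambda>k. x k [^] e k) (T - {i})"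
          using xc by (intro finprod_cong') auto
        have restc: "finprod R (\<lambda>k. x k [^] e k) (T - {i}) \<in> carrier R"
          using xc by (intro finprod_closed) auto
        have split: "?m f = x i [^] f i \<otimes> finprod R (\<lambda>k. x k [^] f k) (T - {i})" for f
        proof -
          have "?m f = finprod R (\<lambda>k. x k [^] f k) (insert i (T - {i}))" using i by (simp add: insert_absorb)
          also have "\<dots> = x i [^] f i \<otimes> finprod R (\<lambda>k. x k [^] f k) (T - {i})"
            using T xc i by (intro finprod_insert) auto
          finally show ?thesis .
        qed
        have up: "?m ?e = ?m e \<otimes> x i"
          unfolding split[of ?e] split[of e] rest using xc[OF i] restc by (simp add: m_ac)
        have "sum ?e T = Suc (sum e T)"
          using T i by (simp add: sum.remove[of T i])
        then have "?m ?e \<otimes> c \<in> J"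
          using Suc.prems(1) by (intro Suc.IH prod) simp
        then have "r i \<otimes> (?m ?e \<otimes> c) \<in> J" using rc[OF i] by (rule J.I_l_closed)
        then show ?thesis unfolding up using mc[of e] cc rc[OF i] xc[OF i] by (simp add: m_ac)
      qed
      have "?m e \<otimes> (c \<otimes> d) = (\<Oplus>i\<in>T. (?m e \<otimes> c) \<otimes> (r i \<otimes> x i))"
        unfolding r(2) using cc mc[of e] T rc xc
        by (simp add: m_assoc[symmetric] finsum_closed) (simp add: finsum_rdistr m_assoc)
      also have "\<dots> \<in> J" by (rule finsum_in_ideal[OF J summand T])
      finally show ?case using cc dc by simp
    next
      case (sum b1 b2)
      then show ?case using mc[of e] by (simp add: r_distr)
    qed
    then show ?case by simp
  }
qed

lemma ideal_pow_subset:
  fixes x :: "nat \<Rightarrow> 'a"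
  assumes "finite T" "x \<in> T \<rightarrow> carrier R" "ideal J R" "\<And>i. i \<in> T \<Longrightarrow> \<exists>k::nat. x i [^] k \<in> J"
  shows "\<exists>n::nat. genideal R (x ` T) [^]\<^bsub>ideals_set R\<^esub> n \<subseteq> J"
proof -
  interpret J: ideal J R by fact
  obtain k where k: "\<And>i. i \<in> T \<Longrightarrow> x i [^] (k i :: nat) \<in> J" using assms(4) by metis
  define K where "K = sum k T"
  have xK: "x i [^] K \<in> J" if "i \<in> T" for i
  proof -
    have "k i \<le> K" unfolding K_def using that assms(1) by (intro member_le_sum) auto
    then have "x i [^] K = x i [^] k i \<otimes> x i [^] (K - k i)"
      using assms(2) that by (subst nat_pow_mult) auto
    then show ?thesis using k[OF that] assms(2) that J.I_r_closed by (auto simp: Pi_iff)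
  qed
  have gi: "ideal (genideal R (x ` T)) R" using assms(2) by (intro genideal_ideal) auto
  have "b \<in> J" if b: "b \<in> genideal R (x ` T) [^]\<^bsub>ideals_set R\<^esub> (Suc (card T * K))" for b
  proof -
    have "b \<in> carrier R" using ideal.Icarr[OF ideal_pow_closed[OF gi] b] .
    then show ?thesis
      using ideal_pow_subset_aux[OF assms(1-3) xK _ b, of "\<lambda>_. 0"] by simp
  qed
  then show ?thesis by blast
qed

text \<open>A power of the ideal generated by the \<open>x\<^sub>i\<close> lies in the ideal generated by the \<open>x\<^sub>i\<^sup>s\<close>.\<close>

lemma power_eq_combination:
  fixes x :: "nat \<Rightarrow> 'a" and s :: nat
  assumes T: "finite T" and x: "x \<in> T \<rightarrow> carrier R" and y: "y \<in> genideal R (x ` T)"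
  shows "\<exists>N::nat. \<exists>r \<in> T \<rightarrow> carrier R. y [^] N = (\<Oplus>i\<in>T. r i \<otimes> x i [^] s)"
proof -
  let ?xs = "\<lambda>i. x i [^] s"
  have xs: "?xs \<in> T \<rightarrow> carrier R" using x by auto
  have "\<exists>n::nat. genideal R (x ` T) [^]\<^bsub>ideals_set R\<^esub> n \<subseteq> genideal R (?xs ` T)"
  proof (rule ideal_pow_subset[OF T x])
    show "ideal (genideal R (?xs ` T)) R" using xs by (intro genideal_ideal) auto
    show "\<exists>k::nat. x i [^] k \<in> genideal R (?xs ` T)" if "i \<in> T" for i
      using genideal_self[of "?xs ` T"] xs that by blast
  qed
  then obtain n :: nat where n: "genideal R (x ` T) [^]\<^bsub>ideals_set R\<^esub> n \<subseteq> genideal R (?xs ` T)" by blast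
  have "ideal (genideal R (x ` T)) R" using x by (intro genideal_ideal) auto
  then have "y [^] n \<in> genideal R (?xs ` T)" using pow_in_ideal_pow[OF _ y] n by blast
  then show ?thesis using genideal_finite_family[OF T xs] by blast
qed

text \<open>The ideals generated by finite subsets of \<open>A\<close> form a directed family, so their union is an ideal.\<close>

lemma genideal_finitely_generated:
  assumes A: "A \<subseteq> carrier R" and L: "finite L" "L \<subseteq> genideal R A"
  shows "\<exists>A0 \<subseteq> A. finite A0 \<and> L \<subseteq> genideal R A0"
proof -
  let ?U = "\<Union>{genideal R A0 | A0. A0 \<subseteq> A \<and> finite A0}"
  have mono: "genideal R A1 \<subseteq> genideal R A2" if "A1 \<subseteq> A2" "A2 \<subseteq> A" for A1 A2
    using that A genideal_self[of A2] by (intro genideal_minimal genideal_ideal) auto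
  have gi: "ideal (genideal R A0) R" if "A0 \<subseteq> A" for A0
    using that A by (intro genideal_ideal) auto
  have "ideal ?U R"
  proof (rule idealI[OF ring_axioms])
    show "subgroup ?U (add_monoid R)"
    proof (rule add.subgroupI)
      show "?U \<subseteq> carrier R"
      proof
        fix y assume "y \<in> ?U"
        then obtain A0 where "A0 \<subseteq> A" "y \<in> genideal R A0" by blast
        then show "y \<in> carrier R" using ideal.Icarr[OF gi] by blast
      qed
      have "\<zero> \<in> genideal R {}" using gi[of "{}"] by (simp add: additive_subgroup.zero_closed ideal.axioms(1))
      then show "?U \<noteq> {}" by blast
    next
      fix y assume "y \<in> ?U"
      then obtain A0 where "A0 \<subseteq> A" "finite A0" "y \<in> genideal R A0" by blast
      moreover from this have "\<ominus> y \<in> genideal R A0"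
        using gi[of A0] by (simp add: additive_subgroup.a_inv_closed ideal.axioms(1))
      ultimately show "\<ominus> y \<in> ?U" by blast
    next
      fix y y' assume "y \<in> ?U" "y' \<in> ?U"
      then obtain A0 A1 where A01: "A0 \<subseteq> A" "finite A0" "y \<in> genideal R A0" "A1 \<subseteq> A" "finite A1" "y' \<in> genideal R A1"
        by blast
      then have "y \<in> genideal R (A0 \<union> A1)" "y' \<in> genideal R (A0 \<union> A1)"
        using mono[of A0 "A0 \<union> A1"] mono[of A1 "A0 \<union> A1"] by auto
      moreover have "ideal (genideal R (A0 \<union> A1)) R" using A01 by (intro gi) auto
      ultimately have "y \<oplus> y' \<in> genideal R (A0 \<union> A1)"
        by (simp add: additive_subgroup.a_closed ideal.axioms(1))
      moreover have "A0 \<union> A1 \<subseteq> A" "finite (A0 \<union> A1)" using A01 by auto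
      ultimately show "y \<oplus> y' \<in> ?U" by blast
    qed
    fix y s assume "y \<in> ?U" and s: "s \<in> carrier R"
    then obtain A0 where A0: "A0 \<subseteq> A" "finite A0" "y \<in> genideal R A0" by blast
    then show "s \<otimes> y \<in> ?U" using ideal.I_l_closed[OF gi[OF A0(1)] A0(3) s] by blast
    show "y \<otimes> s \<in> ?U" using A0 ideal.I_r_closed[OF gi[OF A0(1)] A0(3) s] by blast
  qed
  moreover have "A \<subseteq> ?U"
  proof
    fix y assume "y \<in> A"
    then have "y \<in> genideal R {y}" "{y} \<subseteq> A" using A genideal_self[of "{y}"] by auto
    then show "y \<in> ?U" by blast
  qed
  ultimately have sub: "genideal R A \<subseteq> ?U" by (rule genideal_minimal)
  show ?thesis
    using L
  proof (induction L)
    case empty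
    then show ?case by blast
  next
    case (insert y L)
    then obtain A0 where A0: "A0 \<subseteq> A" "finite A0" "L \<subseteq> genideal R A0" by auto
    obtain A1 where A1: "A1 \<subseteq> A" "finite A1" "y \<in> genideal R A1" using insert.prems sub by blast
    have "insert y L \<subseteq> genideal R (A0 \<union> A1)"
      using mono[of A0 "A0 \<union> A1"] mono[of A1 "A0 \<union> A1"] A0 A1 by auto
    then show ?case using A0 A1 by (intro exI[of _ "A0 \<union> A1"]) auto
  qed
qed

end

lemma annihilator_ideal:
  assumes "module R M" "m \<in> carrier M"
  shows "ideal {r \<in> carrier R. r \<odot>\<^bsub>M\<^esub> m = \<zero>\<^bsub>M\<^esub>} R"
proof -
  interpret module R M by fact
  show ?thesis
  proof (rule idealI)
    show "subgroup {r \<in> carrier R. r \<odot>\<^bsub>M\<^esub> m = \<zero>\<^bsub>M\<^esub>} (add_monoid R)"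
    proof (rule R.add.subgroupI)
      show "\<ominus>\<^bsub>R\<^esub> r \<in> {r \<in> carrier R. r \<odot>\<^bsub>M\<^esub> m = \<zero>\<^bsub>M\<^esub>}"
        if "r \<in> {r \<in> carrier R. r \<odot>\<^bsub>M\<^esub> m = \<zero>\<^bsub>M\<^esub>}" for r
        using that assms(2) M.minus_equality[of "\<zero>\<^bsub>M\<^esub>" "\<zero>\<^bsub>M\<^esub>"] by (auto simp: smult_l_minus)
    qed (use assms(2) in \<open>auto simp: smult_l_distr intro!: exI[of _ "\<zero>\<^bsub>R\<^esub>"]\<close>)
    fix r s assume rs: "r \<in> {r \<in> carrier R. r \<odot>\<^bsub>M\<^esub> m = \<zero>\<^bsub>M\<^esub>}" "s \<in> carrier R"
    then show "s \<otimes>\<^bsub>R\<^esub> r \<in> {r \<in> carrier R. r \<odot>\<^bsub>M\<^esub> m = \<zero>\<^bsub>M\<^esub>}"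
      using assms(2) by (auto simp: smult_assoc1)
    then show "r \<otimes>\<^bsub>R\<^esub> s \<in> {r \<in> carrier R. r \<odot>\<^bsub>M\<^esub> m = \<zero>\<^bsub>M\<^esub>}"
      using rs by (auto simp: R.m_comm)
  qed (rule R.ring_axioms)
qed

text \<open>The annihilator of \<open>m\<close> is an ideal that contains a power of each generator if and only if it
  contains a power of the ideal they generate.\<close>

lemma torsion_iff:
  fixes M :: "('a, 'm) module" and x :: "nat \<Rightarrow> 'a"
  assumes "module R M" "finite T" "x \<in> T \<rightarrow> carrier R"
  shows "m \<in> torsion R (genideal R (x ` T)) M \<longleftrightarrow>
    m \<in> carrier M \<and> (\<forall>i\<in>T. \<exists>k::nat. (x i [^]\<^bsub>R\<^esub> k) \<odot>\<^bsub>M\<^esub> m = \<zero>\<^bsub>M\<^esub>)"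
proof -
  interpret module R M by fact
  have gi: "ideal (genideal R (x ` T)) R" using assms(3) by (intro R.genideal_ideal) auto
  show ?thesis
  proof (intro iffI conjI ballI)
    assume "m \<in> torsion R (genideal R (x ` T)) M"
    then obtain n :: nat where n: "m \<in> carrier M"
      "\<And>b. b \<in> genideal R (x ` T) [^]\<^bsub>ideals_set R\<^esub> n \<Longrightarrow> b \<odot>\<^bsub>M\<^esub> m = \<zero>\<^bsub>M\<^esub>"
      by (auto simp: torsion_def)
    show "m \<in> carrier M" by fact
    fix i assume "i \<in> T"
    then have "x i \<in> genideal R (x ` T)" using R.genideal_self[of "x ` T"] assms(3) by auto
    then show "\<exists>k::nat. (x i [^]\<^bsub>R\<^esub> k) \<odot>\<^bsub>M\<^esub> m = \<zero>\<^bsub>M\<^esub>"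
      using n(2) R.pow_in_ideal_pow[OF gi] by blast
  next
    assume m: "m \<in> carrier M \<and> (\<forall>i\<in>T. \<exists>k::nat. (x i [^]\<^bsub>R\<^esub> k) \<odot>\<^bsub>M\<^esub> m = \<zero>\<^bsub>M\<^esub>)"
    have "\<exists>n::nat. genideal R (x ` T) [^]\<^bsub>ideals_set R\<^esub> n \<subseteq> {r \<in> carrier R. r \<odot>\<^bsub>M\<^esub> m = \<zero>\<^bsub>M\<^esub>}"
    proof (intro R.ideal_pow_subset assms annihilator_ideal)
      show "\<exists>k::nat. x i [^]\<^bsub>R\<^esub> k \<in> {r \<in> carrier R. r \<odot>\<^bsub>M\<^esub> m = \<zero>\<^bsub>M\<^esub>}" if "i \<in> T" for i
        using m assms(3) that R.nat_pow_closed by blast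
    qed (use m in blast)
    then show "m \<in> torsion R (genideal R (x ` T)) M"
      using m by (auto simp: torsion_def)
  qed
qed


section \<open>Injective modules\<close>

subsection \<open>Transport of module structures\<close>

definition transport :: "('m \<Rightarrow> 'n) \<Rightarrow> ('a, 'm) module \<Rightarrow> ('a, 'n) module" where
  "transport e M = (let i = inv_into (carrier M) e in
     \<lparr>carrier = e ` carrier M, monoid.mult = undefined, monoid.one = undefined,
      ring.zero = e \<zero>\<^bsub>M\<^esub>, ring.add = (\<lambda>a b. e (i a \<oplus>\<^bsub>M\<^esub> i b)), smult = (\<lambda>r a. e (r \<odot>\<^bsub>M\<^esub> i a))\<rparr>)"

lemma transport_simps:
  "carrier (transport e M) = e ` carrier M"
  "\<zero>\<^bsub>transport e M\<^esub> = e \<zero>\<^bsub>M\<^esub>"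
  "inj_on e (carrier M) \<Longrightarrow> x \<in> carrier M \<Longrightarrow> y \<in> carrier M \<Longrightarrow> e x \<oplus>\<^bsub>transport e M\<^esub> e y = e (x \<oplus>\<^bsub>M\<^esub> y)"
  "inj_on e (carrier M) \<Longrightarrow> x \<in> carrier M \<Longrightarrow> r \<odot>\<^bsub>transport e M\<^esub> e x = e (r \<odot>\<^bsub>M\<^esub> x)"
  by (auto simp: transport_def Let_def)

lemma transport_module:
  assumes "module R M" "inj_on e (carrier M)"
  shows "module R (transport e M)" "e \<in> mod_hom R M (transport e M)"
proof -
  interpret module R M by fact
  show "module R (transport e M)"
  proof (rule moduleI)
    show "abelian_group (transport e M)"
    proof (rule abelian_groupI)
      fix y assume "y \<in> carrier (transport e M)"
      then obtain x where x: "x \<in> carrier M" "y = e x" by (auto simp: transport_simps)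
      then show "\<exists>z\<in>carrier (transport e M). z \<oplus>\<^bsub>transport e M\<^esub> y = \<zero>\<^bsub>transport e M\<^esub>"
        using assms(2) by (intro bexI[of _ "e (\<ominus>\<^bsub>M\<^esub> x)"]) (auto simp: transport_simps M.l_neg)
    qed (use assms(2) in \<open>auto simp: transport_simps M.a_assoc intro!: arg_cong[of _ _ e] M.a_comm\<close>)
  qed (use assms(2) in \<open>auto simp: transport_simps smult_l_distr smult_r_distr smult_assoc1 intro: R.is_cring\<close>)
  show "e \<in> mod_hom R M (transport e M)"
    using assms(2) by (intro mod_homI) (auto simp: transport_simps)
qed


subsection \<open>Extension of homomorphisms\<close>

text \<open>Injectivity is tested against modules with carriers in one type only; transport along \<open>e\<close> extends
  it to all modules that fit into that type.\<close>

lemma injective_extend: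
  fixes I :: "('a, 'i) module" and W :: "('a, 'w) module" and N :: "('a, 'n) module"
  assumes I: "injective_module R I" and W: "module R W" and N: "module R N"
    and e: "inj_on (e :: 'n \<Rightarrow> 'i) (carrier N)"
    and p: "p \<in> mod_hom R W N" and g: "g \<in> mod_hom R W I"
    and ker: "\<And>w. w \<in> carrier W \<Longrightarrow> p w = \<zero>\<^bsub>N\<^esub> \<Longrightarrow> g w = \<zero>\<^bsub>I\<^esub>"
  shows "\<exists>h \<in> mod_hom R N I. \<forall>w\<in>carrier W. h (p w) = g w"
proof -
  interpret W: module R W by fact
  interpret N: module R N by fact
  have Im: "module R I" using I by (simp add: injective_module_def)
  interpret I: module R I by fact
  let ?N = "transport e N"
  have N': "module R ?N" and eh: "e \<in> mod_hom R N ?N" using transport_module[OF N e] by auto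
  define q where "q w = e (p w)" for w
  have q: "q \<in> mod_hom R W ?N" unfolding q_def using p eh by (rule mod_hom_compose)
  define N0 where "N0 = ?N\<lparr>carrier := q ` carrier W\<rparr>"
  have N0: "module R N0"
    unfolding N0_def
  proof (rule module_restrict_carrier[OF N'])
    show "q ` carrier W \<subseteq> carrier ?N" using q by (auto intro: mod_hom_closed)
    show "\<zero>\<^bsub>?N\<^esub> \<in> q ` carrier W"
      using mod_hom_zero[OF W N' q] by (metis W.M.zero_closed imageI)
    show "x \<oplus>\<^bsub>?N\<^esub> y \<in> q ` carrier W" if "x \<in> q ` carrier W" "y \<in> q ` carrier W" for x y
      using that by (auto simp: mod_hom_add[OF q, symmetric])
    show "r \<odot>\<^bsub>?N\<^esub> x \<in> q ` carrier W" if "r \<in> carrier R" "x \<in> q ` carrier W" for r x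
      using that by (auto simp: mod_hom_smult[OF q, symmetric])
  qed
  have wd: "g w = g w'" if w: "w \<in> carrier W" "w' \<in> carrier W" "q w = q w'" for w w'
  proof -
    have "p w = p w'" using w e p by (auto simp: q_def dest: inj_onD intro: mod_hom_closed)
    then have "p (w \<ominus>\<^bsub>W\<^esub> w') = \<zero>\<^bsub>N\<^esub>"
      using w mod_hom_closed[OF p w(2)]
      by (simp add: a_minus_def mod_hom_add[OF p] mod_hom_neg[OF W N p] N.M.r_neg)
    then have "g (w \<ominus>\<^bsub>W\<^esub> w') = \<zero>\<^bsub>I\<^esub>" using w by (intro ker) auto
    then have "g w \<oplus>\<^bsub>I\<^esub> \<ominus>\<^bsub>I\<^esub> g w' = \<zero>\<^bsub>I\<^esub>"
      using w by (simp add: a_minus_def mod_hom_add[OF g] mod_hom_neg[OF W Im g])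
    then show ?thesis
      using I.M.minus_equality[of "g w" "\<ominus>\<^bsub>I\<^esub> g w'"] mod_hom_closed[OF g] w by simp
  qed
  define g' where "g' y = g (SOME w. w \<in> carrier W \<and> q w = y)" for y
  have g'q: "g' (q w) = g w" if w: "w \<in> carrier W" for w
  proof -
    have "\<exists>v. v \<in> carrier W \<and> q v = q w" using w by blast
    from someI_ex[OF this] show ?thesis unfolding g'_def using wd w by blast
  qed
  have g': "g' \<in> mod_hom R N0 I"
  proof (rule mod_homI)
    show "g' x \<in> carrier I" if "x \<in> carrier N0" for x
      using that g by (auto simp: N0_def g'q intro: mod_hom_closed)
    show "g' (x \<oplus>\<^bsub>N0\<^esub> y) = g' x \<oplus>\<^bsub>I\<^esub> g' y" if "x \<in> carrier N0" "y \<in> carrier N0" for x y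
    proof -
      obtain v w where "v \<in> carrier W" "w \<in> carrier W" "x = q v" "y = q w" using \<open>x \<in> carrier N0\<close> \<open>y \<in> carrier N0\<close> by (auto simp: N0_def)
      then show ?thesis
        using g'q[of "v \<oplus>\<^bsub>W\<^esub> w"] by (simp add: N0_def g'q mod_hom_add[OF g] mod_hom_add[OF q])
    qed
    show "g' (r \<odot>\<^bsub>N0\<^esub> x) = r \<odot>\<^bsub>I\<^esub> g' x" if "r \<in> carrier R" "x \<in> carrier N0" for r x
    proof -
      obtain w where "w \<in> carrier W" "x = q w" using \<open>x \<in> carrier N0\<close> by (auto simp: N0_def)
      then show ?thesis
        using that g'q[of "r \<odot>\<^bsub>W\<^esub> w"] by (simp add: N0_def g'q mod_hom_smult[OF g] mod_hom_smult[OF q])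
    qed
  qed
  have incl: "(\<lambda>x. x) \<in> mod_hom R N0 ?N"
    using q by (intro mod_homI) (auto simp: N0_def intro: mod_hom_closed)
  have "\<exists>h \<in> mod_hom R ?N I. \<forall>x\<in>carrier N0. h x = g' x"
  proof (rule I[unfolded injective_module_def, THEN conjunct2, THEN spec, THEN spec, THEN spec,
        THEN spec, THEN mp])
    have inj: "inj_on (\<lambda>x. x) (carrier N0)" by (simp add: inj_on_def)
    show "module R N0 \<and> module R ?N \<and> (\<lambda>x. x) \<in> mod_hom R N0 ?N \<and> inj_on (\<lambda>x. x) (carrier N0) \<and>
        g' \<in> mod_hom R N0 I"
      by (rule conjI[OF N0 conjI[OF N' conjI[OF incl conjI[OF inj g']]]])
  qed
  then obtain h where h: "h \<in> mod_hom R ?N I" "\<And>x. x \<in> carrier N0 \<Longrightarrow> h x = g' x" by blast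
  have "h (e (p w)) = g w" if "w \<in> carrier W" for w
    using h(2)[of "q w"] g'q[OF that] that by (auto simp: N0_def q_def)
  then show ?thesis
    using mod_hom_compose[OF eh h(1)] by (intro bexI[of _ "\<lambda>x. h (e x)"]) auto
qed


subsection \<open>Duality for Koszul complexes\<close>

text \<open>All functions on \<open>A\<close>; for finite \<open>A\<close>, the free module on \<open>A\<close>.\<close>

definition free_module :: "('a, 'r) ring_scheme \<Rightarrow> 'k set \<Rightarrow> ('a, 'k \<Rightarrow> 'a) module" where
  "free_module R A = \<lparr>carrier = A \<rightarrow>\<^sub>E carrier R, monoid.mult = undefined, monoid.one = undefined,
     ring.zero = (\<lambda>i\<in>A. \<zero>\<^bsub>R\<^esub>), ring.add = (\<lambda>f g. \<lambda>i\<in>A. f i \<oplus>\<^bsub>R\<^esub> g i),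
     smult = (\<lambda>r f. \<lambda>i\<in>A. r \<otimes>\<^bsub>R\<^esub> f i)\<rparr>"

lemma free_module_simps:
  "carrier (free_module R A) = A \<rightarrow>\<^sub>E carrier R" "\<zero>\<^bsub>free_module R A\<^esub> = (\<lambda>i\<in>A. \<zero>\<^bsub>R\<^esub>)"
  "f \<oplus>\<^bsub>free_module R A\<^esub> g = (\<lambda>i\<in>A. f i \<oplus>\<^bsub>R\<^esub> g i)" "r \<odot>\<^bsub>free_module R A\<^esub> f = (\<lambda>i\<in>A. r \<otimes>\<^bsub>R\<^esub> f i)"
  by (auto simp: free_module_def)

context cring
begin

lemma free_module: "module R (free_module R A)"
proof (rule moduleI)
  show "abelian_group (free_module R A)"
  proof (rule abelian_groupI)
    fix f assume "f \<in> carrier (free_module R A)"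
    then show "\<exists>g\<in>carrier (free_module R A). g \<oplus>\<^bsub>free_module R A\<^esub> f = \<zero>\<^bsub>free_module R A\<^esub>"
      by (intro bexI[of _ "\<lambda>i\<in>A. \<ominus> f i"]) (auto simp: free_module_simps PiE_iff l_neg intro!: restrict_ext)
  qed (auto simp: free_module_simps PiE_iff a_ac extensional_def restrict_def fun_eq_iff)
qed (auto simp: free_module_simps PiE_iff is_cring l_distr r_distr m_assoc extensional_def restrict_def fun_eq_iff)

lemma free_module_finsum:
  assumes "finite B" "f \<in> B \<rightarrow> carrier (free_module R A)"
  shows "finsum (free_module R A) f B = (\<lambda>i\<in>A. \<Oplus>b\<in>B. f b i)"
proof -
  interpret F: module R "free_module R A" by (rule free_module)
  show ?thesis
    using assms
  proof (induction B)
    case (insert b B)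
    have c: "f c i \<in> carrier R" if "c \<in> insert b B" "i \<in> A" for c i
      using insert.prems that by (auto simp: free_module_simps)
    show ?case
      using insert c by (auto simp: free_module_simps Pi_iff intro!: restrict_ext)
  qed (simp add: free_module_simps)
qed

end

text \<open>\<open>cobd\<close> is the transpose of \<open>bd\<close> under the pairing \<open>\<Sum> w(\<mu>) u(\<mu>)\<close>, so a cocycle \<open>u\<close> is a linear form that
  vanishes on boundaries.\<close>

lemma (in cochains) bd_cobd_adjoint:
  assumes w: "w \<in> Pow T \<rightarrow> carrier R" and u: "u \<in> Pow T \<rightarrow> carrier M"
  shows "(\<Oplus>\<^bsub>M\<^esub>\<mu>\<in>Pow T. bd R x T s w \<mu> \<odot>\<^bsub>M\<^esub> u \<mu>) = (\<Oplus>\<^bsub>M\<^esub>\<mu>\<in>Pow T. w \<mu> \<odot>\<^bsub>M\<^esub> cobd R M x s u \<mu>)"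
proof -
  let ?f = "\<lambda>\<mu> j. (ksign R j \<mu> \<otimes> (x j [^] s \<otimes> w (insert j \<mu>))) \<odot>\<^bsub>M\<^esub> u \<mu>"
  let ?g = "\<lambda>\<mu> j. w \<mu> \<odot>\<^bsub>M\<^esub> ((ksign R j \<mu> \<otimes> x j [^] s) \<odot>\<^bsub>M\<^esub> u (\<mu> - {j}))"
  have wc: "w \<mu> \<in> carrier R" if "\<mu> \<subseteq> T" for \<mu> using w that by auto
  have uc: "u \<mu> \<in> carrier M" if "\<mu> \<subseteq> T" for \<mu> using u that by auto
  have c: "ksign R j \<mu> \<otimes> (x j [^] s \<otimes> w (insert j \<mu>)) \<in> carrier R" if "\<mu> \<subseteq> T" "j \<in> T" for \<mu> j
    using that by (auto intro!: R.m_closed wc x_closed R.nat_pow_closed)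
  have f: "?f \<mu> j \<in> carrier M" if "\<mu> \<subseteq> T" "j \<in> T" for \<mu> j
    by (rule smult_closed[OF c[OF that] uc[OF that(1)]])
  have g: "?g \<mu> j \<in> carrier M" if "\<mu> \<subseteq> T" "j \<in> T" for \<mu> j
    using that by (intro smult_closed[OF wc] cobd_term_closed u)
  have gf: "?g (insert j \<mu>) j = ?f \<mu> j" if "\<mu> \<subseteq> T" "j \<in> T" "j \<notin> \<mu>" for \<mu> j
  proof -
    have "insert j \<mu> \<subseteq> T" "insert j \<mu> - {j} = \<mu>" using that by auto
    then show ?thesis
      using wc[of "insert j \<mu>"] uc[OF that(1)] x_closed[OF that(2)]
      by (simp add: smult_assoc1[symmetric] R.m_ac)
  qed
  have "(\<Oplus>\<^bsub>M\<^esub>\<mu>\<in>Pow T. bd R x T s w \<mu> \<odot>\<^bsub>M\<^esub> u \<mu>) = (\<Oplus>\<^bsub>M\<^esub>\<mu>\<in>Pow T. \<Oplus>\<^bsub>M\<^esub>j\<in>{j\<in>T. j \<notin> \<mu>}. ?f \<mu> j)"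
  proof (intro M.finsum_cong' refl)
    fix \<mu> assume "\<mu> \<in> Pow T"
    then have \<mu>: "\<mu> \<subseteq> T" by simp
    have "T - \<mu> = {j\<in>T. j \<notin> \<mu>}" by auto
    then show "bd R x T s w \<mu> \<odot>\<^bsub>M\<^esub> u \<mu> = (\<Oplus>\<^bsub>M\<^esub>j\<in>{j\<in>T. j \<notin> \<mu>}. ?f \<mu> j)"
      unfolding bd_def using T c[OF \<mu>] uc[OF \<mu>] by (subst finsum_smult_rdistr) auto
  qed (use f in \<open>auto intro!: M.finsum_closed\<close>)
  also have "\<dots> = (\<Oplus>\<^bsub>M\<^esub>j\<in>T. \<Oplus>\<^bsub>M\<^esub>\<mu>\<in>{\<mu>\<in>Pow T. j \<notin> \<mu>}. ?f \<mu> j)"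
    using T f by (intro M.finsum_swap_dependent) auto
  also have "\<dots> = (\<Oplus>\<^bsub>M\<^esub>j\<in>T. \<Oplus>\<^bsub>M\<^esub>\<mu>\<in>{\<mu>\<in>Pow T. j \<in> \<mu>}. ?g \<mu> j)"
  proof (rule M.finsum_cong'[OF refl])
    fix j assume j: "j \<in> T"
    have im: "{\<mu>\<in>Pow T. j \<in> \<mu>} = insert j ` {\<mu>\<in>Pow T. j \<notin> \<mu>}"
    proof (intro equalityI subsetI)
      fix \<mu> assume "\<mu> \<in> {\<mu>\<in>Pow T. j \<in> \<mu>}"
      then show "\<mu> \<in> insert j ` {\<mu>\<in>Pow T. j \<notin> \<mu>}" by (intro image_eqI[of _ _ "\<mu> - {j}"]) auto
    qed (use j in auto)
    have inj: "inj_on (insert j) {\<mu>\<in>Pow T. j \<notin> \<mu>}" by (auto simp: inj_on_def)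
    have "(\<Oplus>\<^bsub>M\<^esub>\<mu>\<in>{\<mu>\<in>Pow T. j \<in> \<mu>}. ?g \<mu> j) = (\<Oplus>\<^bsub>M\<^esub>\<mu>\<in>{\<mu>\<in>Pow T. j \<notin> \<mu>}. ?g (insert j \<mu>) j)"
      unfolding im
    proof (rule M.finsum_reindex[of "\<lambda>\<mu>. ?g \<mu> j", OF _ inj])
      show "(\<lambda>\<mu>. ?g \<mu> j) \<in> insert j ` {\<mu>\<in>Pow T. j \<notin> \<mu>} \<rightarrow> carrier M"
      proof
        fix \<mu> assume "\<mu> \<in> insert j ` {\<mu>\<in>Pow T. j \<notin> \<mu>}"
        then have "\<mu> \<subseteq> T" using j by auto
        then show "?g \<mu> j \<in> carrier M" using j by (rule g)
      qed
    qed
    also have "\<dots> = (\<Oplus>\<^bsub>M\<^esub>\<mu>\<in>{\<mu>\<in>Pow T. j \<notin> \<mu>}. ?f \<mu> j)"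
      using j f by (intro M.finsum_cong' refl gf) auto
    finally show "(\<Oplus>\<^bsub>M\<^esub>\<mu>\<in>{\<mu>\<in>Pow T. j \<notin> \<mu>}. ?f \<mu> j) = (\<Oplus>\<^bsub>M\<^esub>\<mu>\<in>{\<mu>\<in>Pow T. j \<in> \<mu>}. ?g \<mu> j)" by simp
  qed (use g in \<open>auto intro!: M.finsum_closed\<close>)
  also have "\<dots> = (\<Oplus>\<^bsub>M\<^esub>\<mu>\<in>Pow T. \<Oplus>\<^bsub>M\<^esub>j\<in>{j\<in>T. j \<in> \<mu>}. ?g \<mu> j)"
    using T g by (intro M.finsum_swap_dependent[symmetric]) auto
  also have "\<dots> = (\<Oplus>\<^bsub>M\<^esub>\<mu>\<in>Pow T. w \<mu> \<odot>\<^bsub>M\<^esub> cobd R M x s u \<mu>)"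
  proof (intro M.finsum_cong' refl)
    fix \<mu> assume "\<mu> \<in> Pow T"
    then have \<mu>: "\<mu> \<subseteq> T" by simp
    then have "{j\<in>T. j \<in> \<mu>} = \<mu>" by auto
    then show "(\<Oplus>\<^bsub>M\<^esub>j\<in>{j\<in>T. j \<in> \<mu>}. ?g \<mu> j) = w \<mu> \<odot>\<^bsub>M\<^esub> cobd R M x s u \<mu>"
      unfolding cobd_def using finite_subset_T[OF \<mu>] wc[OF \<mu>] \<mu> u
      by (subst finsum_smult_ldistr) (auto intro!: cobd_term_closed)
  qed (use cobd_closed[OF u] wc in auto)
  finally show ?thesis .
qed

text \<open>If multiplication by a power of the \<open>x(\<mu>)\<close> kills the homology of the Koszul complex, it also kills
  the cohomology of the dual complex with values in an injective module: the linear form \<open>g\<close> given by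
  \<open>x(\<mu>)\<^sup>t u(\<mu>)\<close> vanishes on cycles, so it factors through the boundary map and extends from the
  boundaries to all chains.  The values of the extension on the basis are the required \<open>v\<close>.\<close>

lemma injective_koszul_acyclic:
  fixes I :: "('a, 'i) module"
  assumes I: "injective_module R I" and T: "finite T" and x: "x \<in> T \<rightarrow> carrier R"
    and e: "inj_on (e :: (nat set \<Rightarrow> 'a) \<Rightarrow> 'i) (Pow T \<rightarrow>\<^sub>E carrier R)"
    and proregular: "\<And>s z. z \<in> Pow T \<rightarrow> carrier R \<Longrightarrow> z {} = \<zero>\<^bsub>R\<^esub> \<Longrightarrow>
      (\<And>\<nu>. \<nu> \<subseteq> T \<Longrightarrow> bd R x T (s + t s) z \<nu> = \<zero>\<^bsub>R\<^esub>) \<Longrightarrow>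
      \<exists>w \<in> Pow T \<rightarrow> carrier R. \<forall>\<mu>\<subseteq>T. bd R x T s w \<mu> = finprod R x \<mu> [^]\<^bsub>R\<^esub> t s \<otimes>\<^bsub>R\<^esub> z \<mu>"
  shows "koszul_acyclic R I x T"
  unfolding koszul_acyclic_def
proof (intro allI ballI impI)
  have Im: "module R I" using I by (simp add: injective_module_def)
  interpret cochains R I x T
    using Im T x by (simp add: cochains_def cochains_axioms_def)
  fix s :: nat and u assume u: "u \<in> Pow T \<rightarrow> carrier I"
    and "u {} = \<zero>\<^bsub>I\<^esub> \<and> (\<forall>\<tau>\<subseteq>T. cobd R I x s u \<tau> = \<zero>\<^bsub>I\<^esub>)"
  then have u0: "u {} = \<zero>\<^bsub>I\<^esub>" and ucc: "\<And>\<tau>. \<tau> \<subseteq> T \<Longrightarrow> cobd R I x s u \<tau> = \<zero>\<^bsub>I\<^esub>" by auto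
  have uc: "u \<mu> \<in> carrier I" if "\<mu> \<subseteq> T" for \<mu> using u that by auto
  let ?F = "free_module R (Pow T)"
  let ?s = "s + t s"
  let ?y = "\<lambda>\<mu>. finprod R x \<mu> [^]\<^bsub>R\<^esub> t s"
  have F: "module R ?F" by (rule R.free_module)
  interpret F: module R ?F by (rule F)
  have zc: "z \<mu> \<in> carrier R" if "z \<in> carrier ?F" "\<mu> \<subseteq> T" for z \<mu>
    using that by (auto simp: free_module_simps)
  have xs: "x j [^]\<^bsub>R\<^esub> (n::nat) \<in> carrier R" if "j \<in> T" for j n using x_closed[OF that] by simp
  have y: "?y \<mu> \<in> carrier R" if "\<mu> \<subseteq> T" for \<mu> using xprod_closed[OF that] by simp
  have bdterm: "ksign R j \<nu> \<otimes>\<^bsub>R\<^esub> (x j [^]\<^bsub>R\<^esub> n \<otimes>\<^bsub>R\<^esub> z (insert j \<nu>)) \<in> carrier R"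
    if "z \<in> carrier ?F" "j \<in> T" "\<nu> \<subseteq> T" for z j \<nu> and n :: nat
    using that xs zc[OF that(1), of "insert j \<nu>"] by auto
  define d where "d z = (\<lambda>\<nu>\<in>Pow T. bd R x T ?s z \<nu>)" for z
  have d: "d \<in> mod_hom R ?F ?F"
  proof (rule mod_homI)
    show "d z \<in> carrier ?F" if "z \<in> carrier ?F" for z
      using bdterm[OF that] by (auto simp: d_def free_module_simps bd_def intro!: R.finsum_closed)
    show "d (z \<oplus>\<^bsub>?F\<^esub> z') = d z \<oplus>\<^bsub>?F\<^esub> d z'" if z: "z \<in> carrier ?F" "z' \<in> carrier ?F" for z z'
    proof -
      have "bd R x T ?s (z \<oplus>\<^bsub>?F\<^esub> z') \<nu> = bd R x T ?s z \<nu> \<oplus>\<^bsub>R\<^esub> bd R x T ?s z' \<nu>" if \<nu>: "\<nu> \<subseteq> T" for \<nu>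
      proof -
        have "bd R x T ?s (z \<oplus>\<^bsub>?F\<^esub> z') \<nu> = (\<Oplus>\<^bsub>R\<^esub>j\<in>T - \<nu>.
           ksign R j \<nu> \<otimes>\<^bsub>R\<^esub> (x j [^]\<^bsub>R\<^esub> ?s \<otimes>\<^bsub>R\<^esub> z (insert j \<nu>)) \<oplus>\<^bsub>R\<^esub>
           ksign R j \<nu> \<otimes>\<^bsub>R\<^esub> (x j [^]\<^bsub>R\<^esub> ?s \<otimes>\<^bsub>R\<^esub> z' (insert j \<nu>)))"
          unfolding bd_def
        proof (intro R.finsum_cong' refl)
          fix j assume j: "j \<in> T - \<nu>"
          then have "insert j \<nu> \<subseteq> T" using \<nu> by auto
          then show "ksign R j \<nu> \<otimes>\<^bsub>R\<^esub> (x j [^]\<^bsub>R\<^esub> ?s \<otimes>\<^bsub>R\<^esub> (z \<oplus>\<^bsub>?F\<^esub> z') (insert j \<nu>)) =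
           ksign R j \<nu> \<otimes>\<^bsub>R\<^esub> (x j [^]\<^bsub>R\<^esub> ?s \<otimes>\<^bsub>R\<^esub> z (insert j \<nu>)) \<oplus>\<^bsub>R\<^esub>
           ksign R j \<nu> \<otimes>\<^bsub>R\<^esub> (x j [^]\<^bsub>R\<^esub> ?s \<otimes>\<^bsub>R\<^esub> z' (insert j \<nu>))"
            using zc[OF z(1)] zc[OF z(2)] xs j
            by (simp add: free_module_simps(3) R.r_distr del: R.nat_pow_mult)
        qed (use bdterm[OF z(1)] bdterm[OF z(2)] \<nu> in auto)
        also have "\<dots> = bd R x T ?s z \<nu> \<oplus>\<^bsub>R\<^esub> bd R x T ?s z' \<nu>"
          unfolding bd_def using bdterm[OF z(1)] bdterm[OF z(2)] \<nu> by (intro R.finsum_addf) auto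
        finally show ?thesis .
      qed
      then show ?thesis by (auto simp: d_def free_module_simps(3) intro!: restrict_ext)
    qed
    show "d (r \<odot>\<^bsub>?F\<^esub> z) = r \<odot>\<^bsub>?F\<^esub> d z" if r: "r \<in> carrier R" and z: "z \<in> carrier ?F" for r z
    proof -
      have "bd R x T ?s (r \<odot>\<^bsub>?F\<^esub> z) \<nu> = r \<otimes>\<^bsub>R\<^esub> bd R x T ?s z \<nu>" if \<nu>: "\<nu> \<subseteq> T" for \<nu>
      proof -
        have "r \<otimes>\<^bsub>R\<^esub> bd R x T ?s z \<nu> =
            (\<Oplus>\<^bsub>R\<^esub>j\<in>T - \<nu>. r \<otimes>\<^bsub>R\<^esub> (ksign R j \<nu> \<otimes>\<^bsub>R\<^esub> (x j [^]\<^bsub>R\<^esub> ?s \<otimes>\<^bsub>R\<^esub> z (insert j \<nu>))))"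
          unfolding bd_def using bdterm[OF z] \<nu> T r by (intro R.finsum_rdistr) auto
        also have "\<dots> = bd R x T ?s (r \<odot>\<^bsub>?F\<^esub> z) \<nu>"
          unfolding bd_def
        proof (intro R.finsum_cong' refl)
          fix j assume j: "j \<in> T - \<nu>"
          then have "insert j \<nu> \<subseteq> T" using \<nu> by auto
          then show "r \<otimes>\<^bsub>R\<^esub> (ksign R j \<nu> \<otimes>\<^bsub>R\<^esub> (x j [^]\<^bsub>R\<^esub> ?s \<otimes>\<^bsub>R\<^esub> z (insert j \<nu>))) =
            ksign R j \<nu> \<otimes>\<^bsub>R\<^esub> (x j [^]\<^bsub>R\<^esub> ?s \<otimes>\<^bsub>R\<^esub> (r \<odot>\<^bsub>?F\<^esub> z) (insert j \<nu>))"
            using zc[OF z] xs j r by (simp add: free_module_simps(4) R.m_ac)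
        next
          show "(\<lambda>j. ksign R j \<nu> \<otimes>\<^bsub>R\<^esub> (x j [^]\<^bsub>R\<^esub> ?s \<otimes>\<^bsub>R\<^esub> (r \<odot>\<^bsub>?F\<^esub> z) (insert j \<nu>))) \<in> T - \<nu> \<rightarrow> carrier R"
            using bdterm[OF F.smult_closed[OF r z]] \<nu> by auto
        qed
        finally show ?thesis by simp
      qed
      then show ?thesis by (auto simp: d_def free_module_simps(4) intro!: restrict_ext)
    qed
  qed
  define g where "g z = (\<Oplus>\<^bsub>I\<^esub>\<mu>\<in>Pow T. (?y \<mu> \<otimes>\<^bsub>R\<^esub> z \<mu>) \<odot>\<^bsub>I\<^esub> u \<mu>)" for z
  have gterm: "(?y \<mu> \<otimes>\<^bsub>R\<^esub> z \<mu>) \<odot>\<^bsub>I\<^esub> u \<mu> \<in> carrier I" if "z \<in> carrier ?F" "\<mu> \<subseteq> T" for z \<mu>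
    using that y zc uc by auto
  have g: "g \<in> mod_hom R ?F I"
  proof (rule mod_homI)
    show "g z \<in> carrier I" if "z \<in> carrier ?F" for z
      unfolding g_def using gterm[OF that] by (intro M.finsum_closed) auto
    show "g (z \<oplus>\<^bsub>?F\<^esub> z') = g z \<oplus>\<^bsub>I\<^esub> g z'" if z: "z \<in> carrier ?F" "z' \<in> carrier ?F" for z z'
    proof -
      have "g (z \<oplus>\<^bsub>?F\<^esub> z') = (\<Oplus>\<^bsub>I\<^esub>\<mu>\<in>Pow T. (?y \<mu> \<otimes>\<^bsub>R\<^esub> z \<mu>) \<odot>\<^bsub>I\<^esub> u \<mu> \<oplus>\<^bsub>I\<^esub> (?y \<mu> \<otimes>\<^bsub>R\<^esub> z' \<mu>) \<odot>\<^bsub>I\<^esub> u \<mu>)"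
        unfolding g_def using gterm[OF z(1)] gterm[OF z(2)] y zc[OF z(1)] zc[OF z(2)] uc
        by (intro M.finsum_cong' refl) (auto simp: free_module_simps(3) R.r_distr smult_l_distr)
      also have "\<dots> = g z \<oplus>\<^bsub>I\<^esub> g z'"
        unfolding g_def using gterm[OF z(1)] gterm[OF z(2)] by (intro M.finsum_addf) auto
      finally show ?thesis .
    qed
    show "g (r \<odot>\<^bsub>?F\<^esub> z) = r \<odot>\<^bsub>I\<^esub> g z" if r: "r \<in> carrier R" and z: "z \<in> carrier ?F" for r z
    proof -
      have "r \<odot>\<^bsub>I\<^esub> g z = (\<Oplus>\<^bsub>I\<^esub>\<mu>\<in>Pow T. r \<odot>\<^bsub>I\<^esub> ((?y \<mu> \<otimes>\<^bsub>R\<^esub> z \<mu>) \<odot>\<^bsub>I\<^esub> u \<mu>))"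
        unfolding g_def using gterm[OF z] T r by (intro finsum_smult_ldistr) auto
      also have "\<dots> = g (r \<odot>\<^bsub>?F\<^esub> z)"
        unfolding g_def using gterm[OF z] gterm[OF F.smult_closed[OF r z]] y zc[OF z] uc r
        by (intro M.finsum_cong' refl) (auto simp: free_module_simps(4) smult_assoc1[symmetric] R.m_ac)
      finally show ?thesis by simp
    qed
  qed
  have "\<exists>h \<in> mod_hom R ?F I. \<forall>z\<in>carrier ?F. h (d z) = g z"
  proof (rule injective_extend[OF I F F _ d g])
    show "inj_on e (carrier ?F)" using e by (simp add: free_module_simps)
    fix z assume z: "z \<in> carrier ?F" and dz: "d z = \<zero>\<^bsub>?F\<^esub>"
    \<comment> \<open>The component at \<open>{}\<close> is no part of any boundary that occurs, and \<open>u {}\<close> is zero.\<close>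
    define z' where "z' = z({} := \<zero>\<^bsub>R\<^esub>)"
    have z': "z' \<in> Pow T \<rightarrow> carrier R" using zc[OF z] by (auto simp: z'_def)
    have "bd R x T ?s z' \<nu> = \<zero>\<^bsub>R\<^esub>" if "\<nu> \<subseteq> T" for \<nu>
    proof -
      have "bd R x T ?s z' \<nu> = d z \<nu>" using that by (simp add: d_def bd_def z'_def)
      then show ?thesis using dz that by (simp add: free_module_simps)
    qed
    from proregular[OF z' _ this] obtain w where w: "w \<in> Pow T \<rightarrow> carrier R"
      "\<And>\<mu>. \<mu> \<subseteq> T \<Longrightarrow> bd R x T s w \<mu> = ?y \<mu> \<otimes>\<^bsub>R\<^esub> z' \<mu>"
      by (auto simp: z'_def)
    have "g z = (\<Oplus>\<^bsub>I\<^esub>\<mu>\<in>Pow T. bd R x T s w \<mu> \<odot>\<^bsub>I\<^esub> u \<mu>)"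
      unfolding g_def
    proof (intro M.finsum_cong' refl)
      fix \<mu> assume "\<mu> \<in> Pow T"
      then have \<mu>: "\<mu> \<subseteq> T" by simp
      have "z' \<mu> \<in> carrier R" using z' \<mu> by auto
      then have "bd R x T s w \<mu> \<in> carrier R" using y[OF \<mu>] by (simp add: w(2)[OF \<mu>])
      then show "(?y \<mu> \<otimes>\<^bsub>R\<^esub> z \<mu>) \<odot>\<^bsub>I\<^esub> u \<mu> = bd R x T s w \<mu> \<odot>\<^bsub>I\<^esub> u \<mu>"
        using y[OF \<mu>] zc[OF z \<mu>] u0 w(2)[OF \<mu>] by (cases "\<mu> = {}") (auto simp: z'_def)
    next
      show "(\<lambda>\<mu>. bd R x T s w \<mu> \<odot>\<^bsub>I\<^esub> u \<mu>) \<in> Pow T \<rightarrow> carrier I"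
      proof
        fix \<mu> assume "\<mu> \<in> Pow T"
        then have "z' \<mu> \<in> carrier R" "\<mu> \<subseteq> T" using z' by auto
        then show "bd R x T s w \<mu> \<odot>\<^bsub>I\<^esub> u \<mu> \<in> carrier I" using y uc by (simp add: w(2))
      qed
    qed
    also have "\<dots> = (\<Oplus>\<^bsub>I\<^esub>\<mu>\<in>Pow T. w \<mu> \<odot>\<^bsub>I\<^esub> cobd R I x s u \<mu>)"
      by (rule bd_cobd_adjoint[OF w(1) u])
    also have "\<dots> = \<zero>\<^bsub>I\<^esub>"
    proof (intro M.add.finprod_one_eqI)
      fix \<mu> assume "\<mu> \<in> Pow T"
      then have "w \<mu> \<in> carrier R" "\<mu> \<subseteq> T" using w(1) by auto
      then show "w \<mu> \<odot>\<^bsub>I\<^esub> cobd R I x s u \<mu> = \<zero>\<^bsub>I\<^esub>" by (simp add: ucc)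
    qed
    finally show "g z = \<zero>\<^bsub>I\<^esub>" .
  qed
  then obtain h where h: "h \<in> mod_hom R ?F I" "\<And>z. z \<in> carrier ?F \<Longrightarrow> h (d z) = g z" by blast
  define b where "b \<mu> = (\<lambda>\<nu>\<in>Pow T. if \<mu> = \<nu> then \<one>\<^bsub>R\<^esub> else \<zero>\<^bsub>R\<^esub>)" for \<mu>
  have b: "b \<mu> \<in> carrier ?F" for \<mu> by (auto simp: b_def free_module_simps)
  define v where "v \<mu> = h (b \<mu>)" for \<mu>
  have v: "v \<in> Pow T \<rightarrow> carrier I" using mod_hom_closed[OF h(1) b] by (auto simp: v_def)
  have "level_up R I x (t s) u \<mu> = cobd R I x ?s v \<mu>" if \<mu>: "\<mu> \<subseteq> T" for \<mu>
  proof -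
    have db: "d (b \<mu>) = finsum ?F (\<lambda>j. (ksign R j \<mu> \<otimes>\<^bsub>R\<^esub> x j [^]\<^bsub>R\<^esub> ?s) \<odot>\<^bsub>?F\<^esub> b (\<mu> - {j})) \<mu>"
    proof -
      have c: "(ksign R j \<mu> \<otimes>\<^bsub>R\<^esub> x j [^]\<^bsub>R\<^esub> ?s) \<odot>\<^bsub>?F\<^esub> b (\<mu> - {j}) \<in> carrier ?F" if "j \<in> \<mu>" for j
        using that \<mu> b coeff_closed by (intro F.smult_closed) auto
      have "bd R x T ?s (b \<mu>) \<nu> = (\<Oplus>\<^bsub>R\<^esub>j\<in>\<mu>. ((ksign R j \<mu> \<otimes>\<^bsub>R\<^esub> x j [^]\<^bsub>R\<^esub> ?s) \<odot>\<^bsub>?F\<^esub> b (\<mu> - {j})) \<nu>)"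
        if \<nu>: "\<nu> \<subseteq> T" for \<nu>
        unfolding bd_def
      proof (rule R.add.finprod_mono_neutral_cong)
        show "finite (T - \<nu>)" "finite \<mu>" using T finite_subset_T[OF \<mu>] by auto
        show "((ksign R j \<mu> \<otimes>\<^bsub>R\<^esub> x j [^]\<^bsub>R\<^esub> ?s) \<odot>\<^bsub>?F\<^esub> b (\<mu> - {j})) \<nu> = \<zero>\<^bsub>R\<^esub>" if "j \<in> \<mu> - (T - \<nu>)" for j
        proof -
          have "\<mu> - {j} \<noteq> \<nu>" "j \<in> T" using that \<mu> by auto
          then show ?thesis using \<nu> coeff_closed[of j \<mu> ?s] by (simp add: b_def free_module_simps(4))
        qed
        show "ksign R j \<nu> \<otimes>\<^bsub>R\<^esub> (x j [^]\<^bsub>R\<^esub> ?s \<otimes>\<^bsub>R\<^esub> b \<mu> (insert j \<nu>)) = \<zero>\<^bsub>R\<^esub>" if "j \<in> T - \<nu> - \<mu>" for j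
        proof -
          have "\<mu> \<noteq> insert j \<nu>" "j \<in> T" "insert j \<nu> \<subseteq> T" using that \<nu> by auto
          then show ?thesis using xs[of j ?s] by (simp add: b_def)
        qed
        show "ksign R j \<nu> \<otimes>\<^bsub>R\<^esub> (x j [^]\<^bsub>R\<^esub> ?s \<otimes>\<^bsub>R\<^esub> b \<mu> (insert j \<nu>)) =
            ((ksign R j \<mu> \<otimes>\<^bsub>R\<^esub> x j [^]\<^bsub>R\<^esub> ?s) \<odot>\<^bsub>?F\<^esub> b (\<mu> - {j})) \<nu>" if "j \<in> (T - \<nu>) \<inter> \<mu>" for j
        proof -
          have e: "\<mu> = insert j \<nu> \<longleftrightarrow> \<mu> - {j} = \<nu>" and jT: "j \<in> T" "insert j \<nu> \<subseteq> T" using that \<nu> by auto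
          show ?thesis
            using e jT xs[of j ?s] \<nu> by (cases "\<mu> = insert j \<nu>") (auto simp: b_def free_module_simps(4))
        qed
        show "(\<lambda>j. ksign R j \<nu> \<otimes>\<^bsub>R\<^esub> (x j [^]\<^bsub>R\<^esub> ?s \<otimes>\<^bsub>R\<^esub> b \<mu> (insert j \<nu>))) \<in> T - \<nu> \<rightarrow> carrier R"
          using bdterm[OF b] \<nu> by auto
        show "(\<lambda>j. ((ksign R j \<mu> \<otimes>\<^bsub>R\<^esub> x j [^]\<^bsub>R\<^esub> ?s) \<odot>\<^bsub>?F\<^esub> b (\<mu> - {j})) \<nu>) \<in> \<mu> \<rightarrow> carrier R"
          using zc[OF c \<nu>] by auto
      qed
      then show ?thesis
        using c finite_subset_T[OF \<mu>] by (subst R.free_module_finsum) (auto simp: d_def intro!: restrict_ext)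
    qed
    have "level_up R I x (t s) u \<mu> = g (b \<mu>)"
    proof -
      have "g (b \<mu>) = (\<Oplus>\<^bsub>I\<^esub>\<nu>\<in>Pow T. if \<mu> = \<nu> then ?y \<nu> \<odot>\<^bsub>I\<^esub> u \<nu> else \<zero>\<^bsub>I\<^esub>)"
        unfolding g_def using y uc by (intro M.finsum_cong' refl) (auto simp: b_def)
      also have "\<dots> = ?y \<mu> \<odot>\<^bsub>I\<^esub> u \<mu>"
        using \<mu> T y uc by (intro M.finsum_singleton) auto
      finally show ?thesis by (simp add: level_up_def)
    qed
    also have "\<dots> = h (d (b \<mu>))" using h(2)[OF b] by simp
    also have "\<dots> = (\<Oplus>\<^bsub>I\<^esub>j\<in>\<mu>. h ((ksign R j \<mu> \<otimes>\<^bsub>R\<^esub> x j [^]\<^bsub>R\<^esub> ?s) \<odot>\<^bsub>?F\<^esub> b (\<mu> - {j})))"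
      unfolding db using finite_subset_T[OF \<mu>] \<mu> coeff_closed b
      by (intro mod_hom_finsum[OF F Im h(1)]) (auto intro!: F.smult_closed)
    also have "\<dots> = cobd R I x ?s v \<mu>"
      unfolding cobd_def
    proof (intro M.finsum_cong' refl)
      fix j assume "j \<in> \<mu>"
      then have "j \<in> T" using \<mu> by auto
      then show "h ((ksign R j \<mu> \<otimes>\<^bsub>R\<^esub> x j [^]\<^bsub>R\<^esub> ?s) \<odot>\<^bsub>?F\<^esub> b (\<mu> - {j})) =
          (ksign R j \<mu> \<otimes>\<^bsub>R\<^esub> x j [^]\<^bsub>R\<^esub> ?s) \<odot>\<^bsub>I\<^esub> v (\<mu> - {j})"
        unfolding v_def by (intro mod_hom_smult[OF h(1)] coeff_closed b)
    qed (use \<mu> in \<open>auto intro!: cobd_term_closed[OF v]\<close>)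
    finally show ?thesis .
  qed
  then show "\<exists>t. \<exists>v\<in>Pow T \<rightarrow> carrier I. \<forall>\<mu>\<subseteq>T. level_up R I x t u \<mu> = cobd R I x (s + t) v \<mu>"
    using v by blast
qed

text \<open>A finite set is coded by a natural number, and a family of ring elements by its graph.\<close>

lemma finite_families_embed:
  assumes "finite T"
  shows "inj_on (\<lambda>z (n, a). if z (set_decode n) = a then Inl 1 else Inl 0 :: nat + 'm)
    (Pow T \<rightarrow>\<^sub>E (C :: 'a set))"
proof (rule inj_onI)
  fix z z' :: "nat set \<Rightarrow> 'a"
  assume z: "z \<in> Pow T \<rightarrow>\<^sub>E C" "z' \<in> Pow T \<rightarrow>\<^sub>E C"
    and eq: "(\<lambda>(n, a). if z (set_decode n) = a then Inl 1 else Inl 0 :: nat + 'm) =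
      (\<lambda>(n, a). if z' (set_decode n) = a then Inl 1 else Inl 0)"
  show "z = z'"
  proof
    fix \<mu>
    show "z \<mu> = z' \<mu>"
    proof (cases "\<mu> \<subseteq> T")
      case True
      then have "set_decode (set_encode \<mu>) = \<mu>" using assms by (meson finite_subset set_encode_inverse)
      then show ?thesis
        using fun_cong[OF eq, of "(set_encode \<mu>, z \<mu>)"] by (auto split: if_splits)
    next
      case False
      then show ?thesis using z by (auto simp: PiE_def extensional_def)
    qed
  qed
qed

text \<open>Arbitrary generators \<open>x\<^sub>i\<close> (\<open>i \<in> T\<close>) and monomial generators \<open>x\<^sub>i\<close> (\<open>i \<in> T'\<close>) of the same ideal: add the
  former to the latter one at a time, then drop the latter.\<close>

lemma koszul_acyclic_change_generators:
  assumes M: "module R M" and fin: "finite T" "finite T'" and x: "x \<in> T \<union> T' \<rightarrow> carrier R"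
    and sub: "x ` T \<subseteq> genideal R (x ` T')" "x ` T' \<subseteq> genideal R (x ` T)"
    and acyclic: "koszul_acyclic R M x T'"
  shows "koszul_acyclic R M x T"
proof -
  interpret module R M by fact
  have mono: "genideal R A1 \<subseteq> genideal R A2" if "A1 \<subseteq> A2" "A2 \<subseteq> x ` (T \<union> T')" for A1 A2
    using that x R.genideal_self[of A2] by (intro R.genideal_minimal R.genideal_ideal) auto
  have step: "cochains_insert R M x U j \<and> (\<forall>s::nat. \<exists>N::nat. \<exists>r \<in> U \<rightarrow> carrier R.
      x j [^]\<^bsub>R\<^esub> N = (\<Oplus>\<^bsub>R\<^esub>i\<in>U. r i \<otimes>\<^bsub>R\<^esub> x i [^]\<^bsub>R\<^esub> s))"
    if U: "U \<subseteq> T \<union> T'" "j \<in> T \<union> T'" "j \<notin> U" "x j \<in> genideal R (x ` U)" for U j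
  proof -
    have "finite U" "x \<in> U \<rightarrow> carrier R" using U fin x finite_subset by auto
    then show ?thesis
      using U x R.power_eq_combination[of U x "x j"] M
      by (auto simp: cochains_insert_def cochains_def cochains_insert_axioms_def cochains_axioms_def)
  qed
  have "finite F \<Longrightarrow> F \<subseteq> T \<Longrightarrow> koszul_acyclic R M x (F \<union> T')" for F
  proof (induction F rule: finite_induct)
    case (insert j F)
    show ?case
    proof (cases "j \<in> T'")
      case False
      have "x j \<in> genideal R (x ` (F \<union> T'))"
        using insert.prems sub(1) mono[of "x ` T'" "x ` (F \<union> T')"] by auto
      with False insert.hyps insert.prems
      have "cochains_insert R M x (F \<union> T') j \<and> (\<forall>s::nat. \<exists>N::nat. \<exists>r \<in> F \<union> T' \<rightarrow> carrier R.
          x j [^]\<^bsub>R\<^esub> N = (\<Oplus>\<^bsub>R\<^esub>i\<in>F \<union> T'. r i \<otimes>\<^bsub>R\<^esub> x i [^]\<^bsub>R\<^esub> s))" by (intro step) auto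
      then show ?thesis
        using cochains_insert.koszul_acyclic_add[of R M x "F \<union> T'" j] insert by auto
    qed (use insert in \<open>auto simp: insert_absorb\<close>)
  qed (use acyclic in simp)
  from this[OF fin(1)] have all: "koszul_acyclic R M x (T \<union> T')" by simp
  have "finite F \<Longrightarrow> F \<subseteq> T' \<Longrightarrow> koszul_acyclic R M x (T \<union> F) \<Longrightarrow> koszul_acyclic R M x T" for F
  proof (induction F rule: finite_induct)
    case (insert j F)
    show ?case
    proof (cases "j \<in> T")
      case False
      have "x j \<in> genideal R (x ` (T \<union> F))"
        using insert.prems sub(2) mono[of "x ` T" "x ` (T \<union> F)"] by auto
      with False insert.hyps insert.prems
      have "cochains_insert R M x (T \<union> F) j \<and> (\<forall>s::nat. \<exists>N::nat. \<exists>r \<in> T \<union> F \<rightarrow> carrier R.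
          x j [^]\<^bsub>R\<^esub> N = (\<Oplus>\<^bsub>R\<^esub>i\<in>T \<union> F. r i \<otimes>\<^bsub>R\<^esub> x i [^]\<^bsub>R\<^esub> s))" by (intro step) auto
      then have "koszul_acyclic R M x (T \<union> F)"
        using cochains_insert.koszul_acyclic_drop[of R M x "T \<union> F" j] insert.prems by auto
      then show ?thesis using insert by auto
    qed (use insert in \<open>auto simp: insert_absorb\<close>)
  qed simp
  from this[OF fin(2) _ all] show ?thesis by simp
qed


section \<open>Enough injective modules\<close>

subsection \<open>Divisible groups\<close>

definition divisible :: "('d, 'x) monoid_scheme \<Rightarrow> bool" where
  "divisible D \<longleftrightarrow> (\<forall>n>0. \<forall>d\<in>carrier D. \<exists>e\<in>carrier D. e [^]\<^bsub>D\<^esub> (n::nat) = d)"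

text \<open>Zorn's lemma is applied to graphs: subgroups \<open>G\<close> of \<open>A \<times> D\<close> that contain no \<open>(1, d)\<close> with \<open>d \<noteq> 1\<close>.
  If \<open>n\<close> is not in the domain of a maximal graph, the \<open>k\<close> with \<open>n\<^sup>k\<close> in the domain form an ideal
  \<open>k\<^sub>0\<int>\<close>, and a \<open>k\<^sub>0\<close>-th root of the value at \<open>n\<^sup>k\<^sup>0\<close> is a possible value at \<open>n\<close>.\<close>

lemma divisible_extend:
  fixes A :: "('n, 'x) monoid_scheme" and D :: "('d, 'y) monoid_scheme"
  assumes A: "comm_group A" and D: "comm_group D" and div: "divisible D"
    and H: "subgroup H A"
    and f: "\<And>a. a \<in> H \<Longrightarrow> f a \<in> carrier D"
    and f_mult: "\<And>a b. a \<in> H \<Longrightarrow> b \<in> H \<Longrightarrow> f (a \<otimes>\<^bsub>A\<^esub> b) = f a \<otimes>\<^bsub>D\<^esub> f b"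
  shows "\<exists>h \<in> hom A D. \<forall>a\<in>H. h a = f a"
proof -
  interpret A: comm_group A by fact
  interpret D: comm_group D by fact
  interpret H: subgroup H A by fact
  let ?P = "A \<times>\<times> D"
  interpret P: group ?P by (intro DirProd_group A.group_axioms D.group_axioms)
  have one: "\<one>\<^bsub>?P\<^esub> = (\<one>\<^bsub>A\<^esub>, \<one>\<^bsub>D\<^esub>)" by (simp add: DirProd_def)
  have car: "carrier ?P = carrier A \<times> carrier D" by (simp add: DirProd_def)
  have pow: "(a, d) [^]\<^bsub>?P\<^esub> (k::int) = (a [^]\<^bsub>A\<^esub> k, d [^]\<^bsub>D\<^esub> k)" if "a \<in> carrier A" "d \<in> carrier D" for a d k
  proof -
    have "fst \<in> hom ?P A" "snd \<in> hom ?P D" by (auto simp: hom_def DirProd_def)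
    moreover have "(a, d) \<in> carrier ?P" using that by (simp add: car)
    ultimately show ?thesis
      using hom_int_pow[of fst ?P A "(a, d)" k] hom_int_pow[of snd ?P D "(a, d)" k]
        P.group_axioms A.group_axioms D.group_axioms by (simp add: prod_eq_iff)
  qed
  define good where "good = {G. subgroup G ?P \<and> (\<forall>d. (\<one>\<^bsub>A\<^esub>, d) \<in> G \<longrightarrow> d = \<one>\<^bsub>D\<^esub>) \<and> (\<lambda>a. (a, f a)) ` H \<subseteq> G}"
  have f1: "f \<one>\<^bsub>A\<^esub> = \<one>\<^bsub>D\<^esub>"
    using f_mult[of "\<one>\<^bsub>A\<^esub>" "\<one>\<^bsub>A\<^esub>"] f[of "\<one>\<^bsub>A\<^esub>"] D.l_cancel_one' by auto
  have finv: "f (inv\<^bsub>A\<^esub> a) = inv\<^bsub>D\<^esub> f a" if "a \<in> H" for a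
    using f_mult[of "inv\<^bsub>A\<^esub> a" a] f[of a] f[of "inv\<^bsub>A\<^esub> a"] that f1
    by (intro D.inv_equality[symmetric]) auto
  have "subgroup ((\<lambda>a. (a, f a)) ` H) ?P"
  proof (rule P.subgroupI)
    show "inv\<^bsub>?P\<^esub> p \<in> (\<lambda>a. (a, f a)) ` H" if "p \<in> (\<lambda>a. (a, f a)) ` H" for p
    proof -
      obtain a where a: "a \<in> H" "p = (a, f a)" using \<open>p \<in> _\<close> by auto
      then have "inv\<^bsub>?P\<^esub> p = (inv\<^bsub>A\<^esub> a, f (inv\<^bsub>A\<^esub> a))"
        using f by (simp add: inv_DirProd A.group_axioms D.group_axioms finv)
      then show ?thesis using a by auto
    qed
    show "(\<lambda>a. (a, f a)) ` H \<noteq> {}" using H.one_closed by blast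
  qed (use f f_mult in \<open>auto simp: car intro!: image_eqI\<close>)
  then have good0: "(\<lambda>a. (a, f a)) ` H \<in> good"
    using f1 by (auto simp: good_def)
  have "\<exists>G\<in>good. \<forall>G'\<in>good. G \<subseteq> G' \<longrightarrow> G' = G"
  proof (rule subset_Zorn_nonempty)
    show "good \<noteq> {}" using good0 by blast
    fix \<C> assume ne: "\<C> \<noteq> {}" and ch: "subset.chain good \<C>"
    have sub: "G \<in> good" if "G \<in> \<C>" for G using ch that by (auto simp: subset_chain_def)
    have tot: "G \<subseteq> G' \<or> G' \<subseteq> G" if "G \<in> \<C>" "G' \<in> \<C>" for G G'
      using ch that by (auto simp: subset_chain_def)
    have sg: "subgroup G ?P" if "G \<in> \<C>" for G using sub[OF that] by (simp add: good_def)
    have "subgroup (\<Union>\<C>) ?P"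
    proof (rule P.subgroupI)
      show "\<Union>\<C> \<subseteq> carrier ?P" using sg subgroup.subset by blast
      show "\<Union>\<C> \<noteq> {}" using ne sg subgroup.one_closed by blast
      show "inv\<^bsub>?P\<^esub> p \<in> \<Union>\<C>" if "p \<in> \<Union>\<C>" for p
      proof -
        obtain G where "G \<in> \<C>" "p \<in> G" using \<open>p \<in> \<Union>\<C>\<close> by blast
        then show ?thesis using subgroup.m_inv_closed[OF sg] by blast
      qed
      show "p \<otimes>\<^bsub>?P\<^esub> q \<in> \<Union>\<C>" if pq: "p \<in> \<Union>\<C>" "q \<in> \<Union>\<C>" for p q
      proof -
        obtain G G' where "G \<in> \<C>" "p \<in> G" "G' \<in> \<C>" "q \<in> G'" using pq by blast
        then obtain G'' where "G'' \<in> \<C>" "p \<in> G''" "q \<in> G''" using tot by blast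
        then show ?thesis using subgroup.m_closed[OF sg] by blast
      qed
    qed
    then show "\<Union>\<C> \<in> good" using sub ne unfolding good_def by blast
  qed
  then obtain G where G: "G \<in> good" and max: "\<And>G'. G' \<in> good \<Longrightarrow> G \<subseteq> G' \<Longrightarrow> G' = G" by blast
  interpret G: subgroup G ?P using G by (simp add: good_def)
  have Gc: "a \<in> carrier A" "d \<in> carrier D" if "(a, d) \<in> G" for a d
    using G.subset that by (auto simp: car)
  have Gm: "(a \<otimes>\<^bsub>A\<^esub> b, d \<otimes>\<^bsub>D\<^esub> e) \<in> G" if "(a, d) \<in> G" "(b, e) \<in> G" for a b d e
    using G.m_closed[OF that] by simp
  have Gi: "(inv\<^bsub>A\<^esub> a, inv\<^bsub>D\<^esub> d) \<in> G" if "(a, d) \<in> G" for a d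
    using G.m_inv_closed[OF that] Gc[OF that] by (simp add: inv_DirProd A.group_axioms D.group_axioms)
  have Gp: "(a [^]\<^bsub>A\<^esub> (k::int), d [^]\<^bsub>D\<^esub> k) \<in> G" if "(a, d) \<in> G" for a d k
    using P.subgroup_int_pow_closed[OF G.subgroup_axioms that] pow Gc[OF that] by simp
  have Gsv: "d = \<one>\<^bsub>D\<^esub>" if "(\<one>\<^bsub>A\<^esub>, d) \<in> G" for d using G that by (simp add: good_def)
  have Gfun: "d = e" if "(a, d) \<in> G" "(a, e) \<in> G" for a d e
  proof -
    have "d \<otimes>\<^bsub>D\<^esub> inv\<^bsub>D\<^esub> e = \<one>\<^bsub>D\<^esub>"
      using Gm[OF that(1) Gi[OF that(2)]] Gc[OF that(1)] by (intro Gsv) simp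
    then have "inv\<^bsub>D\<^esub> (inv\<^bsub>D\<^esub> e) = d"
      using Gc[OF that(1)] Gc[OF that(2)] by (intro D.inv_equality) auto
    then show ?thesis using Gc[OF that(2)] by simp
  qed
  have total: "n \<in> fst ` G" if n: "n \<in> carrier A" for n
  proof -
    define k0d where "k0d = {k::int. n [^]\<^bsub>A\<^esub> k \<in> fst ` G}"
    have kdiff: "k - l * q \<in> k0d" if "k \<in> k0d" "l \<in> k0d" for k l q
    proof -
      obtain d e where "(n [^]\<^bsub>A\<^esub> k, d) \<in> G" "(n [^]\<^bsub>A\<^esub> l, e) \<in> G"
        using \<open>k \<in> k0d\<close> \<open>l \<in> k0d\<close> by (auto simp: k0d_def)
      from Gm[OF this(1) Gi[OF Gp[OF this(2), of q]]]
      have "(n [^]\<^bsub>A\<^esub> (k - l * q), d \<otimes>\<^bsub>D\<^esub> inv\<^bsub>D\<^esub> (e [^]\<^bsub>D\<^esub> q)) \<in> G"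
        using n by (simp add: A.int_pow_pow A.int_pow_neg[symmetric] A.int_pow_mult[symmetric])
      then show ?thesis by (force simp: k0d_def)
    qed
    obtain k0 :: int where k0: "k0 \<in> k0d" and dvd: "\<And>k. k \<in> k0d \<Longrightarrow> k0 dvd k"
    proof (cases "\<exists>k\<in>k0d. k > 0")
      case True
      define k0 where "k0 = (LEAST k::nat. 0 < k \<and> int k \<in> k0d)"
      have ex: "\<exists>k::nat. 0 < k \<and> int k \<in> k0d"
        using True by (metis zero_less_imp_eq_int)
      have k0: "0 < k0" "int k0 \<in> k0d" using LeastI_ex[OF ex] by (auto simp: k0_def)
      have "int k0 dvd k" if "k \<in> k0d" for k
      proof (rule ccontr)
        assume nd: "\<not> int k0 dvd k"
        have "k mod int k0 = k - int k0 * (k div int k0)" by (simp add: minus_mult_div_eq_mod)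
        then have "k mod int k0 \<in> k0d" using kdiff[OF that k0(2)] by simp
        moreover have pos: "0 \<le> k mod int k0" "k mod int k0 < int k0" "k mod int k0 \<noteq> 0"
          using nd k0(1) by (auto simp: dvd_eq_mod_eq_0)
        ultimately have "0 < nat (k mod int k0) \<and> int (nat (k mod int k0)) \<in> k0d" by simp
        then have "k0 \<le> nat (k mod int k0)" unfolding k0_def by (rule Least_le)
        then show False using pos by simp
      qed
      then show ?thesis using that k0 by blast
    next
      case False
      have zero: "0 \<in> k0d" using G.one_closed by (force simp: k0d_def one image_iff)
      have "k = 0" if "k \<in> k0d" for k
      proof -
        have "- k \<in> k0d" using kdiff[OF zero that, of 1] by simp
        then have "\<not> 0 < - k" "\<not> 0 < k" using False that by blast+
        then show ?thesis by simp
      qed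
      then show ?thesis using zero that[of 0] by simp
    qed
    obtain c where c: "(n [^]\<^bsub>A\<^esub> k0, c) \<in> G" using k0 by (auto simp: k0d_def)
    have "\<exists>d\<in>carrier D. d [^]\<^bsub>D\<^esub> k0 = c"
    proof (cases k0 rule: int_cases3)
      case zero
      then have "c = \<one>\<^bsub>D\<^esub>" using c Gsv by simp
      then show ?thesis using zero by (intro bexI[of _ "\<one>\<^bsub>D\<^esub>"]) auto
    next
      case (pos m)
      then show ?thesis using div Gc[OF c] by (auto simp: divisible_def int_pow_int)
    next
      case (neg m)
      then obtain e where "e \<in> carrier D" "e [^]\<^bsub>D\<^esub> m = inv\<^bsub>D\<^esub> c"
        using div Gc[OF c] unfolding divisible_def by (metis D.inv_closed)
      then show ?thesis
        using neg Gc[OF c] by (intro bexI[of _ e]) (auto simp: D.int_pow_neg int_pow_int)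
    qed
    then obtain d where d: "d \<in> carrier D" "d [^]\<^bsub>D\<^esub> k0 = c" by blast
    define G' where "G' = {(a \<otimes>\<^bsub>A\<^esub> n [^]\<^bsub>A\<^esub> (k::int), b \<otimes>\<^bsub>D\<^esub> d [^]\<^bsub>D\<^esub> k) | a b k. (a, b) \<in> G}"
    have GG': "G \<subseteq> G'"
    proof
      fix p assume "p \<in> G"
      then show "p \<in> G'" unfolding G'_def using Gc[of "fst p" "snd p"]
        by (auto intro!: exI[of _ "fst p"] exI[of _ "snd p"] exI[of _ "0::int"])
    qed
    have "subgroup G' ?P"
    proof (rule P.subgroupI)
      show "G' \<subseteq> carrier ?P" using Gc n d by (auto simp: G'_def car)
      show "G' \<noteq> {}" using GG' G.one_closed by blast
      show "inv\<^bsub>?P\<^esub> p \<in> G'" if "p \<in> G'" for p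
      proof -
        obtain a b k where p: "p = (a \<otimes>\<^bsub>A\<^esub> n [^]\<^bsub>A\<^esub> (k::int), b \<otimes>\<^bsub>D\<^esub> d [^]\<^bsub>D\<^esub> k)" "(a, b) \<in> G"
          using \<open>p \<in> G'\<close> by (auto simp: G'_def)
        have "inv\<^bsub>?P\<^esub> p = (inv\<^bsub>A\<^esub> a \<otimes>\<^bsub>A\<^esub> n [^]\<^bsub>A\<^esub> (- k), inv\<^bsub>D\<^esub> b \<otimes>\<^bsub>D\<^esub> d [^]\<^bsub>D\<^esub> (- k))"
          using p Gc[OF p(2)] n d
          by (simp add: inv_DirProd A.group_axioms D.group_axioms A.inv_mult D.inv_mult A.int_pow_neg D.int_pow_neg)
        then show ?thesis using Gi[OF p(2)] by (auto simp: G'_def)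
      qed
      show "p \<otimes>\<^bsub>?P\<^esub> q \<in> G'" if "p \<in> G'" "q \<in> G'" for p q
      proof -
        obtain a b k where p: "p = (a \<otimes>\<^bsub>A\<^esub> n [^]\<^bsub>A\<^esub> (k::int), b \<otimes>\<^bsub>D\<^esub> d [^]\<^bsub>D\<^esub> k)" "(a, b) \<in> G"
          using \<open>p \<in> G'\<close> by (auto simp: G'_def)
        obtain a' b' k' where q: "q = (a' \<otimes>\<^bsub>A\<^esub> n [^]\<^bsub>A\<^esub> (k'::int), b' \<otimes>\<^bsub>D\<^esub> d [^]\<^bsub>D\<^esub> k')" "(a', b') \<in> G"
          using \<open>q \<in> G'\<close> by (auto simp: G'_def)
        have "p \<otimes>\<^bsub>?P\<^esub> q = ((a \<otimes>\<^bsub>A\<^esub> a') \<otimes>\<^bsub>A\<^esub> n [^]\<^bsub>A\<^esub> (k + k'), (b \<otimes>\<^bsub>D\<^esub> b') \<otimes>\<^bsub>D\<^esub> d [^]\<^bsub>D\<^esub> (k + k'))"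
          using p q Gc[OF p(2)] Gc[OF q(2)] n d
          by (simp add: A.int_pow_mult D.int_pow_mult A.m_ac D.m_ac)
        then show ?thesis using Gm[OF p(2) q(2)] by (auto simp: G'_def)
      qed
    qed
    moreover have "\<delta> = \<one>\<^bsub>D\<^esub>" if "(\<one>\<^bsub>A\<^esub>, \<delta>) \<in> G'" for \<delta>
    proof -
      obtain a b k where p: "\<one>\<^bsub>A\<^esub> = a \<otimes>\<^bsub>A\<^esub> n [^]\<^bsub>A\<^esub> (k::int)" "\<delta> = b \<otimes>\<^bsub>D\<^esub> d [^]\<^bsub>D\<^esub> k" "(a, b) \<in> G"
        using \<open>(\<one>\<^bsub>A\<^esub>, \<delta>) \<in> G'\<close> by (auto simp: G'_def)
      have "inv\<^bsub>A\<^esub> (n [^]\<^bsub>A\<^esub> k) = a"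
        by (rule A.inv_equality) (use p(1) n Gc[OF p(3)] in auto)
      then have nk: "n [^]\<^bsub>A\<^esub> k = inv\<^bsub>A\<^esub> a"
        using n A.inv_inv[of "n [^]\<^bsub>A\<^esub> k"] by simp
      then have *: "(n [^]\<^bsub>A\<^esub> k, inv\<^bsub>D\<^esub> b) \<in> G" using Gi[OF p(3)] by simp
      then have "k \<in> k0d" by (force simp: k0d_def)
      then obtain q where q: "k = k0 * q" using dvd by blast
      have "(n [^]\<^bsub>A\<^esub> k, d [^]\<^bsub>D\<^esub> k) \<in> G"
        using Gp[OF c, of q] A.int_pow_pow[OF n, of k0 q] D.int_pow_pow[OF d(1), of k0 q]
        unfolding q d(2) by simp
      then have "d [^]\<^bsub>D\<^esub> k = inv\<^bsub>D\<^esub> b" using Gfun * by blast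
      then show ?thesis using p(2) Gc[OF p(3)] by simp
    qed
    moreover have "(\<lambda>a. (a, f a)) ` H \<subseteq> G'" using G GG' by (auto simp: good_def)
    ultimately have "G' \<in> good" by (simp add: good_def)
    then have "G' = G" using max GG' by blast
    moreover have "(\<one>\<^bsub>A\<^esub> \<otimes>\<^bsub>A\<^esub> n [^]\<^bsub>A\<^esub> (1::int), \<one>\<^bsub>D\<^esub> \<otimes>\<^bsub>D\<^esub> d [^]\<^bsub>D\<^esub> (1::int)) \<in> G'"
      unfolding G'_def using G.one_closed[unfolded one]
      by (intro CollectI exI[of _ "\<one>\<^bsub>A\<^esub>"] exI[of _ "\<one>\<^bsub>D\<^esub>"] exI[of _ "1::int"] conjI refl)
    ultimately have "(n, d) \<in> G" using n d by (simp add: A.int_pow_1 D.int_pow_1)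
    then show ?thesis by force
  qed
  define h where "h a = (THE d. (a, d) \<in> G)" for a
  have h: "h a = d" if "(a, d) \<in> G" for a d
    unfolding h_def using that Gfun by blast
  have hG: "(a, h a) \<in> G" if "a \<in> carrier A" for a
    using total[OF that] h by auto
  have "h \<in> hom A D"
  proof (rule homI)
    show "h a \<in> carrier D" if "a \<in> carrier A" for a using Gc(2)[OF hG[OF that]] .
    show "h (a \<otimes>\<^bsub>A\<^esub> b) = h a \<otimes>\<^bsub>D\<^esub> h b" if "a \<in> carrier A" "b \<in> carrier A" for a b
      by (rule h[OF Gm[OF hG[OF that(1)] hG[OF that(2)]]])
  qed
  moreover have "h a = f a" if "a \<in> H" for a
    using G that by (intro h) (auto simp: good_def)
  ultimately show ?thesis by blast
qed

text \<open>The group of finite formal sums of elements of \<open>A\<close> with rational coefficients, and its subgroup of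
  integral sums with value in \<open>H\<close>.  The quotient is divisible and contains \<open>A / H\<close>.\<close>

definition rat_sums :: "('m, 'x) monoid_scheme \<Rightarrow> ('m \<Rightarrow> rat) monoid" where
  "rat_sums A = \<lparr>carrier = {f. finite {m. f m \<noteq> 0} \<and> {m. f m \<noteq> 0} \<subseteq> carrier A},
     monoid.mult = (\<lambda>f g m. f m + g m), monoid.one = (\<lambda>m. 0)\<rparr>"

definition sum_value :: "('m, 'x) monoid_scheme \<Rightarrow> ('m \<Rightarrow> rat) \<Rightarrow> 'm" where
  "sum_value A f = finprod A (\<lambda>m. m [^]\<^bsub>A\<^esub> \<lfloor>f m\<rfloor>) {m. f m \<noteq> 0}"

definition relations :: "('m, 'x) monoid_scheme \<Rightarrow> 'm set \<Rightarrow> ('m \<Rightarrow> rat) set" where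
  "relations A H = {f \<in> carrier (rat_sums A). (\<forall>m. f m \<in> \<int>) \<and> sum_value A f \<in> H}"

lemma rat_sums_group: "comm_group (rat_sums A)"
proof (rule comm_groupI)
  fix f g assume fg: "f \<in> carrier (rat_sums A)" "g \<in> carrier (rat_sums A)"
  have "{m. f m + g m \<noteq> 0} \<subseteq> {m. f m \<noteq> 0} \<union> {m. g m \<noteq> 0}" by auto
  then show "f \<otimes>\<^bsub>rat_sums A\<^esub> g \<in> carrier (rat_sums A)"
    using fg by (auto simp: rat_sums_def intro: finite_subset)
next
  fix f assume "f \<in> carrier (rat_sums A)"
  then show "\<exists>g\<in>carrier (rat_sums A). g \<otimes>\<^bsub>rat_sums A\<^esub> f = \<one>\<^bsub>rat_sums A\<^esub>"
    by (intro bexI[of _ "\<lambda>m. - f m"]) (auto simp: rat_sums_def)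
qed (auto simp: rat_sums_def)

context comm_group
begin

interpretation F: comm_group "rat_sums G" by (rule rat_sums_group)

lemma rat_sums_inv: "f \<in> carrier (rat_sums G) \<Longrightarrow> inv\<^bsub>rat_sums G\<^esub> f = (\<lambda>m. - f m)"
  by (rule F.inv_equality) (auto simp: rat_sums_def)

lemma rat_sums_pow: "f \<in> carrier (rat_sums G) \<Longrightarrow> f [^]\<^bsub>rat_sums G\<^esub> (n::nat) = (\<lambda>m. of_nat n * f m)"
  by (induction n) (auto simp: rat_sums_def fun_eq_iff algebra_simps)

lemma sum_value_superset:
  assumes "f \<in> carrier (rat_sums G)" "finite B" "{m. f m \<noteq> 0} \<subseteq> B" "B \<subseteq> carrier G"
  shows "sum_value G f = finprod G (\<lambda>m. m [^] \<lfloor>f m\<rfloor>) B"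
  unfolding sum_value_def using assms by (intro finprod_mono_neutral_cong_left) auto

lemma sum_value_closed: "f \<in> carrier (rat_sums G) \<Longrightarrow> sum_value G f \<in> carrier G"
  unfolding sum_value_def by (intro finprod_closed) (auto simp: rat_sums_def)

lemma sum_value_add:
  assumes f: "f \<in> carrier (rat_sums G)" "\<And>m. f m \<in> \<int>" and g: "g \<in> carrier (rat_sums G)" "\<And>m. g m \<in> \<int>"
  shows "sum_value G (\<lambda>m. f m + g m) = sum_value G f \<otimes> sum_value G g"
proof -
  let ?B = "{m. f m \<noteq> 0} \<union> {m. g m \<noteq> 0}"
  have B: "finite ?B" "?B \<subseteq> carrier G" using f g by (auto simp: rat_sums_def)
  have fg: "(\<lambda>m. f m + g m) \<in> carrier (rat_sums G)" using F.m_closed[OF f(1) g(1)] by (simp add: rat_sums_def)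
  have "\<lfloor>f m + g m\<rfloor> = \<lfloor>f m\<rfloor> + \<lfloor>g m\<rfloor>" for m using f(2)[of m] g(2)[of m] by (auto elim!: Ints_cases)
  then have "finprod G (\<lambda>m. m [^] \<lfloor>f m + g m\<rfloor>) ?B = finprod G (\<lambda>m. m [^] \<lfloor>f m\<rfloor> \<otimes> m [^] \<lfloor>g m\<rfloor>) ?B"
    using B by (intro finprod_cong') (auto simp: int_pow_mult)
  also have "\<dots> = finprod G (\<lambda>m. m [^] \<lfloor>f m\<rfloor>) ?B \<otimes> finprod G (\<lambda>m. m [^] \<lfloor>g m\<rfloor>) ?B"
    using B by (intro finprod_multf) auto
  moreover have "{m. f m + g m \<noteq> 0} \<subseteq> ?B" by auto
  ultimately show ?thesis
    using sum_value_superset[OF fg B(1) _ B(2)] sum_value_superset[OF f(1) B(1) _ B(2)]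
      sum_value_superset[OF g(1) B(1) _ B(2)] by auto
qed

lemma sum_value_neg:
  assumes f: "f \<in> carrier (rat_sums G)" "\<And>m. f m \<in> \<int>"
  shows "sum_value G (\<lambda>m. - f m) = inv sum_value G f"
proof -
  have n: "(\<lambda>m. - f m) \<in> carrier (rat_sums G)" using f(1) by (simp add: rat_sums_def)
  have "sum_value G (\<lambda>m. - f m) \<otimes> sum_value G f = \<one>"
    using sum_value_add[OF n _ f] f(2) by (simp add: sum_value_def)
  then show ?thesis
    using sum_value_closed[OF n] sum_value_closed[OF f(1)] by (intro inv_equality[symmetric])
qed

definition unit_sum :: "'a \<Rightarrow> 'a \<Rightarrow> rat" where
  "unit_sum a = (\<lambda>m. if m = a then 1 else 0)"

lemma unit_sum: "a \<in> carrier G \<Longrightarrow> unit_sum a \<in> carrier (rat_sums G)" "unit_sum a m \<in> \<int>"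
  "a \<in> carrier G \<Longrightarrow> sum_value G (unit_sum a) = a"
  by (auto simp: unit_sum_def rat_sums_def sum_value_def)

lemma relations_subgroup:
  assumes "subgroup H G"
  shows "subgroup (relations G H) (rat_sums G)"
proof (rule F.subgroupI)
  interpret H: subgroup H G by fact
  have "(\<lambda>m. 0) \<in> relations G H" by (auto simp: relations_def rat_sums_def sum_value_def)
  then show "relations G H \<noteq> {}" by blast
  show "inv\<^bsub>rat_sums G\<^esub> f \<in> relations G H" if "f \<in> relations G H" for f
    using that F.inv_closed[of f] by (auto simp: relations_def rat_sums_inv sum_value_neg)
  show "f \<otimes>\<^bsub>rat_sums G\<^esub> g \<in> relations G H" if "f \<in> relations G H" "g \<in> relations G H" for f g
    using that F.m_closed[of f g] sum_value_add[of f g]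
    by (auto simp: relations_def) (auto simp: rat_sums_def)
qed (auto simp: relations_def)

lemma divisible_hull:
  assumes H: "subgroup H G"
  defines "D \<equiv> rat_sums G Mod relations G H"
  shows "comm_group D" "divisible D"
    "\<exists>j \<in> hom G D. \<forall>a\<in>carrier G. j a = \<one>\<^bsub>D\<^esub> \<longleftrightarrow> a \<in> H"
proof -
  let ?K = "relations G H"
  let ?\<pi> = "\<lambda>f. ?K #>\<^bsub>rat_sums G\<^esub> f"
  have K: "subgroup ?K (rat_sums G)" by (rule relations_subgroup[OF H])
  show D: "comm_group D" unfolding D_def by (rule F.abelian_FactGroup[OF K])
  interpret D: comm_group D by (rule D)
  have N: "normal ?K (rat_sums G)" using F.subgroup_imp_normal[OF K] .
  have \<pi>: "?\<pi> \<in> hom (rat_sums G) D" unfolding D_def by (rule normal.r_coset_hom_Mod[OF N])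
  interpret \<pi>: group_hom "rat_sums G" D ?\<pi>
    by (intro group_hom.intro F.group_axioms D.group_axioms group_hom_axioms.intro \<pi>)
  have ker: "?\<pi> f = \<one>\<^bsub>D\<^esub> \<longleftrightarrow> f \<in> ?K" if "f \<in> carrier (rat_sums G)" for f
    using F.coset_join1[OF _ that K] F.coset_join2[OF that K] by (auto simp: D_def FactGroup_def)
  show "divisible D"
    unfolding divisible_def
  proof (intro allI impI ballI)
    fix n :: nat and y assume n: "n > 0" and "y \<in> carrier D"
    then obtain f where f: "f \<in> carrier (rat_sums G)" "y = ?\<pi> f" by (auto simp: D_def FactGroup_def RCOSETS_def)
    define g where "g = (\<lambda>m. f m / of_nat n)"
    have g: "g \<in> carrier (rat_sums G)" using f n by (auto simp: g_def rat_sums_def)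
    have "g [^]\<^bsub>rat_sums G\<^esub> n = f" unfolding rat_sums_pow[OF g] using n by (simp add: g_def)
    then show "\<exists>e\<in>carrier D. e [^]\<^bsub>D\<^esub> n = y"
      using \<pi>.hom_nat_pow[OF g, of n] f(2) \<pi>.hom_closed[OF g] by metis
  qed
  define j where "j a = ?\<pi> (unit_sum a)" for a
  have "j \<in> hom G D"
  proof (rule homI)
    show "j a \<in> carrier D" if "a \<in> carrier G" for a unfolding j_def using unit_sum(1)[OF that] by simp
    fix a b assume ab: "a \<in> carrier G" "b \<in> carrier G"
    define f where "f = unit_sum a \<otimes>\<^bsub>rat_sums G\<^esub> unit_sum b"
    define g where "g = inv\<^bsub>rat_sums G\<^esub> unit_sum (a \<otimes> b)"
    have c: "f \<in> carrier (rat_sums G)" "g \<in> carrier (rat_sums G)"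
      using ab unit_sum(1) by (auto simp: f_def g_def)
    have fe: "f = (\<lambda>m. unit_sum a m + unit_sum b m)" by (simp add: f_def rat_sums_def)
    have ge: "g = (\<lambda>m. - unit_sum (a \<otimes> b) m)" using ab unit_sum(1) by (simp add: g_def rat_sums_inv)
    have "sum_value G f = a \<otimes> b" "sum_value G g = inv (a \<otimes> b)"
      unfolding fe ge using ab unit_sum by (auto simp: sum_value_add sum_value_neg)
    moreover have int: "f m \<in> \<int>" "g m \<in> \<int>" for m unfolding fe ge using unit_sum(2) by auto
    ultimately have "sum_value G (\<lambda>m. f m + g m) = \<one>"
      using ab by (simp add: sum_value_add c)
    moreover have "f \<otimes>\<^bsub>rat_sums G\<^esub> g = (\<lambda>m. f m + g m)" by (simp add: rat_sums_def)
    ultimately have "f \<otimes>\<^bsub>rat_sums G\<^esub> g \<in> ?K"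
      using F.m_closed[OF c] int subgroup.one_closed[OF H] by (simp add: relations_def)
    then have "?\<pi> f \<otimes>\<^bsub>D\<^esub> ?\<pi> g = \<one>\<^bsub>D\<^esub>"
      using ker[OF F.m_closed[OF c]] \<pi>.hom_mult[OF c] by simp
    moreover have "?\<pi> g = inv\<^bsub>D\<^esub> j (a \<otimes> b)"
      unfolding g_def j_def using ab unit_sum(1) by simp
    moreover have "?\<pi> f = j a \<otimes>\<^bsub>D\<^esub> j b"
      unfolding f_def j_def using ab unit_sum(1) by simp
    moreover have "j (a \<otimes> b) \<in> carrier D" "j a \<otimes>\<^bsub>D\<^esub> j b \<in> carrier D"
      unfolding j_def using ab unit_sum(1) by auto
    ultimately have "inv\<^bsub>D\<^esub> (inv\<^bsub>D\<^esub> j (a \<otimes> b)) = j a \<otimes>\<^bsub>D\<^esub> j b"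
      by (intro D.inv_equality) auto
    then show "j (a \<otimes> b) = j a \<otimes>\<^bsub>D\<^esub> j b"
      using \<open>j (a \<otimes> b) \<in> carrier D\<close> by simp
  qed
  moreover have "j a = \<one>\<^bsub>D\<^esub> \<longleftrightarrow> a \<in> H" if "a \<in> carrier G" for a
    unfolding j_def ker[OF unit_sum(1)[OF that]] using unit_sum that by (auto simp: relations_def)
  ultimately show "\<exists>j \<in> hom G D. \<forall>a\<in>carrier G. j a = \<one>\<^bsub>D\<^esub> \<longleftrightarrow> a \<in> H" by blast
qed

end


subsection \<open>Coinduced modules\<close>

text \<open>\<open>Hom\<^sub>\<int>(R, D)\<close> for an abelian group \<open>D\<close>, written multiplicatively.\<close>

definition coinduced :: "('a, 'r) ring_scheme \<Rightarrow> ('d, 'x) monoid_scheme \<Rightarrow> ('a, 'a \<Rightarrow> 'd) module" where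
  "coinduced R D = \<lparr>carrier = {f \<in> carrier R \<rightarrow>\<^sub>E carrier D.
       \<forall>r\<in>carrier R. \<forall>s\<in>carrier R. f (r \<oplus>\<^bsub>R\<^esub> s) = f r \<otimes>\<^bsub>D\<^esub> f s},
     monoid.mult = undefined, monoid.one = undefined,
     ring.zero = (\<lambda>r\<in>carrier R. \<one>\<^bsub>D\<^esub>), ring.add = (\<lambda>f g. \<lambda>r\<in>carrier R. f r \<otimes>\<^bsub>D\<^esub> g r),
     smult = (\<lambda>a f. \<lambda>r\<in>carrier R. f (r \<otimes>\<^bsub>R\<^esub> a))\<rparr>"

lemma coinduced_simps:
  "f \<in> carrier (coinduced R D) \<longleftrightarrow> f \<in> carrier R \<rightarrow>\<^sub>E carrier D \<and>
     (\<forall>r\<in>carrier R. \<forall>s\<in>carrier R. f (r \<oplus>\<^bsub>R\<^esub> s) = f r \<otimes>\<^bsub>D\<^esub> f s)"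
  "\<zero>\<^bsub>coinduced R D\<^esub> = (\<lambda>r\<in>carrier R. \<one>\<^bsub>D\<^esub>)"
  "f \<oplus>\<^bsub>coinduced R D\<^esub> g = (\<lambda>r\<in>carrier R. f r \<otimes>\<^bsub>D\<^esub> g r)"
  "a \<odot>\<^bsub>coinduced R D\<^esub> f = (\<lambda>r\<in>carrier R. f (r \<otimes>\<^bsub>R\<^esub> a))"
  by (auto simp: coinduced_def)

lemma coinduced_module:
  assumes "cring R" "comm_group D"
  shows "module R (coinduced R D)"
proof -
  interpret R: cring R by fact
  interpret D: comm_group D by fact
  show ?thesis
  proof (rule moduleI)
    show "abelian_group (coinduced R D)"
    proof (rule abelian_groupI)
      fix f assume f: "f \<in> carrier (coinduced R D)"
      let ?g = "\<lambda>r\<in>carrier R. inv\<^bsub>D\<^esub> f r"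
      have "?g \<in> carrier (coinduced R D)"
        using f by (auto simp: coinduced_simps PiE_iff D.inv_mult)
      moreover have "?g \<oplus>\<^bsub>coinduced R D\<^esub> f = \<zero>\<^bsub>coinduced R D\<^esub>"
        using f by (auto simp: coinduced_simps PiE_iff intro!: restrict_ext)
      ultimately show "\<exists>g\<in>carrier (coinduced R D). g \<oplus>\<^bsub>coinduced R D\<^esub> f = \<zero>\<^bsub>coinduced R D\<^esub>" by blast
    next
      fix f g assume "f \<in> carrier (coinduced R D)" "g \<in> carrier (coinduced R D)"
      then show "f \<oplus>\<^bsub>coinduced R D\<^esub> g \<in> carrier (coinduced R D)" "f \<oplus>\<^bsub>coinduced R D\<^esub> g = g \<oplus>\<^bsub>coinduced R D\<^esub> f"
        by (auto simp: coinduced_simps PiE_iff D.m_ac intro!: restrict_ext)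
    qed (auto simp: coinduced_simps PiE_iff D.m_assoc extensional_def restrict_def fun_eq_iff)
    fix a f assume "a \<in> carrier R" "f \<in> carrier (coinduced R D)"
    then show "a \<odot>\<^bsub>coinduced R D\<^esub> f \<in> carrier (coinduced R D)"
      by (auto simp: coinduced_simps PiE_iff R.l_distr)
  qed (auto simp: coinduced_simps PiE_iff R.is_cring R.r_distr R.m_assoc extensional_def restrict_def fun_eq_iff)
qed

text \<open>\<open>Hom\<^sub>R(N, Hom\<^sub>\<int>(R, D)) = Hom\<^sub>\<int>(N, D)\<close>, so the extension property of \<open>D\<close> carries over.\<close>

lemma coinduced_extend:
  assumes D: "comm_group D" "divisible D" and M: "module R M" and N: "module R N"
    and f: "f \<in> mod_hom R M N" and inj: "inj_on f (carrier M)" and g: "g \<in> mod_hom R M (coinduced R D)"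
  shows "\<exists>h \<in> mod_hom R N (coinduced R D). \<forall>x\<in>carrier M. h (f x) = g x"
proof -
  interpret M: module R M by fact
  interpret N: module R N by fact
  interpret D: comm_group D by fact
  have gc: "g x \<in> carrier (coinduced R D)" if "x \<in> carrier M" for x using mod_hom_closed[OF g that] .
  define f0 where "f0 y = g (inv_into (carrier M) f y) \<one>\<^bsub>R\<^esub>" for y
  have f0: "f0 (f x) = g x \<one>\<^bsub>R\<^esub>" if "x \<in> carrier M" for x using inj that by (simp add: f0_def)
  have "\<exists>h \<in> hom (add_monoid N) D. \<forall>a\<in>f ` carrier M. h a = f0 a"
  proof (rule divisible_extend[OF N.M.a_comm_group D])
    show "subgroup (f ` carrier M) (add_monoid N)"
    proof (rule N.M.add.subgroupI)
      show "f ` carrier M \<subseteq> carrier N" using f by (auto intro: mod_hom_closed)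
      show "f ` carrier M \<noteq> {}" using M.M.zero_closed by blast
      show "\<ominus>\<^bsub>N\<^esub> y \<in> f ` carrier M" if "y \<in> f ` carrier M" for y
        using that by (auto simp: mod_hom_neg[OF M N f, symmetric])
      show "y \<oplus>\<^bsub>N\<^esub> z \<in> f ` carrier M" if "y \<in> f ` carrier M" "z \<in> f ` carrier M" for y z
        using that by (auto simp: mod_hom_add[OF f, symmetric])
    qed
    show "f0 a \<in> carrier D" if "a \<in> f ` carrier M" for a
      using that gc by (auto simp: f0 coinduced_simps PiE_iff)
    show "f0 (a \<otimes>\<^bsub>add_monoid N\<^esub> b) = f0 a \<otimes>\<^bsub>D\<^esub> f0 b" if ab: "a \<in> f ` carrier M" "b \<in> f ` carrier M" for a b
    proof -
      obtain x y where xy: "x \<in> carrier M" "y \<in> carrier M" "a = f x" "b = f y" using ab by auto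
      then show ?thesis
        using f0[of "x \<oplus>\<^bsub>M\<^esub> y"] by (simp add: mod_hom_add[OF f] mod_hom_add[OF g] f0 coinduced_simps(3))
    qed
  qed
  then obtain h0 where h0: "h0 \<in> hom (add_monoid N) D" "\<And>x. x \<in> carrier M \<Longrightarrow> h0 (f x) = g x \<one>\<^bsub>R\<^esub>"
    using f0 by (metis imageI)
  have h0c: "h0 y \<in> carrier D" if "y \<in> carrier N" for y using h0(1) that by (auto simp: hom_def)
  have h0a: "h0 (y \<oplus>\<^bsub>N\<^esub> z) = h0 y \<otimes>\<^bsub>D\<^esub> h0 z" if "y \<in> carrier N" "z \<in> carrier N" for y z
    using h0(1) that by (auto simp: hom_def)
  define h where "h y = (\<lambda>r\<in>carrier R. h0 (r \<odot>\<^bsub>N\<^esub> y))" for y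
  have "h \<in> mod_hom R N (coinduced R D)"
  proof (rule mod_homI)
    show "h y \<in> carrier (coinduced R D)" if "y \<in> carrier N" for y
      using that by (auto simp: h_def coinduced_simps h0c h0a N.smult_l_distr)
    show "h (y \<oplus>\<^bsub>N\<^esub> z) = h y \<oplus>\<^bsub>coinduced R D\<^esub> h z" if "y \<in> carrier N" "z \<in> carrier N" for y z
      using that by (auto simp: h_def coinduced_simps h0a N.smult_r_distr intro!: restrict_ext)
    show "h (a \<odot>\<^bsub>N\<^esub> y) = a \<odot>\<^bsub>coinduced R D\<^esub> h y" if "a \<in> carrier R" "y \<in> carrier N" for a y
      using that by (auto simp: h_def coinduced_simps N.smult_assoc1 intro!: restrict_ext)
  qed
  moreover have "h (f x) = g x" if x: "x \<in> carrier M" for x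
  proof
    fix r
    show "h (f x) r = g x r"
    proof (cases "r \<in> carrier R")
      case True
      then have "h (f x) r = g (r \<odot>\<^bsub>M\<^esub> x) \<one>\<^bsub>R\<^esub>"
        using x h0(2)[of "r \<odot>\<^bsub>M\<^esub> x"] by (simp add: h_def mod_hom_smult[OF f])
      also have "\<dots> = g x r"
        using x True by (simp add: mod_hom_smult[OF g] coinduced_simps(4))
      finally show ?thesis .
    next
      case False
      then show ?thesis using gc[OF x] by (auto simp: h_def coinduced_simps PiE_iff extensional_def)
    qed
  qed
  ultimately show ?thesis by blast
qed

lemma inv_into_mod_hom:
  assumes "module R M" "inj_on e (carrier M)"
  shows "inv_into (carrier M) e \<in> mod_hom R (transport e M) M"
proof -
  interpret module R M by fact
  show ?thesis
    by (rule mod_homI) (use assms(2) in \<open>auto simp: transport_simps\<close>)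
qed

text \<open>The group \<open>N / L\<close> embeds into a divisible group \<open>D\<close>, and so the module \<open>N / L\<close> embeds into the
  injective module \<open>Hom\<^sub>\<int>(R, D)\<close>.  The two assumptions on the type
  \<open>'i\<close> make room for the divisible hull, whose elements have representatives with finite support, and
  for the coinduced module, which consists of functions on \<open>R\<close>.\<close>

lemma enough_injectives:
  fixes N :: "('a, 'i) module" and c1 :: "('i \<times> rat) list \<Rightarrow> 'i" and c2 :: "('a \<Rightarrow> 'i) \<Rightarrow> 'i"
  assumes c1: "inj c1" and c2: "inj c2" and N: "module R N"
    and L: "L \<subseteq> carrier N" "\<zero>\<^bsub>N\<^esub> \<in> L" "\<And>x y. x \<in> L \<Longrightarrow> y \<in> L \<Longrightarrow> x \<oplus>\<^bsub>N\<^esub> y \<in> L"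
      "\<And>r x. r \<in> carrier R \<Longrightarrow> x \<in> L \<Longrightarrow> r \<odot>\<^bsub>N\<^esub> x \<in> L"
  shows "\<exists>J :: ('a, 'i) module. injective_module R J \<and>
    (\<exists>d \<in> mod_hom R N J. \<forall>x\<in>carrier N. d x = \<zero>\<^bsub>J\<^esub> \<longleftrightarrow> x \<in> L)"
proof -
  interpret N: module R N by fact
  let ?A = "add_monoid N"
  have sub: "subgroup L ?A"
  proof (rule N.M.add.subgroupI)
    show "\<ominus>\<^bsub>N\<^esub> x \<in> L" if "x \<in> L" for x
      using L(4)[of "\<ominus>\<^bsub>R\<^esub> \<one>\<^bsub>R\<^esub>" x] that L(1) N.smult_l_minus[of "\<one>\<^bsub>R\<^esub>" x] by auto
  qed (use L in auto)
  define D where "D = rat_sums ?A Mod relations ?A L"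
  note hull = comm_group.divisible_hull[OF N.M.a_comm_group sub, folded D_def]
  obtain j where j: "j \<in> hom ?A D" "\<And>x. x \<in> carrier N \<Longrightarrow> j x = \<one>\<^bsub>D\<^esub> \<longleftrightarrow> x \<in> L"
    using hull(3) by auto
  interpret D: comm_group D by (rule hull(1))
  let ?C = "coinduced R D"
  have C: "module R ?C" by (rule coinduced_module[OF N.R.is_cring hull(1)])
  define rep where "rep Y = (SOME f. f \<in> carrier (rat_sums ?A) \<and> Y = relations ?A L #>\<^bsub>rat_sums ?A\<^esub> f)" for Y
  have rep: "rep Y \<in> carrier (rat_sums ?A) \<and> Y = relations ?A L #>\<^bsub>rat_sums ?A\<^esub> rep Y" if "Y \<in> carrier D" for Y
  proof -
    have "\<exists>f. f \<in> carrier (rat_sums ?A) \<and> Y = relations ?A L #>\<^bsub>rat_sums ?A\<^esub> f"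
      using that by (auto simp: D_def FactGroup_def RCOSETS_def)
    from someI_ex[OF this] show ?thesis unfolding rep_def .
  qed
  define graph where "graph f = (SOME xs. set xs = {(m, f m) | m. f m \<noteq> (0::rat)})" for f :: "'i \<Rightarrow> rat"
  have graph: "set (graph f) = {(m, f m) | m. f m \<noteq> 0}" if "f \<in> carrier (rat_sums ?A)" for f
  proof -
    have "finite ((\<lambda>m. (m, f m)) ` {m. f m \<noteq> 0})" using that by (simp add: rat_sums_def)
    moreover have "(\<lambda>m. (m, f m)) ` {m. f m \<noteq> 0} = {(m, f m) | m. f m \<noteq> 0}" by auto
    ultimately have "finite {(m, f m) | m. f m \<noteq> 0}" by simp
    from someI_ex[OF finite_list[OF this]] show ?thesis unfolding graph_def .
  qed
  have graph_inj: "f = g" if "f \<in> carrier (rat_sums ?A)" "g \<in> carrier (rat_sums ?A)" "graph f = graph g" for f g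
  proof
    fix m
    have "{(m, f m) | m. f m \<noteq> 0} = {(m, g m) | m. g m \<noteq> 0}"
      using graph[OF that(1)] graph[OF that(2)] that(3) by simp
    then have "(m, f m) \<in> {(m, f m) | m. f m \<noteq> 0} \<longleftrightarrow> (m, f m) \<in> {(m, g m) | m. g m \<noteq> 0}"
      "(m, g m) \<in> {(m, f m) | m. f m \<noteq> 0} \<longleftrightarrow> (m, g m) \<in> {(m, g m) | m. g m \<noteq> 0}" by simp_all
    then show "f m = g m" by (cases "f m = 0"; cases "g m = 0") simp_all
  qed
  define e where "e \<phi> = c2 (\<lambda>r. if r \<in> carrier R then c1 (graph (rep (\<phi> r))) else undefined)" for \<phi>
  have e: "inj_on e (carrier ?C)"
  proof (rule inj_onI)
    fix \<phi> \<psi> assume p: "\<phi> \<in> carrier ?C" "\<psi> \<in> carrier ?C" "e \<phi> = e \<psi>"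
    show "\<phi> = \<psi>"
    proof
      fix r
      show "\<phi> r = \<psi> r"
      proof (cases "r \<in> carrier R")
        case True
        have c: "\<phi> r \<in> carrier D" "\<psi> r \<in> carrier D" using p True by (auto simp: coinduced_simps)
        have "(\<lambda>r. if r \<in> carrier R then c1 (graph (rep (\<phi> r))) else undefined) =
            (\<lambda>r. if r \<in> carrier R then c1 (graph (rep (\<psi> r))) else undefined)"
          using p(3) c2 by (simp only: e_def inj_eq)
        from fun_cong[OF this, of r] have "graph (rep (\<phi> r)) = graph (rep (\<psi> r))"
          using True c1 by (simp add: inj_eq)
        then have "rep (\<phi> r) = rep (\<psi> r)" using graph_inj rep[OF c(1)] rep[OF c(2)] by blast
        then show ?thesis using rep[OF c(1)] rep[OF c(2)] by metis
      next
        case False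
        then show ?thesis using p by (auto simp: coinduced_simps PiE_iff extensional_def)
      qed
    qed
  qed
  let ?J = "transport e ?C"
  let ?i = "inv_into (carrier ?C) e"
  have J: "module R ?J" and eh: "e \<in> mod_hom R ?C ?J" using transport_module[OF C e] by auto
  have ih: "?i \<in> mod_hom R ?J ?C" by (rule inv_into_mod_hom[OF C e])
  have "injective_module R ?J"
    unfolding injective_module_def
  proof (intro conjI allI impI J, elim conjE)
    fix M N :: "('a, 'i) module" and f g
    assume M: "module R M" "module R N" "f \<in> mod_hom R M N" "inj_on f (carrier M)" and g: "g \<in> mod_hom R M ?J"
    obtain h where h: "h \<in> mod_hom R N ?C" "\<And>x. x \<in> carrier M \<Longrightarrow> h (f x) = ?i (g x)"
      using coinduced_extend[OF hull(1,2) M mod_hom_compose[OF g ih]] by blast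
    have "e (h (f x)) = g x" if "x \<in> carrier M" for x
      using h(2)[OF that] mod_hom_closed[OF g that] by (simp add: transport_simps f_inv_into_f)
    then show "\<exists>h \<in> mod_hom R N ?J. \<forall>x\<in>carrier M. h (f x) = g x"
      using mod_hom_compose[OF h(1) eh] by (intro bexI[of _ "\<lambda>y. e (h y)"]) auto
  qed
  moreover have "\<exists>d \<in> mod_hom R N ?J. \<forall>x\<in>carrier N. d x = \<zero>\<^bsub>?J\<^esub> \<longleftrightarrow> x \<in> L"
  proof -
    define k where "k x = (\<lambda>r\<in>carrier R. j (r \<odot>\<^bsub>N\<^esub> x))" for x
    have jc: "j x \<in> carrier D" if "x \<in> carrier N" for x using j(1) that by (auto simp: hom_def)
    have ja: "j (x \<oplus>\<^bsub>N\<^esub> y) = j x \<otimes>\<^bsub>D\<^esub> j y" if "x \<in> carrier N" "y \<in> carrier N" for x y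
      using j(1) that by (auto simp: hom_def)
    have k: "k \<in> mod_hom R N ?C"
    proof (rule mod_homI)
      show "k y \<in> carrier ?C" if "y \<in> carrier N" for y
        using that by (auto simp: k_def coinduced_simps jc ja N.smult_l_distr)
      show "k (y \<oplus>\<^bsub>N\<^esub> z) = k y \<oplus>\<^bsub>?C\<^esub> k z" if "y \<in> carrier N" "z \<in> carrier N" for y z
        using that by (auto simp: k_def coinduced_simps ja N.smult_r_distr intro!: restrict_ext)
      show "k (a \<odot>\<^bsub>N\<^esub> y) = a \<odot>\<^bsub>?C\<^esub> k y" if "a \<in> carrier R" "y \<in> carrier N" for a y
        using that by (auto simp: k_def coinduced_simps N.smult_assoc1 intro!: restrict_ext)
    qed
    have "k x = \<zero>\<^bsub>?C\<^esub> \<longleftrightarrow> x \<in> L" if x: "x \<in> carrier N" for x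
    proof
      assume "k x = \<zero>\<^bsub>?C\<^esub>"
      then have "k x \<one>\<^bsub>R\<^esub> = \<one>\<^bsub>D\<^esub>" by (simp add: coinduced_simps)
      then show "x \<in> L" using x j(2)[OF x] by (simp add: k_def)
    next
      assume "x \<in> L"
      then have "j (r \<odot>\<^bsub>N\<^esub> x) = \<one>\<^bsub>D\<^esub>" if "r \<in> carrier R" for r
        using L(4)[OF that] j(2) x that by simp
      then show "k x = \<zero>\<^bsub>?C\<^esub>" by (auto simp: k_def coinduced_simps intro!: restrict_ext)
    qed
    moreover have "e (k x) = \<zero>\<^bsub>?J\<^esub> \<longleftrightarrow> k x = \<zero>\<^bsub>?C\<^esub>" if "x \<in> carrier N" for x
    proof -
      interpret C: module R ?C by (rule C)
      show ?thesis
        using e mod_hom_closed[OF k that] by (auto simp: transport_simps dest: inj_onD)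
    qed
    ultimately show ?thesis
      using mod_hom_compose[OF k eh] by (intro bexI[of _ "\<lambda>x. e (k x)"]) auto
  qed
  ultimately show ?thesis by blast
qed


subsection \<open>Injective resolutions\<close>

text \<open>The cokernel of each map is embedded into an injective module, which is the next term.  The
  recursion carries along the term \<open>I\<close> and the image \<open>L\<close> of the previous map.\<close>

lemma injective_resolution_exists:
  fixes M :: "('a, 'm) module" and c0 :: "'m \<Rightarrow> 'i" and c1 :: "('i \<times> rat) list \<Rightarrow> 'i" and c2 :: "('a \<Rightarrow> 'i) \<Rightarrow> 'i"
  assumes c: "inj c0" "inj c1" "inj c2" and M: "module R M"
  shows "\<exists>P :: ('a, 'm, 'i) resolution. injective_resolution R M P"
proof -
  interpret M: module R M by fact
  have inj0: "inj_on c0 (carrier M)" using c(1) by (rule inj_on_subset) simp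
  let ?M = "transport c0 M"
  have M': "module R ?M" and c0: "c0 \<in> mod_hom R M ?M" using transport_module[OF M inj0] by auto
  interpret M': module R ?M by fact
  have "\<exists>J :: ('a, 'i) module. injective_module R J \<and>
    (\<exists>d \<in> mod_hom R ?M J. \<forall>x\<in>carrier ?M. d x = \<zero>\<^bsub>J\<^esub> \<longleftrightarrow> x \<in> {\<zero>\<^bsub>?M\<^esub>})"
    by (rule enough_injectives[OF c(2,3) M']) auto
  then obtain J0 :: "('a, 'i) module" and d0 where J0: "injective_module R J0" "d0 \<in> mod_hom R ?M J0"
    "\<And>x. x \<in> carrier ?M \<Longrightarrow> d0 x = \<zero>\<^bsub>J0\<^esub> \<longleftrightarrow> x = \<zero>\<^bsub>?M\<^esub>" by auto
  have J0m: "module R J0" using J0(1) by (simp add: injective_module_def)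
  define aug where "aug x = d0 (c0 x)" for x
  have aug: "aug \<in> mod_hom R M J0" unfolding aug_def by (rule mod_hom_compose[OF c0 J0(2)])
  have "inj_on aug (carrier M)"
  proof (rule inj_onI)
    interpret J0: module R J0 by (rule J0m)
    fix x y assume xy: "x \<in> carrier M" "y \<in> carrier M" "aug x = aug y"
    then have "aug (x \<ominus>\<^bsub>M\<^esub> y) = \<zero>\<^bsub>J0\<^esub>"
      using mod_hom_closed[OF aug xy(2)]
      by (simp add: a_minus_def mod_hom_add[OF aug] mod_hom_neg[OF M J0m aug] J0.M.r_neg)
    then have "c0 (x \<ominus>\<^bsub>M\<^esub> y) = c0 \<zero>\<^bsub>M\<^esub>"
      using J0(3)[of "c0 (x \<ominus>\<^bsub>M\<^esub> y)"] xy by (simp add: aug_def transport_simps)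
    then have "x \<oplus>\<^bsub>M\<^esub> \<ominus>\<^bsub>M\<^esub> y = \<zero>\<^bsub>M\<^esub>" using c(1) by (simp add: inj_eq a_minus_def)
    then show "x = y" using xy M.M.minus_equality[of x "\<ominus>\<^bsub>M\<^esub> y"] by simp
  qed
  define sub :: "('a, 'i) module \<times> 'i set \<Rightarrow> bool" where
    "sub = (\<lambda>(I, L). injective_module R I \<and> L \<subseteq> carrier I \<and> \<zero>\<^bsub>I\<^esub> \<in> L \<and>
      (\<forall>x\<in>L. \<forall>y\<in>L. x \<oplus>\<^bsub>I\<^esub> y \<in> L) \<and> (\<forall>r\<in>carrier R. \<forall>x\<in>L. r \<odot>\<^bsub>I\<^esub> x \<in> L))"
  have image_sub: "sub (J, d ` carrier N)" if "module R N" "injective_module R J" "d \<in> mod_hom R N J"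
    for N :: "('a, 'n) module" and J d
  proof -
    interpret N: module R N by fact
    have J: "module R J" using that by (simp add: injective_module_def)
    have "\<zero>\<^bsub>J\<^esub> \<in> d ` carrier N"
      using mod_hom_zero[OF that(1) J that(3)] by (metis N.M.zero_closed imageI)
    then show ?thesis
      using that by (auto simp: sub_def mod_hom_closed mod_hom_add[symmetric] mod_hom_smult[symmetric])
  qed
  let ?Q = "\<lambda>s s'. \<exists>d \<in> mod_hom R (fst s) (fst s'). (\<forall>x\<in>carrier (fst s). d x = \<zero>\<^bsub>fst s'\<^esub> \<longleftrightarrow> x \<in> snd s) \<and>
      snd s' = d ` carrier (fst s)"
  have "\<exists>f. \<forall>n. (sub (f n) \<and> (n = 0 \<longrightarrow> f n = (J0, aug ` carrier M))) \<and> ?Q (f n) (f (Suc n))"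
  proof (rule dependent_nat_choice)
    show "\<exists>s. sub s \<and> (0 = (0::nat) \<longrightarrow> s = (J0, aug ` carrier M))"
      using image_sub[OF M J0(1) aug] by blast
    fix s :: "('a, 'i) module \<times> 'i set" and n :: nat
    assume "sub s \<and> (n = 0 \<longrightarrow> s = (J0, aug ` carrier M))"
    moreover obtain I L where s: "s = (I, L)" by (cases s)
    ultimately have IL: "sub (I, L)" by simp
    then have I: "module R I" by (simp add: sub_def injective_module_def)
    have "\<exists>J :: ('a, 'i) module. injective_module R J \<and>
      (\<exists>d \<in> mod_hom R I J. \<forall>x\<in>carrier I. d x = \<zero>\<^bsub>J\<^esub> \<longleftrightarrow> x \<in> L)"
      using IL by (intro enough_injectives[OF c(2,3) I]) (auto simp: sub_def)
    then obtain J :: "('a, 'i) module" and d where "injective_module R J" "d \<in> mod_hom R I J"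
      "\<forall>x\<in>carrier I. d x = \<zero>\<^bsub>J\<^esub> \<longleftrightarrow> x \<in> L" by blast
    then show "\<exists>s'. (sub s' \<and> (Suc n = 0 \<longrightarrow> s' = (J0, aug ` carrier M))) \<and> ?Q s s'"
      using image_sub[OF I] by (intro exI[of _ "(J, d ` carrier I)"]) (auto simp: s)
  qed
  then obtain st where st': "\<forall>n. (sub (st n) \<and> (n = 0 \<longrightarrow> st n = (J0, aug ` carrier M))) \<and> ?Q (st n) (st (Suc n))"
    by (rule exE)
  have st: "sub (st n)" "st 0 = (J0, aug ` carrier M)" "?Q (st n) (st (Suc n))" for n
    using spec[OF st', of n] spec[OF st', of 0] by simp_all
  obtain d where d: "\<And>n. d n \<in> mod_hom R (fst (st n)) (fst (st (Suc n)))"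
    "\<And>n x. x \<in> carrier (fst (st n)) \<Longrightarrow> d n x = \<zero>\<^bsub>fst (st (Suc n))\<^esub> \<longleftrightarrow> x \<in> snd (st n)"
    "\<And>n. snd (st (Suc n)) = d n ` carrier (fst (st n))"
    using st(3) by metis
  let ?P = "\<lparr>terms = \<lambda>n. fst (st n), diff = d, aug = aug\<rparr>"
  have coc: "cocycles (terms ?P) (diff ?P) n = snd (st n)" for n
    using d(2)[of _ n] st(1)[of n] by (auto simp: cocycles_def sub_def split: prod.splits)
  have I: "injective_module R (fst (st n))" for n
    using st(1)[of n] by (simp add: sub_def split: prod.splits)
  have "injective_resolution R M ?P"
    unfolding injective_resolution_def coc
    using d(1,3) I st(2) aug \<open>inj_on aug (carrier M)\<close> by simp
  then show ?thesis by blast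
qed

lemma injective_resolutionD:
  assumes "injective_resolution R M P"
  shows "injective_module R (terms P n)" "module R (terms P n)"
    "diff P n \<in> mod_hom R (terms P n) (terms P (Suc n))" "aug P \<in> mod_hom R M (terms P 0)"
    "inj_on (aug P) (carrier M)"
    "y \<in> carrier (terms P 0) \<Longrightarrow> diff P 0 y = \<zero>\<^bsub>terms P (Suc 0)\<^esub> \<longleftrightarrow> y \<in> aug P ` carrier M"
    "z \<in> carrier (terms P (Suc n)) \<Longrightarrow>
      diff P (Suc n) z = \<zero>\<^bsub>terms P (Suc (Suc n))\<^esub> \<longleftrightarrow> z \<in> diff P n ` carrier (terms P n)"
proof -
  note * = assms[unfolded injective_resolution_def]
  show "injective_module R (terms P n)" "module R (terms P n)"
    "diff P n \<in> mod_hom R (terms P n) (terms P (Suc n))" "aug P \<in> mod_hom R M (terms P 0)"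
    "inj_on (aug P) (carrier M)"
    using * by (auto simp: injective_module_def)
  show "diff P 0 y = \<zero>\<^bsub>terms P (Suc 0)\<^esub> \<longleftrightarrow> y \<in> aug P ` carrier M" if "y \<in> carrier (terms P 0)"
  proof -
    have "aug P ` carrier M = cocycles (terms P) (diff P) 0" using * by blast
    then show ?thesis using that by (simp add: cocycles_def)
  qed
  show "diff P (Suc n) z = \<zero>\<^bsub>terms P (Suc (Suc n))\<^esub> \<longleftrightarrow> z \<in> diff P n ` carrier (terms P n)"
    if "z \<in> carrier (terms P (Suc n))"
  proof -
    have "diff P n ` carrier (terms P n) = cocycles (terms P) (diff P) (Suc n)" using * by blast
    then show ?thesis using that by (simp add: cocycles_def)
  qed
qed

text \<open>By injectivity the lift is extended from one term to the next; this requires that the lift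
  constructed so far maps cocycles to cocycles.\<close>

lemma lift_exists:
  fixes M N :: "('a, 'm) module" and P Q :: "('a, 'm, 'i) resolution"
  assumes M: "module R M" and N: "module R N" and f: "f \<in> mod_hom R M N"
    and P: "injective_resolution R M P" and Q: "injective_resolution R N Q"
  shows "\<exists>\<phi>. lifts_to_resolutions R M f P Q \<phi>"
proof -
  note Pd = injective_resolutionD[OF P] and Qd = injective_resolutionD[OF Q]
  have inj: "inj_on (\<lambda>x. x) (carrier (terms P n))" for n by (simp add: inj_on_def)
  have 0: "\<exists>h \<in> mod_hom R (terms P 0) (terms Q 0). \<forall>x\<in>carrier M. h (aug P x) = aug Q (f x)"
  proof (rule injective_extend[OF Qd(1) M Pd(2) inj Pd(4) mod_hom_compose[OF f Qd(4)]])
    fix x assume x: "x \<in> carrier M" "aug P x = \<zero>\<^bsub>terms P 0\<^esub>"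
    interpret M: module R M by fact
    have "x = \<zero>\<^bsub>M\<^esub>"
      using x mod_hom_zero[OF M Pd(2) Pd(4)] by (intro inj_onD[OF Pd(5)]) auto
    then show "aug Q (f x) = \<zero>\<^bsub>terms Q 0\<^esub>"
      using mod_hom_zero[OF M N f] mod_hom_zero[OF N Qd(2) Qd(4)] by simp
  qed
  let ?A = "\<lambda>n h. h \<in> mod_hom R (terms P n) (terms Q n) \<and>
    (\<forall>x\<in>carrier (terms P n). diff P n x = \<zero>\<^bsub>terms P (Suc n)\<^esub> \<longrightarrow> diff Q n (h x) = \<zero>\<^bsub>terms Q (Suc n)\<^esub>) \<and>
    (n = 0 \<longrightarrow> (\<forall>x\<in>carrier M. h (aug P x) = aug Q (f x)))"
  have "\<exists>\<phi>. \<forall>n. ?A n (\<phi> n) \<and> (\<forall>x\<in>carrier (terms P n). \<phi> (Suc n) (diff P n x) = diff Q n (\<phi> n x))"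
  proof (rule dependent_nat_choice)
    obtain h where h: "h \<in> mod_hom R (terms P 0) (terms Q 0)" "\<And>x. x \<in> carrier M \<Longrightarrow> h (aug P x) = aug Q (f x)"
      using 0 by blast
    have "diff Q 0 (h x) = \<zero>\<^bsub>terms Q (Suc 0)\<^esub>" if x: "x \<in> carrier (terms P 0)" "diff P 0 x = \<zero>\<^bsub>terms P (Suc 0)\<^esub>" for x
    proof -
      obtain y where y: "y \<in> carrier M" "x = aug P y" using Pd(6)[OF x(1)] x(2) by auto
      then have "h x = aug Q (f y)" "f y \<in> carrier N" using h(2) mod_hom_closed[OF f] by auto
      then show ?thesis using Qd(6)[of "h x"] mod_hom_closed[OF h(1) x(1)] by auto
    qed
    then show "\<exists>h. ?A 0 h" using h by auto
  next
    fix h n assume h: "?A n h"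
    have "\<exists>k \<in> mod_hom R (terms P (Suc n)) (terms Q (Suc n)).
        \<forall>x\<in>carrier (terms P n). k (diff P n x) = diff Q n (h x)"
      by (rule injective_extend[OF Qd(1) Pd(2) Pd(2) inj Pd(3) mod_hom_compose[OF conjunct1[OF h] Qd(3)]])
        (use h in auto)
    then obtain k where k: "k \<in> mod_hom R (terms P (Suc n)) (terms Q (Suc n))"
      "\<And>x. x \<in> carrier (terms P n) \<Longrightarrow> k (diff P n x) = diff Q n (h x)" by blast
    have "diff Q (Suc n) (k x) = \<zero>\<^bsub>terms Q (Suc (Suc n))\<^esub>"
      if x: "x \<in> carrier (terms P (Suc n))" "diff P (Suc n) x = \<zero>\<^bsub>terms P (Suc (Suc n))\<^esub>" for x
    proof -
      obtain y where y: "y \<in> carrier (terms P n)" "x = diff P n y" using Pd(7)[OF x(1)] x(2) by auto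
      then have "k x = diff Q n (h y)" "h y \<in> carrier (terms Q n)"
        using k(2) mod_hom_closed[OF conjunct1[OF h]] by auto
      then show ?thesis using Qd(7)[of "k x"] mod_hom_closed[OF k(1) x(1)] by auto
    qed
    then show "\<exists>k. ?A (Suc n) k \<and> (\<forall>x\<in>carrier (terms P n). k (diff P n x) = diff Q n (h x))"
      using k by auto
  qed
  then obtain \<phi> where \<phi>: "\<forall>n. ?A n (\<phi> n) \<and>
      (\<forall>x\<in>carrier (terms P n). \<phi> (Suc n) (diff P n x) = diff Q n (\<phi> n x))" by (rule exE)
  have "lifts_to_resolutions R M f P Q \<phi>"
    unfolding lifts_to_resolutions_def
    using \<phi>[THEN spec] \<phi>[THEN spec, of 0] by (intro conjI allI) simp_all
  then show ?thesis by blast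
qed


subsection \<open>The universe for the terms of injective resolutions\<close>

text \<open>The first argument codes a pair \<open>(k, l)\<close>.  The length of the list is stored at \<open>k = 0\<close>, and its \<open>k\<close>-th entry
  at the positions \<open>(k, l)\<close>: the rational number at \<open>l = 0\<close>, the function at \<open>l > 0\<close>.\<close>

lemma inj_univ_list_code:
  "\<exists>c :: (('a, 'm) inj_univ \<times> rat) list \<Rightarrow> ('a, 'm) inj_univ. inj c"
proof -
  define c :: "(('a, 'm) inj_univ \<times> rat) list \<Rightarrow> ('a, 'm) inj_univ" where
    "c xs = (\<lambda>(n, a). case prod_decode n of (k, l) \<Rightarrow>
       if k = 0 then Inl (length xs)
       else if k \<le> length xs then (case l of 0 \<Rightarrow> Inl (to_nat (snd (xs ! (k - 1)))) | Suc l' \<Rightarrow> fst (xs ! (k - 1)) (l', a))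
       else Inl 0)" for xs
  have "inj c"
  proof (rule injI)
    fix xs ys assume eq: "c xs = c ys"
    have len: "length xs = length ys"
      using fun_cong[OF eq, of "(prod_encode (0, 0), undefined)"] by (simp add: c_def)
    show "xs = ys"
    proof (rule nth_equalityI[OF len])
      fix i assume i: "i < length xs"
      have "snd (xs ! i) = snd (ys ! i)"
        using fun_cong[OF eq, of "(prod_encode (Suc i, 0), undefined)"] i len by (simp add: c_def)
      moreover have "fst (xs ! i) p = fst (ys ! i) p" for p
        using fun_cong[OF eq, of "(prod_encode (Suc i, Suc (fst p)), snd p)"] i len by (simp add: c_def)
      ultimately show "xs ! i = ys ! i" by (simp add: prod_eq_iff fun_eq_iff)
    qed
  qed
  then show ?thesis by blast
qed

text \<open>A function from \<open>'a\<close> to functions on \<open>nat \<times> 'a\<close> is a function on \<open>(nat \<times> 'a) \<times> 'a\<close>, and this type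
  embeds into the infinite type \<open>nat \<times> 'a\<close>.\<close>

lemma inj_univ_fun_code:
  "\<exists>c :: ('a \<Rightarrow> ('a, 'm) inj_univ) \<Rightarrow> ('a, 'm) inj_univ. inj c"
proof -
  have inf: "infinite (UNIV :: (nat \<times> 'a) set)" by (simp add: finite_prod)
  have "|(UNIV :: (nat \<times> 'a) set) \<times> (UNIV :: (nat \<times> 'a) set)| \<le>o |UNIV :: (nat \<times> 'a) set|"
    using card_of_Times_same_infinite[OF inf] ordIso_imp_ordLeq by blast
  then obtain p :: "(nat \<times> 'a) \<times> (nat \<times> 'a) \<Rightarrow> nat \<times> 'a" where p: "inj p"
    by (auto simp: card_of_ordLeq[symmetric])
  define c :: "('a \<Rightarrow> ('a, 'm) inj_univ) \<Rightarrow> ('a, 'm) inj_univ" where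
    "c f = (\<lambda>q. case inv_into UNIV p q of (u, (_, b)) \<Rightarrow> f b u)" for f
  have "inj c"
  proof (rule injI)
    fix f g assume "c f = c g"
    then have "c f (p (u, (0, b))) = c g (p (u, (0, b)))" for u b by simp
    then have "f b u = g b u" for u b using p by (simp add: c_def)
    then show "f = g" by (intro ext)
  qed
  then show ?thesis by blast
qed

lemma inj_univ_resolution_exists:
  fixes M :: "('a, 'm) module"
  assumes "module R M"
  shows "\<exists>P :: ('a, 'm, ('a, 'm) inj_univ) resolution. injective_resolution R M P"
proof -
  have "inj (\<lambda>m :: 'm. (\<lambda>_. Inr m) :: ('a, 'm) inj_univ)" by (auto simp: inj_def fun_eq_iff)
  moreover obtain c1 :: "(('a, 'm) inj_univ \<times> rat) list \<Rightarrow> ('a, 'm) inj_univ" where "inj c1"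
    using inj_univ_list_code by blast
  moreover obtain c2 :: "('a \<Rightarrow> ('a, 'm) inj_univ) \<Rightarrow> ('a, 'm) inj_univ" where "inj c2"
    using inj_univ_fun_code by blast
  ultimately show ?thesis using assms by (rule injective_resolution_exists)
qed


section \<open>Localisation\<close>

locale localisation = module R M for R :: "('a, 'r) ring_scheme" (structure) and M :: "('a, 'm) module" +
  fixes x :: 'a
  assumes x: "x \<in> carrier R"
begin

abbreviation frac where "frac \<equiv> loc_frac R M x"
abbreviation L where "L \<equiv> loc_module R M x"

lemma pow_smult: "m \<in> carrier M \<Longrightarrow> x [^] (i::nat) \<odot>\<^bsub>M\<^esub> (x [^] (j::nat) \<odot>\<^bsub>M\<^esub> m) = x [^] (i + j) \<odot>\<^bsub>M\<^esub> m"
  using x by (simp add: smult_assoc1[symmetric] R.nat_pow_mult)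

lemma pow_closed: "m \<in> carrier M \<Longrightarrow> x [^] (i::nat) \<odot>\<^bsub>M\<^esub> m \<in> carrier M"
  using x by simp

lemma equiv: "equiv (carrier M \<times> UNIV) (loc_rel R M x)"
proof (rule equivI)
  show "refl_on (carrier M \<times> UNIV) (loc_rel R M x)" "sym (loc_rel R M x)"
    "loc_rel R M x \<subseteq> (carrier M \<times> UNIV) \<times> (carrier M \<times> UNIV)"
    by (auto simp: refl_on_def sym_def loc_rel_def) metis
  show "trans (loc_rel R M x)"
  proof (rule transI)
    fix p q r assume "(p, q) \<in> loc_rel R M x" "(q, r) \<in> loc_rel R M x"
    then obtain m k n l o' i and s t :: nat where
      e: "p = (m, k)" "q = (n, l)" "r = (o', i)" "m \<in> carrier M" "n \<in> carrier M" "o' \<in> carrier M"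
        "x [^] (s + l) \<odot>\<^bsub>M\<^esub> m = x [^] (s + k) \<odot>\<^bsub>M\<^esub> n" "x [^] (t + i) \<odot>\<^bsub>M\<^esub> n = x [^] (t + l) \<odot>\<^bsub>M\<^esub> o'"
      by (cases p; cases q; cases r) (auto simp: loc_rel_def)
    have "x [^] ((s + t + l) + i) \<odot>\<^bsub>M\<^esub> m = x [^] (t + i) \<odot>\<^bsub>M\<^esub> (x [^] (s + l) \<odot>\<^bsub>M\<^esub> m)"
      using e(4) by (simp add: pow_smult ac_simps)
    also have "\<dots> = x [^] (s + k) \<odot>\<^bsub>M\<^esub> (x [^] (t + i) \<odot>\<^bsub>M\<^esub> n)"
      unfolding e(7) using e(5) by (simp add: pow_smult ac_simps)
    also have "\<dots> = x [^] ((s + t + l) + k) \<odot>\<^bsub>M\<^esub> o'"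
      unfolding e(8) using e(6) by (simp add: pow_smult ac_simps)
    finally show "(p, r) \<in> loc_rel R M x" using e by (auto simp: loc_rel_def)
  qed
qed

lemma frac_eq_iff:
  assumes "m \<in> carrier M" "n \<in> carrier M"
  shows "frac m k = frac n l \<longleftrightarrow> (\<exists>t::nat. x [^] (t + l) \<odot>\<^bsub>M\<^esub> m = x [^] (t + k) \<odot>\<^bsub>M\<^esub> n)"
  unfolding loc_frac_def using assms
  by (subst eq_equiv_class_iff[OF equiv]) (auto simp: loc_rel_def)

lemma frac_eqI:
  assumes "m \<in> carrier M" "n \<in> carrier M" "x [^] (t + l) \<odot>\<^bsub>M\<^esub> m = x [^] (t + k) \<odot>\<^bsub>M\<^esub> n"
  shows "frac m k = frac n l"
  using assms frac_eq_iff by blast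

text \<open>The operations on fractions are defined as unions over representatives; if all representatives
  give the same result, the union is that result.\<close>

lemma frac_UN:
  assumes m: "m \<in> carrier M"
    and g: "\<And>n l. n \<in> carrier M \<Longrightarrow> frac n l = frac m k \<Longrightarrow> g n l = g m k"
  shows "(\<Union>(n, l)\<in>frac m k. g n l) = g m k"
proof -
  have mem: "(m, k) \<in> frac m k"
    unfolding loc_frac_def using equiv m by (intro equiv_class_self) auto
  have "g n l = g m k" if "(n, l) \<in> frac m k" for n l
  proof -
    have r: "((m, k), (n, l)) \<in> loc_rel R M x" using that by (simp add: loc_frac_def)
    then have "n \<in> carrier M" by (auto simp: loc_rel_def)
    moreover have "frac n l = frac m k"
      unfolding loc_frac_def using equiv_class_eq[OF equiv r] by simp
    ultimately show ?thesis by (rule g)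
  qed
  then have "\<forall>q\<in>frac m k. (case q of (n, l) \<Rightarrow> g n l) = g m k" by (auto split: prod.split)
  then show ?thesis by (rule UN_constant_eq[OF mem])
qed

lemma frac_scale: "m \<in> carrier M \<Longrightarrow> frac (x [^] (j::nat) \<odot>\<^bsub>M\<^esub> m) (k + j) = frac m k"
  by (rule frac_eqI[of _ _ 0]) (auto simp: pow_closed pow_smult ac_simps)

lemma frac_closed: "m \<in> carrier M \<Longrightarrow> frac m k \<in> carrier L"
  by (auto simp: loc_module_def loc_frac_def intro: quotientI)

lemma loc_cases:
  assumes "Z \<in> carrier L"
  obtains m k where "m \<in> carrier M" "Z = frac m k"
  using assms by (auto simp: loc_module_def loc_frac_def elim!: quotientE)

lemma frac_add_general:
  assumes mn: "m \<in> carrier M" "n \<in> carrier M"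
  shows "frac m k \<oplus>\<^bsub>L\<^esub> frac n l = frac (x [^] l \<odot>\<^bsub>M\<^esub> m \<oplus>\<^bsub>M\<^esub> x [^] k \<odot>\<^bsub>M\<^esub> n) (k + l)"
proof -
  let ?g = "\<lambda>m k n l. frac (x [^] (l::nat) \<odot>\<^bsub>M\<^esub> m \<oplus>\<^bsub>M\<^esub> x [^] (k::nat) \<odot>\<^bsub>M\<^esub> n) (k + l)"
  have left: "?g m' k' n l = ?g m k n l" if c: "m' \<in> carrier M" "m \<in> carrier M" "n \<in> carrier M" "frac m' k' = frac m k" for m' m n k' k l
  proof -
    obtain t :: nat where t: "x [^] (t + k) \<odot>\<^bsub>M\<^esub> m' = x [^] (t + k') \<odot>\<^bsub>M\<^esub> m"
      using c frac_eq_iff by blast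
    have "x [^] (l + l) \<odot>\<^bsub>M\<^esub> (x [^] (t + k) \<odot>\<^bsub>M\<^esub> m') = x [^] (l + l) \<odot>\<^bsub>M\<^esub> (x [^] (t + k') \<odot>\<^bsub>M\<^esub> m)" by (simp only: t)
    then have "x [^] (t + k + l + l) \<odot>\<^bsub>M\<^esub> m' = x [^] (t + k' + l + l) \<odot>\<^bsub>M\<^esub> m"
      using c by (simp add: pow_smult ac_simps)
    then show ?thesis
      using c x by (intro frac_eqI[of _ _ t]) (auto simp: smult_r_distr pow_smult pow_closed ac_simps)
  qed
  have right: "?g m k n' l' = ?g m k n l" if c: "n' \<in> carrier M" "m \<in> carrier M" "n \<in> carrier M" "frac n' l' = frac n l" for n' m n k l' l
  proof -
    have sym: "?g m k a i = ?g a i m k" if "a \<in> carrier M" for a i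
      using M.a_comm[OF pow_closed[OF \<open>m \<in> carrier M\<close>] pow_closed[OF that], of i k] by (simp add: add.commute)
    have "?g n' l' m k = ?g n l m k" by (rule left) (use c in auto)
    then show ?thesis unfolding sym[OF c(1)] sym[OF c(3)] .
  qed
  have "frac m k \<oplus>\<^bsub>L\<^esub> frac n l = (\<Union>(m', k')\<in>frac m k. \<Union>(n', l')\<in>frac n l. ?g m' k' n' l')"
    by (simp add: loc_module_def)
  also have "\<dots> = (\<Union>(n', l')\<in>frac n l. ?g m k n' l')"
  proof (rule frac_UN[OF mn(1)])
    fix m' k' assume c: "m' \<in> carrier M" "frac m' k' = frac m k"
    have "(\<Union>(n', l')\<in>frac n l. ?g m' k' n' l') = ?g m' k' n l"
      by (rule frac_UN[OF mn(2)]) (rule right[OF _ c(1) mn(2)])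
    also have "\<dots> = ?g m k n l" by (rule left[OF c(1) mn c(2)])
    also have "\<dots> = (\<Union>(n', l')\<in>frac n l. ?g m k n' l')"
      by (rule frac_UN[OF mn(2), symmetric]) (rule right[OF _ mn])
    finally show "(\<Union>(n', l')\<in>frac n l. ?g m' k' n' l') = (\<Union>(n', l')\<in>frac n l. ?g m k n' l')" .
  qed
  also have "\<dots> = ?g m k n l"
    by (rule frac_UN[OF mn(2)]) (rule right[OF _ mn])
  finally show ?thesis .
qed

lemma frac_add:
  assumes "m \<in> carrier M" "n \<in> carrier M"
  shows "frac m k \<oplus>\<^bsub>L\<^esub> frac n k = frac (m \<oplus>\<^bsub>M\<^esub> n) k"
  using assms frac_scale[of "m \<oplus>\<^bsub>M\<^esub> n" k k] x by (simp add: frac_add_general smult_r_distr)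

lemma frac_smult:
  assumes m: "m \<in> carrier M" and a: "a \<in> carrier R"
  shows "a \<odot>\<^bsub>L\<^esub> frac m k = frac (a \<odot>\<^bsub>M\<^esub> m) k"
proof -
  have "frac (a \<odot>\<^bsub>M\<^esub> n) l = frac (a \<odot>\<^bsub>M\<^esub> m) k" if n: "n \<in> carrier M" "frac n l = frac m k" for n l
  proof -
    obtain t :: nat where t: "x [^] (t + k) \<odot>\<^bsub>M\<^esub> n = x [^] (t + l) \<odot>\<^bsub>M\<^esub> m" using n m frac_eq_iff by blast
    have "x [^] i \<odot>\<^bsub>M\<^esub> (a \<odot>\<^bsub>M\<^esub> y) = a \<odot>\<^bsub>M\<^esub> (x [^] i \<odot>\<^bsub>M\<^esub> y)" if "y \<in> carrier M" for y and i :: nat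
      using that a x by (simp add: smult_assoc1[symmetric] R.m_comm)
    then show ?thesis using t n m a by (intro frac_eqI[of _ _ t]) auto
  qed
  then have "(\<Union>(n, l)\<in>frac m k. frac (a \<odot>\<^bsub>M\<^esub> n) l) = frac (a \<odot>\<^bsub>M\<^esub> m) k"
    by (rule frac_UN[OF m])
  then show ?thesis by (simp add: loc_module_def)
qed

lemma frac_zero: "\<zero>\<^bsub>L\<^esub> = frac \<zero>\<^bsub>M\<^esub> k"
proof -
  have "frac \<zero>\<^bsub>M\<^esub> 0 = frac \<zero>\<^bsub>M\<^esub> k" by (rule frac_eqI[of _ _ 0]) (use x in auto)
  then show ?thesis by (simp add: loc_module_def)
qed

lemma loc_cases2:
  assumes "Y \<in> carrier L" "Z \<in> carrier L"
  obtains m n k where "m \<in> carrier M" "n \<in> carrier M" "Y = frac m k" "Z = frac n k"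
proof -
  obtain m k n l where "m \<in> carrier M" "Y = frac m k" "n \<in> carrier M" "Z = frac n l"
    using assms by (metis loc_cases)
  then show ?thesis
    using that[of "x [^] l \<odot>\<^bsub>M\<^esub> m" "x [^] k \<odot>\<^bsub>M\<^esub> n" "k + l"] frac_scale[of m l k] frac_scale[of n k l]
    by (simp add: pow_closed add.commute)
qed

lemma loc_module: "module R L"
proof (rule moduleI)
  show "abelian_group L"
  proof (rule abelian_groupI)
    fix Y Z W assume Y: "Y \<in> carrier L" and Z: "Z \<in> carrier L" and W: "W \<in> carrier L"
    obtain m n k o' l where e: "m \<in> carrier M" "n \<in> carrier M" "Y = frac m k" "Z = frac n k"
      "o' \<in> carrier M" "W = frac o' l"
      using loc_cases2[OF Y Z] loc_cases[OF W] by metis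
    let ?m = "x [^] l \<odot>\<^bsub>M\<^esub> m" and ?n = "x [^] l \<odot>\<^bsub>M\<^esub> n" and ?o = "x [^] k \<odot>\<^bsub>M\<^esub> o'"
    have "Y = frac ?m (k + l)" "Z = frac ?n (k + l)" "W = frac ?o (k + l)"
      using e frac_scale[of m l k] frac_scale[of n l k] frac_scale[of o' k l] by (simp_all add: add.commute)
    then show "Y \<oplus>\<^bsub>L\<^esub> Z \<oplus>\<^bsub>L\<^esub> W = Y \<oplus>\<^bsub>L\<^esub> (Z \<oplus>\<^bsub>L\<^esub> W)"
      using e by (simp add: frac_add pow_closed M.a_assoc)
  next
    fix Y Z assume "Y \<in> carrier L" "Z \<in> carrier L"
    then obtain m n k where "m \<in> carrier M" "n \<in> carrier M" "Y = frac m k" "Z = frac n k"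
      by (rule loc_cases2)
    then show "Y \<oplus>\<^bsub>L\<^esub> Z \<in> carrier L" "Y \<oplus>\<^bsub>L\<^esub> Z = Z \<oplus>\<^bsub>L\<^esub> Y"
      by (simp_all add: frac_add frac_closed M.a_comm[of m n])
  next
    fix Y assume "Y \<in> carrier L"
    then obtain m k where Y: "m \<in> carrier M" "Y = frac m k" by (rule loc_cases)
    then show "\<zero>\<^bsub>L\<^esub> \<oplus>\<^bsub>L\<^esub> Y = Y" by (simp add: frac_zero[of k] frac_add)
    show "\<exists>Z\<in>carrier L. Z \<oplus>\<^bsub>L\<^esub> Y = \<zero>\<^bsub>L\<^esub>"
      using Y by (intro bexI[of _ "frac (\<ominus>\<^bsub>M\<^esub> m) k"]) (auto simp: frac_zero[of k] frac_add M.l_neg intro!: frac_closed)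
  qed (simp add: frac_zero[of 0] frac_closed)
next
  fix a Y Z assume a: "a \<in> carrier R" and "Y \<in> carrier L" "Z \<in> carrier L"
  then obtain m n k where "m \<in> carrier M" "n \<in> carrier M" "Y = frac m k" "Z = frac n k"
    using loc_cases2 by metis
  then show "a \<odot>\<^bsub>L\<^esub> (Y \<oplus>\<^bsub>L\<^esub> Z) = a \<odot>\<^bsub>L\<^esub> Y \<oplus>\<^bsub>L\<^esub> a \<odot>\<^bsub>L\<^esub> Z"
    using a by (simp add: frac_smult frac_add smult_r_distr)
next
  fix a Y assume a: "a \<in> carrier R" and "Y \<in> carrier L"
  then obtain m k where Y: "m \<in> carrier M" "Y = frac m k" using loc_cases by metis
  then show "a \<odot>\<^bsub>L\<^esub> Y \<in> carrier L" using a by (simp add: frac_smult frac_closed)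
  show "(a \<oplus> b) \<odot>\<^bsub>L\<^esub> Y = a \<odot>\<^bsub>L\<^esub> Y \<oplus>\<^bsub>L\<^esub> b \<odot>\<^bsub>L\<^esub> Y" "(a \<otimes> b) \<odot>\<^bsub>L\<^esub> Y = a \<odot>\<^bsub>L\<^esub> (b \<odot>\<^bsub>L\<^esub> Y)"
    if "b \<in> carrier R" for b
    using a that Y by (simp_all add: frac_smult frac_add smult_l_distr smult_assoc1)
next
  fix Y assume "Y \<in> carrier L"
  then obtain m k where "m \<in> carrier M" "Y = frac m k" by (rule loc_cases)
  then show "\<one> \<odot>\<^bsub>L\<^esub> Y = Y" by (simp add: frac_smult)
qed (rule R.is_cring)

lemma frac_neg: "m \<in> carrier M \<Longrightarrow> \<ominus>\<^bsub>L\<^esub> frac m k = frac (\<ominus>\<^bsub>M\<^esub> m) k"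
proof -
  interpret L: module R L by (rule loc_module)
  assume "m \<in> carrier M"
  then show ?thesis
    by (intro L.M.minus_equality) (auto simp: frac_add M.l_neg frac_zero[of k] intro!: frac_closed)
qed

lemma frac_finsum:
  assumes "finite A" "f \<in> A \<rightarrow> carrier M"
  shows "finsum L (\<lambda>i. frac (f i) k) A = frac (finsum M f A) k"
proof -
  interpret L: module R L by (rule loc_module)
  show ?thesis
    using assms
  proof (induction A)
    case (insert a A)
    then have c: "f a \<in> carrier M" "f \<in> A \<rightarrow> carrier M" by auto
    then have "(\<lambda>i. frac (f i) k) \<in> A \<rightarrow> carrier L" by (auto intro!: frac_closed)
    then show ?case using insert c by (simp add: frac_add frac_closed M.finsum_closed)
  qed (simp add: frac_zero[of k])
qed

end


section \<open>The Cech complex\<close>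

lemma product_module:
  fixes L :: "'i \<Rightarrow> ('a, 'n) module"
  assumes R: "cring R" and L: "\<And>i. i \<in> A \<Longrightarrow> module R (L i)"
  shows "module R \<lparr>carrier = (\<Pi>\<^sub>E i\<in>A. carrier (L i)), monoid.mult = undefined, monoid.one = undefined,
    ring.zero = (\<lambda>i\<in>A. \<zero>\<^bsub>L i\<^esub>), ring.add = (\<lambda>b c. \<lambda>i\<in>A. b i \<oplus>\<^bsub>L i\<^esub> c i),
    smult = (\<lambda>a c. \<lambda>i\<in>A. a \<odot>\<^bsub>L i\<^esub> c i)\<rparr>" (is "module R ?P")
proof (rule moduleI)
  have G: "abelian_group (L i)" "abelian_monoid (L i)" if "i \<in> A" for i
    using L[OF that] by (auto simp: module_def abelian_group_def)
  note simps = PiE_iff extensional_def restrict_def fun_eq_iff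
  show "abelian_group ?P"
  proof (rule abelian_groupI)
    fix b assume b: "b \<in> carrier ?P"
    show "\<exists>c\<in>carrier ?P. c \<oplus>\<^bsub>?P\<^esub> b = \<zero>\<^bsub>?P\<^esub>"
      using b by (intro bexI[of _ "\<lambda>i\<in>A. \<ominus>\<^bsub>L i\<^esub> b i"])
        (auto simp: simps abelian_group.l_neg[OF G(1)] abelian_group.a_inv_closed[OF G(1)])
  next
    fix b c assume "b \<in> carrier ?P" "c \<in> carrier ?P"
    then show "b \<oplus>\<^bsub>?P\<^esub> c = c \<oplus>\<^bsub>?P\<^esub> b"
      using abelian_monoid.a_comm[OF G(2)] by (simp add: simps)
  qed (simp_all add: simps abelian_monoid.a_closed[OF G(2)] abelian_monoid.zero_closed[OF G(2)]
      abelian_monoid.a_assoc[OF G(2)] abelian_monoid.l_zero[OF G(2)])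
  show "module.smult ?P a b \<in> carrier ?P" if "a \<in> carrier R" "b \<in> carrier ?P" for a b
    using that by (simp add: simps module.smult_closed[OF L])
qed (simp_all add: R PiE_iff extensional_def restrict_def fun_eq_iff module.smult_l_distr[OF L]
    module.smult_r_distr[OF L] module.smult_assoc1[OF L] module.smult_one[OF L])

locale cech = cochains R M "\<lambda>i. xs ! i" "{..<length xs}"
  for R :: "('a, 'r) ring_scheme" (structure) and M :: "('a, 'm) module" and xs :: "'a list"
begin

abbreviation T where "T \<equiv> {..<length xs}"
abbreviation idx where "idx \<equiv> cech_index xs"
abbreviation C where "C \<equiv> cech_term R xs M"

lemma prod_eq: "cech_prod R xs \<mu> = finprod R (\<lambda>i. xs ! i) \<mu>"
  by (simp add: cech_prod_def)

lemma idxD: "\<mu> \<in> idx p \<Longrightarrow> \<mu> \<subseteq> T" "\<mu> \<in> idx p \<Longrightarrow> card \<mu> = p"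
  by (auto simp: cech_index_def)

lemma finite_idx: "finite (idx p)"
  by (rule finite_subset[of _ "Pow T"]) (auto simp: cech_index_def)

lemma loc: "\<mu> \<in> idx p \<Longrightarrow> localisation R M (cech_prod R xs \<mu>)"
  using xprod_closed[OF idxD(1)] module_axioms by (simp add: prod_eq localisation_def localisation_axioms_def)

text \<open>Elements of the Cech complex with a common exponent of the denominators.\<close>

definition cfrac :: "nat \<Rightarrow> nat \<Rightarrow> (nat set \<Rightarrow> 'm) \<Rightarrow> nat set \<Rightarrow> ('m \<times> nat) set" where
  "cfrac p s u = (\<lambda>\<mu>\<in>idx p. loc_frac R M (cech_prod R xs \<mu>) (u \<mu>) s)"

lemma C_simps:
  "carrier (C p) = (\<Pi>\<^sub>E \<mu>\<in>idx p. carrier (loc_module R M (cech_prod R xs \<mu>)))"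
  "\<zero>\<^bsub>C p\<^esub> = (\<lambda>\<mu>\<in>idx p. \<zero>\<^bsub>loc_module R M (cech_prod R xs \<mu>)\<^esub>)"
  "b \<oplus>\<^bsub>C p\<^esub> c = (\<lambda>\<mu>\<in>idx p. b \<mu> \<oplus>\<^bsub>loc_module R M (cech_prod R xs \<mu>)\<^esub> c \<mu>)"
  "a \<odot>\<^bsub>C p\<^esub> c = (\<lambda>\<mu>\<in>idx p. a \<odot>\<^bsub>loc_module R M (cech_prod R xs \<mu>)\<^esub> c \<mu>)"
  by (simp_all add: cech_term_def Let_def)

lemma cfrac_closed:
  assumes "u \<in> idx p \<rightarrow> carrier M"
  shows "cfrac p s u \<in> carrier (C p)"
  unfolding C_simps cfrac_def using assms by (auto intro!: localisation.frac_closed[OF loc])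

text \<open>The sum of the exponents that work for the finitely many \<open>\<mu>\<close> works for all of them.\<close>

lemma cfrac_eq_iff:
  assumes u: "u \<in> idx p \<rightarrow> carrier M" and v: "v \<in> idx p \<rightarrow> carrier M"
  shows "cfrac p s u = cfrac p s v \<longleftrightarrow> (\<exists>t. \<forall>\<mu>\<in>idx p.
    level_up R M (\<lambda>i. xs ! i) t u \<mu> = level_up R M (\<lambda>i. xs ! i) t v \<mu>)"
proof
  let ?y = "\<lambda>\<mu>. cech_prod R xs \<mu>"
  assume eq: "cfrac p s u = cfrac p s v"
  have "\<exists>t::nat. ?y \<mu> [^] t \<odot>\<^bsub>M\<^esub> u \<mu> = ?y \<mu> [^] t \<odot>\<^bsub>M\<^esub> v \<mu>" if \<mu>: "\<mu> \<in> idx p" for \<mu>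
  proof -
    interpret localisation R M "?y \<mu>" by (rule loc[OF \<mu>])
    have "frac (u \<mu>) s = frac (v \<mu>) s" using fun_cong[OF eq, of \<mu>] \<mu> by (simp add: cfrac_def)
    then show ?thesis using frac_eq_iff[of "u \<mu>" "v \<mu>"] u v \<mu> by blast
  qed
  then obtain t where t: "\<And>\<mu>. \<mu> \<in> idx p \<Longrightarrow> ?y \<mu> [^] (t \<mu> :: nat) \<odot>\<^bsub>M\<^esub> u \<mu> = ?y \<mu> [^] t \<mu> \<odot>\<^bsub>M\<^esub> v \<mu>"
    by metis
  have "level_up R M (\<lambda>i. xs ! i) (sum t (idx p)) u \<mu> = level_up R M (\<lambda>i. xs ! i) (sum t (idx p)) v \<mu>" if \<mu>: "\<mu> \<in> idx p" for \<mu>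
  proof -
    interpret localisation R M "?y \<mu>" by (rule loc[OF \<mu>])
    have c: "u \<mu> \<in> carrier M" "v \<mu> \<in> carrier M" using u v \<mu> by auto
    obtain k where k: "sum t (idx p) = k + t \<mu>"
      using \<mu> finite_idx member_le_sum[of \<mu> "idx p" t] by (metis add.commute le_add_diff_inverse zero_le)
    show ?thesis
      unfolding level_up_def prod_eq[symmetric] k using t[OF \<mu>] c pow_smult[of "u \<mu>" k "t \<mu>"] pow_smult[of "v \<mu>" k "t \<mu>"] by simp
  qed
  then show "\<exists>t. \<forall>\<mu>\<in>idx p. level_up R M (\<lambda>i. xs ! i) t u \<mu> = level_up R M (\<lambda>i. xs ! i) t v \<mu>" by blast
next
  assume "\<exists>t. \<forall>\<mu>\<in>idx p. level_up R M (\<lambda>i. xs ! i) t u \<mu> = level_up R M (\<lambda>i. xs ! i) t v \<mu>"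
  then obtain t :: nat where t: "\<And>\<mu>. \<mu> \<in> idx p \<Longrightarrow>
      level_up R M (\<lambda>i. xs ! i) t u \<mu> = level_up R M (\<lambda>i. xs ! i) t v \<mu>" by blast
  show "cfrac p s u = cfrac p s v"
    unfolding cfrac_def
  proof (rule restrict_ext)
    fix \<mu> assume \<mu>: "\<mu> \<in> idx p"
    interpret localisation R M "cech_prod R xs \<mu>" by (rule loc[OF \<mu>])
    have c: "u \<mu> \<in> carrier M" "v \<mu> \<in> carrier M" using u v \<mu> by auto
    have "cech_prod R xs \<mu> [^] t \<odot>\<^bsub>M\<^esub> u \<mu> = cech_prod R xs \<mu> [^] t \<odot>\<^bsub>M\<^esub> v \<mu>"
      using t[OF \<mu>] by (simp add: level_up_def prod_eq)
    then have "frac (cech_prod R xs \<mu> [^] t \<odot>\<^bsub>M\<^esub> u \<mu>) (s + t) = frac (cech_prod R xs \<mu> [^] t \<odot>\<^bsub>M\<^esub> v \<mu>) (s + t)" by simp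
    then show "frac (u \<mu>) s = frac (v \<mu>) s" using c by (simp add: frac_scale)
  qed
qed

lemma cfrac_cong: "(\<And>\<mu>. \<mu> \<in> idx p \<Longrightarrow> u \<mu> = v \<mu>) \<Longrightarrow> cfrac p s u = cfrac p s v"
  unfolding cfrac_def by (rule restrict_ext) simp

lemma cfrac_level_up:
  assumes u: "u \<in> idx p \<rightarrow> carrier M"
  shows "cfrac p (s + t) (level_up R M (\<lambda>i. xs ! i) t u) = cfrac p s u"
  unfolding cfrac_def level_up_def prod_eq[symmetric]
  using u by (intro restrict_ext localisation.frac_scale[OF loc]) auto

lemma cfrac_cases:
  assumes c: "c \<in> carrier (C p)"
  obtains s u where "u \<in> Pow T \<rightarrow> carrier M" "\<And>\<mu>. \<mu> \<notin> idx p \<Longrightarrow> u \<mu> = \<zero>\<^bsub>M\<^esub>" "c = cfrac p s u"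
proof -
  have "\<exists>m k. m \<in> carrier M \<and> c \<mu> = loc_frac R M (cech_prod R xs \<mu>) m k" if \<mu>: "\<mu> \<in> idx p" for \<mu>
  proof -
    interpret localisation R M "cech_prod R xs \<mu>" by (rule loc[OF \<mu>])
    have "c \<mu> \<in> carrier L" using c \<mu> by (auto simp: C_simps)
    then show ?thesis by (metis loc_cases)
  qed
  then obtain m k where mk: "\<And>\<mu>. \<mu> \<in> idx p \<Longrightarrow> m \<mu> \<in> carrier M \<and> c \<mu> = loc_frac R M (cech_prod R xs \<mu>) (m \<mu>) (k \<mu>)"
    by metis
  define s where "s = sum k (idx p)"
  define u where "u \<mu> = (if \<mu> \<in> idx p then cech_prod R xs \<mu> [^] (s - k \<mu>) \<odot>\<^bsub>M\<^esub> m \<mu> else \<zero>\<^bsub>M\<^esub>)" for \<mu>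
  have u: "u \<in> Pow T \<rightarrow> carrier M"
    using mk xprod_closed by (auto simp: u_def prod_eq)
  have "c \<mu> = cfrac p s u \<mu>" for \<mu>
  proof (cases "\<mu> \<in> idx p")
    case True
    interpret localisation R M "cech_prod R xs \<mu>" by (rule loc[OF True])
    have "k \<mu> \<le> s" unfolding s_def using True finite_idx by (intro member_le_sum) auto
    then have "frac (u \<mu>) s = frac (m \<mu>) (k \<mu>)"
      using frac_scale[of "m \<mu>" "s - k \<mu>" "k \<mu>"] mk[OF True] True by (simp add: u_def)
    then show ?thesis using mk[OF True] True by (simp add: cfrac_def)
  next
    case False
    then show ?thesis using c by (auto simp: C_simps cfrac_def PiE_def extensional_def)
  qed
  then have "c = cfrac p s u" by (rule ext)
  with u show ?thesis using that[of u s] by (simp add: u_def)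
qed

lemma Pow_idx: "u \<in> Pow T \<rightarrow> carrier M \<Longrightarrow> u \<in> idx p \<rightarrow> carrier M"
  using idxD(1)[of _ p] by (auto simp: Pi_iff)

lemma cfrac_cases2:
  assumes "b \<in> carrier (C p)" "c \<in> carrier (C p)"
  obtains s u v where "u \<in> Pow T \<rightarrow> carrier M" "v \<in> Pow T \<rightarrow> carrier M" "b = cfrac p s u" "c = cfrac p s v"
proof -
  obtain s u where u: "u \<in> Pow T \<rightarrow> carrier M" "b = cfrac p s u" using assms(1) by (rule cfrac_cases)
  obtain t v where v: "v \<in> Pow T \<rightarrow> carrier M" "c = cfrac p t v" using assms(2) by (rule cfrac_cases)
  note i = Pow_idx[OF u(1), of p] Pow_idx[OF v(1), of p]
  show ?thesis
    using that[OF level_up_closed[OF u(1), of t] level_up_closed[OF v(1), of s], of "s + t"]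
      cfrac_level_up[OF i(1), of s t] cfrac_level_up[OF i(2), of t s] u v by (simp add: add.commute)
qed

lemma cfrac_add:
  assumes "u \<in> Pow T \<rightarrow> carrier M" "v \<in> Pow T \<rightarrow> carrier M"
  shows "cfrac p s u \<oplus>\<^bsub>C p\<^esub> cfrac p s v = cfrac p s (\<lambda>\<mu>. u \<mu> \<oplus>\<^bsub>M\<^esub> v \<mu>)"
  unfolding C_simps cfrac_def
proof (rule restrict_ext)
  fix \<mu> assume \<mu>: "\<mu> \<in> idx p"
  have "u \<mu> \<in> carrier M" "v \<mu> \<in> carrier M" using assms idxD(1)[OF \<mu>] by auto
  with \<mu> show "(\<lambda>\<mu>\<in>idx p. loc_frac R M (cech_prod R xs \<mu>) (u \<mu>) s) \<mu>
      \<oplus>\<^bsub>loc_module R M (cech_prod R xs \<mu>)\<^esub> (\<lambda>\<mu>\<in>idx p. loc_frac R M (cech_prod R xs \<mu>) (v \<mu>) s) \<mu> =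
      loc_frac R M (cech_prod R xs \<mu>) (u \<mu> \<oplus>\<^bsub>M\<^esub> v \<mu>) s"
    by (simp add: localisation.frac_add[OF loc[OF \<mu>]])
qed

lemma cfrac_smult:
  assumes "u \<in> Pow T \<rightarrow> carrier M" "r \<in> carrier R"
  shows "r \<odot>\<^bsub>C p\<^esub> cfrac p s u = cfrac p s (\<lambda>\<mu>. r \<odot>\<^bsub>M\<^esub> u \<mu>)"
  unfolding C_simps cfrac_def
proof (rule restrict_ext)
  fix \<mu> assume \<mu>: "\<mu> \<in> idx p"
  have "u \<mu> \<in> carrier M" using assms idxD(1)[OF \<mu>] by auto
  with \<mu> assms(2) show "r \<odot>\<^bsub>loc_module R M (cech_prod R xs \<mu>)\<^esub>
      (\<lambda>\<mu>\<in>idx p. loc_frac R M (cech_prod R xs \<mu>) (u \<mu>) s) \<mu> =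
      loc_frac R M (cech_prod R xs \<mu>) (r \<odot>\<^bsub>M\<^esub> u \<mu>) s"
    by (simp add: localisation.frac_smult[OF loc[OF \<mu>]])
qed

lemma cfrac_zero: "\<zero>\<^bsub>C p\<^esub> = cfrac p s (\<lambda>\<mu>. \<zero>\<^bsub>M\<^esub>)"
  unfolding C_simps cfrac_def by (intro restrict_ext localisation.frac_zero[OF loc])

lemma cfrac_eq_zero_iff:
  assumes "u \<in> Pow T \<rightarrow> carrier M"
  shows "cfrac p s u = \<zero>\<^bsub>C p\<^esub> \<longleftrightarrow> (\<exists>t. \<forall>\<mu>\<in>idx p. level_up R M (\<lambda>i. xs ! i) t u \<mu> = \<zero>\<^bsub>M\<^esub>)"
proof -
  have "level_up R M (\<lambda>i. xs ! i) t (\<lambda>\<mu>. \<zero>\<^bsub>M\<^esub>) \<mu> = \<zero>\<^bsub>M\<^esub>" if "\<mu> \<in> idx p" for t \<mu>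
    using xprod_closed[OF idxD(1)[OF that]] by (simp add: level_up_def)
  then show ?thesis
    unfolding cfrac_zero[of p s] by (subst cfrac_eq_iff[OF Pow_idx[OF assms]]) auto
qed

lemma C_module: "module R (C p)"
  unfolding cech_term_def Let_def
  by (rule product_module[OF R.is_cring localisation.loc_module[OF loc]])

lemma cech_res_frac:
  assumes \<mu>: "\<mu> \<subseteq> T" and j: "j \<in> \<mu>" and m: "m \<in> carrier M"
  shows "cech_res R xs M \<mu> j (loc_frac R M (cech_prod R xs (\<mu> - {j})) m k) =
    loc_frac R M (cech_prod R xs \<mu>) (xs ! j [^] k \<odot>\<^bsub>M\<^esub> m) k"
proof -
  have xj: "xs ! j \<in> carrier R" using x_closed \<mu> j by auto
  have yc: "cech_prod R xs (\<mu> - {j}) \<in> carrier R" unfolding prod_eq using \<mu> by (intro xprod_closed) auto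
  have "cech_prod R xs (insert j (\<mu> - {j})) = xs ! j \<otimes> cech_prod R xs (\<mu> - {j})"
    unfolding prod_eq using finite_subset_T[OF \<mu>] \<mu> j x_closed by (intro R.finprod_insert) auto
  then have y: "cech_prod R xs \<mu> = xs ! j \<otimes> cech_prod R xs (\<mu> - {j})" using j by (simp add: insert_absorb)
  interpret A: localisation R M "cech_prod R xs (\<mu> - {j})"
    using yc module_axioms by (simp add: localisation_def localisation_axioms_def)
  interpret B: localisation R M "cech_prod R xs \<mu>"
    using xprod_closed[OF \<mu>] module_axioms by (simp add: prod_eq localisation_def localisation_axioms_def)
  have "B.frac (xs ! j [^] l \<odot>\<^bsub>M\<^esub> n) l = B.frac (xs ! j [^] k \<odot>\<^bsub>M\<^esub> m) k"
    if n: "n \<in> carrier M" "A.frac n l = A.frac m k" for n l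
  proof -
    let ?y = "cech_prod R xs (\<mu> - {j})"
    obtain t :: nat where t: "?y [^] (t + k) \<odot>\<^bsub>M\<^esub> n = ?y [^] (t + l) \<odot>\<^bsub>M\<^esub> m" using n m A.frac_eq_iff by blast
    have e: "cech_prod R xs \<mu> [^] (t + a) \<odot>\<^bsub>M\<^esub> (xs ! j [^] b \<odot>\<^bsub>M\<^esub> w) = xs ! j [^] (t + a + b) \<odot>\<^bsub>M\<^esub> (?y [^] (t + a) \<odot>\<^bsub>M\<^esub> w)"
      if "w \<in> carrier M" for a b :: nat and w
      unfolding y using that xj yc
      by (simp add: smult_assoc1[symmetric] R.nat_pow_distrib R.nat_pow_mult[symmetric] R.m_ac)
    show ?thesis
    proof (rule B.frac_eqI[of _ _ t])
      show "cech_prod R xs \<mu> [^] (t + k) \<odot>\<^bsub>M\<^esub> (xs ! j [^] l \<odot>\<^bsub>M\<^esub> n) =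
          cech_prod R xs \<mu> [^] (t + l) \<odot>\<^bsub>M\<^esub> (xs ! j [^] k \<odot>\<^bsub>M\<^esub> m)"
        unfolding e[OF n(1)] e[OF m] t by (simp add: ac_simps)
    qed (use n m xj in auto)
  qed
  then show ?thesis
    unfolding cech_res_def by (rule A.frac_UN[OF m])
qed

lemma cech_diff_cfrac:
  assumes u: "u \<in> Pow T \<rightarrow> carrier M"
  shows "cech_diff R xs M p (cfrac p s u) = cfrac (Suc p) s (cobd R M (\<lambda>i. xs ! i) s u)"
  unfolding cech_diff_def cfrac_def[of "Suc p"] Let_def
proof (rule restrict_ext)
  fix \<mu> assume \<mu>: "\<mu> \<in> idx (Suc p)"
  interpret B: localisation R M "cech_prod R xs \<mu>" by (rule loc[OF \<mu>])
  interpret L: module R B.L by (rule B.loc_module)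
  have f: "finite \<mu>" using finite_subset_T[OF idxD(1)[OF \<mu>]] .
  let ?w = "\<lambda>j. (ksign R j \<mu> \<otimes> xs ! j [^] s) \<odot>\<^bsub>M\<^esub> u (\<mu> - {j})"
  have w: "?w j \<in> carrier M" if "j \<in> \<mu>" for j
    using that idxD(1)[OF \<mu>] by (intro cobd_term_closed[OF u]) auto
  have "finsum B.L (\<lambda>j. if even (card {i \<in> \<mu>. i < j}) then cech_res R xs M \<mu> j (cfrac p s u (\<mu> - {j}))
      else \<ominus>\<^bsub>B.L\<^esub> cech_res R xs M \<mu> j (cfrac p s u (\<mu> - {j}))) \<mu> = finsum B.L (\<lambda>j. B.frac (?w j) s) \<mu>"
  proof (intro L.M.finsum_cong' refl)
    fix j assume j: "j \<in> \<mu>"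
    have i: "\<mu> - {j} \<in> idx p" using \<mu> j f by (auto simp: cech_index_def)
    have c: "u (\<mu> - {j}) \<in> carrier M" "xs ! j [^] s \<in> carrier R"
      using u idxD(1)[OF \<mu>] j x_closed by auto
    have "cech_res R xs M \<mu> j (cfrac p s u (\<mu> - {j})) = B.frac (xs ! j [^] s \<odot>\<^bsub>M\<^esub> u (\<mu> - {j})) s"
      using i by (simp add: cfrac_def cech_res_frac[OF idxD(1)[OF \<mu>] j c(1)])
    then show "(if even (card {i \<in> \<mu>. i < j}) then cech_res R xs M \<mu> j (cfrac p s u (\<mu> - {j}))
      else \<ominus>\<^bsub>B.L\<^esub> cech_res R xs M \<mu> j (cfrac p s u (\<mu> - {j}))) = B.frac (?w j) s"
      using c by (simp add: ksign_def B.frac_neg R.l_minus smult_l_minus)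
  qed (use w in \<open>auto intro!: B.frac_closed\<close>)
  also have "\<dots> = B.frac (cobd R M (\<lambda>i. xs ! i) s u \<mu>) s"
    unfolding cobd_def using w f by (intro B.frac_finsum) auto
  finally show "finsum B.L (\<lambda>j. if even (card {i \<in> \<mu>. i < j}) then cech_res R xs M \<mu> j (cfrac p s u (\<mu> - {j}))
      else \<ominus>\<^bsub>B.L\<^esub> cech_res R xs M \<mu> j (cfrac p s u (\<mu> - {j}))) \<mu> = B.frac (cobd R M (\<lambda>i. xs ! i) s u \<mu>) s" .
qed

lemma cobd_Pow:
  assumes "u \<in> Pow T \<rightarrow> carrier M"
  shows "cobd R M (\<lambda>i. xs ! i) s u \<in> Pow T \<rightarrow> carrier M"
  using cobd_closed[OF assms] by auto

lemma cech_complex: "cochain_complex R C (cech_diff R xs M)"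
proof (rule cochain_complex.intro[OF C_module])
  fix p
  show "cech_diff R xs M p \<in> mod_hom R (C p) (C (Suc p))"
  proof (rule mod_homI)
    fix b assume "b \<in> carrier (C p)"
    then obtain s u where u: "u \<in> Pow T \<rightarrow> carrier M" "b = cfrac p s u" by (rule cfrac_cases)
    then show "cech_diff R xs M p b \<in> carrier (C (Suc p))"
      by (simp add: cech_diff_cfrac cfrac_closed Pow_idx cobd_Pow)
    fix r assume r: "r \<in> carrier R"
    have ru: "(\<lambda>\<mu>. r \<odot>\<^bsub>M\<^esub> u \<mu>) \<in> Pow T \<rightarrow> carrier M" using u r by (auto simp: Pi_iff)
    show "cech_diff R xs M p (r \<odot>\<^bsub>C p\<^esub> b) = r \<odot>\<^bsub>C (Suc p)\<^esub> cech_diff R xs M p b"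
      using u r ru
      by (simp add: cfrac_smult cech_diff_cfrac cobd_Pow) (intro cfrac_cong cobd_smult idxD(1))
  next
    fix b c assume "b \<in> carrier (C p)" "c \<in> carrier (C p)"
    then obtain s u v where u: "u \<in> Pow T \<rightarrow> carrier M" "v \<in> Pow T \<rightarrow> carrier M" "b = cfrac p s u" "c = cfrac p s v"
      by (rule cfrac_cases2)
    have uv: "(\<lambda>\<mu>. u \<mu> \<oplus>\<^bsub>M\<^esub> v \<mu>) \<in> Pow T \<rightarrow> carrier M" using u by (auto simp: Pi_iff)
    show "cech_diff R xs M p (b \<oplus>\<^bsub>C p\<^esub> c) = cech_diff R xs M p b \<oplus>\<^bsub>C (Suc p)\<^esub> cech_diff R xs M p c"
      using u uv
      by (simp add: cfrac_add cech_diff_cfrac cobd_Pow) (intro cfrac_cong cobd_add idxD(1))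
  qed
next
  fix p b assume "b \<in> carrier (C p)"
  then obtain s u where u: "u \<in> Pow T \<rightarrow> carrier M" "b = cfrac p s u" by (rule cfrac_cases)
  then show "cech_diff R xs M (Suc p) (cech_diff R xs M p b) = \<zero>\<^bsub>C (Suc (Suc p))\<^esub>"
    by (simp add: cech_diff_cfrac cobd_Pow cfrac_zero[of "Suc (Suc p)" s])
      (intro cfrac_cong cobd_cobd idxD(1))
qed

text \<open>The complex is the union of the images of the Koszul complexes of the \<open>x\<^sub>i\<^sup>s\<close> with values in \<open>M\<close>, and a
  fraction is zero if its numerators become zero at a higher level.  So every cocycle comes from a
  Koszul cocycle.\<close>

lemma cech_exact:
  assumes acyclic: "koszul_acyclic R M (\<lambda>i. xs ! i) T"
    and c: "c \<in> carrier (C (Suc p))" "cech_diff R xs M (Suc p) c = \<zero>\<^bsub>C (Suc (Suc p))\<^esub>"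
  shows "\<exists>b\<in>carrier (C p). c = cech_diff R xs M p b"
proof -
  let ?x = "\<lambda>i. xs ! i"
  obtain s u where u: "u \<in> Pow T \<rightarrow> carrier M" "\<And>\<mu>. \<mu> \<notin> idx (Suc p) \<Longrightarrow> u \<mu> = \<zero>\<^bsub>M\<^esub>" "c = cfrac (Suc p) s u"
    using c(1) by (rule cfrac_cases) blast
  have "cfrac (Suc (Suc p)) s (cobd R M ?x s u) = \<zero>\<^bsub>C (Suc (Suc p))\<^esub>"
    using c(2) u by (simp add: cech_diff_cfrac)
  then obtain t where t: "\<And>\<mu>. \<mu> \<in> idx (Suc (Suc p)) \<Longrightarrow> level_up R M ?x t (cobd R M ?x s u) \<mu> = \<zero>\<^bsub>M\<^esub>"
    using cfrac_eq_zero_iff[OF cobd_Pow[OF u(1)]] by blast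
  define u2 where "u2 = level_up R M ?x t u"
  have u2: "u2 \<in> Pow T \<rightarrow> carrier M" unfolding u2_def by (rule level_up_closed[OF u(1)])
  have u2z: "u2 \<mu> = \<zero>\<^bsub>M\<^esub>" if "\<mu> \<subseteq> T" "\<mu> \<notin> idx (Suc p)" for \<mu>
    using u(2)[OF that(2)] xprod_closed[OF that(1)] by (simp add: u2_def level_up_def)
  have "u2 {} = \<zero>\<^bsub>M\<^esub>" by (rule u2z) (auto simp: cech_index_def)
  moreover have "cobd R M ?x (s + t) u2 \<tau> = \<zero>\<^bsub>M\<^esub>" if \<tau>: "\<tau> \<subseteq> T" for \<tau>
  proof (cases "\<tau> \<in> idx (Suc (Suc p))")
    case True
    then show ?thesis using t cobd_level_up[OF u(1) \<tau>] by (simp add: u2_def)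
  next
    case False
    have "(ksign R j \<tau> \<otimes> ?x j [^] (s + t)) \<odot>\<^bsub>M\<^esub> u2 (\<tau> - {j}) = \<zero>\<^bsub>M\<^esub>" if j: "j \<in> \<tau>" for j
    proof -
      have "card \<tau> = Suc (card (\<tau> - {j}))"
        using finite_subset_T[OF \<tau>] j by (rule card.remove)
      then have "\<tau> - {j} \<notin> idx (Suc p)" using False \<tau> by (auto simp: cech_index_def)
      then have "u2 (\<tau> - {j}) = \<zero>\<^bsub>M\<^esub>" using \<tau> by (intro u2z) auto
      then show ?thesis using coeff_closed[of j \<tau> "s + t"] j \<tau> by auto
    qed
    then show ?thesis unfolding cobd_def by (intro M.add.finprod_one_eqI)
  qed
  ultimately have "\<exists>t'. \<exists>v\<in>Pow T \<rightarrow> carrier M. \<forall>\<mu>\<subseteq>T. level_up R M ?x t' u2 \<mu> = cobd R M ?x (s + t + t') v \<mu>"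
    by (rule koszul_acyclicD[OF acyclic u2])
  then obtain t' v where v: "v \<in> Pow T \<rightarrow> carrier M"
    "\<And>\<mu>. \<mu> \<subseteq> T \<Longrightarrow> level_up R M ?x t' u2 \<mu> = cobd R M ?x (s + t + t') v \<mu>" by blast
  have "cech_diff R xs M p (cfrac p (s + t + t') v) = cfrac (Suc p) (s + t + t') (level_up R M ?x t' u2)"
    unfolding cech_diff_cfrac[OF v(1)] by (rule cfrac_cong) (use v(2) idxD(1) in metis)
  also have "\<dots> = c"
    unfolding u2_def u(3) using u(1) level_up_closed[OF u(1)] by (simp add: cfrac_level_up Pow_idx)
  finally show ?thesis using cfrac_closed[OF Pow_idx[OF v(1)]] by metis
qed

text \<open>In degree \<open>0\<close> the complex consists of \<open>M\<close>, localised at the empty product.\<close>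

definition coaug :: "'m \<Rightarrow> nat set \<Rightarrow> ('m \<times> nat) set" where
  "coaug m = cfrac 0 0 (\<lambda>\<mu>. m)"

lemma idx_0: "idx 0 = {{}}"
proof -
  have "\<mu> = {}" if "\<mu> \<subseteq> T" "card \<mu> = 0" for \<mu>
    using finite_subset_T[OF that(1)] that(2) by simp
  then show ?thesis by (auto simp: cech_index_def)
qed

lemma idx_1: "idx (Suc 0) = (\<lambda>j. {j}) ` T"
proof (intro equalityI subsetI)
  fix \<mu> assume \<mu>: "\<mu> \<in> idx (Suc 0)"
  then obtain j where "\<mu> = {j}" using idxD(2)[OF \<mu>] by (auto simp: card_1_singleton_iff)
  then show "\<mu> \<in> (\<lambda>j. {j}) ` T" using idxD(1)[OF \<mu>] by auto
qed (auto simp: cech_index_def)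

lemma coaug_hom: "coaug \<in> mod_hom R M (C 0)"
  unfolding coaug_def by (rule mod_homI) (auto simp: cfrac_add cfrac_smult intro!: cfrac_closed)

lemma coaug_inj:
  assumes "m \<in> carrier M" "coaug m = \<zero>\<^bsub>C 0\<^esub>"
  shows "m = \<zero>\<^bsub>M\<^esub>"
  using assms by (subst (asm) coaug_def, subst (asm) cfrac_eq_zero_iff) (auto simp: idx_0 level_up_def)

lemma coaug_surj:
  assumes "c \<in> carrier (C 0)"
  shows "\<exists>m\<in>carrier M. c = coaug m"
proof -
  obtain s u where u: "u \<in> Pow T \<rightarrow> carrier M" "c = cfrac 0 s u" using assms by (rule cfrac_cases)
  have uc: "u {} \<in> carrier M" using u by auto
  have "cfrac 0 s u = cfrac 0 (0 + s) (level_up R M (\<lambda>i. xs ! i) s (\<lambda>\<mu>. u {}))"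
    unfolding add_0 by (rule cfrac_cong) (use uc in \<open>simp add: idx_0 level_up_def\<close>)
  also have "\<dots> = coaug (u {})" unfolding coaug_def using uc by (intro cfrac_level_up) auto
  finally show ?thesis using u uc by blast
qed

lemma coaug_cocycle_iff:
  assumes m: "m \<in> carrier M"
  shows "cech_diff R xs M 0 (coaug m) = \<zero>\<^bsub>C (Suc 0)\<^esub> \<longleftrightarrow> m \<in> torsion R (genideal R (set xs)) M"
proof -
  let ?x = "\<lambda>i. xs ! i"
  have set: "set xs = ?x ` T" by (auto simp: set_conv_nth)
  have um: "(\<lambda>\<mu>. m) \<in> Pow T \<rightarrow> carrier M" using m by simp
  have "level_up R M ?x t (cobd R M ?x 0 (\<lambda>\<mu>. m)) {j} = xs ! j [^] t \<odot>\<^bsub>M\<^esub> m" if j: "j \<in> T" for t j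
  proof -
    have s: "ksign R j {} = \<one>" by (simp add: ksign_def)
    have xj: "xs ! j \<in> carrier R" using x_closed[OF j] .
    then show ?thesis using m by (simp add: level_up_def cobd_def s)
  qed
  then have "cech_diff R xs M 0 (coaug m) = \<zero>\<^bsub>C (Suc 0)\<^esub> \<longleftrightarrow>
      (\<exists>t::nat. \<forall>j\<in>T. xs ! j [^] t \<odot>\<^bsub>M\<^esub> m = \<zero>\<^bsub>M\<^esub>)"
    unfolding coaug_def cech_diff_cfrac[OF um] cfrac_eq_zero_iff[OF cobd_Pow[OF um]] idx_1 by simp
  also have "\<dots> \<longleftrightarrow> (\<forall>j\<in>T. \<exists>t::nat. xs ! j [^] t \<odot>\<^bsub>M\<^esub> m = \<zero>\<^bsub>M\<^esub>)"
  proof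
    assume "\<forall>j\<in>T. \<exists>t::nat. xs ! j [^] t \<odot>\<^bsub>M\<^esub> m = \<zero>\<^bsub>M\<^esub>"
    then obtain t where t: "\<And>j. j \<in> T \<Longrightarrow> xs ! j [^] (t j :: nat) \<odot>\<^bsub>M\<^esub> m = \<zero>\<^bsub>M\<^esub>" by metis
    have "xs ! j [^] (sum t T) \<odot>\<^bsub>M\<^esub> m = \<zero>\<^bsub>M\<^esub>" if j: "j \<in> T" for j
    proof -
      obtain k where k: "sum t T = k + t j"
        using j member_le_sum[of j T t] by (metis add.commute finite_lessThan le_add_diff_inverse zero_le)
      show ?thesis
        unfolding k using x_closed[OF j] m t[OF j] by (simp add: R.nat_pow_mult[symmetric] smult_assoc1)
    qed
    then show "\<exists>t::nat. \<forall>j\<in>T. xs ! j [^] t \<odot>\<^bsub>M\<^esub> m = \<zero>\<^bsub>M\<^esub>" by blast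
  qed blast
  also have "\<dots> \<longleftrightarrow> m \<in> torsion R (genideal R (set xs)) M"
    unfolding set torsion_iff[OF module_axioms T x] using m by simp
  finally show ?thesis .
qed

end

lemma cech_intro: "module R M \<Longrightarrow> set xs \<subseteq> carrier R \<Longrightarrow> cech R M xs"
  by (auto simp: cech_def cochains_def cochains_axioms_def)


subsection \<open>Functoriality\<close>

locale cech_hom = M: cech R M xs + N: cech R N xs
  for R :: "('a, 'r) ring_scheme" and M :: "('a, 'm) module" and N :: "('a, 'n) module" and xs :: "'a list" +
  fixes f :: "'m \<Rightarrow> 'n"
  assumes f: "f \<in> mod_hom R M N"
begin

lemma fu: "u \<in> Pow M.T \<rightarrow> carrier M \<Longrightarrow> (\<lambda>\<mu>. f (u \<mu>)) \<in> Pow N.T \<rightarrow> carrier N"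
  using mod_hom_closed[OF f] by (auto simp: Pi_iff)

lemma f_level_up:
  assumes "u \<in> Pow M.T \<rightarrow> carrier M" "\<mu> \<subseteq> M.T"
  shows "level_up R N (\<lambda>i. xs ! i) t (\<lambda>\<mu>. f (u \<mu>)) \<mu> = f (level_up R M (\<lambda>i. xs ! i) t u \<mu>)"
proof -
  have "u \<mu> \<in> carrier M" using assms by auto
  then show ?thesis
    using M.xprod_closed[OF assms(2)] by (simp add: level_up_def mod_hom_smult[OF f])
qed

lemma f_cobd:
  assumes "u \<in> Pow M.T \<rightarrow> carrier M" "\<mu> \<subseteq> M.T"
  shows "cobd R N (\<lambda>i. xs ! i) s (\<lambda>\<mu>. f (u \<mu>)) \<mu> = f (cobd R M (\<lambda>i. xs ! i) s u \<mu>)"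
proof -
  have "f (cobd R M (\<lambda>i. xs ! i) s u \<mu>) =
      finsum N (\<lambda>j. f ((ksign R j \<mu> \<otimes>\<^bsub>R\<^esub> xs ! j [^]\<^bsub>R\<^esub> s) \<odot>\<^bsub>M\<^esub> u (\<mu> - {j}))) \<mu>"
    unfolding cobd_def using assms M.finite_subset_T[OF assms(2)]
    by (intro mod_hom_finsum[OF M.module_axioms N.module_axioms f]) (auto intro!: M.cobd_term_closed)
  also have "\<dots> = cobd R N (\<lambda>i. xs ! i) s (\<lambda>\<mu>. f (u \<mu>)) \<mu>"
    unfolding cobd_def
  proof (intro N.M.finsum_cong' refl)
    fix j assume "j \<in> \<mu>"
    then show "f ((ksign R j \<mu> \<otimes>\<^bsub>R\<^esub> xs ! j [^]\<^bsub>R\<^esub> s) \<odot>\<^bsub>M\<^esub> u (\<mu> - {j})) =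
        (ksign R j \<mu> \<otimes>\<^bsub>R\<^esub> xs ! j [^]\<^bsub>R\<^esub> s) \<odot>\<^bsub>N\<^esub> f (u (\<mu> - {j}))"
      using assms by (intro mod_hom_smult[OF f] M.coeff_closed) auto
  qed (use assms in \<open>auto intro!: N.cobd_term_closed[OF fu]\<close>)
  finally show ?thesis by simp
qed

lemma cech_map_cfrac:
  assumes u: "u \<in> Pow M.T \<rightarrow> carrier M"
  shows "cech_map R xs N f p (M.cfrac p s u) = N.cfrac p s (\<lambda>\<mu>. f (u \<mu>))"
  unfolding cech_map_def N.cfrac_def
proof (rule restrict_ext)
  fix \<mu> assume \<mu>: "\<mu> \<in> M.idx p"
  interpret A: localisation R M "cech_prod R xs \<mu>" by (rule M.loc[OF \<mu>])
  interpret B: localisation R N "cech_prod R xs \<mu>" by (rule N.loc[OF \<mu>])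
  have uc: "u \<mu> \<in> carrier M" using u M.idxD[OF \<mu>] by auto
  have "B.frac (f n) l = B.frac (f (u \<mu>)) s" if n: "n \<in> carrier M" "A.frac n l = A.frac (u \<mu>) s" for n l
  proof -
    obtain t :: nat where t: "cech_prod R xs \<mu> [^]\<^bsub>R\<^esub> (t + s) \<odot>\<^bsub>M\<^esub> n = cech_prod R xs \<mu> [^]\<^bsub>R\<^esub> (t + l) \<odot>\<^bsub>M\<^esub> u \<mu>"
      using n uc A.frac_eq_iff by blast
    show ?thesis
      using arg_cong[OF t, of f] n uc A.x mod_hom_closed[OF f]
      by (intro B.frac_eqI[of _ _ t]) (auto simp: mod_hom_smult[OF f])
  qed
  then have "(\<Union>(m, k)\<in>A.frac (u \<mu>) s. B.frac (f m) k) = B.frac (f (u \<mu>)) s"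
    by (rule A.frac_UN[OF uc])
  then show "(\<Union>(m, k)\<in>M.cfrac p s u \<mu>. B.frac (f m) k) = B.frac (f (u \<mu>)) s"
    using \<mu> by (simp add: M.cfrac_def)
qed

lemma cech_map_hom: "cech_map R xs N f p \<in> mod_hom R (M.C p) (N.C p)"
proof (rule mod_homI)
  fix b assume "b \<in> carrier (M.C p)"
  then obtain s u where u: "u \<in> Pow M.T \<rightarrow> carrier M" "b = M.cfrac p s u" by (rule M.cfrac_cases)
  then show "cech_map R xs N f p b \<in> carrier (N.C p)"
    by (simp add: cech_map_cfrac N.cfrac_closed N.Pow_idx fu)
  fix r assume r: "r \<in> carrier R"
  have ru: "(\<lambda>\<mu>. r \<odot>\<^bsub>M\<^esub> u \<mu>) \<in> Pow M.T \<rightarrow> carrier M" using u r by (auto simp: Pi_iff)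
  have "N.cfrac p s (\<lambda>\<mu>. f (r \<odot>\<^bsub>M\<^esub> u \<mu>)) = N.cfrac p s (\<lambda>\<mu>. r \<odot>\<^bsub>N\<^esub> f (u \<mu>))"
    using M.Pow_idx[OF u(1), of p] r by (intro N.cfrac_cong) (simp add: Pi_iff mod_hom_smult[OF f])
  then show "cech_map R xs N f p (r \<odot>\<^bsub>M.C p\<^esub> b) = r \<odot>\<^bsub>N.C p\<^esub> cech_map R xs N f p b"
    unfolding u(2) M.cfrac_smult[OF u(1) r] cech_map_cfrac[OF ru] cech_map_cfrac[OF u(1)]
      N.cfrac_smult[OF fu[OF u(1)] r] .
next
  fix b c assume "b \<in> carrier (M.C p)" "c \<in> carrier (M.C p)"
  then obtain s u v where u: "u \<in> Pow M.T \<rightarrow> carrier M" "v \<in> Pow M.T \<rightarrow> carrier M" "b = M.cfrac p s u" "c = M.cfrac p s v"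
    by (rule M.cfrac_cases2)
  have uv: "(\<lambda>\<mu>. u \<mu> \<oplus>\<^bsub>M\<^esub> v \<mu>) \<in> Pow M.T \<rightarrow> carrier M" using u by (auto simp: Pi_iff)
  have "N.cfrac p s (\<lambda>\<mu>. f (u \<mu> \<oplus>\<^bsub>M\<^esub> v \<mu>)) = N.cfrac p s (\<lambda>\<mu>. f (u \<mu>) \<oplus>\<^bsub>N\<^esub> f (v \<mu>))"
    using M.Pow_idx[OF u(1), of p] M.Pow_idx[OF u(2), of p]
    by (intro N.cfrac_cong) (simp add: Pi_iff mod_hom_add[OF f])
  then show "cech_map R xs N f p (b \<oplus>\<^bsub>M.C p\<^esub> c) = cech_map R xs N f p b \<oplus>\<^bsub>N.C p\<^esub> cech_map R xs N f p c"
    unfolding u(3,4) M.cfrac_add[OF u(1,2)] cech_map_cfrac[OF uv] cech_map_cfrac[OF u(1)] cech_map_cfrac[OF u(2)]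
      N.cfrac_add[OF fu[OF u(1)] fu[OF u(2)]] .
qed

lemma cech_map_diff:
  assumes "b \<in> carrier (M.C p)"
  shows "cech_map R xs N f (Suc p) (cech_diff R xs M p b) = cech_diff R xs N p (cech_map R xs N f p b)"
proof -
  obtain s u where u: "u \<in> Pow M.T \<rightarrow> carrier M" "b = M.cfrac p s u" using assms by (rule M.cfrac_cases)
  have e: "N.cfrac (Suc p) s (\<lambda>\<mu>. f (cobd R M (\<lambda>i. xs ! i) s u \<mu>)) =
      N.cfrac (Suc p) s (cobd R N (\<lambda>i. xs ! i) s (\<lambda>\<mu>. f (u \<mu>)))"
    by (rule N.cfrac_cong) (use u M.idxD f_cobd in auto)
  show ?thesis
    using u e by (simp add: M.cech_diff_cfrac N.cech_diff_cfrac cech_map_cfrac fu M.cobd_Pow)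
qed

lemma cech_map_coaug:
  assumes "m \<in> carrier M"
  shows "cech_map R xs N f 0 (M.coaug m) = N.coaug (f m)"
  using assms by (simp add: M.coaug_def N.coaug_def cech_map_cfrac)

end

text \<open>Localisation is exact: once the fractions are expanded far enough, \<open>g\<close> vanishes on their numerators,
  and these come from \<open>M\<close>.\<close>

lemma cech_map_exact:
  fixes M :: "('a, 'm) module" and N :: "('a, 'n) module" and Q :: "('a, 'q) module"
  assumes "cech_hom R M N xs f" "cech_hom R N Q xs g"
    and exact: "\<And>y. y \<in> carrier N \<Longrightarrow> g y = \<zero>\<^bsub>Q\<^esub> \<Longrightarrow> y \<in> f ` carrier M"
    and c: "c \<in> carrier (cech_term R xs N p)" "cech_map R xs Q g p c = \<zero>\<^bsub>cech_term R xs Q p\<^esub>"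
  shows "\<exists>b\<in>carrier (cech_term R xs M p). c = cech_map R xs N f p b"
proof -
  interpret F: cech_hom R M N xs f by fact
  interpret G: cech_hom R N Q xs g by fact
  obtain s u where u: "u \<in> Pow F.N.T \<rightarrow> carrier N" "c = F.N.cfrac p s u"
    using c(1) by (rule F.N.cfrac_cases)
  have "G.N.cfrac p s (\<lambda>\<mu>. g (u \<mu>)) = \<zero>\<^bsub>G.N.C p\<^esub>" using c(2) u by (simp add: G.cech_map_cfrac)
  then obtain t where t: "\<And>\<mu>. \<mu> \<in> F.N.idx p \<Longrightarrow> level_up R Q (\<lambda>i. xs ! i) t (\<lambda>\<mu>. g (u \<mu>)) \<mu> = \<zero>\<^bsub>Q\<^esub>"
    using G.N.cfrac_eq_zero_iff[OF G.fu[OF u(1)]] by blast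
  let ?u = "level_up R N (\<lambda>i. xs ! i) t u"
  have "\<exists>y\<in>carrier M. ?u \<mu> = f y" if \<mu>: "\<mu> \<in> F.N.idx p" for \<mu>
  proof -
    have "?u \<mu> \<in> carrier N" using F.N.level_up_closed[OF u(1), of t] F.N.idxD[OF \<mu>] by auto
    moreover have "g (?u \<mu>) = \<zero>\<^bsub>Q\<^esub>" using t[OF \<mu>] G.f_level_up[OF u(1) F.N.idxD(1)[OF \<mu>]] by simp
    ultimately show ?thesis using exact by blast
  qed
  then obtain w0 where w0: "\<And>\<mu>. \<mu> \<in> F.N.idx p \<Longrightarrow> w0 \<mu> \<in> carrier M \<and> ?u \<mu> = f (w0 \<mu>)" by metis
  define w where "w \<mu> = (if \<mu> \<in> F.N.idx p then w0 \<mu> else \<zero>\<^bsub>M\<^esub>)" for \<mu>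
  have w: "w \<in> Pow F.M.T \<rightarrow> carrier M" using w0 by (auto simp: w_def)
  have "c = F.N.cfrac p (s + t) ?u" using u by (simp add: F.N.cfrac_level_up F.N.Pow_idx)
  also have "\<dots> = F.N.cfrac p (s + t) (\<lambda>\<mu>. f (w \<mu>))"
    using w0 by (intro F.N.cfrac_cong) (simp add: w_def)
  also have "\<dots> = cech_map R xs N f p (F.M.cfrac p (s + t) w)"
    using w by (simp add: F.cech_map_cfrac)
  finally show ?thesis using F.M.cfrac_closed[OF F.M.Pow_idx[OF w]] by blast
qed

lemma cech_map_compose:
  fixes M :: "('a, 'm) module" and N :: "('a, 'n) module" and Q :: "('a, 'q) module"
  assumes "cech_hom R M N xs f" "cech_hom R N Q xs g" "cech_hom R M Q xs h"
    and "\<And>m. m \<in> carrier M \<Longrightarrow> h m = g (f m)"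
    and "b \<in> carrier (cech_term R xs M p)"
  shows "cech_map R xs Q g p (cech_map R xs N f p b) = cech_map R xs Q h p b"
proof -
  interpret F: cech_hom R M N xs f by fact
  interpret G: cech_hom R N Q xs g by fact
  interpret H: cech_hom R M Q xs h by fact
  obtain s u where u: "u \<in> Pow F.M.T \<rightarrow> carrier M" "b = F.M.cfrac p s u"
    using assms(5) by (rule F.M.cfrac_cases)
  have "G.N.cfrac p s (\<lambda>\<mu>. g (f (u \<mu>))) = G.N.cfrac p s (\<lambda>\<mu>. h (u \<mu>))"
    using assms(4) F.M.Pow_idx[OF u(1), of p] by (intro G.N.cfrac_cong) (simp add: Pi_iff)
  then show ?thesis
    unfolding u(2) F.cech_map_cfrac[OF u(1)] G.cech_map_cfrac[OF F.fu[OF u(1)]] H.cech_map_cfrac[OF u(1)] .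
qed

lemma cech_map_eq_zero:
  fixes M :: "('a, 'm) module" and N :: "('a, 'n) module"
  assumes "cech_hom R M N xs f" and "\<And>m. m \<in> carrier M \<Longrightarrow> f m = \<zero>\<^bsub>N\<^esub>"
    and "b \<in> carrier (cech_term R xs M p)"
  shows "cech_map R xs N f p b = \<zero>\<^bsub>cech_term R xs N p\<^esub>"
proof -
  interpret F: cech_hom R M N xs f by fact
  obtain s u where u: "u \<in> Pow F.M.T \<rightarrow> carrier M" "b = F.M.cfrac p s u"
    using assms(3) by (rule F.M.cfrac_cases)
  then show ?thesis
    using assms(2) F.M.Pow_idx[OF u(1), of p]
    by (auto simp: F.cech_map_cfrac F.N.cfrac_zero[of p s] intro!: F.N.cfrac_cong)
qed


section \<open>Comparison with the derived functors\<close>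

subsection \<open>Morphisms of resolved double complexes\<close>

text \<open>The map of double complexes carries a cochain that links \<open>z\<close> and \<open>w\<close> to one that links their images.\<close>

lemma linked_map:
  assumes bi: "biresolved_complex R K h v A dA a B dB b" "biresolved_complex R K' h' v' A' dA' a' B' dB' b'"
    and k: "\<And>p q. k p q \<in> mod_hom R (K p q) (K' p q)"
    and fA: "\<And>p. fA p \<in> mod_hom R (A p) (A' p)" and fB: "\<And>q. fB q \<in> mod_hom R (B q) (B' q)"
    and kh: "\<And>p q x. x \<in> carrier (K p q) \<Longrightarrow> k (Suc p) q (h p q x) = h' p q (k p q x)"
    and kv: "\<And>p q x. x \<in> carrier (K p q) \<Longrightarrow> k p (Suc q) (v p q x) = v' p q (k p q x)"
    and ka: "\<And>p x. x \<in> carrier (A p) \<Longrightarrow> k p 0 (a p x) = a' p (fA p x)"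
    and kb: "\<And>q x. x \<in> carrier (B q) \<Longrightarrow> k 0 q (b q x) = b' q (fB q x)"
    and fdA: "\<And>p x. x \<in> carrier (A p) \<Longrightarrow> fA (Suc p) (dA p x) = dA' p (fA p x)"
    and fdB: "\<And>q x. x \<in> carrier (B q) \<Longrightarrow> fB (Suc q) (dB q x) = dB' q (fB q x)"
    and zw: "biresolved_complex.linked K h v A dA a B dB b l z w"
  shows "biresolved_complex.linked K' h' v' A' dA' a' B' dB' b' l (fA l z) (fB l w)"
proof -
  interpret X1: biresolved_complex R K h v A dA a B dB b by fact
  interpret X2: biresolved_complex R K' h' v' A' dA' a' B' dB' b' by fact
  obtain c where c: "X1.A.fam c"
      "\<And>p q. p + q = l \<Longrightarrow> X1.A.aug l z p q = X1.B.aug l w q p \<oplus>\<^bsub>K p q\<^esub> X1.A.tdiff c p q"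
    and z: "z \<in> carrier (A l)" "dA l z = \<zero>\<^bsub>A (Suc l)\<^esub>" and w: "w \<in> carrier (B l)" "dB l w = \<zero>\<^bsub>B (Suc l)\<^esub>"
    using zw unfolding X1.linked_def by (auto simp: cocycles_def)
  define c' where "c' = (\<lambda>p q. k p q (c p q))"
  have c': "X2.A.fam c'"
    using X1.A.famD[OF c(1)] mod_hom_closed[OF k] by (simp add: X2.A.fam_def c'_def)
  have k0: "k p q \<zero>\<^bsub>K p q\<^esub> = \<zero>\<^bsub>K' p q\<^esub>" for p q by (rule mod_hom_zero[OF X1.A.K X2.A.K k])
  have td: "k p q (X1.A.tdiff c p q) = X2.A.tdiff c' p q" for p q
  proof -
    have "k p q (X1.A.hpart c p q) = X2.A.hpart c' p q"
      by (cases p) (auto simp: X1.A.hpart_def X2.A.hpart_def k0 c'_def kh X1.A.famD[OF c(1)])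
    moreover have "k p q (X1.A.vpart c p q) = X2.A.vpart c' p q"
      by (cases q) (auto simp: X1.A.vpart_def X2.A.vpart_def k0 c'_def kv X1.A.famD[OF c(1)])
    ultimately show ?thesis
      unfolding X1.A.tdiff_def X2.A.tdiff_def
      using mod_hom_add[OF k X1.A.hpart_closed[OF c(1)] X1.A.vpart_closed[OF c(1)]] by simp
  qed
  have kA: "k p q (X1.A.aug l z p q) = X2.A.aug l (fA l z) p q" for p q
    using ka[OF z(1)] by (auto simp: X1.A.aug_def X2.A.aug_def k0)
  have kB: "k p q (X1.B.aug l w q p) = X2.B.aug l (fB l w) q p" for p q
    using kb[OF w(1)] by (auto simp: X1.B.aug_def X2.B.aug_def k0)
  have "X2.A.aug l (fA l z) p q = X2.B.aug l (fB l w) q p \<oplus>\<^bsub>K' p q\<^esub> X2.A.tdiff c' p q" if pq: "p + q = l" for p q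
    unfolding kA[symmetric] kB[symmetric] td[symmetric] c(2)[OF pq]
    by (rule mod_hom_add[OF k X1.A.famD[OF X1.fam_baug[OF w(1)]] X1.A.famD[OF X1.A.fam_tdiff[OF c(1)]]])
  moreover have "fA l z \<in> cocycles A' dA' l"
    using fdA[OF z(1)] z mod_hom_zero[OF X1.A.A X2.A.A fA] mod_hom_closed[OF fA z(1)] by (simp add: cocycles_def)
  moreover have "fB l w \<in> cocycles B' dB' l"
    using fdB[OF w(1)] w mod_hom_zero[OF X1.B.A X2.B.A fB] mod_hom_closed[OF fB w(1)] by (simp add: cocycles_def)
  ultimately show ?thesis using c' unfolding X2.linked_def by blast
qed


subsection \<open>Torsion submodules\<close>

abbreviation torsion_module :: "('a, 'r) ring_scheme \<Rightarrow> 'a list \<Rightarrow> ('a, 'm) module \<Rightarrow> ('a, 'm) module" where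
  "torsion_module R xs M \<equiv> M\<lparr>carrier := torsion R (genideal R (set xs)) M\<rparr>"

text \<open>The torsion elements form the kernel of the map from \<open>M\<close> to the term of degree \<open>1\<close>.\<close>

lemma (in cech) torsion_module: "module R (torsion_module R xs M)"
proof (rule module_restrict_carrier[OF module_axioms])
  let ?g = "\<lambda>m. cech_diff R xs M 0 (coaug m)"
  have g: "?g \<in> mod_hom R M (C (Suc 0))"
    by (rule mod_hom_compose[OF coaug_hom cochain_complex.d[OF cech_complex]])
  have tor: "m \<in> torsion R (genideal R (set xs)) M \<longleftrightarrow> m \<in> carrier M \<and> ?g m = \<zero>\<^bsub>C (Suc 0)\<^esub>" for m
    using coaug_cocycle_iff[of m] by (auto simp: torsion_def)
  interpret C1: module R "C (Suc 0)" by (rule C_module)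
  show "torsion R (genideal R (set xs)) M \<subseteq> carrier M" by (auto simp: torsion_def)
  show "\<zero>\<^bsub>M\<^esub> \<in> torsion R (genideal R (set xs)) M"
    using mod_hom_zero[OF module_axioms C_module g] by (simp add: tor)
  show "m \<oplus>\<^bsub>M\<^esub> n \<in> torsion R (genideal R (set xs)) M"
    if "m \<in> torsion R (genideal R (set xs)) M" "n \<in> torsion R (genideal R (set xs)) M" for m n
    using that mod_hom_add[OF g, of m n] by (simp add: tor)
  show "r \<odot>\<^bsub>M\<^esub> m \<in> torsion R (genideal R (set xs)) M"
    if "r \<in> carrier R" "m \<in> torsion R (genideal R (set xs)) M" for r m
    using that mod_hom_smult[OF g, of r m] by (simp add: tor)
qed

lemma torsion_map:
  assumes "module R M" "module R N" "f \<in> mod_hom R M N" "ideal B R" "m \<in> torsion R B M"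
  shows "f m \<in> torsion R B N"
proof -
  interpret M: module R M by fact
  obtain n :: nat where n: "m \<in> carrier M" "\<And>b. b \<in> B [^]\<^bsub>ideals_set R\<^esub> n \<Longrightarrow> b \<odot>\<^bsub>M\<^esub> m = \<zero>\<^bsub>M\<^esub>"
    using assms(5) by (auto simp: torsion_def)
  have "b \<odot>\<^bsub>N\<^esub> f m = \<zero>\<^bsub>N\<^esub>" if b: "b \<in> B [^]\<^bsub>ideals_set R\<^esub> n" for b
  proof -
    have "b \<in> carrier R" using ideal.Icarr[OF M.R.ideal_pow_closed[OF assms(4)] b] .
    then show ?thesis
      using n(2)[OF b] mod_hom_smult[OF assms(3) _ n(1), of b] mod_hom_zero[OF assms(1-3)] by simp
  qed
  then show ?thesis using n(1) mod_hom_closed[OF assms(3)] by (auto simp: torsion_def)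
qed

lemma torsion_hom:
  assumes "module R M" "module R N" "f \<in> mod_hom R M N" "set xs \<subseteq> carrier R"
  shows "restrict f (torsion R (genideal R (set xs)) M) \<in> mod_hom R (torsion_module R xs M) (torsion_module R xs N)"
proof -
  interpret M: module R M by fact
  interpret T: module R "torsion_module R xs M"
    by (rule cech.torsion_module[OF cech_intro[OF assms(1,4)]])
  have tc: "m \<in> carrier M" if "m \<in> torsion R (genideal R (set xs)) M" for m using that by (simp add: torsion_def)
  show ?thesis
  proof (rule mod_homI)
    show "restrict f (torsion R (genideal R (set xs)) M) m \<in> carrier (torsion_module R xs N)"
      if "m \<in> carrier (torsion_module R xs M)" for m
      using that torsion_map[OF assms(1-3) M.R.genideal_ideal[OF assms(4)]] by simp
    show "restrict f (torsion R (genideal R (set xs)) M) (m \<oplus>\<^bsub>torsion_module R xs M\<^esub> n) =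
        restrict f (torsion R (genideal R (set xs)) M) m \<oplus>\<^bsub>torsion_module R xs N\<^esub>
        restrict f (torsion R (genideal R (set xs)) M) n"
      if "m \<in> carrier (torsion_module R xs M)" "n \<in> carrier (torsion_module R xs M)" for m n
      using that T.M.a_closed[OF that] tc by (simp add: mod_hom_add[OF assms(3)])
    show "restrict f (torsion R (genideal R (set xs)) M) (r \<odot>\<^bsub>torsion_module R xs M\<^esub> m) =
        r \<odot>\<^bsub>torsion_module R xs N\<^esub> restrict f (torsion R (genideal R (set xs)) M) m"
      if "r \<in> carrier R" "m \<in> carrier (torsion_module R xs M)" for r m
      using that T.smult_closed[OF that] tc by (simp add: mod_hom_smult[OF assms(3)])
  qed
qed


subsection \<open>The double complex of a resolution\<close>

text \<open>The sign \<open>(-1)\<^sup>p\<close> makes the maps induced by the resolution anticommute with the Cech differentials,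
  with which they commute by naturality.\<close>

definition vdiff :: "('a, 'r) ring_scheme \<Rightarrow> 'a list \<Rightarrow> ('a, 'm, 'i) resolution \<Rightarrow> nat \<Rightarrow> nat \<Rightarrow>
    (nat set \<Rightarrow> ('i \<times> nat) set) \<Rightarrow> nat set \<Rightarrow> ('i \<times> nat) set" where
  "vdiff R xs P p q c = (if even p then cech_map R xs (terms P (Suc q)) (diff P q) p c
     else \<ominus>\<^bsub>cech_term R xs (terms P (Suc q)) p\<^esub> cech_map R xs (terms P (Suc q)) (diff P q) p c)"

abbreviation resolution_linked where
  "resolution_linked R xs M P \<equiv> biresolved_complex.linked
     (\<lambda>p q. cech_term R xs (terms P q) p) (\<lambda>p q. cech_diff R xs (terms P q) p) (vdiff R xs P)
     (cech_term R xs M) (cech_diff R xs M) (cech_map R xs (terms P 0) (aug P))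
     (\<lambda>q. torsion_module R xs (terms P q)) (\<lambda>q. restrict (diff P q) (torsion R (genideal R (set xs)) (terms P q)))
     (\<lambda>q. cech.coaug R (terms P q) xs)"

text \<open>The columns are exact because localisation is exact, the rows because the Cech complexes of the
  terms of the resolution are acyclic.\<close>

lemma resolution_biresolved:
  fixes M :: "('a, 'm) module" and P :: "('a, 'm, 'i) resolution"
  assumes M: "module R M" and xs: "set xs \<subseteq> carrier R" and P: "injective_resolution R M P"
    and acyclic: "\<And>q. koszul_acyclic R (terms P q) (\<lambda>i. xs ! i) {..<length xs}"
  shows "biresolved_complex R
     (\<lambda>p q. cech_term R xs (terms P q) p) (\<lambda>p q. cech_diff R xs (terms P q) p) (vdiff R xs P)
     (cech_term R xs M) (cech_diff R xs M) (cech_map R xs (terms P 0) (aug P))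
     (\<lambda>q. torsion_module R xs (terms P q)) (\<lambda>q. restrict (diff P q) (torsion R (genideal R (set xs)) (terms P q)))
     (\<lambda>q. cech.coaug R (terms P q) xs)"
proof -
  note Pd = injective_resolutionD[OF P]
  let ?I = "terms P" and ?d = "diff P"
  let ?K = "\<lambda>p q. cech_term R xs (?I q) p"
  let ?h = "\<lambda>p q. cech_diff R xs (?I q) p"
  let ?v = "vdiff R xs P"
  let ?m = "\<lambda>p q. cech_map R xs (?I (Suc q)) (?d q) p"
  let ?a = "cech_map R xs (?I 0) (aug P)"
  let ?tor = "\<lambda>q. torsion R (genideal R (set xs)) (?I q)"
  let ?B = "\<lambda>q. torsion_module R xs (?I q)" and ?dB = "\<lambda>q. restrict (?d q) (?tor q)"
  let ?b = "\<lambda>q. cech.coaug R (?I q) xs"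
  have cI: "cech R (?I q) xs" for q by (rule cech_intro[OF Pd(2) xs])
  have cM: "cech R M xs" by (rule cech_intro[OF M xs])
  have hd: "cech_hom R (?I q) (?I (Suc q)) xs (?d q)" for q
    by (intro cech_hom.intro cech_hom_axioms.intro cI Pd(3))
  have ha: "cech_hom R M (?I 0) xs (aug P)"
    by (intro cech_hom.intro cech_hom_axioms.intro cI cM Pd(4))
  note cxI = cech.cech_complex[OF cI] and cxM = cech.cech_complex[OF cM]
  have K: "module R (?K p q)" for p q by (rule cech.C_module[OF cI])
  have h: "?h p q \<in> mod_hom R (?K p q) (?K (Suc p) q)" for p q by (rule cochain_complex.d[OF cxI])
  have m: "?m p q \<in> mod_hom R (?K p q) (?K p (Suc q))" for p q by (rule cech_hom.cech_map_hom[OF hd])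
  have mc: "?m p q x \<in> carrier (?K p (Suc q))" if "x \<in> carrier (?K p q)" for p q x
    using mod_hom_closed[OF m that] .
  have v_zero_iff: "?v p q x = \<zero>\<^bsub>?K p (Suc q)\<^esub> \<longleftrightarrow> ?m p q x = \<zero>\<^bsub>?K p (Suc q)\<^esub>" if "x \<in> carrier (?K p q)" for p q x
  proof -
    interpret N: module R "?K p (Suc q)" by (rule K)
    have "\<ominus>\<^bsub>?K p (Suc q)\<^esub> \<zero>\<^bsub>?K p (Suc q)\<^esub> = \<zero>\<^bsub>?K p (Suc q)\<^esub>" by (rule N.M.minus_equality) simp_all
    then show ?thesis
      unfolding vdiff_def using N.M.minus_minus[OF mc[OF that]] by (auto, metis)
  qed
  have v: "?v p q \<in> mod_hom R (?K p q) (?K p (Suc q))" for p q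
  proof (rule mod_homI)
    interpret N: module R "?K p (Suc q)" by (rule K)
    show "?v p q x \<in> carrier (?K p (Suc q))" if "x \<in> carrier (?K p q)" for x
      using mc[OF that] by (simp add: vdiff_def)
    show "?v p q (x \<oplus>\<^bsub>?K p q\<^esub> y) = ?v p q x \<oplus>\<^bsub>?K p (Suc q)\<^esub> ?v p q y"
      if "x \<in> carrier (?K p q)" "y \<in> carrier (?K p q)" for x y
      using mc[OF that(1)] mc[OF that(2)] mod_hom_add[OF m that] by (simp add: vdiff_def N.M.minus_add)
    show "?v p q (r \<odot>\<^bsub>?K p q\<^esub> x) = r \<odot>\<^bsub>?K p (Suc q)\<^esub> ?v p q x"
      if "r \<in> carrier R" "x \<in> carrier (?K p q)" for r x
      using mc[OF that(2)] mod_hom_smult[OF m that] that(1) by (simp add: vdiff_def N.smult_r_minus)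
  qed
  have mm: "?m p (Suc q) (?m p q x) = \<zero>\<^bsub>?K p (Suc (Suc q))\<^esub>" if x: "x \<in> carrier (?K p q)" for p q x
  proof -
    have d2: "?d (Suc q) (?d q y) = \<zero>\<^bsub>?I (Suc (Suc q))\<^esub>" if "y \<in> carrier (?I q)" for y
      using Pd(7)[of "?d q y" q] mod_hom_closed[OF Pd(3) that] that by blast
    have hz: "cech_hom R (?I q) (?I (Suc (Suc q))) xs (\<lambda>y. ?d (Suc q) (?d q y))"
      by (intro cech_hom.intro cech_hom_axioms.intro cI mod_hom_compose[OF Pd(3) Pd(3)])
    show ?thesis
      using cech_map_compose[OF hd hd hz refl x] cech_map_eq_zero[OF hz d2 x] by simp
  qed
  have dc: "double_complex R ?K ?h ?v"
  proof (rule double_complex.intro)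
    show "module R (?K p q)" "?h p q \<in> mod_hom R (?K p q) (?K (Suc p) q)"
      "?v p q \<in> mod_hom R (?K p q) (?K p (Suc q))" for p q
      by (rule K h v)+
    show "?h (Suc p) q (?h p q x) = \<zero>\<^bsub>?K (Suc (Suc p)) q\<^esub>" if "x \<in> carrier (?K p q)" for p q x
      by (rule cochain_complex.dd[OF cxI that])
    show "?v p (Suc q) (?v p q x) = \<zero>\<^bsub>?K p (Suc (Suc q))\<^esub>" if x: "x \<in> carrier (?K p q)" for p q x
    proof -
      have "?m p (Suc q) (?v p q x) = \<zero>\<^bsub>?K p (Suc (Suc q))\<^esub>"
      proof -
        interpret N: module R "?K p (Suc (Suc q))" by (rule K)
        have "\<ominus>\<^bsub>?K p (Suc (Suc q))\<^esub> \<zero>\<^bsub>?K p (Suc (Suc q))\<^esub> = \<zero>\<^bsub>?K p (Suc (Suc q))\<^esub>"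
          by (rule N.M.minus_equality) simp_all
        then show ?thesis
          using mm[OF x] mod_hom_neg[OF K K m mc[OF x]] by (simp add: vdiff_def[of R xs P p q x])
      qed
      then show ?thesis using v_zero_iff[OF mod_hom_closed[OF v x]] by simp
    qed
    show "?h p (Suc q) (?v p q x) \<oplus>\<^bsub>?K (Suc p) (Suc q)\<^esub> ?v (Suc p) q (?h p q x) = \<zero>\<^bsub>?K (Suc p) (Suc q)\<^esub>"
      if x: "x \<in> carrier (?K p q)" for p q x
    proof -
      interpret N: module R "?K (Suc p) (Suc q)" by (rule K)
      have e: "?m (Suc p) q (?h p q x) = ?h p (Suc q) (?m p q x)"
        by (rule cech_hom.cech_map_diff[OF hd x])
      have c: "?h p (Suc q) (?m p q x) \<in> carrier (?K (Suc p) (Suc q))"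
        by (rule mod_hom_closed[OF h mc[OF x]])
      show ?thesis
        using c mod_hom_neg[OF K K h mc[OF x]] by (simp add: vdiff_def e N.M.l_neg N.M.r_neg)
    qed
  qed
  have ac: "?a p \<in> mod_hom R (cech_term R xs M p) (?K p 0)" for p by (rule cech_hom.cech_map_hom[OF ha])
  have resA: "resolved_complex R ?K ?h ?v (cech_term R xs M) (cech_diff R xs M) ?a"
  proof (intro resolved_complex.intro dc resolved_complex_axioms.intro)
    show "module R (cech_term R xs M p)" for p by (rule cech.C_module[OF cM])
    show "cech_diff R xs M p \<in> mod_hom R (cech_term R xs M p) (cech_term R xs M (Suc p))" for p
      by (rule cochain_complex.d[OF cxM])
    show "?a p \<in> mod_hom R (cech_term R xs M p) (?K p 0)" for p by (rule ac)
    show "?h p 0 (?a p x) = ?a (Suc p) (cech_diff R xs M p x)" if "x \<in> carrier (cech_term R xs M p)" for p x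
      using cech_hom.cech_map_diff[OF ha that] by simp
    show "?v p 0 (?a p x) = \<zero>\<^bsub>?K p (Suc 0)\<^esub>" if x: "x \<in> carrier (cech_term R xs M p)" for p x
    proof -
      have hz: "cech_hom R M (?I (Suc 0)) xs (\<lambda>y. ?d 0 (aug P y))"
        by (intro cech_hom.intro cech_hom_axioms.intro cI cM mod_hom_compose[OF Pd(4) Pd(3)])
      have "?d 0 (aug P y) = \<zero>\<^bsub>?I (Suc 0)\<^esub>" if "y \<in> carrier M" for y
        using Pd(6)[of "aug P y"] mod_hom_closed[OF Pd(4) that] that by blast
      then have "?m p 0 (?a p x) = \<zero>\<^bsub>?K p (Suc 0)\<^esub>"
        using cech_map_compose[OF ha hd hz refl x] cech_map_eq_zero[OF hz _ x] by simp
      then show ?thesis using v_zero_iff[OF mod_hom_closed[OF ac x]] by simp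
    qed
    show "x = \<zero>\<^bsub>cech_term R xs M p\<^esub>"
      if x: "x \<in> carrier (cech_term R xs M p)" and ax: "?a p x = \<zero>\<^bsub>?K p 0\<^esub>" for p x
    proof -
      interpret M: module R M by fact
      have hz: "cech_hom R M M xs (\<lambda>y. \<zero>\<^bsub>M\<^esub>)"
        by (intro cech_hom.intro cech_hom_axioms.intro cM mod_homI) auto
      have "\<exists>b\<in>carrier (cech_term R xs M p). x = cech_map R xs M (\<lambda>y. \<zero>\<^bsub>M\<^esub>) p b"
      proof (rule cech_map_exact[OF hz ha _ x ax])
        fix y assume y: "y \<in> carrier M" "aug P y = \<zero>\<^bsub>?I 0\<^esub>"
        have "y = \<zero>\<^bsub>M\<^esub>"
          using y mod_hom_zero[OF M Pd(2) Pd(4)] by (intro inj_onD[OF Pd(5)]) auto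
        then show "y \<in> (\<lambda>y. \<zero>\<^bsub>M\<^esub>) ` carrier M" using y by blast
      qed
      then show ?thesis using cech_map_eq_zero[OF hz] by auto
    qed
    show "\<exists>x\<in>carrier (cech_term R xs M p). y = ?a p x"
      if y: "y \<in> carrier (?K p 0)" and vy: "?v p 0 y = \<zero>\<^bsub>?K p (Suc 0)\<^esub>" for p y
    proof (rule cech_map_exact[OF ha hd _ y])
      show "?m p 0 y = \<zero>\<^bsub>?K p (Suc 0)\<^esub>" using v_zero_iff[OF y] vy by simp
      show "z \<in> aug P ` carrier M" if "z \<in> carrier (?I 0)" "?d 0 z = \<zero>\<^bsub>?I (Suc 0)\<^esub>" for z
        using Pd(6)[OF that(1)] that(2) by simp
    qed
    show "\<exists>x\<in>carrier (?K p q). y = ?v p q x"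
      if y: "y \<in> carrier (?K p (Suc q))" and vy: "?v p (Suc q) y = \<zero>\<^bsub>?K p (Suc (Suc q))\<^esub>" for p q y
    proof -
      have "\<exists>x\<in>carrier (?K p q). y = ?m p q x"
      proof (rule cech_map_exact[OF hd hd _ y])
        show "?m p (Suc q) y = \<zero>\<^bsub>?K p (Suc (Suc q))\<^esub>" using v_zero_iff[OF y] vy by simp
        show "z \<in> ?d q ` carrier (?I q)" if "z \<in> carrier (?I (Suc q))" "?d (Suc q) z = \<zero>\<^bsub>?I (Suc (Suc q))\<^esub>" for z
          using Pd(7)[OF that(1)] that(2) by simp
      qed
      then obtain x where x: "x \<in> carrier (?K p q)" "y = ?m p q x" by blast
      interpret N: module R "?K p q" by (rule K)
      interpret N': module R "?K p (Suc q)" by (rule K)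
      show ?thesis
      proof (cases "even p")
        case True
        then show ?thesis using x by (auto simp: vdiff_def)
      next
        case False
        have "y = ?v p q (\<ominus>\<^bsub>?K p q\<^esub> x)"
          using False x mc[OF x(1)] mod_hom_neg[OF K K m x(1)] by (simp add: vdiff_def)
        then show ?thesis using x(1) by blast
      qed
    qed
  qed
  have B: "module R (?B q)" for q by (rule cech.torsion_module[OF cI])
  have dB: "?dB q \<in> mod_hom R (?B q) (?B (Suc q))" for q by (rule torsion_hom[OF Pd(2) Pd(2) Pd(3) xs])
  have torc: "m \<in> carrier (?I q)" if "m \<in> ?tor q" for m q using that by (simp add: torsion_def)
  have bI: "?b q \<in> mod_hom R (?I q) (?K 0 q)" for q by (rule cech.coaug_hom[OF cI])
  have b: "?b q \<in> mod_hom R (?B q) (?K 0 q)" for q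
    using torc by (intro mod_homI) (auto simp: mod_hom_add[OF bI] mod_hom_smult[OF bI] intro: mod_hom_closed[OF bI])
  have resB: "resolved_complex R (\<lambda>p q. ?K q p) (\<lambda>p q. ?v q p) (\<lambda>p q. ?h q p) ?B ?dB ?b"
  proof (intro resolved_complex.intro double_complex.double_complex_transpose[OF dc] resolved_complex_axioms.intro)
    show "module R (?B p)" "?dB p \<in> mod_hom R (?B p) (?B (Suc p))" "?b p \<in> mod_hom R (?B p) (?K 0 p)" for p
      by (rule B dB b)+
    show "?v 0 p (?b p x) = ?b (Suc p) (?dB p x)" if "x \<in> carrier (?B p)" for p x
      using that torc cech_hom.cech_map_coaug[OF hd, of x p] by (simp add: vdiff_def)
    show "x = \<zero>\<^bsub>?B p\<^esub>" if "x \<in> carrier (?B p)" "?b p x = \<zero>\<^bsub>?K 0 p\<^esub>" for p x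
      using cech.coaug_inj[OF cI _ that(2)] that(1) torc by simp
    show "?h 0 p (?b p x) = \<zero>\<^bsub>?K (Suc 0) p\<^esub>" if "x \<in> carrier (?B p)" for p x
      using cech.coaug_cocycle_iff[OF cI torc] that by simp
    show "\<exists>x\<in>carrier (?B p). y = ?b p x"
      if y: "y \<in> carrier (?K 0 p)" "?h 0 p y = \<zero>\<^bsub>?K (Suc 0) p\<^esub>" for p y
    proof -
      obtain m where m: "m \<in> carrier (?I p)" "y = ?b p m" using cech.coaug_surj[OF cI y(1)] by blast
      then show ?thesis using cech.coaug_cocycle_iff[OF cI m(1)] y(2) by auto
    qed
    show "\<exists>x\<in>carrier (?K q p). y = ?h q p x"
      if "y \<in> carrier (?K (Suc q) p)" "?h (Suc q) p y = \<zero>\<^bsub>?K (Suc (Suc q)) p\<^esub>" for p q y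
      by (rule cech.cech_exact[OF cI acyclic that])
  qed
  have "cochain_complex R ?B ?dB"
  proof (rule cochain_complex.intro)
    show "module R (?B q)" "?dB q \<in> mod_hom R (?B q) (?B (Suc q))" for q
      by (rule B dB)+
  next
    fix q x assume x: "x \<in> carrier (?B q)"
    have "?d q x \<in> ?tor (Suc q)" using mod_hom_closed[OF dB x] x by simp
    then show "?dB (Suc q) (?dB q x) = \<zero>\<^bsub>?B (Suc (Suc q))\<^esub>"
      using x torc Pd(7)[of "?d q x" q] by auto
  qed
  then show ?thesis
    by (intro biresolved_complex.intro resA resB biresolved_complex_axioms.intro cxM)
qed


subsection \<open>The comparison isomorphism\<close>

text \<open>Naturality holds because a lift of \<open>f\<close> to the resolutions induces a map of double complexes that is
  compatible with both augmentations.\<close>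

lemma cech_cohomology_right_derived:
  fixes R :: "('a, 'r) ring_scheme" and \<rho> :: "('a, 'm) module \<Rightarrow> ('a, 'm, 'i) resolution"
  assumes xs: "set xs \<subseteq> carrier R"
    and \<rho>: "\<And>M. module R M \<Longrightarrow> injective_resolution R M (\<rho> M)"
    and acyclic: "\<And>I :: ('a, 'i) module. injective_module R I \<Longrightarrow> koszul_acyclic R I (\<lambda>i. xs ! i) {..<length xs}"
  shows "naturally_isomorphic R (cech_cohomology R xs l)
    (right_derived R \<rho> l (torsion_functor R (genideal R (set xs))))"
proof -
  let ?F = "torsion_functor R (genideal R (set xs)) :: ('a, 'i, 'i) mod_functor"
  let ?tor = "\<lambda>M q. torsion R (genideal R (set xs)) (terms (\<rho> M) q)"
  let ?B = "\<lambda>M q. torsion_module R xs (terms (\<rho> M) q)"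
  let ?dB = "\<lambda>M q. restrict (diff (\<rho> M) q) (?tor M q)"
  let ?rel = "\<lambda>M. resolution_linked R xs M (\<rho> M) l"
  define \<theta> where "\<theta> M = cohomology_relation.rel_map (?rel M)" for M
  have bi: "biresolved_complex R
     (\<lambda>p q. cech_term R xs (terms (\<rho> M) q) p) (\<lambda>p q. cech_diff R xs (terms (\<rho> M) q) p) (vdiff R xs (\<rho> M))
     (cech_term R xs M) (cech_diff R xs M) (cech_map R xs (terms (\<rho> M) 0) (aug (\<rho> M)))
     (?B M) (?dB M) (\<lambda>q. cech.coaug R (terms (\<rho> M) q) xs)" if "module R M" for M
    by (rule resolution_biresolved[OF that xs \<rho>[OF that] acyclic[OF injective_resolutionD(1)[OF \<rho>[OF that]]]])
  have rel: "cohomology_relation R (cech_term R xs M) (cech_diff R xs M) (?B M) (?dB M) l (?rel M)"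
    if "module R M" for M
    by (rule biresolved_complex.linked_cohomology_relation[OF bi[OF that]])
  have objF: "on_obj (cech_cohomology R xs l) M = cohomology (cech_term R xs M) (cech_diff R xs M) l" for M :: "('a, 'm) module"
    by (simp add: cech_cohomology_def)
  have objG: "on_obj (right_derived R \<rho> l ?F) M = cohomology (?B M) (?dB M) l" for M
    by (simp add: right_derived_def Let_def torsion_functor_def)
  have nat: "\<theta> N (on_hom (cech_cohomology R xs l) M N f Y) = on_hom (right_derived R \<rho> l ?F) M N f (\<theta> M Y)"
    if M: "module R M" and N: "module R N" and f: "f \<in> mod_hom R M N"
      and Y: "Y \<in> carrier (cohomology (cech_term R xs M) (cech_diff R xs M) l)" for M N f Y
  proof -
    interpret RM: cohomology_relation R "cech_term R xs M" "cech_diff R xs M" "?B M" "?dB M" l "?rel M"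
      by (rule rel[OF M])
    interpret RN: cohomology_relation R "cech_term R xs N" "cech_diff R xs N" "?B N" "?dB N" l "?rel N"
      by (rule rel[OF N])
    define \<phi> where "\<phi> = (SOME \<phi>. lifts_to_resolutions R M f (\<rho> M) (\<rho> N) \<phi>)"
    have "lifts_to_resolutions R M f (\<rho> M) (\<rho> N) \<phi>"
      unfolding \<phi>_def by (rule someI_ex[OF lift_exists[OF M N f \<rho>[OF M] \<rho>[OF N]]])
    then have \<phi>: "\<And>n. \<phi> n \<in> mod_hom R (terms (\<rho> M) n) (terms (\<rho> N) n)"
      "\<And>n x. x \<in> carrier (terms (\<rho> M) n) \<Longrightarrow> \<phi> (Suc n) (diff (\<rho> M) n x) = diff (\<rho> N) n (\<phi> n x)"
      "\<And>x. x \<in> carrier M \<Longrightarrow> \<phi> 0 (aug (\<rho> M) x) = aug (\<rho> N) (f x)"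
      by (auto simp: lifts_to_resolutions_def)
    note PM = injective_resolutionD[OF \<rho>[OF M]] and PN = injective_resolutionD[OF \<rho>[OF N]]
    have cIM: "cech R (terms (\<rho> M) q) xs" and cIN: "cech R (terms (\<rho> N) q) xs" for q
      by (rule cech_intro[OF PM(2) xs], rule cech_intro[OF PN(2) xs])
    have cM: "cech R M xs" and cN: "cech R N xs" by (rule cech_intro[OF M xs], rule cech_intro[OF N xs])
    have hf: "cech_hom R M N xs f" by (intro cech_hom.intro cech_hom_axioms.intro cM cN f)
    have h\<phi>: "cech_hom R (terms (\<rho> M) q) (terms (\<rho> N) q) xs (\<phi> q)" for q
      by (intro cech_hom.intro cech_hom_axioms.intro cIM cIN \<phi>(1))
    have hdM: "cech_hom R (terms (\<rho> M) q) (terms (\<rho> M) (Suc q)) xs (diff (\<rho> M) q)" for q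
      by (intro cech_hom.intro cech_hom_axioms.intro cIM PM(3))
    have hdN: "cech_hom R (terms (\<rho> N) q) (terms (\<rho> N) (Suc q)) xs (diff (\<rho> N) q)" for q
      by (intro cech_hom.intro cech_hom_axioms.intro cIN PN(3))
    have haM: "cech_hom R M (terms (\<rho> M) 0) xs (aug (\<rho> M))"
      by (intro cech_hom.intro cech_hom_axioms.intro cM cIM PM(4))
    have haN: "cech_hom R N (terms (\<rho> N) 0) xs (aug (\<rho> N))"
      by (intro cech_hom.intro cech_hom_axioms.intro cN cIN PN(4))
    let ?k = "\<lambda>p q. cech_map R xs (terms (\<rho> N) q) (\<phi> q) p"
    let ?fA = "cech_map R xs N f"
    let ?fB = "\<lambda>q. restrict (\<phi> q) (?tor M q)"
    have torc: "m \<in> carrier (terms (\<rho> M) q)" if "m \<in> ?tor M q" for m q using that by (simp add: torsion_def)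
    have fA: "?fA p \<in> mod_hom R (cech_term R xs M p) (cech_term R xs N p)" for p by (rule cech_hom.cech_map_hom[OF hf])
    have fB: "?fB q \<in> mod_hom R (?B M q) (?B N q)" for q by (rule torsion_hom[OF PM(2) PN(2) \<phi>(1) xs])
    have fdA: "?fA (Suc p) (cech_diff R xs M p x) = cech_diff R xs N p (?fA p x)"
      if "x \<in> carrier (cech_term R xs M p)" for p x by (rule cech_hom.cech_map_diff[OF hf that])
    have fdB: "?fB (Suc q) (?dB M q x) = ?dB N q (?fB q x)" if "x \<in> carrier (?B M q)" for q x
    proof -
      have "?dB M q x \<in> ?tor M (Suc q)" "?fB q x \<in> ?tor N q"
        using mod_hom_closed[OF RM.D.d that] mod_hom_closed[OF fB that] by auto
      then show ?thesis using that \<phi>(2) torc by simp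
    qed
    have km: "?k p (Suc q) (cech_map R xs (terms (\<rho> M) (Suc q)) (diff (\<rho> M) q) p x) =
        cech_map R xs (terms (\<rho> N) (Suc q)) (diff (\<rho> N) q) p (?k p q x)"
      if x: "x \<in> carrier (cech_term R xs (terms (\<rho> M) q) p)" for p q x
    proof -
      have hz: "cech_hom R (terms (\<rho> M) q) (terms (\<rho> N) (Suc q)) xs (\<lambda>y. diff (\<rho> N) q (\<phi> q y))"
        by (intro cech_hom.intro cech_hom_axioms.intro cIM cIN mod_hom_compose[OF \<phi>(1) PN(3)])
      show ?thesis
        using cech_map_compose[OF hdM h\<phi> hz _ x] cech_map_compose[OF h\<phi> hdN hz _ x] \<phi>(2) by simp
    qed
    have linked: "?rel N (?fA l z) (?fB l w)" if zw: "?rel M z w" for z w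
    proof (rule linked_map[OF bi[OF M] bi[OF N], where k = ?k, OF _ fA fB _ _ _ _ fdA fdB zw])
      show "?k p q \<in> mod_hom R (cech_term R xs (terms (\<rho> M) q) p) (cech_term R xs (terms (\<rho> N) q) p)" for p q
        by (rule cech_hom.cech_map_hom[OF h\<phi>])
      show "?k (Suc p) q (cech_diff R xs (terms (\<rho> M) q) p x) = cech_diff R xs (terms (\<rho> N) q) p (?k p q x)"
        if "x \<in> carrier (cech_term R xs (terms (\<rho> M) q) p)" for p q x
        by (rule cech_hom.cech_map_diff[OF h\<phi> that])
      show "?k p (Suc q) (vdiff R xs (\<rho> M) p q x) = vdiff R xs (\<rho> N) p q (?k p q x)"
        if x: "x \<in> carrier (cech_term R xs (terms (\<rho> M) q) p)" for p q x
        using km[OF x] mod_hom_neg[OF cech.C_module[OF cIM] cech.C_module[OF cIN] cech_hom.cech_map_hom[OF h\<phi>]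
            mod_hom_closed[OF cech_hom.cech_map_hom[OF hdM] x]]
        by (simp add: vdiff_def)
      show "?k p 0 (cech_map R xs (terms (\<rho> M) 0) (aug (\<rho> M)) p x) =
          cech_map R xs (terms (\<rho> N) 0) (aug (\<rho> N)) p (?fA p x)" if x: "x \<in> carrier (cech_term R xs M p)" for p x
      proof -
        have hz: "cech_hom R M (terms (\<rho> N) 0) xs (\<lambda>y. aug (\<rho> N) (f y))"
          by (intro cech_hom.intro cech_hom_axioms.intro cM cIN mod_hom_compose[OF f PN(4)])
        show ?thesis
          using cech_map_compose[OF haM h\<phi> hz _ x] cech_map_compose[OF hf haN hz _ x] \<phi>(3) by simp
      qed
      show "?k 0 q (cech.coaug R (terms (\<rho> M) q) xs x) = cech.coaug R (terms (\<rho> N) q) xs (?fB q x)"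
        if "x \<in> carrier (?B M q)" for q x
        using that torc cech_hom.cech_map_coaug[OF h\<phi>, of x q] by simp
    qed
    obtain z where z: "z \<in> cocycles (cech_term R xs M) (cech_diff R xs M) l" "Y = RM.C.cls l z"
      using Y by (rule RM.C.cohomology_cases)
    obtain w where w: "?rel M z w" using RM.rel_left[OF z(1)] by blast
    have "on_hom (cech_cohomology R xs l) M N f Y = RN.C.cls l (?fA l z)"
      unfolding z(2) cech_cohomology_def
      using RM.C.cohomology_map_coset[OF RM.rel_carrier(1)[OF w] RN.C.cochain_complex_axioms fA fdA] by simp
    then have "\<theta> N (on_hom (cech_cohomology R xs l) M N f Y) = RN.D.cls l (?fB l w)"
      unfolding \<theta>_def by (simp only: RN.rel_map_coset[OF linked[OF w]])
    moreover have "\<theta> M Y = RM.D.cls l w"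
      unfolding \<theta>_def z(2) by (rule RM.rel_map_coset[OF w])
    moreover have "on_hom (right_derived R \<rho> l ?F) M N f = cohomology_map (?B N) (?dB N) ?fB l"
      unfolding \<phi>_def right_derived_def Let_def torsion_functor_def
      by (simp only: mod_functor.simps)
    moreover have "cohomology_map (?B N) (?dB N) ?fB l (RM.D.cls l w) = RN.D.cls l (?fB l w)"
      by (rule RM.D.cohomology_map_coset[OF RM.rel_carrier(2)[OF w] RN.D.cochain_complex_axioms fB fdB])
    ultimately show ?thesis by (simp only:)
  qed
  show ?thesis
    unfolding naturally_isomorphic_def
  proof (intro exI[of _ \<theta>] conjI allI impI ballI)
    fix M :: "('a, 'm) module" assume M: "module R M"
    show "\<theta> M \<in> mod_iso R (on_obj (cech_cohomology R xs l) M) (on_obj (right_derived R \<rho> l ?F) M)"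
      unfolding objF objG \<theta>_def by (rule cohomology_relation.rel_map_iso[OF rel[OF M]])
  next
    fix M N :: "('a, 'm) module" and f Y
    assume "module R M \<and> module R N \<and> f \<in> mod_hom R M N"
      and "Y \<in> carrier (on_obj (cech_cohomology R xs l) M)"
    then show "\<theta> N (on_hom (cech_cohomology R xs l) M N f Y) = on_hom (right_derived R \<rho> l ?F) M N f (\<theta> M Y)"
      unfolding objF by (intro nat) auto
  qed
qed


subsection \<open>Vanishing for generators of monomial ideals\<close>

lemma koszul_acyclic_cong:
  assumes M: "module R M" and x: "x \<in> T \<rightarrow> carrier R" and eq: "\<And>i. i \<in> T \<Longrightarrow> x i = y i"
    and acyclic: "koszul_acyclic R M x T"
  shows "koszul_acyclic R M y T"
proof -
  interpret module R M by fact
  have y: "y \<in> T \<rightarrow> carrier R"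
  proof
    fix i assume i: "i \<in> T"
    then have "x i \<in> carrier R" using x by auto
    then show "y i \<in> carrier R" using eq[OF i] by simp
  qed
  have "finprod R x \<mu> = finprod R y \<mu>" if "\<mu> \<subseteq> T" for \<mu>
    using that y eq by (intro R.finprod_cong' refl) auto
  then have lv: "level_up R M x t u \<mu> = level_up R M y t u \<mu>" if "\<mu> \<subseteq> T" for t u \<mu>
    using that by (simp add: level_up_def)
  have cb: "cobd R M x s u \<mu> = cobd R M y s u \<mu>" if "\<mu> \<subseteq> T" "u \<in> Pow T \<rightarrow> carrier M" for s u \<mu>
    unfolding cobd_def
  proof (intro M.finsum_cong' refl)
    fix j assume "j \<in> \<mu>"
    then show "(ksign R j \<mu> \<otimes>\<^bsub>R\<^esub> x j [^]\<^bsub>R\<^esub> s) \<odot>\<^bsub>M\<^esub> u (\<mu> - {j}) = (ksign R j \<mu> \<otimes>\<^bsub>R\<^esub> y j [^]\<^bsub>R\<^esub> s) \<odot>\<^bsub>M\<^esub> u (\<mu> - {j})"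
      using that eq[of j] by auto
  next
    show "(\<lambda>j. (ksign R j \<mu> \<otimes>\<^bsub>R\<^esub> y j [^]\<^bsub>R\<^esub> s) \<odot>\<^bsub>M\<^esub> u (\<mu> - {j})) \<in> \<mu> \<rightarrow> carrier M"
    proof
      fix j assume "j \<in> \<mu>"
      then have "y j \<in> carrier R" "u (\<mu> - {j}) \<in> carrier M" using that y by auto
      then show "(ksign R j \<mu> \<otimes>\<^bsub>R\<^esub> y j [^]\<^bsub>R\<^esub> s) \<odot>\<^bsub>M\<^esub> u (\<mu> - {j}) \<in> carrier M" by simp
    qed
  qed
  show ?thesis
    unfolding koszul_acyclic_def
  proof (intro allI ballI impI)
    fix s u assume u: "u \<in> Pow T \<rightarrow> carrier M"
      and "u {} = \<zero>\<^bsub>M\<^esub> \<and> (\<forall>\<tau>\<subseteq>T. cobd R M y s u \<tau> = \<zero>\<^bsub>M\<^esub>)"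
    then have "\<exists>t. \<exists>v \<in> Pow T \<rightarrow> carrier M. \<forall>\<mu>\<subseteq>T. level_up R M x t u \<mu> = cobd R M x (s + t) v \<mu>"
      by (intro koszul_acyclicD[OF acyclic u]) (simp_all add: cb u)
    then show "\<exists>t. \<exists>v \<in> Pow T \<rightarrow> carrier M. \<forall>\<mu>\<subseteq>T. level_up R M y t u \<mu> = cobd R M y (s + t) v \<mu>"
      using lv cb by metis
  qed
qed

text \<open>The ideal is given both by the list \<open>xs\<close> and by a possibly infinite set of monomials.  Finitely many
  of these already generate it.  They are indexed by the numbers from \<open>length xs\<close> on, so that one family
  \<open>x\<close> comprises both systems of generators.\<close>

lemma monomial_ideal_koszul_acyclic:
  fixes S :: "('s, 'c) ring_scheme" and V :: "'v set" and xs :: "('v multiset \<Rightarrow> 's) list"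
    and I :: "('v multiset \<Rightarrow> 's, ('v multiset \<Rightarrow> 's, 'm) inj_univ) module"
  assumes S: "cring S" and xs: "set xs \<subseteq> carrier (mpoly_ring S V)"
    and mon: "monomial_ideal S V (genideal (mpoly_ring S V) (set xs))"
    and I: "injective_module (mpoly_ring S V) I"
  shows "koszul_acyclic (mpoly_ring S V) I (\<lambda>i. xs ! i) {..<length xs}"
proof -
  interpret mpoly S V using S by (simp add: mpoly_def)
  let ?R = "mpoly_ring S V"
  obtain A where A: "A \<subseteq> {a. set_mset a \<subseteq> V}" "genideal ?R (set xs) = genideal ?R (mpoly_monom S ` A)"
    using mon by (auto simp: monomial_ideal_def)
  have Ac: "mpoly_monom S ` A \<subseteq> carrier ?R" using A(1) monom_closed by auto
  have "set xs \<subseteq> genideal ?R (mpoly_monom S ` A)" using P.genideal_self[OF xs] A(2) by simp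
  from P.genideal_finitely_generated[OF Ac finite_set this]
  obtain A0 where A0: "A0 \<subseteq> mpoly_monom S ` A" "finite A0" "set xs \<subseteq> genideal ?R A0" by blast
  obtain A1 where A1: "A1 \<subseteq> A" "finite A1" "A0 = mpoly_monom S ` A1"
    using finite_subset_image[OF A0(2,1)] by auto
  obtain as where as: "set as = A1" using finite_list[OF A1(2)] by blast
  define n where "n = length xs"
  define x where "x i = (if i < n then xs ! i else mpoly_monom S (as ! (i - n)))" for i
  let ?T = "{..<n}" and ?T' = "{n..<n + length as}"
  have xT: "x ` ?T = set xs" by (auto simp: x_def n_def set_conv_nth)
  have xT': "x ` ?T' = A0"
  proof -
    have "?T' = (\<lambda>i. n + i) ` {..<length as}"
      using image_add_atLeastLessThan[of n 0 "length as"] by (simp add: lessThan_atLeast0 add.commute)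
    then have "x ` ?T' = (\<lambda>i. x (n + i)) ` {..<length as}" by (simp only: image_image)
    also have "\<dots> = (\<lambda>i. mpoly_monom S (as ! i)) ` {..<length as}" by (simp add: x_def)
    also have "\<dots> = mpoly_monom S ` set as" by (auto simp: set_conv_nth)
    finally show ?thesis using A1(3) as by simp
  qed
  have aV: "set_mset (as ! (i - n)) \<subseteq> V" if "i \<in> ?T'" for i
  proof -
    have "as ! (i - n) \<in> set as" using that by (intro nth_mem) auto
    then show ?thesis using A(1) A1(1) as by blast
  qed
  interpret monomials S V ?T' "\<lambda>i. as ! (i - n)" x
    by unfold_locales (use aV in \<open>auto simp: x_def\<close>)
  have A0c: "A0 \<subseteq> carrier ?R" using A0(1) Ac by blast
  have xc: "x \<in> ?T \<union> ?T' \<rightarrow> carrier ?R" using xs A0c xT xT' by blast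
  have Im: "module ?R I" using I by (simp add: injective_module_def)
  have "koszul_acyclic ?R I x ?T'"
  proof (rule injective_koszul_acyclic[OF I _ _ finite_families_embed, where t = "\<lambda>s. card ?T' * s"])
    show "x \<in> ?T' \<rightarrow> carrier ?R" using xc by auto
  qed (use weakly_proregular in auto)
  moreover have "A0 \<subseteq> genideal ?R (set xs)"
    using A0(1) P.genideal_self[OF Ac] A(2) by blast
  ultimately have acyclic: "koszul_acyclic ?R I x ?T"
    using A0(3) by (intro koszul_acyclic_change_generators[OF Im _ _ xc]) (simp_all only: xT xT' finite_lessThan finite_atLeastLessThan)
  have "x \<in> ?T \<rightarrow> carrier ?R" using xc by auto
  moreover have "x i = xs ! i" if "i \<in> ?T" for i using that by (simp add: x_def)
  ultimately have "koszul_acyclic ?R I (\<lambda>i. xs ! i) ?T"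
    using acyclic by (rule koszul_acyclic_cong[OF Im])
  then show ?thesis by (simp only: n_def)
qed

theorem theorem2p3:
  fixes S :: "('s, 'c) ring_scheme"
    and V :: "'v set"
    and R :: "('v multiset \<Rightarrow> 's) ring"
    and B :: "('v multiset \<Rightarrow> 's) set"
    and xs :: "('v multiset \<Rightarrow> 's) list"
    and l :: nat
  assumes "cring S"
    and "R = mpoly_ring S V"
    and "monomial_ideal S V B"
    and "set xs \<subseteq> carrier R"
    and "B = genideal R (set xs)"
  shows "is_right_derived_functor R l
     (torsion_functor R B ::
        ('v multiset \<Rightarrow> 's,
         ('v multiset \<Rightarrow> 's, 'm) inj_univ,
         ('v multiset \<Rightarrow> 's, 'm) inj_univ) mod_functor)
     (cech_cohomology R xs l ::
        ('v multiset \<Rightarrow> 's, 'm, (nat set \<Rightarrow> ('m \<times> nat) set) set) mod_functor)"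
  unfolding is_right_derived_functor_def
proof (intro conjI allI impI)
  show "\<exists>\<rho> :: ('v multiset \<Rightarrow> 's, 'm) module \<Rightarrow>
        ('v multiset \<Rightarrow> 's, 'm, ('v multiset \<Rightarrow> 's, 'm) inj_univ) resolution.
      \<forall>M. module R M \<longrightarrow> injective_resolution R M (\<rho> M)"
  proof (intro exI[of _ "\<lambda>M. SOME P. injective_resolution R M P"] allI impI)
    fix M :: "('v multiset \<Rightarrow> 's, 'm) module" assume "module R M"
    from inj_univ_resolution_exists[OF this]
    show "injective_resolution R M (SOME P :: ('v multiset \<Rightarrow> 's, 'm, ('v multiset \<Rightarrow> 's, 'm) inj_univ) resolution.
        injective_resolution R M P)"
      by (rule someI_ex)
  qed
next
  fix \<rho> :: "('v multiset \<Rightarrow> 's, 'm) module \<Rightarrow>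
      ('v multiset \<Rightarrow> 's, 'm, ('v multiset \<Rightarrow> 's, 'm) inj_univ) resolution"
  assume "\<forall>M. module R M \<longrightarrow> injective_resolution R M (\<rho> M)"
  then show "naturally_isomorphic R (cech_cohomology R xs l) (right_derived R \<rho> l (torsion_functor R B))"
    unfolding assms(5)
    using monomial_ideal_koszul_acyclic[OF assms(1), of xs V] assms(2-5)
    by (intro cech_cohomology_right_derived) auto
qed


end
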